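(* (Soundness.) Let $\mathcal P$ be a typing context, $\sigma$ a type and $M$ a term of $\mathsf{pCBPV}$ with $\mathcal P\vdash M:\sigma$. Then $[\![M]\!]^{\mathcal P}=\sum_{M'\,:\,\mathcal P\vdash M':\sigma}\mathrm{Red}_{M,M'}\,[\![M']\!]^{\mathcal P}$.
   Context: PROBABILISTIC COHERENCE SPACES. For a countable $I$, $u,u'\in[0,\infty)^I$, $\langle u,u'\rangle=\sum_iu_iu'_i$; $F^\perp=\{u'\mid\forall u\in F\ \langle u,u'\rangle\le1\}$. A PCS is $X=(|X|,\mathrm PX)$, $|X|$ countable, $\mathrm PX^{\perp\perp}=\mathrm PX\subseteq[0,\infty)^{|X|}$, every $a$ has some $u\in\mathrm PX$ with $u_a>0$ and a bound $A$ with $u_a\le A$ on $\mathrm PX$. $\mathbf{Pcoh}(X,Y)$: matrices $t$ with $t\cdot u\in\mathrm PY$ for $u\in\mathrm PX$, $(t\cdot u)_b=\sum_at_{a,b}u_a$. $1=(\{*\},[0,1])$. $X\otimes Y$: web $|X|\times|Y|$, $\mathrm P=\{u\otimes v\}^{\perp\perp}$, $(u\otimes v)_{(a,b)}=u_av_b$. $X\multimap Y=(X\otimes Y^\perp)^\perp$, $\mathrm P(X\multimap Y)=\mathbf{Pcoh}(X,Y)$. $\|u\|_X=\sup_{u'\in\mathrm PX^\perp}\langle u,u'\rangle$. $X_\ell\oplus X_r$: web $\{\ell\}\times|X_\ell|\cup\{r\}\times|X_r|$, $u\in\mathrm P$ iff $u(i)\in\mathrm PX_i$ and $\|u(\ell)\|+\|u(r)\|\le1$;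 injections $\mathrm{in}_i$. $!X$: web finite multisets, $u^!=(\prod_au_a^{b(a)})_b$, $\mathrm P(!X)=\{u^!\}^{\perp\perp}$; $(\mathrm{der})_{b,a}=\delta_{b,[a]}$; $(\mathrm{dig})_{b,[b_1..b_n]}=\delta_{b,\sum b_i}$. Coalgebra $(X,h)$: $h\in\mathbf{Pcoh}(X,!X)$, $\mathrm{der}\,h=\mathrm{id}$, $\mathrm{dig}\,h=!h\,h$; $u$ coalgebraic iff $h\cdot u=u^!$. Coalgebras on $1$ ($h_{*,k[*]}=1$), $!X$ ($\mathrm{dig}$), $\otimes$ ($m\circ(h_X\otimes h_Y)$ with $m(u^!\otimes v^!)=(u\otimes v)^!$), $\oplus$ ($h\,\mathrm{in}_i=!\mathrm{in}_i\,h_i$). Substructure order $\subseteq$ (inclusion of webs with extension-by-zero and restriction being morphisms) admits directed unions. LANGUAGE $\mathsf{pCBPV}$. Positive types $\phi::=1\mid\,!\sigma\mid\phi\otimes\psi\mid\phi\oplus\psi\mid\zeta\mid\mu\zeta.\phi$; general types $\sigma::=\phi\mid\phi\multimap\sigma$. Terms $x\mid()\mid\mathrm{stop}(M)\mid\langle M,N\rangle\mid\mathrm{in}_iM\mid\lambda x^\phi.M\mid\langle M\rangle N\mid\mathrm{case}(M,x_\ell\cdot N_\ell,x_r\cdot N_r)\mid\mathrm{pr}_iM\mid\mathrm{go}(M)\mid\mathrm{fix}\,x^\sigma.M\mid\mathrm{fold}(M)\mid\mathrm{unfold}(M)\mid\mathrm{coin}(p)$, $i\in\{\ell,r\}$,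 $p\in[0,1]\cap\mathbb Q$. Typing contexts $\mathcal P=(x_1:\phi_1,\dots,x_k:\phi_k)$ with positive types; rules: variables; $():1$; $\lambda x^\phi.M:\phi\multimap\sigma$ from $\mathcal P,x:\phi\vdash M:\sigma$; $\langle M\rangle N:\sigma$ from $M:\phi\multimap\sigma,N:\phi$; $\mathrm{stop}(M):!\sigma$ from $M:\sigma$; $\mathrm{go}(M):\sigma$ from $M:!\sigma$; $\langle M_\ell,M_r\rangle:\phi_\ell\otimes\phi_r$; $\mathrm{in}_iM:\phi_\ell\oplus\phi_r$ from $M:\phi_i$; $\mathrm{pr}_iM:\phi_i$ from $M:\phi_\ell\otimes\phi_r$; $\mathrm{fix}\,x^\sigma.M:\sigma$ from $\mathcal P,x:!\sigma\vdash M:\sigma$; $\mathrm{case}$ from $M:\phi_\ell\oplus\phi_r$ and $\mathcal P,x_i:\phi_i\vdash N_i:\sigma$; $\mathrm{coin}(p):1\oplus1$; $\mathrm{fold}:\psi[\mu\zeta.\psi/\zeta]\to\mu\zeta.\psi$ and $\mathrm{unfold}$ conversely. Values $V::=x\mid()\mid\mathrm{stop}(M)\mid\langle V,W\rangle\mid\mathrm{in}_iV\mid\mathrm{fold}(V)$. Weak reduction $\rightsquigarrow$: $\mathrm{go}(\mathrm{stop}(M))\rightsquigarrow M$; $\langle\lambda x.M\rangle V\rightsquigarrow M[V/x]$; $\mathrm{pr}_i\langle V_\ell,V_r\rangle\rightsquigarrow V_i$; $\mathrm{fix}\,x^\sigma.M\rightsquigarrow M[\mathrm{stop}(\mathrm{fix}\,x^\sigma.M)/x]$;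 $\mathrm{case}(\mathrm{in}_iV,x_\ell\cdot M_\ell,x_r\cdot M_r)\rightsquigarrow M_i[V/x_i]$; $\mathrm{unfold}(\mathrm{fold}(V))\rightsquigarrow V$. $M\to_pM'$: $M\rightsquigarrow M'$ gives $\to_1$; $\mathrm{coin}(p)\to_p\mathrm{in}_\ell()$, $\mathrm{coin}(p)\to_{1-p}\mathrm{in}_r()$; closed under contexts $\mathrm{go}(\cdot)$, $\langle\cdot\rangle V$ ($V$ value), $\langle N\rangle\cdot$, $\mathrm{pr}_i(\cdot)$, $\langle\cdot,N\rangle$, $\langle V,\cdot\rangle$, $\mathrm{in}_i(\cdot)$, $\mathrm{case}(\cdot,\dots)$, $\mathrm{fold}(\cdot)$, $\mathrm{unfold}(\cdot)$. $M$ weak normal if no $M\to_pM'$. $\mathrm{Red}_{M,M'}=p$ if $M\to_pM'$, $1$ if $M$ weak normal and $M'=M$, $0$ otherwise. SEMANTICS. Closed positive types are coalgebras $([\![\phi]\!],h_\phi)$ built with the coalgebras above; $[\![\phi\multimap\sigma]\!]=[\![\phi]\!]\multimap[\![\sigma]\!]$; $[\![\mu\zeta.\phi]\!]$ is the $\subseteq$-least fixpoint, so $[\![\mu\zeta.\phi]\!]=[\![\phi[\mu\zeta.\phi/\zeta]]\!]$. For $\mathcal P\vdash M:\sigma$, $[\![M]\!]^{\mathcal P}\in\mathbf{Pcoh}([\![\phi_1]\!]\otimes\dots\otimes[\![\phi_k]\!],[\![\sigma]\!])$ is determined by its values on $\vec u=u_1\otimes\dots\otimes u_k$ with $u_i$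 coalgebraic: $[\![()]\!]=1$; $[\![x_i]\!](\vec u)=u_i$; $[\![\mathrm{stop}(N)]\!](\vec u)=([\![N]\!](\vec u))^!$; $[\![\langle M_\ell,M_r\rangle]\!](\vec u)=[\![M_\ell]\!](\vec u)\otimes[\![M_r]\!](\vec u)$; $[\![\mathrm{in}_iN]\!]=\mathrm{in}_i[\![N]\!]$; $[\![\mathrm{go}(N)]\!]=\mathrm{der}\cdot[\![N]\!]$; $[\![\langle N\rangle R]\!](\vec u)=[\![N]\!](\vec u)\cdot[\![R]\!](\vec u)$; $[\![\lambda x^\phi.N]\!](\vec u)$ the $t$ with $t\cdot v=[\![N]\!](\vec u\otimes v)$ for coalgebraic $v$; $[\![\mathrm{case}(N,y_\ell\cdot R_\ell,y_r\cdot R_r)]\!](\vec u)=\sum_i[\![R_i]\!](\vec u\otimes\rho_i[\![N]\!](\vec u))$, $(\rho_i)_{(j,a),b}=\delta_{ij}\delta_{ab}$; $[\![\mathrm{pr}_iN]\!]=\pi_i\cdot[\![N]\!]$, $(\pi_\ell)_{(a,b),a'}=\delta_{aa'}(h_{\phi_r})_{b,[]}$ and symmetrically; $[\![\mathrm{fix}\,x^\sigma.N]\!](\vec u)=\sup_nf^n(0)$, $f(w)=[\![N]\!](\vec u\otimes w^!)$; $[\![\mathrm{fold}(N)]\!]=[\![\mathrm{unfold}(N)]\!]=[\![N]\!]$; $[\![\mathrm{coin}(p)]\!]=pe_{(\ell,* )}+(1-p)e_{(r,* )}$. *)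

theory Defs
  imports "HOL-Analysis.Analysis" "HOL-Library.Multiset" "HOL-Library.Countable_Set"
begin

section \<open>Vectors and matrices over a universal web\<close>

text \<open>
  The webs of all spaces used to interpret types are subsets of one countable type of points.
  A vector over a web \<open>I\<close> is a function on all points that is finite everywhere and vanishes
  outside \<open>I\<close>; so \<open>ennreal\<close> only serves to give a meaning to every infinite sum, and
  extension by zero is the identity on functions.
\<close>

datatype side = Lft | Rgt

datatype pt = Star | Pair pt pt | In side pt | Bag "pt multiset"

type_synonym vec = "pt \<Rightarrow> ennreal"
type_synonym mat = "pt \<Rightarrow> pt \<Rightarrow> ennreal"

definition vecs :: "pt set \<Rightarrow> vec set" where
  "vecs I = {u. (\<forall>a. u a < \<infinity>) \<and> (\<forall>a. a \<notin> I \<longrightarrow> u a = 0)}"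

definition mats :: "pt set \<Rightarrow> pt set \<Rightarrow> mat set" where
  "mats I J = {t. (\<forall>a b. t a b < \<infinity>) \<and> (\<forall>a b. a \<notin> I \<or> b \<notin> J \<longrightarrow> t a b = 0)}"

definition pairing :: "vec \<Rightarrow> vec \<Rightarrow> ennreal" where
  "pairing u u' = (\<Sum>\<^sub>\<infinity>a. u a * u' a)"

definition orth :: "pt set \<Rightarrow> vec set \<Rightarrow> vec set" where
  "orth I F = {u' \<in> vecs I. \<forall>u\<in>F. pairing u u' \<le> 1}"

definition unit_vec :: "pt \<Rightarrow> vec" where
  "unit_vec a = (\<lambda>b. if b = a then 1 else 0)"

definition mapp :: "mat \<Rightarrow> vec \<Rightarrow> vec"  (infixr \<open>\<odot>\<close> 75) where
  "t \<odot> u = (\<lambda>b. \<Sum>\<^sub>\<infinity>a. t a b * u a)"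

definition mcomp :: "mat \<Rightarrow> mat \<Rightarrow> mat"  (infixl \<open>\<circ>\<^sub>m\<close> 70) where
  "s \<circ>\<^sub>m t = (\<lambda>a c. \<Sum>\<^sub>\<infinity>b. t a b * s b c)"

definition idm :: "pt set \<Rightarrow> mat" where
  "idm I = (\<lambda>a b. if a \<in> I \<and> a = b then 1 else 0)"

definition tensv :: "vec \<Rightarrow> vec \<Rightarrow> vec"  (infixl \<open>\<otimes>\<^sub>v\<close> 72) where
  "u \<otimes>\<^sub>v v = (\<lambda>c. case c of Pair a b \<Rightarrow> u a * v b | _ \<Rightarrow> 0)"

definition tensm :: "mat \<Rightarrow> mat \<Rightarrow> mat"  (infixl \<open>\<otimes>\<^sub>m\<close> 72) where
  "s \<otimes>\<^sub>m t = (\<lambda>c d. case (c, d) of (Pair a b, Pair a' b') \<Rightarrow> s a a' * t b b' | _ \<Rightarrow> 0)"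

definition prom :: "vec \<Rightarrow> vec" where
  "prom u = (\<lambda>c. case c of Bag b \<Rightarrow> (\<Prod>a\<in>#b. u a) | _ \<Rightarrow> 0)"

text \<open>A vector over the web of a linear function space, seen as a matrix.\<close>

definition mat_of :: "vec \<Rightarrow> mat" where
  "mat_of w = (\<lambda>a b. w (Pair a b))"


section \<open>Probabilistic coherence spaces\<close>

record pcs =
  web :: "pt set"
  pts :: "vec set"

definition is_pcs :: "pcs \<Rightarrow> bool" where
  "is_pcs X \<longleftrightarrow>
     countable (web X) \<and> pts X \<subseteq> vecs (web X) \<and>
     orth (web X) (orth (web X) (pts X)) = pts X \<and>
     (\<forall>a\<in>web X. \<exists>u\<in>pts X. u a > 0) \<and>
     (\<forall>a\<in>web X. \<exists>A<\<infinity>. \<forall>u\<in>pts X. u a \<le> A)"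

definition Pcoh :: "pcs \<Rightarrow> pcs \<Rightarrow> mat set" where
  "Pcoh X Y = {t \<in> mats (web X) (web Y). \<forall>u\<in>pts X. t \<odot> u \<in> pts Y}"

definition dual :: "pcs \<Rightarrow> pcs" where
  "dual X = \<lparr>web = web X, pts = orth (web X) (pts X)\<rparr>"

definition norm_pcs :: "pcs \<Rightarrow> vec \<Rightarrow> ennreal" where
  "norm_pcs X u = (SUP u'\<in>pts (dual X). pairing u u')"

definition one_pcs :: pcs where
  "one_pcs = \<lparr>web = {Star}, pts = {u \<in> vecs {Star}. u Star \<le> 1}\<rparr>"

definition tensor :: "pcs \<Rightarrow> pcs \<Rightarrow> pcs" where
  "tensor X Y =
     (let I = {Pair a b |a b. a \<in> web X \<and> b \<in> web Y}
      in \<lparr>web = I, pts = orth I (orth I {u \<otimes>\<^sub>v v |u v. u \<in> pts X \<and> v \<in> pts Y})\<rparr>)"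

definition lolli :: "pcs \<Rightarrow> pcs \<Rightarrow> pcs" where
  "lolli X Y = dual (tensor X (dual Y))"

definition component :: "side \<Rightarrow> vec \<Rightarrow> vec" where
  "component i u = (\<lambda>a. u (In i a))"

definition oplus :: "pcs \<Rightarrow> pcs \<Rightarrow> pcs" where
  "oplus X Y =
     (let I = In Lft ` web X \<union> In Rgt ` web Y
      in \<lparr>web = I,
          pts = {u \<in> vecs I. component Lft u \<in> pts X \<and> component Rgt u \<in> pts Y \<and>
                   norm_pcs X (component Lft u) + norm_pcs Y (component Rgt u) \<le> 1}\<rparr>)"

definition injm :: "side \<Rightarrow> pcs \<Rightarrow> mat" where
  "injm i X = (\<lambda>a c. if a \<in> web X \<and> c = In i a then 1 else 0)"

definition restrm :: "side \<Rightarrow> pcs \<Rightarrow> mat" where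
  "restrm i X = (\<lambda>c b. if b \<in> web X \<and> c = In i b then 1 else 0)"

definition bang :: "pcs \<Rightarrow> pcs" where
  "bang X =
     (let I = {Bag b |b. set_mset b \<subseteq> web X}
      in \<lparr>web = I, pts = orth I (orth I {prom u |u. u \<in> pts X})\<rparr>)"

definition der :: "pcs \<Rightarrow> mat" where
  "der X = (\<lambda>c a. if a \<in> web X \<and> c = Bag {#a#} then 1 else 0)"

definition dig :: "pcs \<Rightarrow> mat" where
  "dig X = (\<lambda>c d. if c \<in> web (bang X) \<and>
                      (\<exists>B. c = Bag (\<Sum>\<^sub># B) \<and> d = Bag (image_mset Bag B)) then 1 else 0)"

definition bangm :: "pcs \<Rightarrow> pcs \<Rightarrow> mat \<Rightarrow> mat" where
  "bangm X Y t =
     (THE s. s \<in> Pcoh (bang X) (bang Y) \<and> (\<forall>u\<in>pts X. s \<odot> prom u = prom (t \<odot> u)))"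

definition monm :: "pcs \<Rightarrow> pcs \<Rightarrow> mat" where
  "monm X Y =
     (THE s. s \<in> Pcoh (tensor (bang X) (bang Y)) (bang (tensor X Y)) \<and>
             (\<forall>u\<in>pts X. \<forall>v\<in>pts Y. s \<odot> (prom u \<otimes>\<^sub>v prom v) = prom (u \<otimes>\<^sub>v v)))"


section \<open>Coalgebras\<close>

type_synonym coalg = "pcs \<times> mat"

definition is_coalg :: "coalg \<Rightarrow> bool" where
  "is_coalg = (\<lambda>(X, h). is_pcs X \<and> h \<in> Pcoh X (bang X) \<and>
     der X \<circ>\<^sub>m h = idm (web X) \<and> dig X \<circ>\<^sub>m h = bangm X (bang X) h \<circ>\<^sub>m h)"

definition coalgebraic :: "coalg \<Rightarrow> vec \<Rightarrow> bool" where
  "coalgebraic = (\<lambda>(X, h) u. u \<in> pts X \<and> h \<odot> u = prom u)"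

definition one_coalg :: coalg where
  "one_coalg =
     (one_pcs, \<lambda>a c. if a = Star \<and> (\<exists>k. c = Bag (replicate_mset k Star)) then 1 else 0)"

definition bang_coalg :: "pcs \<Rightarrow> coalg" where
  "bang_coalg X = (bang X, dig X)"

definition tensor_coalg :: "coalg \<Rightarrow> coalg \<Rightarrow> coalg" where
  "tensor_coalg = (\<lambda>(X, h) (Y, k). (tensor X Y, monm X Y \<circ>\<^sub>m (h \<otimes>\<^sub>m k)))"

definition oplus_coalg :: "coalg \<Rightarrow> coalg \<Rightarrow> coalg" where
  "oplus_coalg = (\<lambda>(X, h) (Y, k). (oplus X Y,
     \<lambda>c d. case c of
         In Lft a \<Rightarrow> (bangm X (oplus X Y) (injm Lft X) \<circ>\<^sub>m h) a d
       | In Rgt b \<Rightarrow> (bangm Y (oplus X Y) (injm Rgt Y) \<circ>\<^sub>m k) b d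
       | _ \<Rightarrow> 0))"

text \<open>
  Both extension by zero (from \<open>X\<close> to \<open>Y\<close>) and restriction (from \<open>Y\<close> to \<open>X\<close>) have the
  matrix \<open>idm (web X)\<close>. On coalgebras, the extension is moreover a coalgebra morphism; this
  cannot be asked of the restriction, which fails to preserve weakening.
\<close>

definition sub_pcs :: "pcs \<Rightarrow> pcs \<Rightarrow> bool" where
  "sub_pcs X Y \<longleftrightarrow>
     web X \<subseteq> web Y \<and> idm (web X) \<in> Pcoh X Y \<and> idm (web X) \<in> Pcoh Y X"

definition sub_coalg :: "coalg \<Rightarrow> coalg \<Rightarrow> bool" where
  "sub_coalg = (\<lambda>(X, h) (Y, k).
     sub_pcs X Y \<and> k \<circ>\<^sub>m idm (web X) = bangm X Y (idm (web X)) \<circ>\<^sub>m h)"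

definition lfp_coalg :: "(coalg \<Rightarrow> coalg) \<Rightarrow> coalg" where
  "lfp_coalg F =
     (THE C. is_coalg C \<and> F C = C \<and> (\<forall>D. is_coalg D \<and> F D = D \<longrightarrow> sub_coalg C D))"


section \<open>Types\<close>

text \<open>Type variables are de Bruijn indices bound by \<open>Mu\<close>.\<close>

datatype pty = One | Bang gty | Tensor pty pty | Plus pty pty | TVar nat | Mu pty
  and gty = Pos pty | Lolli pty gty

primrec ptclosed :: "nat \<Rightarrow> pty \<Rightarrow> bool" and gtclosed :: "nat \<Rightarrow> gty \<Rightarrow> bool" where
  "ptclosed k One \<longleftrightarrow> True"
| "ptclosed k (Bang \<sigma>) \<longleftrightarrow> gtclosed k \<sigma>"
| "ptclosed k (Tensor \<phi> \<psi>) \<longleftrightarrow> ptclosed k \<phi> \<and> ptclosed k \<psi>"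
| "ptclosed k (Plus \<phi> \<psi>) \<longleftrightarrow> ptclosed k \<phi> \<and> ptclosed k \<psi>"
| "ptclosed k (TVar n) \<longleftrightarrow> n < k"
| "ptclosed k (Mu \<phi>) \<longleftrightarrow> ptclosed (Suc k) \<phi>"
| "gtclosed k (Pos \<phi>) \<longleftrightarrow> ptclosed k \<phi>"
| "gtclosed k (Lolli \<phi> \<sigma>) \<longleftrightarrow> ptclosed k \<phi> \<and> gtclosed k \<sigma>"

primrec ptlift :: "nat \<Rightarrow> pty \<Rightarrow> pty" and gtlift :: "nat \<Rightarrow> gty \<Rightarrow> gty" where
  "ptlift k One = One"
| "ptlift k (Bang \<sigma>) = Bang (gtlift k \<sigma>)"
| "ptlift k (Tensor \<phi> \<psi>) = Tensor (ptlift k \<phi>) (ptlift k \<psi>)"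
| "ptlift k (Plus \<phi> \<psi>) = Plus (ptlift k \<phi>) (ptlift k \<psi>)"
| "ptlift k (TVar n) = TVar (if n < k then n else Suc n)"
| "ptlift k (Mu \<phi>) = Mu (ptlift (Suc k) \<phi>)"
| "gtlift k (Pos \<phi>) = Pos (ptlift k \<phi>)"
| "gtlift k (Lolli \<phi> \<sigma>) = Lolli (ptlift k \<phi>) (gtlift k \<sigma>)"

primrec ptsubst :: "pty \<Rightarrow> nat \<Rightarrow> pty \<Rightarrow> pty" and gtsubst :: "gty \<Rightarrow> nat \<Rightarrow> pty \<Rightarrow> gty" where
  "ptsubst One k \<theta> = One"
| "ptsubst (Bang \<sigma>) k \<theta> = Bang (gtsubst \<sigma> k \<theta>)"
| "ptsubst (Tensor \<phi> \<psi>) k \<theta> = Tensor (ptsubst \<phi> k \<theta>) (ptsubst \<psi> k \<theta>)"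
| "ptsubst (Plus \<phi> \<psi>) k \<theta> = Plus (ptsubst \<phi> k \<theta>) (ptsubst \<psi> k \<theta>)"
| "ptsubst (TVar n) k \<theta> = (if n < k then TVar n else if n = k then \<theta> else TVar (n - 1))"
| "ptsubst (Mu \<phi>) k \<theta> = Mu (ptsubst \<phi> (Suc k) (ptlift 0 \<theta>))"
| "gtsubst (Pos \<phi>) k \<theta> = Pos (ptsubst \<phi> k \<theta>)"
| "gtsubst (Lolli \<phi> \<sigma>) k \<theta> = Lolli (ptsubst \<phi> k \<theta>) (gtsubst \<sigma> k \<theta>)"

primrec psem_env :: "pty \<Rightarrow> (nat \<Rightarrow> coalg) \<Rightarrow> coalg"
  and gsem_env :: "gty \<Rightarrow> (nat \<Rightarrow> coalg) \<Rightarrow> pcs" where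
  "psem_env One \<rho> = one_coalg"
| "psem_env (Bang \<sigma>) \<rho> = bang_coalg (gsem_env \<sigma> \<rho>)"
| "psem_env (Tensor \<phi> \<psi>) \<rho> = tensor_coalg (psem_env \<phi> \<rho>) (psem_env \<psi> \<rho>)"
| "psem_env (Plus \<phi> \<psi>) \<rho> = oplus_coalg (psem_env \<phi> \<rho>) (psem_env \<psi> \<rho>)"
| "psem_env (TVar n) \<rho> = \<rho> n"
| "psem_env (Mu \<phi>) \<rho> = lfp_coalg (\<lambda>C. psem_env \<phi> (case_nat C \<rho>))"
| "gsem_env (Pos \<phi>) \<rho> = fst (psem_env \<phi> \<rho>)"
| "gsem_env (Lolli \<phi> \<sigma>) \<rho> = lolli (fst (psem_env \<phi> \<rho>)) (gsem_env \<sigma> \<rho>)"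

text \<open>For closed types the environment is irrelevant.\<close>

definition psem :: "pty \<Rightarrow> coalg" where
  "psem \<phi> = psem_env \<phi> (\<lambda>_. undefined)"

definition gsem :: "gty \<Rightarrow> pcs" where
  "gsem \<sigma> = gsem_env \<sigma> (\<lambda>_. undefined)"


section \<open>Terms and typing\<close>

text \<open>
  Terms are taken up to renaming of bound variables, by means of de Bruijn indices: \<open>Lam\<close>,
  \<open>Fix\<close> and each branch of \<open>Case\<close> bind index 0.
\<close>

datatype tm =
    Var nat
  | Unit
  | Stop tm
  | Tup tm tm
  | Inj side tm
  | Lam pty tm
  | App tm tm
  | Case tm tm tm
  | Prj side tm
  | Go tm
  | Fix gty tm
  | Fold tm
  | Unfold tm
  | Coin rat

primrec lift :: "nat \<Rightarrow> tm \<Rightarrow> tm" where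
  "lift k (Var n) = Var (if n < k then n else Suc n)"
| "lift k Unit = Unit"
| "lift k (Stop M) = Stop (lift k M)"
| "lift k (Tup M N) = Tup (lift k M) (lift k N)"
| "lift k (Inj i M) = Inj i (lift k M)"
| "lift k (Lam \<phi> M) = Lam \<phi> (lift (Suc k) M)"
| "lift k (App M N) = App (lift k M) (lift k N)"
| "lift k (Case M N\<^sub>l N\<^sub>r) = Case (lift k M) (lift (Suc k) N\<^sub>l) (lift (Suc k) N\<^sub>r)"
| "lift k (Prj i M) = Prj i (lift k M)"
| "lift k (Go M) = Go (lift k M)"
| "lift k (Fix \<sigma> M) = Fix \<sigma> (lift (Suc k) M)"
| "lift k (Fold M) = Fold (lift k M)"
| "lift k (Unfold M) = Unfold (lift k M)"
| "lift k (Coin p) = Coin p"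

primrec subst :: "tm \<Rightarrow> nat \<Rightarrow> tm \<Rightarrow> tm" where
  "subst (Var n) k S = (if n < k then Var n else if n = k then S else Var (n - 1))"
| "subst Unit k S = Unit"
| "subst (Stop M) k S = Stop (subst M k S)"
| "subst (Tup M N) k S = Tup (subst M k S) (subst N k S)"
| "subst (Inj i M) k S = Inj i (subst M k S)"
| "subst (Lam \<phi> M) k S = Lam \<phi> (subst M (Suc k) (lift 0 S))"
| "subst (App M N) k S = App (subst M k S) (subst N k S)"
| "subst (Case M N\<^sub>l N\<^sub>r) k S =
     Case (subst M k S) (subst N\<^sub>l (Suc k) (lift 0 S)) (subst N\<^sub>r (Suc k) (lift 0 S))"
| "subst (Prj i M) k S = Prj i (subst M k S)"
| "subst (Go M) k S = Go (subst M k S)"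
| "subst (Fix \<sigma> M) k S = Fix \<sigma> (subst M (Suc k) (lift 0 S))"
| "subst (Fold M) k S = Fold (subst M k S)"
| "subst (Unfold M) k S = Unfold (subst M k S)"
| "subst (Coin p) k S = Coin p"

text \<open>
  The most recent variable comes first: the context \<open>x\<^sub>1:\<phi>\<^sub>1, \<dots>, x\<^sub>k:\<phi>\<^sub>k\<close> is the list
  \<open>[\<phi>\<^sub>k, \<dots>, \<phi>\<^sub>1]\<close>. Only closed types occur in derivations: the axioms ask for it, and
  \<open>Inj\<close> is the only other rule that introduces a type out of nothing.
\<close>

type_synonym ctx = "pty list"

definition wf_ctx :: "ctx \<Rightarrow> bool" where
  "wf_ctx \<Gamma> \<longleftrightarrow> (\<forall>\<phi>\<in>set \<Gamma>. ptclosed 0 \<phi>)"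

inductive typing :: "ctx \<Rightarrow> tm \<Rightarrow> gty \<Rightarrow> bool"  (\<open>_ \<turnstile> _ \<Ztypecolon> _\<close> [50, 50, 50] 50) where
  t_var: "\<lbrakk>wf_ctx \<Gamma>; n < length \<Gamma>\<rbrakk> \<Longrightarrow> \<Gamma> \<turnstile> Var n \<Ztypecolon> Pos (\<Gamma> ! n)"
| t_unit: "wf_ctx \<Gamma> \<Longrightarrow> \<Gamma> \<turnstile> Unit \<Ztypecolon> Pos One"
| t_stop: "\<Gamma> \<turnstile> M \<Ztypecolon> \<sigma> \<Longrightarrow> \<Gamma> \<turnstile> Stop M \<Ztypecolon> Pos (Bang \<sigma>)"
| t_tup: "\<lbrakk>\<Gamma> \<turnstile> M \<Ztypecolon> Pos \<phi>\<^sub>l; \<Gamma> \<turnstile> N \<Ztypecolon> Pos \<phi>\<^sub>r\<rbrakk> \<Longrightarrow> \<Gamma> \<turnstile> Tup M N \<Ztypecolon> Pos (Tensor \<phi>\<^sub>l \<phi>\<^sub>r)"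
| t_inl: "\<lbrakk>\<Gamma> \<turnstile> M \<Ztypecolon> Pos \<phi>\<^sub>l; ptclosed 0 \<phi>\<^sub>r\<rbrakk> \<Longrightarrow> \<Gamma> \<turnstile> Inj Lft M \<Ztypecolon> Pos (Plus \<phi>\<^sub>l \<phi>\<^sub>r)"
| t_inr: "\<lbrakk>\<Gamma> \<turnstile> M \<Ztypecolon> Pos \<phi>\<^sub>r; ptclosed 0 \<phi>\<^sub>l\<rbrakk> \<Longrightarrow> \<Gamma> \<turnstile> Inj Rgt M \<Ztypecolon> Pos (Plus \<phi>\<^sub>l \<phi>\<^sub>r)"
| t_lam: "\<phi> # \<Gamma> \<turnstile> M \<Ztypecolon> \<sigma> \<Longrightarrow> \<Gamma> \<turnstile> Lam \<phi> M \<Ztypecolon> Lolli \<phi> \<sigma>"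
| t_app: "\<lbrakk>\<Gamma> \<turnstile> M \<Ztypecolon> Lolli \<phi> \<sigma>; \<Gamma> \<turnstile> N \<Ztypecolon> Pos \<phi>\<rbrakk> \<Longrightarrow> \<Gamma> \<turnstile> App M N \<Ztypecolon> \<sigma>"
| t_case: "\<lbrakk>\<Gamma> \<turnstile> M \<Ztypecolon> Pos (Plus \<phi>\<^sub>l \<phi>\<^sub>r); \<phi>\<^sub>l # \<Gamma> \<turnstile> N\<^sub>l \<Ztypecolon> \<sigma>; \<phi>\<^sub>r # \<Gamma> \<turnstile> N\<^sub>r \<Ztypecolon> \<sigma>\<rbrakk>
    \<Longrightarrow> \<Gamma> \<turnstile> Case M N\<^sub>l N\<^sub>r \<Ztypecolon> \<sigma>"
| t_prl: "\<Gamma> \<turnstile> M \<Ztypecolon> Pos (Tensor \<phi>\<^sub>l \<phi>\<^sub>r) \<Longrightarrow> \<Gamma> \<turnstile> Prj Lft M \<Ztypecolon> Pos \<phi>\<^sub>l"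
| t_prr: "\<Gamma> \<turnstile> M \<Ztypecolon> Pos (Tensor \<phi>\<^sub>l \<phi>\<^sub>r) \<Longrightarrow> \<Gamma> \<turnstile> Prj Rgt M \<Ztypecolon> Pos \<phi>\<^sub>r"
| t_go: "\<Gamma> \<turnstile> M \<Ztypecolon> Pos (Bang \<sigma>) \<Longrightarrow> \<Gamma> \<turnstile> Go M \<Ztypecolon> \<sigma>"
| t_fix: "Bang \<sigma> # \<Gamma> \<turnstile> M \<Ztypecolon> \<sigma> \<Longrightarrow> \<Gamma> \<turnstile> Fix \<sigma> M \<Ztypecolon> \<sigma>"
| t_fold: "\<Gamma> \<turnstile> M \<Ztypecolon> Pos (ptsubst \<psi> 0 (Mu \<psi>)) \<Longrightarrow> \<Gamma> \<turnstile> Fold M \<Ztypecolon> Pos (Mu \<psi>)"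
| t_unfold: "\<Gamma> \<turnstile> M \<Ztypecolon> Pos (Mu \<psi>) \<Longrightarrow> \<Gamma> \<turnstile> Unfold M \<Ztypecolon> Pos (ptsubst \<psi> 0 (Mu \<psi>))"
| t_coin: "\<lbrakk>wf_ctx \<Gamma>; 0 \<le> p; p \<le> 1\<rbrakk> \<Longrightarrow> \<Gamma> \<turnstile> Coin p \<Ztypecolon> Pos (Plus One One)"


section \<open>Reduction\<close>

inductive is_val :: "tm \<Rightarrow> bool" where
  "is_val (Var n)"
| "is_val Unit"
| "is_val (Stop M)"
| "\<lbrakk>is_val V; is_val W\<rbrakk> \<Longrightarrow> is_val (Tup V W)"
| "is_val V \<Longrightarrow> is_val (Inj i V)"
| "is_val V \<Longrightarrow> is_val (Fold V)"

inductive weak_red :: "tm \<Rightarrow> tm \<Rightarrow> bool"  (infix \<open>\<leadsto>\<close> 50) where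
  "Go (Stop M) \<leadsto> M"
| "is_val V \<Longrightarrow> App (Lam \<phi> M) V \<leadsto> subst M 0 V"
| "\<lbrakk>is_val V\<^sub>l; is_val V\<^sub>r\<rbrakk> \<Longrightarrow> Prj Lft (Tup V\<^sub>l V\<^sub>r) \<leadsto> V\<^sub>l"
| "\<lbrakk>is_val V\<^sub>l; is_val V\<^sub>r\<rbrakk> \<Longrightarrow> Prj Rgt (Tup V\<^sub>l V\<^sub>r) \<leadsto> V\<^sub>r"
| "Fix \<sigma> M \<leadsto> subst M 0 (Stop (Fix \<sigma> M))"
| "is_val V \<Longrightarrow> Case (Inj Lft V) M\<^sub>l M\<^sub>r \<leadsto> subst M\<^sub>l 0 V"
| "is_val V \<Longrightarrow> Case (Inj Rgt V) M\<^sub>l M\<^sub>r \<leadsto> subst M\<^sub>r 0 V"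
| "is_val V \<Longrightarrow> Unfold (Fold V) \<leadsto> V"

inductive red :: "tm \<Rightarrow> real \<Rightarrow> tm \<Rightarrow> bool" where
  "M \<leadsto> M' \<Longrightarrow> red M 1 M'"
| "red (Coin p) (of_rat p) (Inj Lft Unit)"
| "red (Coin p) (1 - of_rat p) (Inj Rgt Unit)"
| "red M p M' \<Longrightarrow> red (Go M) p (Go M')"
| "\<lbrakk>red M p M'; is_val V\<rbrakk> \<Longrightarrow> red (App M V) p (App M' V)"
| "red M p M' \<Longrightarrow> red (App N M) p (App N M')"
| "red M p M' \<Longrightarrow> red (Prj i M) p (Prj i M')"
| "red M p M' \<Longrightarrow> red (Tup M N) p (Tup M' N)"
| "\<lbrakk>red M p M'; is_val V\<rbrakk> \<Longrightarrow> red (Tup V M) p (Tup V M')"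
| "red M p M' \<Longrightarrow> red (Inj i M) p (Inj i M')"
| "red M p M' \<Longrightarrow> red (Case M N\<^sub>l N\<^sub>r) p (Case M' N\<^sub>l N\<^sub>r)"
| "red M p M' \<Longrightarrow> red (Fold M) p (Fold M')"
| "red M p M' \<Longrightarrow> red (Unfold M) p (Unfold M')"

definition weak_normal :: "tm \<Rightarrow> bool" where
  "weak_normal M \<longleftrightarrow> \<not> (\<exists>p M'. red M p M')"

text \<open>Reduction follows a deterministic strategy, so \<open>p\<close> is unique in the first case.\<close>

definition Red :: "tm \<Rightarrow> tm \<Rightarrow> real" where
  "Red M M' =
     (if \<exists>p. red M p M' then (THE p. red M p M')
      else if weak_normal M \<and> M' = M then 1 else 0)"


section \<open>Denotational semantics of terms\<close>

primrec ctx_sem :: "ctx \<Rightarrow> pcs" where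
  "ctx_sem [] = one_pcs"
| "ctx_sem (\<phi> # \<Gamma>) = tensor (ctx_sem \<Gamma>) (fst (psem \<phi>))"

primrec tens :: "vec list \<Rightarrow> vec" where
  "tens [] = unit_vec Star"
| "tens (u # us) = tens us \<otimes>\<^sub>v u"

definition coalgebraic_env :: "ctx \<Rightarrow> vec list \<Rightarrow> bool" where
  "coalgebraic_env \<Gamma> us \<longleftrightarrow> list_all2 (\<lambda>\<phi> u. coalgebraic (psem \<phi>) u) \<Gamma> us"

definition prl :: "coalg \<Rightarrow> coalg \<Rightarrow> mat" where
  "prl = (\<lambda>(X, h) (Y, k) c a'.
     case c of Pair a b \<Rightarrow> if a \<in> web X \<and> a = a' then k b (Bag {#}) else 0 | _ \<Rightarrow> 0)"

definition prr :: "coalg \<Rightarrow> coalg \<Rightarrow> mat" where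
  "prr = (\<lambda>(X, h) (Y, k) c b'.
     case c of Pair a b \<Rightarrow> if b \<in> web Y \<and> b = b' then h a (Bag {#}) else 0 | _ \<Rightarrow> 0)"

definition represents :: "ctx \<Rightarrow> gty \<Rightarrow> (vec list \<Rightarrow> vec) \<Rightarrow> mat \<Rightarrow> bool" where
  "represents \<Gamma> \<sigma> f t \<longleftrightarrow>
     t \<in> Pcoh (ctx_sem \<Gamma>) (gsem \<sigma>) \<and> (\<forall>us. coalgebraic_env \<Gamma> us \<longrightarrow> t \<odot> tens us = f us)"

text \<open>
  \<open>denotes \<Gamma> M \<sigma> t\<close>: the matrix \<open>t\<close> interprets some derivation of \<open>\<Gamma> \<turnstile> M \<Ztypecolon> \<sigma>\<close>. Terms do not
  carry enough annotations to determine their derivation (the other summand in \<open>Inj\<close>, the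
  recursive type in \<open>Fold\<close>), hence a relation, with one rule for each typing rule.
\<close>

inductive denotes :: "ctx \<Rightarrow> tm \<Rightarrow> gty \<Rightarrow> mat \<Rightarrow> bool" where
  d_var: "\<lbrakk>wf_ctx \<Gamma>; n < length \<Gamma>; represents \<Gamma> (Pos (\<Gamma> ! n)) (\<lambda>us. us ! n) t\<rbrakk>
    \<Longrightarrow> denotes \<Gamma> (Var n) (Pos (\<Gamma> ! n)) t"
| d_unit: "\<lbrakk>wf_ctx \<Gamma>; represents \<Gamma> (Pos One) (\<lambda>us. unit_vec Star) t\<rbrakk>
    \<Longrightarrow> denotes \<Gamma> Unit (Pos One) t"
| d_stop: "\<lbrakk>denotes \<Gamma> M \<sigma> m; represents \<Gamma> (Pos (Bang \<sigma>)) (\<lambda>us. prom (m \<odot> tens us)) t\<rbrakk>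
    \<Longrightarrow> denotes \<Gamma> (Stop M) (Pos (Bang \<sigma>)) t"
| d_tup: "\<lbrakk>denotes \<Gamma> M (Pos \<phi>\<^sub>l) m; denotes \<Gamma> N (Pos \<phi>\<^sub>r) n;
      represents \<Gamma> (Pos (Tensor \<phi>\<^sub>l \<phi>\<^sub>r)) (\<lambda>us. (m \<odot> tens us) \<otimes>\<^sub>v (n \<odot> tens us)) t\<rbrakk>
    \<Longrightarrow> denotes \<Gamma> (Tup M N) (Pos (Tensor \<phi>\<^sub>l \<phi>\<^sub>r)) t"
| d_inl: "\<lbrakk>denotes \<Gamma> M (Pos \<phi>\<^sub>l) m; ptclosed 0 \<phi>\<^sub>r;
      represents \<Gamma> (Pos (Plus \<phi>\<^sub>l \<phi>\<^sub>r)) (\<lambda>us. injm Lft (fst (psem \<phi>\<^sub>l)) \<odot> m \<odot> tens us) t\<rbrakk>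
    \<Longrightarrow> denotes \<Gamma> (Inj Lft M) (Pos (Plus \<phi>\<^sub>l \<phi>\<^sub>r)) t"
| d_inr: "\<lbrakk>denotes \<Gamma> M (Pos \<phi>\<^sub>r) m; ptclosed 0 \<phi>\<^sub>l;
      represents \<Gamma> (Pos (Plus \<phi>\<^sub>l \<phi>\<^sub>r)) (\<lambda>us. injm Rgt (fst (psem \<phi>\<^sub>r)) \<odot> m \<odot> tens us) t\<rbrakk>
    \<Longrightarrow> denotes \<Gamma> (Inj Rgt M) (Pos (Plus \<phi>\<^sub>l \<phi>\<^sub>r)) t"
| d_lam: "\<lbrakk>denotes (\<phi> # \<Gamma>) M \<sigma> m; t \<in> Pcoh (ctx_sem \<Gamma>) (gsem (Lolli \<phi> \<sigma>));
      \<forall>us v. coalgebraic_env \<Gamma> us \<and> coalgebraic (psem \<phi>) v \<longrightarrow>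
        mat_of (t \<odot> tens us) \<odot> v = m \<odot> (tens us \<otimes>\<^sub>v v)\<rbrakk>
    \<Longrightarrow> denotes \<Gamma> (Lam \<phi> M) (Lolli \<phi> \<sigma>) t"
| d_app: "\<lbrakk>denotes \<Gamma> M (Lolli \<phi> \<sigma>) m; denotes \<Gamma> N (Pos \<phi>) n;
      represents \<Gamma> \<sigma> (\<lambda>us. mat_of (m \<odot> tens us) \<odot> n \<odot> tens us) t\<rbrakk>
    \<Longrightarrow> denotes \<Gamma> (App M N) \<sigma> t"
| d_case: "\<lbrakk>denotes \<Gamma> M (Pos (Plus \<phi>\<^sub>l \<phi>\<^sub>r)) m;
      denotes (\<phi>\<^sub>l # \<Gamma>) N\<^sub>l \<sigma> n\<^sub>l; denotes (\<phi>\<^sub>r # \<Gamma>) N\<^sub>r \<sigma> n\<^sub>r;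
      represents \<Gamma> \<sigma> (\<lambda>us b.
        (n\<^sub>l \<odot> (tens us \<otimes>\<^sub>v (restrm Lft (fst (psem \<phi>\<^sub>l)) \<odot> m \<odot> tens us))) b +
        (n\<^sub>r \<odot> (tens us \<otimes>\<^sub>v (restrm Rgt (fst (psem \<phi>\<^sub>r)) \<odot> m \<odot> tens us))) b) t\<rbrakk>
    \<Longrightarrow> denotes \<Gamma> (Case M N\<^sub>l N\<^sub>r) \<sigma> t"
| d_prl: "\<lbrakk>denotes \<Gamma> M (Pos (Tensor \<phi>\<^sub>l \<phi>\<^sub>r)) m;
      represents \<Gamma> (Pos \<phi>\<^sub>l) (\<lambda>us. prl (psem \<phi>\<^sub>l) (psem \<phi>\<^sub>r) \<odot> m \<odot> tens us) t\<rbrakk>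
    \<Longrightarrow> denotes \<Gamma> (Prj Lft M) (Pos \<phi>\<^sub>l) t"
| d_prr: "\<lbrakk>denotes \<Gamma> M (Pos (Tensor \<phi>\<^sub>l \<phi>\<^sub>r)) m;
      represents \<Gamma> (Pos \<phi>\<^sub>r) (\<lambda>us. prr (psem \<phi>\<^sub>l) (psem \<phi>\<^sub>r) \<odot> m \<odot> tens us) t\<rbrakk>
    \<Longrightarrow> denotes \<Gamma> (Prj Rgt M) (Pos \<phi>\<^sub>r) t"
| d_go: "\<lbrakk>denotes \<Gamma> M (Pos (Bang \<sigma>)) m;
      represents \<Gamma> \<sigma> (\<lambda>us. der (gsem \<sigma>) \<odot> m \<odot> tens us) t\<rbrakk>
    \<Longrightarrow> denotes \<Gamma> (Go M) \<sigma> t"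
| d_fix: "\<lbrakk>denotes (Bang \<sigma> # \<Gamma>) M \<sigma> m;
      represents \<Gamma> \<sigma> (\<lambda>us. SUP k. ((\<lambda>w. m \<odot> (tens us \<otimes>\<^sub>v prom w)) ^^ k) (\<lambda>_. 0)) t\<rbrakk>
    \<Longrightarrow> denotes \<Gamma> (Fix \<sigma> M) \<sigma> t"
| d_fold: "denotes \<Gamma> M (Pos (ptsubst \<psi> 0 (Mu \<psi>))) t \<Longrightarrow> denotes \<Gamma> (Fold M) (Pos (Mu \<psi>)) t"
| d_unfold: "denotes \<Gamma> M (Pos (Mu \<psi>)) t
    \<Longrightarrow> denotes \<Gamma> (Unfold M) (Pos (ptsubst \<psi> 0 (Mu \<psi>))) t"
| d_coin: "\<lbrakk>wf_ctx \<Gamma>; 0 \<le> p; p \<le> 1;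
      represents \<Gamma> (Pos (Plus One One)) (\<lambda>us b.
        ennreal (of_rat p) * unit_vec (In Lft Star) b +
        ennreal (1 - of_rat p) * unit_vec (In Rgt Star) b) t\<rbrakk>
    \<Longrightarrow> denotes \<Gamma> (Coin p) (Pos (Plus One One)) t"

definition sem :: "ctx \<Rightarrow> tm \<Rightarrow> gty \<Rightarrow> mat" where
  "sem \<Gamma> M \<sigma> = (THE t. denotes \<Gamma> M \<sigma> t)"

end

theory Submission
  imports Defs
begin

text \<open>
  The semantics is computed on coalgebraic points, where values are again coalgebraic; hence
  substituting a value is composition, every redex has the denotation of its reduct, and
  evaluation contexts act linearly. A term that is not weak normal has exactly one reduct, of
  weight \<open>1\<close>, or two, of weights \<open>p\<close> and \<open>1 - p\<close>, so that its equation between matrices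
  holds on tensors of coalgebraic points. These determine morphisms: coalgebraic points separate
  the spaces of all closed positive types, for \<open>!X\<close> because power series have unique coefficients.

  The semantics of types and terms is given by definite descriptions, which have to be shown to be
  well defined. All type constructors commute with the restriction of a space to a part of its
  web, so that they are continuous and the least fixpoint is the union of the iterates from the
  empty web. Since it has to be least among all coalgebras, all constructions are carried out for
  arbitrary coalgebras, with or without enough coalgebraic points. Finally, every
  structural matrix is the restriction of one matrix over all points, which makes the semantics of
  a term independent of the derivation.
\<close>

section \<open>Sums of extended nonnegative reals\<close>

text \<open>Copying and discarding a variable go through the coalgebra structure and behave as
  expected at coalgebraic points only, since \<open>u \<mapsto> u \<otimes>\<^sub>v u\<close> is not
  linear. This is why pairs, applications, projections and fixpoints are evaluated at such points,
  and why redexes demand values. The one place where other points are unavoidable is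
  \<open>Case\<close>, whose branches receive the components of a point of a coproduct; these are
  reached from the coalgebraic points by linearity.

  A type variable may occur to the left of an arrow, where one would expect an order on spaces to be
  reversed. The substructure order survives duality because it consists of an extension together
  with a restriction, and transposition exchanges the two. Hence all constructors are covariant, and
  fixpoints are obtained by plain iteration.

  Vectors may be infinite a priori, so that sums can be exchanged freely; finiteness is recovered by
  pairing with functionals.\<close>

lemma infsum_eq_SUP_sum:
  fixes f :: "'a \<Rightarrow> ennreal"
  shows "infsum f UNIV = (SUP F\<in>{F. finite F}. sum f F)"
  by (simp add: nonneg_infsum_complete)

lemma infsum_cmult_ennreal:
  fixes f :: "'a \<Rightarrow> ennreal"
  shows "(\<Sum>\<^sub>\<infinity>x. c * f x) = c * (\<Sum>\<^sub>\<infinity>x. f x)"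
  by (simp add: infsum_eq_SUP_sum SUP_mult_left_ennreal sum_distrib_left)

lemma infsum_multc_ennreal:
  fixes f :: "'a \<Rightarrow> ennreal"
  shows "(\<Sum>\<^sub>\<infinity>x. f x * c) = (\<Sum>\<^sub>\<infinity>x. f x) * c"
  using infsum_cmult_ennreal[of c f] by (simp add: mult.commute)

lemma infsum_add_ennreal:
  fixes f g :: "'a \<Rightarrow> ennreal"
  shows "(\<Sum>\<^sub>\<infinity>x. f x + g x) = (\<Sum>\<^sub>\<infinity>x. f x) + (\<Sum>\<^sub>\<infinity>x. g x)"
  by (intro infsum_add nonneg_summable_on_complete) simp_all

lemma infsum_mono_ennreal:
  fixes f g :: "'a \<Rightarrow> ennreal"
  assumes "\<And>x. f x \<le> g x"
  shows "(\<Sum>\<^sub>\<infinity>x. f x) \<le> (\<Sum>\<^sub>\<infinity>x. g x)"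
  using assms by (intro infsum_mono nonneg_summable_on_complete) simp_all

lemma infsum_single_point:
  fixes f :: "'a \<Rightarrow> ennreal"
  assumes "\<And>x. x \<noteq> a \<Longrightarrow> f x = 0"
  shows "infsum f UNIV = f a"
proof -
  have "infsum f UNIV = infsum f {a}"
    using assms by (intro infsum_cong_neutral) auto
  then show ?thesis by simp
qed

lemma infsum_delta [simp]:
  fixes f :: "'a \<Rightarrow> ennreal"
  shows "(\<Sum>\<^sub>\<infinity>x. if x = a then f x else 0) = f a"
    and "(\<Sum>\<^sub>\<infinity>x. if a = x then f x else 0) = f a"
  by (subst infsum_single_point[where a = a]; simp)+

lemma le_infsum_ennreal:
  fixes f :: "'a \<Rightarrow> ennreal"
  shows "f a \<le> infsum f UNIV"
proof -
  have "(\<Sum>\<^sub>\<infinity>x. if x = a then f x else 0) \<le> infsum f UNIV"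
    by (rule infsum_mono_ennreal) simp
  then show ?thesis by simp
qed

text \<open>Directedness is what lets a supremum pass through a sum: the indices chosen for two
  summands have a common upper bound.\<close>

lemma sum_SUP_directed_ennreal:
  fixes f :: "'i \<Rightarrow> 'a \<Rightarrow> ennreal"
  assumes "I \<noteq> {}" and dir: "\<And>i j. i \<in> I \<Longrightarrow> j \<in> I \<Longrightarrow> \<exists>k\<in>I. f i \<le> f k \<and> f j \<le> f k"
    and "finite F"
  shows "(\<Sum>x\<in>F. SUP i\<in>I. f i x) = (SUP i\<in>I. \<Sum>x\<in>F. f i x)"
  using \<open>finite F\<close>
proof (induction F)
  case empty
  then show ?case using \<open>I \<noteq> {}\<close> by (simp add: bot_ennreal)
next
  case (insert x F)
  have "(SUP i\<in>I. f i x + (\<Sum>x\<in>F. f i x)) = (SUP i\<in>I. f i x) + (SUP i\<in>I. \<Sum>x\<in>F. f i x)"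
  proof (rule SUP_add_directed_ennreal)
    fix i j assume "i \<in> I" "j \<in> I"
    then obtain k where "k \<in> I" "f i \<le> f k" "f j \<le> f k" using dir by blast
    then show "\<exists>k\<in>I. f i x + (\<Sum>x\<in>F. f j x) \<le> f k x + (\<Sum>x\<in>F. f k x)"
      by (intro bexI[of _ k] add_mono sum_mono) (auto simp: le_fun_def)
  qed
  then show ?case using insert by simp
qed

text \<open>Monotone convergence: an infinite sum is itself a supremum over finite sets, so after
  the finite case only two suprema have to be exchanged.\<close>

lemma infsum_SUP_directed_ennreal:
  fixes f :: "'i \<Rightarrow> 'a \<Rightarrow> ennreal"
  assumes "I \<noteq> {}" and "\<And>i j. i \<in> I \<Longrightarrow> j \<in> I \<Longrightarrow> \<exists>k\<in>I. f i \<le> f k \<and> f j \<le> f k"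
  shows "(\<Sum>\<^sub>\<infinity>x. SUP i\<in>I. f i x) = (SUP i\<in>I. \<Sum>\<^sub>\<infinity>x. f i x)"
proof -
  have "(\<Sum>\<^sub>\<infinity>x. SUP i\<in>I. f i x) = (SUP F\<in>{F. finite F}. \<Sum>x\<in>F. SUP i\<in>I. f i x)"
    by (rule infsum_eq_SUP_sum)
  also have "\<dots> = (SUP F\<in>{F. finite F}. SUP i\<in>I. \<Sum>x\<in>F. f i x)"
    using sum_SUP_directed_ennreal[OF assms] by (intro SUP_cong) auto
  also have "\<dots> = (SUP i\<in>I. SUP F\<in>{F. finite F}. \<Sum>x\<in>F. f i x)"
    by (rule SUP_commute)
  finally show ?thesis by (simp add: infsum_eq_SUP_sum)
qed

lemma infsum_SUP_incseq:
  fixes f :: "nat \<Rightarrow> 'a \<Rightarrow> ennreal"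
  assumes "incseq f"
  shows "(\<Sum>\<^sub>\<infinity>x. SUP n. f n x) = (SUP n. \<Sum>\<^sub>\<infinity>x. f n x)"
proof (rule infsum_SUP_directed_ennreal)
  fix i j :: nat
  show "\<exists>k\<in>UNIV. f i \<le> f k \<and> f j \<le> f k"
    using assms by (intro bexI[of _ "max i j"]) (auto simp: incseq_def)
qed simp

lemma infsum_sum_ennreal:
  fixes f :: "'a \<Rightarrow> 'b \<Rightarrow> ennreal"
  assumes "finite F"
  shows "(\<Sum>\<^sub>\<infinity>x. \<Sum>y\<in>F. f x y) = (\<Sum>y\<in>F. \<Sum>\<^sub>\<infinity>x. f x y)"
  using assms by (induction F) (simp_all add: infsum_add_ennreal)

text \<open>Tonelli: the inner sum is a supremum of finite partial sums, directed by union, and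
  monotone convergence moves it outside.\<close>

lemma infsum_swap_ennreal:
  fixes f :: "'a \<Rightarrow> 'b \<Rightarrow> ennreal"
  shows "(\<Sum>\<^sub>\<infinity>x. \<Sum>\<^sub>\<infinity>y. f x y) = (\<Sum>\<^sub>\<infinity>y. \<Sum>\<^sub>\<infinity>x. f x y)"
proof -
  have "(\<Sum>\<^sub>\<infinity>x. \<Sum>\<^sub>\<infinity>y. f x y) = (\<Sum>\<^sub>\<infinity>x. SUP F\<in>{F. finite F}. \<Sum>y\<in>F. f x y)"
    by (simp add: infsum_eq_SUP_sum)
  also have "\<dots> = (SUP F\<in>{F. finite F}. \<Sum>\<^sub>\<infinity>x. \<Sum>y\<in>F. f x y)"
  proof (rule infsum_SUP_directed_ennreal)
    fix F G :: "'b set" assume "F \<in> {F. finite F}" "G \<in> {F. finite F}"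
    then show "\<exists>K\<in>{F. finite F}. (\<lambda>x. \<Sum>y\<in>F. f x y) \<le> (\<lambda>x. \<Sum>y\<in>K. f x y) \<and>
        (\<lambda>x. \<Sum>y\<in>G. f x y) \<le> (\<lambda>x. \<Sum>y\<in>K. f x y)"
      by (intro bexI[of _ "F \<union> G"]) (auto simp: le_fun_def intro!: sum_mono2)
  qed auto
  also have "\<dots> = (SUP F\<in>{F. finite F}. \<Sum>y\<in>F. \<Sum>\<^sub>\<infinity>x. f x y)"
    by (intro SUP_cong) (auto simp: infsum_sum_ennreal)
  finally show ?thesis by (simp add: infsum_eq_SUP_sum)
qed

text \<open>Sorts a sum by the value of \<open>g\<close>. Monomials are grouped in this way later:
  lists by their multiset, multisets by the multiplicity of one variable.\<close>

lemma infsum_fibers: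
  fixes f :: "'a \<Rightarrow> ennreal"
  shows "(\<Sum>\<^sub>\<infinity>y. \<Sum>\<^sub>\<infinity>x. if g x = y then f x else 0) = (\<Sum>\<^sub>\<infinity>x. f x)"
proof -
  have "(\<Sum>\<^sub>\<infinity>y. \<Sum>\<^sub>\<infinity>x. if g x = y then f x else 0) = (\<Sum>\<^sub>\<infinity>x. \<Sum>\<^sub>\<infinity>y. if g x = y then f x else 0)"
    by (rule infsum_swap_ennreal)
  then show ?thesis by simp
qed

lemma infsum_support_range:
  fixes f :: "'a \<Rightarrow> ennreal"
  assumes "inj g" and "\<And>x. x \<notin> range g \<Longrightarrow> f x = 0"
  shows "infsum f UNIV = (\<Sum>\<^sub>\<infinity>y. f (g y))"
proof -
  have "infsum f UNIV = infsum f (range g)"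
    using assms(2) by (intro infsum_cong_neutral) auto
  then show ?thesis using infsum_reindex[OF assms(1), of f] by (simp add: comp_def)
qed

text \<open>Stated for a curried injective constructor \<open>g\<close>, to serve both for
  \<open>Pair\<close> and for nonempty lists.\<close>

lemma infsum_support_range2:
  fixes f :: "'c \<Rightarrow> ennreal"
  assumes inj: "\<And>a b a' b'. g a b = g a' b' \<Longrightarrow> a = a' \<and> b = b'"
    and supp: "\<And>c. (\<And>a b. c \<noteq> g a b) \<Longrightarrow> f c = 0"
  shows "infsum f UNIV = (\<Sum>\<^sub>\<infinity>a. \<Sum>\<^sub>\<infinity>b. f (g a b))"
proof -
  have "f c = (\<Sum>\<^sub>\<infinity>a. \<Sum>\<^sub>\<infinity>b. if g a b = c then f (g a b) else 0)" for c
  proof (cases "\<exists>a b. c = g a b")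
    case True
    then obtain a' b' where c: "c = g a' b'" by blast
    have "(\<Sum>\<^sub>\<infinity>b. if g a b = c then f (g a b) else 0) = (if a = a' then f c else 0)" for a
      unfolding c by (subst infsum_single_point[where a = b']) (auto dest: inj)
    then show ?thesis by simp
  next
    case False
    then have "f c = 0" "\<And>a b. g a b \<noteq> c" using supp by auto
    then show ?thesis by simp
  qed
  then have "infsum f UNIV = (\<Sum>\<^sub>\<infinity>c. \<Sum>\<^sub>\<infinity>a. \<Sum>\<^sub>\<infinity>b. if g a b = c then f (g a b) else 0)"
    by (intro infsum_cong)
  also have "\<dots> = (\<Sum>\<^sub>\<infinity>a. \<Sum>\<^sub>\<infinity>c. \<Sum>\<^sub>\<infinity>b. if g a b = c then f (g a b) else 0)"
    by (rule infsum_swap_ennreal)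
  also have "\<dots> = (\<Sum>\<^sub>\<infinity>a. \<Sum>\<^sub>\<infinity>b. f (g a b))"
    by (simp add: infsum_fibers)
  finally show ?thesis .
qed

section \<open>Sums over points of a given shape\<close>

lemma infsum_Pair:
  fixes f :: "pt \<Rightarrow> ennreal"
  assumes "\<And>c. (\<And>a b. c \<noteq> Pair a b) \<Longrightarrow> f c = 0"
  shows "infsum f UNIV = (\<Sum>\<^sub>\<infinity>a. \<Sum>\<^sub>\<infinity>b. f (Pair a b))"
  using assms by (intro infsum_support_range2) simp_all

lemma infsum_Bag:
  fixes f :: "pt \<Rightarrow> ennreal"
  assumes "\<And>c. (\<And>b. c \<noteq> Bag b) \<Longrightarrow> f c = 0"
  shows "infsum f UNIV = (\<Sum>\<^sub>\<infinity>b. f (Bag b))"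
  using assms by (intro infsum_support_range) (auto intro: injI)

lemma infsum_In:
  fixes f :: "pt \<Rightarrow> ennreal"
  assumes "\<And>c. (\<And>i a. c \<noteq> In i a) \<Longrightarrow> f c = 0"
  shows "infsum f UNIV = (\<Sum>\<^sub>\<infinity>a. f (In Lft a)) + (\<Sum>\<^sub>\<infinity>a. f (In Rgt a))"
proof -
  have eq: "f c = (if c \<in> range (In Lft) then f c else 0) + (if c \<in> range (In Rgt) then f c else 0)" for c
  proof (cases "\<exists>i a. c = In i a")
    case True
    then obtain i a where "c = In i a" by blast
    then show ?thesis by (cases i) auto
  next
    case False
    then show ?thesis using assms[of c] by auto
  qed
  have "infsum f UNIV = (\<Sum>\<^sub>\<infinity>c. if c \<in> range (In Lft) then f c else 0) +
      (\<Sum>\<^sub>\<infinity>c. if c \<in> range (In Rgt) then f c else 0)"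
    unfolding infsum_add_ennreal[symmetric] using eq by (rule infsum_cong)
  also have "\<dots> = (\<Sum>\<^sub>\<infinity>a. f (In Lft a)) + (\<Sum>\<^sub>\<infinity>a. f (In Rgt a))"
    using infsum_support_range[of "In Lft" "\<lambda>c. if c \<in> range (In Lft) then f c else 0"]
      infsum_support_range[of "In Rgt" "\<lambda>c. if c \<in> range (In Rgt) then f c else 0"]
    by (simp add: inj_def)
  finally show ?thesis .
qed

text \<open>The diagonal is cofinal: \<open>max m n\<close> dominates both indices.\<close>

lemma SUP_mult_incseq_ennreal:
  fixes f g :: "nat \<Rightarrow> ennreal"
  assumes "incseq f" "incseq g"
  shows "(SUP n. f n) * (SUP n. g n) = (SUP n. f n * g n)"
proof (rule antisym)
  have "f m * g n \<le> (SUP n. f n * g n)" for m n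
    by (rule SUP_upper2[of "max m n"])
      (use assms in \<open>auto intro!: mult_mono simp: incseq_def\<close>)
  then show "(SUP n. f n) * (SUP n. g n) \<le> (SUP n. f n * g n)"
    by (simp add: SUP_mult_left_ennreal SUP_mult_right_ennreal SUP_least)
  show "(SUP n. f n * g n) \<le> (SUP n. f n) * (SUP n. g n)"
    by (intro SUP_least mult_mono SUP_upper) auto
qed

text \<open>The lowest coefficient where two series differ would dominate near \<open>0\<close>.\<close>

lemma power_series_coefficients_le:
  fixes f g :: "nat \<Rightarrow> ennreal"
  assumes fin: "infsum f UNIV < \<infinity>" "infsum g UNIV < \<infinity>"
    and eq: "\<And>x::ennreal. \<lbrakk>0 < x; x < 1\<rbrakk> \<Longrightarrow> (\<Sum>\<^sub>\<infinity>n. f n * x ^ n) = (\<Sum>\<^sub>\<infinity>n. g n * x ^ n)"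
    and low: "\<And>k. k < n \<Longrightarrow> f k = g k"
  shows "f n \<le> g n"
proof -
  define G where "G = infsum g UNIV"
  have gfin: "g k < \<infinity>" for k
    using le_infsum_ennreal[of g k] fin by (simp add: order_le_less_trans)
  \<comment> \<open>Separates the terms below degree \<open>n\<close>, on which \<open>f\<close> and
    \<open>g\<close> agree, from the tails. As these terms are finite, they can be
    cancelled.\<close>
  have split: "(\<Sum>\<^sub>\<infinity>k. h k * x ^ k) = (\<Sum>k<n. h k * x ^ k) + (\<Sum>\<^sub>\<infinity>j. h (n + j) * x ^ (n + j))"
    for h :: "nat \<Rightarrow> ennreal" and x :: ennreal
  proof -
    have "(\<Sum>\<^sub>\<infinity>k. h k * x ^ k) = (\<Sum>\<^sub>\<infinity>k. (if k < n then h k * x ^ k else 0) + (if n \<le> k then h k * x ^ k else 0))"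
      by (intro infsum_cong) auto
    also have "\<dots> = (\<Sum>\<^sub>\<infinity>k. if k < n then h k * x ^ k else 0) + (\<Sum>\<^sub>\<infinity>k. if n \<le> k then h k * x ^ k else 0)"
      by (rule infsum_add_ennreal)
    also have "(\<Sum>\<^sub>\<infinity>k. if k < n then h k * x ^ k else 0) = infsum (\<lambda>k. h k * x ^ k) {..<n}"
      by (intro infsum_cong_neutral) auto
    also have "(\<Sum>\<^sub>\<infinity>k. if n \<le> k then h k * x ^ k else 0) = (\<Sum>\<^sub>\<infinity>j. h (n + j) * x ^ (n + j))"
      by (subst infsum_support_range[where g = "\<lambda>j. n + j"]) (auto simp: inj_def image_iff le_iff_add)
    finally show ?thesis by simp
  qed
  \<comment> \<open>After cancellation of \<open>x ^ n\<close> the constant terms of the tails are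
    \<open>f n\<close> and \<open>g n\<close>. Every further power of \<open>x\<close> is at most
    \<open>x\<close>, so the rest of the tail of \<open>g\<close> weighs at most
    \<open>x * G\<close>.\<close>
  have bound: "f n \<le> g n + x * G" if x: "0 < x" "x < 1" for x :: ennreal
  proof -
    have xfin: "x < top" using x by (meson order_less_le_trans top_greatest)
    have "(\<Sum>k<n. g k * x ^ k) < top"
      using gfin xfin by (simp add: ennreal_mult_less_top power_less_top_ennreal)
    moreover have "(\<Sum>k<n. f k * x ^ k) = (\<Sum>k<n. g k * x ^ k)"
      using low by (intro sum.cong) auto
    ultimately have "(\<Sum>k<n. g k * x ^ k) \<noteq> top"
        "(\<Sum>k<n. g k * x ^ k) + (\<Sum>\<^sub>\<infinity>j. f (n + j) * x ^ (n + j)) =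
         (\<Sum>k<n. g k * x ^ k) + (\<Sum>\<^sub>\<infinity>j. g (n + j) * x ^ (n + j))"
      using eq[OF x] unfolding split[of f x] split[of g x] by (simp_all only: less_top)
    then have "(\<Sum>\<^sub>\<infinity>j. f (n + j) * x ^ (n + j)) = (\<Sum>\<^sub>\<infinity>j. g (n + j) * x ^ (n + j))"
      by (simp only: ennreal_add_left_cancel simp_thms infinity_ennreal_def)
    then have "x ^ n * (\<Sum>\<^sub>\<infinity>j. f (n + j) * x ^ j) = x ^ n * (\<Sum>\<^sub>\<infinity>j. g (n + j) * x ^ j)"
      by (simp add: infsum_cmult_ennreal[symmetric] power_add mult.commute mult.left_commute)
    then have eq': "(\<Sum>\<^sub>\<infinity>j. f (n + j) * x ^ j) = (\<Sum>\<^sub>\<infinity>j. g (n + j) * x ^ j)"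
      using x xfin by (subst (asm) ennreal_mult_cancel_left) (auto simp: power_eq_top_ennreal)
    have "f n \<le> (\<Sum>\<^sub>\<infinity>j. f (n + j) * x ^ j)"
      using le_infsum_ennreal[of "\<lambda>j. f (n + j) * x ^ j" 0] by simp
    also have "\<dots> \<le> (\<Sum>\<^sub>\<infinity>j. (if j = 0 then g n else 0) + x * g (n + j))"
      unfolding eq'
    proof (rule infsum_mono_ennreal)
      fix j
      show "g (n + j) * x ^ j \<le> (if j = 0 then g n else 0) + x * g (n + j)"
      proof (cases j)
        case (Suc i)
        have "x ^ i \<le> 1" using x by (simp add: power_le_one)
        then have "g (n + j) * (x * x ^ i) \<le> g (n + j) * (x * 1)"
          by (intro mult_left_mono) auto
        then show ?thesis using Suc by (simp add: mult.commute)
      qed simp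
    qed
    also have "\<dots> = g n + x * (\<Sum>\<^sub>\<infinity>j. g (n + j))"
      by (simp add: infsum_add_ennreal infsum_cmult_ennreal)
    also have "(\<Sum>\<^sub>\<infinity>j. g (n + j)) = (\<Sum>\<^sub>\<infinity>k. if n \<le> k then g k else 0)"
      by (subst infsum_support_range[where g = "\<lambda>j. n + j"]) (auto simp: inj_def image_iff le_iff_add)
    also have "\<dots> \<le> G" unfolding G_def by (rule infsum_mono_ennreal) simp
    finally show ?thesis by (simp add: add_left_mono mult_left_mono)
  qed
  obtain r s where r: "g n = ennreal r" "r \<ge> 0" and s: "G = ennreal s" "s \<ge> 0"
    using gfin[of n] fin(2) unfolding G_def
    by (metis ennreal_cases infinity_ennreal_def less_irrefl)
  show "f n \<le> g n"
  proof (rule ennreal_le_epsilon)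
    fix e :: real assume "0 < e"
    \<comment> \<open>\<open>y\<close> must lie strictly between \<open>0\<close> and
      \<open>1\<close> and satisfy \<open>y * s \<le> e\<close>; adding \<open>1\<close> to
      \<open>s\<close> covers \<open>s = 0\<close>.\<close>
    define y where "y = min (1/2) (e / (s + 1))"
    have y: "0 < y" "y < 1" using \<open>0 < e\<close> s by (auto simp: y_def)
    have "y * s \<le> e / (s + 1) * s" using s by (intro mult_right_mono) (auto simp: y_def)
    also have "\<dots> \<le> e" using s \<open>0 < e\<close> by (simp add: field_simps)
    finally have "y * s \<le> e" .
    have "f n \<le> g n + ennreal y * G" using y by (intro bound) (auto simp: ennreal_less_one_iff)
    also have "ennreal y * G = ennreal (y * s)" using y s by (simp add: ennreal_mult)
    also have "g n + \<dots> \<le> g n + ennreal e" using \<open>y * s \<le> e\<close> by (intro add_left_mono ennreal_leI)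
    finally show "f n \<le> g n + ennreal e" .
  qed
qed

text \<open>By strong induction, the previous bound being applied in both directions.\<close>

lemma power_series_coefficients_eq:
  fixes f g :: "nat \<Rightarrow> ennreal"
  assumes "infsum f UNIV < \<infinity>" "infsum g UNIV < \<infinity>"
    and "\<And>x::ennreal. \<lbrakk>0 < x; x < 1\<rbrakk> \<Longrightarrow> (\<Sum>\<^sub>\<infinity>n. f n * x ^ n) = (\<Sum>\<^sub>\<infinity>n. g n * x ^ n)"
  shows "f n = g n"
proof (induction n rule: less_induct)
  case (less n)
  show ?case
    using power_series_coefficients_le[of f g n, OF assms(1,2,3) less]
      power_series_coefficients_le[of g f n, OF assms(2,1) assms(3)[symmetric] less[symmetric]]
    by (rule antisym)
qed

section \<open>Linear algebra\<close>

text \<open>Turns a matrix over all points into one that vanishes off the source web, as membership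
  in \<open>Pcoh\<close> demands.\<close>

definition rowr :: "pt set \<Rightarrow> mat \<Rightarrow> mat" where
  "rowr I t = (\<lambda>a b. if a \<in> I then t a b else 0)"

definition rst :: "pt set \<Rightarrow> vec \<Rightarrow> vec" where
  "rst J u = (\<lambda>a. if a \<in> J then u a else 0)"

lemma mapp_mcomp: "(s \<circ>\<^sub>m t) \<odot> u = s \<odot> t \<odot> u"
proof
  fix c
  have "((s \<circ>\<^sub>m t) \<odot> u) c = (\<Sum>\<^sub>\<infinity>a. \<Sum>\<^sub>\<infinity>b. s b c * (t a b * u a))"
    unfolding mapp_def mcomp_def infsum_multc_ennreal[symmetric] by (simp add: mult_ac)
  also have "\<dots> = (\<Sum>\<^sub>\<infinity>b. \<Sum>\<^sub>\<infinity>a. s b c * (t a b * u a))"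
    by (rule infsum_swap_ennreal)
  also have "\<dots> = (s \<odot> t \<odot> u) c"
    by (simp add: mapp_def infsum_cmult_ennreal)
  finally show "((s \<circ>\<^sub>m t) \<odot> u) c = (s \<odot> t \<odot> u) c" .
qed

text \<open>A row is the image of a basis vector. Equations between composites will be checked row
  by row, and in this form a structural matrix simply acts on a row of a coalgebra
  structure.\<close>

lemma mcomp_row: "(s \<circ>\<^sub>m t) a = s \<odot> t a"
  by (simp add: mcomp_def mapp_def mult.commute)

lemma pairing_commute: "pairing u v = pairing v u"
  by (simp add: pairing_def mult.commute)

text \<open>Transposition: the functional \<open>w\<close> is pulled back along
  \<open>t\<close>.\<close>

lemma pairing_mapp: "pairing (t \<odot> u) w = pairing u (\<lambda>a. pairing (t a) w)"
proof -
  have "pairing (t \<odot> u) w = (\<Sum>\<^sub>\<infinity>b. \<Sum>\<^sub>\<infinity>a. t a b * u a * w b)"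
    by (simp add: pairing_def mapp_def infsum_multc_ennreal)
  also have "\<dots> = (\<Sum>\<^sub>\<infinity>a. \<Sum>\<^sub>\<infinity>b. t a b * u a * w b)"
    by (rule infsum_swap_ennreal)
  also have "\<dots> = pairing u (\<lambda>a. pairing (t a) w)"
    by (simp add: pairing_def infsum_cmult_ennreal[symmetric] mult_ac)
  finally show ?thesis .
qed

lemma pairing_mono: "u \<le> u' \<Longrightarrow> v \<le> v' \<Longrightarrow> pairing u v \<le> pairing u' v'"
  unfolding pairing_def by (intro infsum_mono_ennreal mult_mono) (auto simp: le_fun_def)

lemma mapp_mono: "(\<And>a. u a \<noteq> 0 \<Longrightarrow> s a \<le> t a) \<Longrightarrow> u \<le> v \<Longrightarrow> s \<odot> u \<le> t \<odot> v"
  unfolding mapp_def le_fun_def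
  by (intro allI infsum_mono_ennreal) (metis mult_mono mult_zero_right zero_le)

lemma mapp_cong: "(\<And>a. u a \<noteq> 0 \<Longrightarrow> s a = t a) \<Longrightarrow> s \<odot> u = t \<odot> u"
  unfolding mapp_def by (intro ext infsum_cong) (metis mult_zero_right)

lemma mapp_add: "t \<odot> (\<lambda>a. u a + v a) = (\<lambda>b. (t \<odot> u) b + (t \<odot> v) b)"
  by (simp add: mapp_def distrib_left infsum_add_ennreal)

lemma mapp_cmult: "t \<odot> (\<lambda>a. c * u a) = (\<lambda>b. c * (t \<odot> u) b)"
  by (simp add: mapp_def infsum_cmult_ennreal[symmetric] mult_ac)

lemma mat_add_mapp: "(\<lambda>a b. s a b + t a b) \<odot> u = (\<lambda>b. (s \<odot> u) b + (t \<odot> u) b)"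
  by (simp add: mapp_def distrib_right infsum_add_ennreal)

lemma mat_cmult_mapp: "(\<lambda>a b. c * t a b) \<odot> u = (\<lambda>b. c * (t \<odot> u) b)"
  by (simp add: mapp_def infsum_cmult_ennreal[symmetric] mult_ac)

lemma mapp_zero [simp]: "t \<odot> (\<lambda>_. 0) = (\<lambda>_. 0)"
  by (simp add: mapp_def)

lemma zero_mapp [simp]: "(\<lambda>_ _. 0) \<odot> u = (\<lambda>_. 0)"
  by (simp add: mapp_def)

lemma mapp_unit_vec [simp]: "t \<odot> unit_vec a = t a"
proof
  fix b
  show "(t \<odot> unit_vec a) b = t a b"
    unfolding mapp_def by (subst infsum_single_point[where a = a]) (auto simp: unit_vec_def)
qed

text \<open>The identity of every space at once, in contrast to \<open>idm\<close>, which depends on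
  a web.\<close>

definition IDU :: mat where
  "IDU = (\<lambda>a. unit_vec a)"

lemma IDU_mapp [simp]: "IDU \<odot> u = u"
proof
  fix b show "(IDU \<odot> u) b = u b"
    unfolding mapp_def by (subst infsum_single_point[where a = b]) (simp_all add: IDU_def unit_vec_def)
qed

text \<open>Continuity in the matrix, by monotone convergence; it governs the supremum of
  approximations that interprets \<open>Fix\<close>.\<close>

lemma mapp_SUP_left:
  assumes "incseq t"
  shows "(\<lambda>a b. SUP n. t n a b) \<odot> u = (\<lambda>b. SUP n. (t n \<odot> u) b)"
  unfolding mapp_def SUP_mult_right_ennreal
  using assms
  by (intro ext infsum_SUP_incseq) (auto simp: incseq_def le_fun_def intro!: mult_right_mono)

lemma mapp_SUP_right:
  assumes "incseq u"
  shows "t \<odot> (\<lambda>a. SUP n. u n a) = (\<lambda>b. SUP n. (t \<odot> u n) b)"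
  unfolding mapp_def SUP_mult_left_ennreal
  using assms
  by (intro ext infsum_SUP_incseq) (auto simp: incseq_def le_fun_def intro!: mult_left_mono)

lemma pairing_SUP_left:
  assumes "incseq u"
  shows "pairing (\<lambda>a. SUP n. u n a) v = (SUP n. pairing (u n) v)"
  unfolding pairing_def SUP_mult_right_ennreal
  using assms
  by (intro infsum_SUP_incseq) (auto simp: incseq_def le_fun_def intro!: mult_right_mono)

lemma pairing_add_left: "pairing (\<lambda>a. u a + v a) w = pairing u w + pairing v w"
  by (simp add: pairing_def distrib_right infsum_add_ennreal)

lemma pairing_cmult_left: "pairing (\<lambda>a. c * u a) w = c * pairing u w"
  by (simp add: pairing_def mult.assoc infsum_cmult_ennreal)

lemma pairing_cmult_right: "pairing u (\<lambda>a. c * w a) = c * pairing u w"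
  using pairing_cmult_left[of c w u] by (simp add: pairing_commute)

lemma pairing_unit_vec [simp]: "pairing u (unit_vec a) = u a"
  unfolding pairing_def by (subst infsum_single_point[where a = a]) (auto simp: unit_vec_def)

lemma mult_le_pairing: "u a * v a \<le> pairing u v"
  unfolding pairing_def by (rule le_infsum_ennreal[of "\<lambda>a. u a * v a"])

lemma mult_le_mapp: "t a b * u a \<le> (t \<odot> u) b"
  unfolding mapp_def by (rule le_infsum_ennreal[of "\<lambda>a. t a b * u a"])

lemma pairing_rst: "pairing (rst J u) v = pairing u (rst J v)"
  unfolding pairing_def rst_def by (intro infsum_cong) auto

lemma rst_le: "rst J u \<le> u"
  by (simp add: rst_def le_fun_def)

lemma rst_id: "(\<And>a. a \<notin> J \<Longrightarrow> u a = 0) \<Longrightarrow> rst J u = u"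
  by (auto simp: rst_def)

lemma idm_mapp: "idm I \<odot> u = rst I u"
proof
  fix b
  show "(idm I \<odot> u) b = rst I u b"
    unfolding mapp_def by (subst infsum_single_point[where a = b]) (auto simp: idm_def rst_def)
qed

lemma tensv_Pair [simp]: "(u \<otimes>\<^sub>v v) (Pair a b) = u a * v b"
  by (simp add: tensv_def)

lemma tensv_eq_0: "(\<And>a b. c \<noteq> Pair a b) \<Longrightarrow> (u \<otimes>\<^sub>v v) c = 0"
  by (cases c) (auto simp: tensv_def)

lemma tensm_row [simp]: "(s \<otimes>\<^sub>m t) (Pair a b) = s a \<otimes>\<^sub>v t b"
  by (auto simp: tensm_def tensv_def split: pt.splits)

lemma tensm_row_0: "(\<And>a b. c \<noteq> Pair a b) \<Longrightarrow> (s \<otimes>\<^sub>m t) c = (\<lambda>_. 0)"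
  by (cases c) (auto simp: tensm_def)

lemma mapp_tensv: "(T \<odot> (u \<otimes>\<^sub>v v)) c = (\<Sum>\<^sub>\<infinity>a. \<Sum>\<^sub>\<infinity>b. T (Pair a b) c * (u a * v b))"
  unfolding mapp_def by (subst infsum_Pair) (auto simp: tensv_eq_0)

lemma pairing_tensv: "pairing w (u \<otimes>\<^sub>v v) = (\<Sum>\<^sub>\<infinity>a. \<Sum>\<^sub>\<infinity>b. w (Pair a b) * (u a * v b))"
  unfolding pairing_def by (subst infsum_Pair) (auto simp: tensv_eq_0)

lemma mapp_tensm: "(s \<otimes>\<^sub>m t) \<odot> (u \<otimes>\<^sub>v v) = (s \<odot> u) \<otimes>\<^sub>v (t \<odot> v)"
proof
  fix c
  show "((s \<otimes>\<^sub>m t) \<odot> (u \<otimes>\<^sub>v v)) c = ((s \<odot> u) \<otimes>\<^sub>v (t \<odot> v)) c"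
  proof (cases "\<exists>a' b'. c = Pair a' b'")
    case True
    then obtain a' b' where c: "c = Pair a' b'" by blast
    have "((s \<otimes>\<^sub>m t) \<odot> (u \<otimes>\<^sub>v v)) c = (\<Sum>\<^sub>\<infinity>a. \<Sum>\<^sub>\<infinity>b. (s a a' * u a) * (t b b' * v b))"
      unfolding mapp_tensv c by (simp add: mult_ac)
    also have "\<dots> = (s \<odot> u) a' * (t \<odot> v) b'"
      by (simp only: infsum_cmult_ennreal infsum_multc_ennreal mapp_def)
    finally show ?thesis by (simp add: c)
  next
    case False
    then show ?thesis by (simp add: mapp_tensv tensv_eq_0)
  qed
qed

text \<open>The matrix on the left freezes the first argument of \<open>T\<close>. It reduces
  questions about a bilinear map to a linear one in the remaining argument.\<close>

lemma tensv_mat_right: "(\<lambda>d. T \<odot> (u \<otimes>\<^sub>v unit_vec d)) \<odot> v = T \<odot> (u \<otimes>\<^sub>v v)"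
proof
  fix c
  have "(T \<odot> (u \<otimes>\<^sub>v unit_vec d)) c = (\<Sum>\<^sub>\<infinity>a. T (Pair a d) c * u a)" for d
    unfolding mapp_tensv
    by (intro infsum_cong, subst infsum_single_point[where a = d]) (simp_all add: unit_vec_def)
  then have "((\<lambda>d. T \<odot> (u \<otimes>\<^sub>v unit_vec d)) \<odot> v) c = (\<Sum>\<^sub>\<infinity>d. (\<Sum>\<^sub>\<infinity>a. T (Pair a d) c * u a) * v d)"
    by (simp add: mapp_def)
  also have "\<dots> = (\<Sum>\<^sub>\<infinity>d. \<Sum>\<^sub>\<infinity>a. T (Pair a d) c * (u a * v d))"
    by (simp only: infsum_multc_ennreal[symmetric] mult.assoc)
  also have "\<dots> = (\<Sum>\<^sub>\<infinity>a. \<Sum>\<^sub>\<infinity>d. T (Pair a d) c * (u a * v d))"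
    by (rule infsum_swap_ennreal)
  finally show "((\<lambda>d. T \<odot> (u \<otimes>\<^sub>v unit_vec d)) \<odot> v) c = (T \<odot> (u \<otimes>\<^sub>v v)) c"
    unfolding mapp_tensv .
qed

lemma tensv_mat_left: "(\<lambda>d. T \<odot> (unit_vec d \<otimes>\<^sub>v v)) \<odot> u = T \<odot> (u \<otimes>\<^sub>v v)"
proof
  fix c
  have "(T \<odot> (unit_vec d \<otimes>\<^sub>v v)) c = (\<Sum>\<^sub>\<infinity>b. T (Pair d b) c * v b)" for d
    unfolding mapp_tensv
    by (subst infsum_single_point[where a = d]) (simp_all add: unit_vec_def)
  then have "((\<lambda>d. T \<odot> (unit_vec d \<otimes>\<^sub>v v)) \<odot> u) c = (\<Sum>\<^sub>\<infinity>d. (\<Sum>\<^sub>\<infinity>b. T (Pair d b) c * v b) * u d)"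
    by (simp add: mapp_def)
  also have "\<dots> = (\<Sum>\<^sub>\<infinity>d. \<Sum>\<^sub>\<infinity>b. T (Pair d b) c * (u d * v b))"
    by (simp only: infsum_multc_ennreal[symmetric] mult.assoc mult.commute[of "v _"])
  finally show "((\<lambda>d. T \<odot> (unit_vec d \<otimes>\<^sub>v v)) \<odot> u) c = (T \<odot> (u \<otimes>\<^sub>v v)) c"
    unfolding mapp_tensv .
qed

lemma tensv_zero [simp]: "u \<otimes>\<^sub>v (\<lambda>_. 0) = (\<lambda>_. 0)" "(\<lambda>_. 0) \<otimes>\<^sub>v v = (\<lambda>_. 0)"
  by (auto simp: tensv_def split: pt.splits)

lemma tensv_mono: "u \<le> u' \<Longrightarrow> v \<le> v' \<Longrightarrow> u \<otimes>\<^sub>v v \<le> u' \<otimes>\<^sub>v v'"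
  by (auto simp: tensv_def le_fun_def intro!: mult_mono split: pt.splits)

lemma tensv_SUP_right:
  "u \<otimes>\<^sub>v (\<lambda>a. SUP n. v n a) = (\<lambda>c. SUP n::nat. (u \<otimes>\<^sub>v v n) c)"
  by (auto simp: tensv_def SUP_mult_left_ennreal split: pt.splits)

lemma rowr_mapp: "u \<in> vecs I \<Longrightarrow> rowr I t \<odot> u = t \<odot> u"
  by (rule mapp_cong) (auto simp: rowr_def vecs_def fun_eq_iff)

lemma vecs_rst: "u \<in> vecs I \<Longrightarrow> J \<subseteq> I \<Longrightarrow> rst J u \<in> vecs J"
  by (auto simp: vecs_def rst_def)

lemma prom_Bag [simp]: "prom u (Bag b) = (\<Prod>a\<in>#b. u a)"
  by (simp add: prom_def)

lemma prom_eq_0: "(\<And>b. c \<noteq> Bag b) \<Longrightarrow> prom u c = 0"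
  unfolding prom_def by (auto split: pt.split)

lemma prod_mset_mono_ennreal:
  fixes f g :: "'a \<Rightarrow> ennreal"
  shows "(\<And>a. a \<in># b \<Longrightarrow> f a \<le> g a) \<Longrightarrow> (\<Prod>a\<in>#b. f a) \<le> (\<Prod>a\<in>#b. g a)"
  by (induction b) (auto intro!: mult_mono)

lemma prom_mono: "u \<le> v \<Longrightarrow> prom u \<le> prom v"
  by (auto simp: prom_def le_fun_def intro!: prod_mset_mono_ennreal split: pt.splits)

text \<open>Finite products are continuous although not linear. Promotion inherits this, and the
  unfolding of \<open>Fix\<close> rests on it.\<close>

lemma prod_mset_SUP_ennreal:
  fixes f :: "nat \<Rightarrow> 'a \<Rightarrow> ennreal"
  assumes "incseq f"
  shows "(\<Prod>a\<in>#b. SUP n. f n a) = (SUP n. \<Prod>a\<in>#b. f n a)"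
proof (induction b)
  case (add x b)
  have "incseq (\<lambda>n. f n x)" "incseq (\<lambda>n. \<Prod>a\<in>#b. f n a)"
    using assms by (auto simp: incseq_def le_fun_def intro!: prod_mset_mono_ennreal)
  then show ?case using add by (simp add: SUP_mult_incseq_ennreal)
qed simp

lemma prom_SUP:
  assumes "incseq u"
  shows "prom (\<lambda>a. SUP n. u n a) = (\<lambda>c. SUP n. prom (u n) c)"
  using prod_mset_SUP_ennreal[OF assms] by (auto simp: prom_def split: pt.splits)


section \<open>Probabilistic coherence spaces\<close>

lemma countable_multisets:
  assumes "countable A"
  shows "countable {b. set_mset b \<subseteq> A}"
proof -
  have "{b. set_mset b \<subseteq> A} \<subseteq> mset ` lists A"
  proof
    fix b assume "b \<in> {b. set_mset b \<subseteq> A}"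
    moreover obtain xs where "b = mset xs" using ex_mset by metis
    ultimately show "b \<in> mset ` lists A" by (auto simp: lists_eq_set)
  qed
  then show ?thesis using assms by (meson countable_image countable_lists countable_subset)
qed

text \<open>Disposes of the countability clause of \<open>is_pcs\<close> for all webs at
  once.\<close>

lemma countable_pt: "countable (A :: pt set)"
proof -
  \<comment> \<open>\<open>L n\<close> consists of the points in which constructors are nested at
    most \<open>n\<close> deep.\<close>
  define L where "L = rec_nat {} (\<lambda>_ S. {Star} \<union> case_prod Pair ` (S \<times> S) \<union> case_prod In ` (UNIV \<times> S) \<union>
    Bag ` {b. set_mset b \<subseteq> S})"
  have L_Suc: "L (Suc n) = {Star} \<union> case_prod Pair ` (L n \<times> L n) \<union> case_prod In ` (UNIV \<times> L n) \<union>
    Bag ` {b. set_mset b \<subseteq> L n}" for n by (simp add: L_def)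
  have side: "(UNIV :: side set) = {Lft, Rgt}" by (auto intro: side.exhaust)
  have "countable (L n)" for n
  proof (induction n)
    case 0 then show ?case by (simp add: L_def)
  next
    case (Suc n)
    then show ?case unfolding L_Suc side
      by (intro countable_Un countable_image countable_SIGMA countable_multisets) auto
  qed
  moreover have mono: "L n \<subseteq> L (Suc n)" for n
  proof (induction n)
    case 0 then show ?case by (simp add: L_def)
  next
    case (Suc n)
    then show ?case by (subst (1 2) L_Suc) auto
  qed
  have mono': "L n \<subseteq> L m" if "n \<le> m" for n m
    using mono that by (rule lift_Suc_mono_le)
  have "\<exists>n. a \<in> L n" for a
  proof (induction a)
    case Star
    then show ?case by (intro exI[of _ "Suc 0"]) (simp add: L_Suc)
  next
    case (Pair a b)
    then obtain n m where "a \<in> L n" "b \<in> L m" by blast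
    then have "a \<in> L (max n m)" "b \<in> L (max n m)"
      using mono'[of n "max n m"] mono'[of m "max n m"] by auto
    then show ?case by (intro exI[of _ "Suc (max n m)"]) (auto simp: L_Suc)
  next
    case (In i a)
    then obtain n where "a \<in> L n" by blast
    then show ?case by (intro exI[of _ "Suc n"]) (auto simp: L_Suc)
  next
    case (Bag b)
    then obtain f where f: "\<And>a. a \<in># b \<Longrightarrow> a \<in> L (f a)" by metis
    \<comment> \<open>A bag has finitely many distinct elements, so one level contains them all; for
      the empty bag the claim is vacuous and any value serves.\<close>
    define n where "n = Max (f ` set_mset b)"
    have "a \<in> L n" if "a \<in># b" for a
      using f[OF that] mono'[of "f a" n] that by (auto simp: n_def)
    then show ?case by (intro exI[of _ "Suc n"]) (auto simp: L_Suc)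
  qed
  then have "A \<subseteq> (\<Union>n. L n)" by blast
  ultimately show ?thesis by (meson countable_UN countable_subset countableI_type)
qed

text \<open>The conditions that accompany biorthogonality in \<open>is_pcs\<close>, isolated because
  they can be verified on a generating set and carry over to the space it generates.\<close>

definition covered :: "pt set \<Rightarrow> vec set \<Rightarrow> bool" where
  "covered I F \<longleftrightarrow> F \<subseteq> vecs I \<and> (\<forall>a\<in>I. \<exists>u\<in>F. u a > 0) \<and> (\<forall>a\<in>I. \<exists>A<\<infinity>. \<forall>u\<in>F. u a \<le> A)"

lemma is_pcs_iff: "is_pcs X \<longleftrightarrow> covered (web X) (pts X) \<and> orth (web X) (orth (web X) (pts X)) = pts X"
  by (auto simp: is_pcs_def covered_def countable_pt)

section \<open>Orthogonals and the spaces generated by a set of vectors\<close>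

lemma orth_anti: "F \<subseteq> G \<Longrightarrow> orth I G \<subseteq> orth I F"
  by (auto simp: orth_def)

lemma subset_biorth: "F \<subseteq> vecs I \<Longrightarrow> F \<subseteq> orth I (orth I F)"
  by (auto simp: orth_def pairing_commute)

lemma orth_vecs: "orth I F \<subseteq> vecs I"
  by (auto simp: orth_def)

lemma triple_orth: "F \<subseteq> vecs I \<Longrightarrow> orth I (orth I (orth I F)) = orth I F"
  by (simp add: antisym orth_anti orth_vecs subset_biorth)

lemma ennreal_inverse_mult_le_1: "(A::ennreal) < \<infinity> \<Longrightarrow> inverse (A + 1) * A \<le> 1"
proof -
  assume "A < \<infinity>"
  have "inverse (A + 1) * A \<le> inverse (A + 1) * (A + 1)" by (rule mult_left_mono) auto
  also have "\<dots> = 1"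
    using \<open>A < \<infinity>\<close> by (simp add: ennreal_divide_self divide_ennreal_def[symmetric] mult.commute)
  finally show ?thesis .
qed

lemma ennreal_le_inverse: "(x::ennreal) * y \<le> 1 \<Longrightarrow> 0 < y \<Longrightarrow> x \<le> inverse y"
proof (cases "y = \<infinity>")
  case True
  assume "x * y \<le> 1" "0 < y"
  then show ?thesis using True by (auto simp: ennreal_mult_top top_unique split: if_splits)
next
  case False
  assume "x * y \<le> 1" "0 < y"
  then have "x * y * inverse y \<le> 1 * inverse y" by (intro mult_right_mono) auto
  moreover have "y * inverse y = 1"
    using False \<open>0 < y\<close> by (simp add: ennreal_divide_self divide_ennreal_def[symmetric] less_top[symmetric])
  ultimately show ?thesis by (simp add: mult.assoc)
qed

lemma inverse_less_top: "inverse (x::ennreal) < top \<longleftrightarrow> 0 < x"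
  by (simp add: less_top[symmetric] zero_less_iff_neq_zero)

text \<open>Duality exchanges the two conditions: a bound at \<open>a\<close> provides a small
  multiple of the unit vector in the orthogonal, and a vector positive at \<open>a\<close> bounds
  the orthogonal there.\<close>

lemma covered_orth:
  assumes "covered I F"
  shows "covered I (orth I F)"
  unfolding covered_def
proof (intro conjI ballI)
  show "orth I F \<subseteq> vecs I" by (rule orth_vecs)
next
  fix a assume "a \<in> I"
  then obtain A where A: "A < \<infinity>" "\<And>u. u \<in> F \<Longrightarrow> u a \<le> A"
    using assms by (auto simp: covered_def)
  \<comment> \<open>The scalar is \<open>1 / (A + 1)\<close> rather than \<open>1 / A\<close>,
    because it has to stay finite when \<open>A = 0\<close>.\<close>
  define w where "w = (\<lambda>b. inverse (A + 1) * unit_vec a b)"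
  have "w a > 0" using A by (simp add: w_def unit_vec_def ennreal_inverse_positive)
  moreover have "w \<in> orth I F"
    unfolding orth_def
  proof (intro CollectI conjI ballI)
    show "w \<in> vecs I" using \<open>a \<in> I\<close> A by (auto simp: w_def vecs_def unit_vec_def inverse_less_top add_nonneg_pos)
    fix u assume "u \<in> F"
    then have "inverse (A + 1) * u a \<le> inverse (A + 1) * A" using A by (intro mult_left_mono) auto
    then show "pairing u w \<le> 1"
      using ennreal_inverse_mult_le_1[OF A(1)] by (simp add: w_def pairing_cmult_right)
  qed
  ultimately show "\<exists>u\<in>orth I F. u a > 0" by blast
next
  fix a assume "a \<in> I"
  then obtain u where u: "u \<in> F" "u a > 0" using assms by (auto simp: covered_def)
  have "w a \<le> inverse (u a)" if "w \<in> orth I F" for w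
  proof (rule ennreal_le_inverse)
    have "w a * u a \<le> pairing u w" using mult_le_pairing[of u a w] by (simp add: mult.commute)
    then show "w a * u a \<le> 1" using that u by (auto simp: orth_def)
  qed (fact u)
  then show "\<exists>A<\<infinity>. \<forall>u\<in>orth I F. u a \<le> A"
    using u(2) by (intro exI[of _ "inverse (u a)"]) (auto simp: inverse_less_top)
qed

lemma is_pcs_orth: "covered I F \<Longrightarrow> is_pcs \<lparr>web = I, pts = orth I F\<rparr>"
  by (simp add: is_pcs_iff covered_orth triple_orth covered_def[of I F])

text \<open>Biorthogonal closure, the common form of \<open>tensor\<close> and \<open>bang\<close>;
  \<open>mor_gen_pcs\<close> is its extension property.\<close>

definition gen_pcs :: "pt set \<Rightarrow> vec set \<Rightarrow> pcs" where
  "gen_pcs I F = \<lparr>web = I, pts = orth I (orth I F)\<rparr>"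

lemma web_gen_pcs [simp]: "web (gen_pcs I F) = I"
  by (simp add: gen_pcs_def)

lemma is_pcs_gen: "covered I F \<Longrightarrow> is_pcs (gen_pcs I F)"
  unfolding gen_pcs_def by (intro is_pcs_orth covered_orth)

lemma gen_pcs_generator: "covered I F \<Longrightarrow> u \<in> F \<Longrightarrow> u \<in> pts (gen_pcs I F)"
  using subset_biorth[of F I] by (auto simp: gen_pcs_def covered_def)

lemma pts_dual_gen: "covered I F \<Longrightarrow> pts (dual (gen_pcs I F)) = orth I F"
  by (simp add: dual_def gen_pcs_def triple_orth covered_def)

lemma web_dual [simp]: "web (dual X) = web X"
  by (simp add: dual_def)

lemma is_pcs_dual: "is_pcs X \<Longrightarrow> is_pcs (dual X)"
  unfolding dual_def by (intro is_pcs_orth) (simp add: is_pcs_iff)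

lemma dual_dual: "is_pcs X \<Longrightarrow> dual (dual X) = X"
  by (simp add: dual_def is_pcs_iff)

lemma dualD: "w \<in> pts (dual X) \<Longrightarrow> u \<in> pts X \<Longrightarrow> pairing u w \<le> 1"
  by (auto simp: dual_def orth_def)

lemma pts_vecs: "is_pcs X \<Longrightarrow> u \<in> pts X \<Longrightarrow> u \<in> vecs (web X)"
  by (auto simp: is_pcs_iff covered_def)

lemma pts_support: "is_pcs X \<Longrightarrow> u \<in> pts X \<Longrightarrow> a \<notin> web X \<Longrightarrow> u a = 0"
  using pts_vecs by (auto simp: vecs_def)

lemma pts_finite: "is_pcs X \<Longrightarrow> u \<in> pts X \<Longrightarrow> u a < \<infinity>"
  using pts_vecs by (auto simp: vecs_def)

lemma pts_pos: "is_pcs X \<Longrightarrow> a \<in> web X \<Longrightarrow> \<exists>u\<in>pts X. u a > 0"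
  by (auto simp: is_pcs_iff covered_def)

lemma pts_bound: "is_pcs X \<Longrightarrow> a \<in> web X \<Longrightarrow> \<exists>A<\<infinity>. \<forall>u\<in>pts X. u a \<le> A"
  by (auto simp: is_pcs_iff covered_def)

text \<open>Finiteness of the entries comes for free, as the dual is covering.\<close>

lemma ptsI:
  assumes X: "is_pcs X" and supp: "\<And>a. a \<notin> web X \<Longrightarrow> u a = 0"
    and le: "\<And>w. w \<in> pts (dual X) \<Longrightarrow> pairing u w \<le> 1"
  shows "u \<in> pts X"
proof -
  have "u a < \<infinity>" for a
  proof (cases "a \<in> web X")
    case True
    \<comment> \<open>A functional that is positive at \<open>a\<close> bounds \<open>u a\<close> by
      the inverse of its own entry.\<close>
    then obtain w where w: "w \<in> pts (dual X)" "w a > 0"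
      using pts_pos[OF is_pcs_dual[OF X]] by auto
    have "u a * w a \<le> 1" using mult_le_pairing[of u a w] le[OF w(1)] by (rule order_trans)
    then have "u a \<le> inverse (w a)" using w(2) by (rule ennreal_le_inverse)
    then show ?thesis using w(2) by (simp add: inverse_less_top order_le_less_trans)
  qed (simp add: supp)
  then have "u \<in> pts (dual (dual X))"
    using supp le unfolding dual_def orth_def vecs_def by (auto simp: pairing_commute)
  then show ?thesis using dual_dual[OF X] by simp
qed

lemma dualI:
  assumes X: "is_pcs X" and "\<And>a. a \<notin> web X \<Longrightarrow> w a = 0" and "\<And>u. u \<in> pts X \<Longrightarrow> pairing u w \<le> 1"
  shows "w \<in> pts (dual X)"
  using assms by (intro ptsI is_pcs_dual) (auto simp: dual_dual pairing_commute)

section \<open>Closure properties of the set of points\<close>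

lemma pts_down:
  assumes X: "is_pcs X" and "u \<in> pts X" "v \<le> u"
  shows "v \<in> pts X"
proof (rule ptsI[OF X])
  fix a assume "a \<notin> web X"
  then show "v a = 0" using assms pts_support[OF X assms(2)] by (auto simp: le_fun_def dest: spec[of _ a])
next
  fix w assume "w \<in> pts (dual X)"
  then show "pairing v w \<le> 1"
    using pairing_mono[OF \<open>v \<le> u\<close> order_refl, of w] dualD[OF _ \<open>u \<in> pts X\<close>] by (meson order_trans)
qed

lemma pts_zero: "is_pcs X \<Longrightarrow> (\<lambda>_. 0) \<in> pts X"
  by (rule ptsI) (simp_all add: pairing_def)

text \<open>Functionals are continuous, so the bound \<open>1\<close> passes to suprema of
  increasing sequences. Denotations of fixpoints exist for this reason.\<close>

lemma pts_SUP:
  assumes X: "is_pcs X" and "incseq u" "\<And>n. u n \<in> pts X"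
  shows "(\<lambda>a. SUP n. u n a) \<in> pts X"
proof (rule ptsI[OF X])
  fix a assume "a \<notin> web X"
  then show "(SUP n. u n a) = 0" using pts_support[OF X assms(3)] by (simp add: bot_ennreal)
next
  fix w assume "w \<in> pts (dual X)"
  then show "pairing (\<lambda>a. SUP n. u n a) w \<le> 1"
    using assms dualD by (simp add: pairing_SUP_left SUP_least)
qed

lemma pts_convex:
  assumes X: "is_pcs X" and "u \<in> pts X" "v \<in> pts X" "p + q \<le> (1::ennreal)"
  shows "(\<lambda>a. p * u a + q * v a) \<in> pts X"
proof (rule ptsI[OF X])
  fix a assume "a \<notin> web X"
  then show "p * u a + q * v a = 0" using pts_support[OF X] assms by simp
next
  fix w assume w: "w \<in> pts (dual X)"
  have "pairing (\<lambda>a. p * u a + q * v a) w = p * pairing u w + q * pairing v w"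
    by (simp add: pairing_add_left pairing_cmult_left)
  also have "\<dots> \<le> p * 1 + q * 1"
    using dualD[OF w] assms by (intro add_mono mult_left_mono) auto
  finally show "pairing (\<lambda>a. p * u a + q * v a) w \<le> 1" using assms(4) by simp
qed

lemma pts_scale:
  assumes "is_pcs X" "u \<in> pts X" "c \<le> (1::ennreal)"
  shows "(\<lambda>a. c * u a) \<in> pts X"
proof (rule pts_down[OF assms(1,2)])
  show "(\<lambda>a. c * u a) \<le> u" using mult_right_mono[OF assms(3)] by (auto simp: le_fun_def)
qed

text \<open>Averaging two points with weights \<open>1/2\<close> keeps every coordinate positive
  that is positive in one of them. Needed for \<open>bang\<close>, where one bag tests several
  coordinates of the same point.\<close>

lemma pts_pos_finite:
  assumes X: "is_pcs X" and "finite J" "J \<subseteq> web X"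
  shows "\<exists>u\<in>pts X. \<forall>a\<in>J. u a > 0"
  using assms(2,3)
proof (induction J)
  case empty
  then show ?case using pts_zero[OF X] by auto
next
  case (insert a J)
  then obtain u where u: "u \<in> pts X" "\<forall>a\<in>J. u a > 0" by auto
  obtain v where v: "v \<in> pts X" "v a > 0" using pts_pos[OF X, of a] insert by auto
  let ?h = "ennreal (1/2)"
  have "?h + ?h = ennreal (1/2 + 1/2)" by (subst ennreal_plus) auto
  then have "?h + ?h \<le> 1" by simp
  then have "(\<lambda>b. ?h * u b + ?h * v b) \<in> pts X"
    using pts_convex[OF X u(1) v(1)] by blast
  moreover have "\<forall>b\<in>insert a J. ?h * u b + ?h * v b > 0"
  proof
    fix b assume "b \<in> insert a J"
    then have "u b > 0 \<or> v b > 0" using u v by auto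
    then have "?h * u b > 0 \<or> ?h * v b > 0" by (auto simp: ennreal_zero_less_mult_iff ennreal_inverse_positive)
    then show "?h * u b + ?h * v b > 0" by (auto intro: add_pos_nonneg add_nonneg_pos)
  qed
  ultimately show ?case by (intro bexI[where x = "\<lambda>b. ?h * u b + ?h * v b"])
qed


section \<open>Morphisms\<close>

text \<open>
  A matrix is not required to vanish on the rows outside the source: this lets one matrix be a
  morphism between many spaces.
\<close>

definition mor :: "pcs \<Rightarrow> pcs \<Rightarrow> mat \<Rightarrow> bool" where
  "mor X Y T \<longleftrightarrow> (\<forall>u\<in>pts X. T \<odot> u \<in> pts Y)"

lemma morD: "mor X Y T \<Longrightarrow> u \<in> pts X \<Longrightarrow> T \<odot> u \<in> pts Y"
  by (simp add: mor_def)

lemma mor_IDU: "mor X X IDU"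
  by (simp add: mor_def)

lemma mor_mcomp: "mor X Y T \<Longrightarrow> mor Y Z S \<Longrightarrow> mor X Z (S \<circ>\<^sub>m T)"
  by (simp add: mor_def mapp_mcomp)

lemma mor_support:
  assumes "is_pcs X" "is_pcs Y" "mor X Y T" "a \<in> web X" "b \<notin> web Y"
  shows "T a b = 0"
proof -
  obtain u where u: "u \<in> pts X" "u a > 0" using pts_pos assms by blast
  have "T a b * u a \<le> (T \<odot> u) b" by (rule mult_le_mapp)
  also have "\<dots> = 0" using pts_support morD assms u by blast
  finally show ?thesis using u(2) by auto
qed

lemma mor_finite:
  assumes "is_pcs X" "is_pcs Y" "mor X Y T" "a \<in> web X"
  shows "T a b < \<infinity>"
proof -
  obtain u where u: "u \<in> pts X" "u a > 0" using pts_pos assms by blast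
  have "T a b * u a \<le> (T \<odot> u) b" by (rule mult_le_mapp)
  also have "\<dots> < \<infinity>" using pts_finite morD assms u by blast
  finally show ?thesis using u(2) by (auto simp: ennreal_mult_less_top)
qed

lemma mor_row_vecs:
  assumes "is_pcs X" "is_pcs Y" "mor X Y T" "a \<in> web X"
  shows "T a \<in> vecs (web Y)"
  using mor_support[OF assms] mor_finite[OF assms] by (auto simp: vecs_def)

text \<open>Since some point is positive at each \<open>a\<close> of the web, finiteness of entries
  and support in the target are consequences of preserving points. The condition to be added to
  \<open>mor\<close> concerns the rows off the source.\<close>

lemma Pcoh_iff:
  assumes "is_pcs X" "is_pcs Y"
  shows "t \<in> Pcoh X Y \<longleftrightarrow> mor X Y t \<and> (\<forall>a. a \<notin> web X \<longrightarrow> t a = (\<lambda>_. 0))"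
proof
  assume "mor X Y t \<and> (\<forall>a. a \<notin> web X \<longrightarrow> t a = (\<lambda>_. 0))"
  then have t: "mor X Y t" "\<And>a. a \<notin> web X \<Longrightarrow> t a = (\<lambda>_. 0)" by auto
  have "t a b < \<infinity>" for a b
    using mor_finite[OF assms t(1), of a b] t(2)[of a] by (cases "a \<in> web X") auto
  then show "t \<in> Pcoh X Y"
    using mor_support[OF assms t(1)] t unfolding Pcoh_def mats_def mor_def by auto metis
qed (auto simp: Pcoh_def mats_def mor_def)

lemma rowr_Pcoh:
  assumes "is_pcs X" "is_pcs Y" "mor X Y T"
  shows "rowr (web X) T \<in> Pcoh X Y"
  using assms pts_vecs[OF assms(1)] by (auto simp: Pcoh_iff mor_def rowr_mapp) (simp add: rowr_def)

text \<open>The transpose of a morphism acts between the duals. It is restricted because the rows of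
  \<open>T\<close> off the web of \<open>X\<close> are arbitrary.\<close>

lemma mor_transpose:
  assumes X: "is_pcs X" and Y: "is_pcs Y" and T: "mor X Y T" and z: "z \<in> pts (dual Y)"
  shows "rst (web X) (\<lambda>a. pairing (T a) z) \<in> pts (dual X)"
proof (rule dualI[OF X])
  fix u assume u: "u \<in> pts X"
  have "pairing u (rst (web X) (\<lambda>a. pairing (T a) z)) = pairing (rst (web X) u) (\<lambda>a. pairing (T a) z)"
    by (simp add: pairing_rst)
  also have "rst (web X) u = u" using pts_support[OF X u] by (rule rst_id)
  also have "pairing u (\<lambda>a. pairing (T a) z) = pairing (T \<odot> u) z" by (simp add: pairing_mapp)
  finally show "pairing u (rst (web X) (\<lambda>a. pairing (T a) z)) \<le> 1"
    using dualD[OF z morD[OF T u]] by simp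
qed (simp add: rst_def)

text \<open>A functional of \<open>Y\<close> pulled back along \<open>T\<close> is at most
  \<open>1\<close> on the generators, hence lies in the orthogonal of \<open>F\<close>, and is
  therefore at most \<open>1\<close> on the whole biorthogonal.\<close>

lemma mor_gen_pcs:
  assumes F: "covered I F" and Y: "is_pcs Y" and T: "\<And>u. u \<in> F \<Longrightarrow> T \<odot> u \<in> pts Y"
  shows "mor (gen_pcs I F) Y T"
  unfolding mor_def
proof (intro ballI ptsI[OF Y])
  fix u assume u: "u \<in> pts (gen_pcs I F)"
  have uI: "u \<in> vecs I" using pts_vecs[OF is_pcs_gen[OF F] u] by simp
  have supp0: "T a b = 0" if a: "a \<in> I" and b: "b \<notin> web Y" for a b
  proof -
    obtain v where v: "v \<in> F" "v a > 0" using F a by (auto simp: covered_def)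
    have "T a b * v a \<le> (T \<odot> v) b" by (rule mult_le_mapp)
    also have "\<dots> = 0" using pts_support[OF Y T[OF v(1)] b] .
    finally show ?thesis using v by auto
  qed
  {
    fix b assume b: "b \<notin> web Y"
    have "T a b * u a = 0" for a
      using supp0[OF _ b, of a] uI by (cases "a \<in> I") (auto simp: vecs_def)
    then show "(T \<odot> u) b = 0" unfolding mapp_def by (simp only: infsum_0_simp)
  }
  fix z assume z: "z \<in> pts (dual Y)"
  define s where "s = rst I (\<lambda>a. pairing (T a) z)"
  have ps: "pairing v s = pairing (T \<odot> v) z" if "v \<in> vecs I" for v
  proof -
    have "rst I v = v" using that by (intro rst_id) (auto simp: vecs_def)
    then show ?thesis unfolding s_def pairing_rst[symmetric] by (simp add: pairing_mapp)
  qed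
  have "s \<in> orth I F"
    unfolding orth_def vecs_def
  proof (intro CollectI conjI ballI allI impI)
    show le: "pairing v s \<le> 1" if "v \<in> F" for v
      using that F dualD[OF z T[OF that]] by (auto simp: ps covered_def)
    show "s a = 0" if "a \<notin> I" for a using that by (simp add: s_def rst_def)
    \<comment> \<open>\<open>orth\<close> consists of finite vectors; a generator positive at
      \<open>a\<close> supplies the bound.\<close>
    show "s a < \<infinity>" for a
    proof (cases "a \<in> I")
      case True
      then obtain v where v: "v \<in> F" "v a > 0" using F by (auto simp: covered_def)
      have "s a * v a \<le> pairing v s" using mult_le_pairing[of v a s] by (simp add: mult.commute)
      then have "s a \<le> inverse (v a)" using le[OF v(1)] v(2) by (auto intro: ennreal_le_inverse)
      then show ?thesis using v(2) by (simp add: inverse_less_top order_le_less_trans)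
    qed (simp add: s_def rst_def)
  qed
  then have "pairing s u \<le> 1" using u by (simp add: gen_pcs_def orth_def)
  then show "pairing (T \<odot> u) z \<le> 1" using ps[OF uI] by (simp add: pairing_commute)
qed

section \<open>Separating sets of points\<close>

text \<open>Separation is required for linear functionals. Arbitrary morphisms follow by
  \<open>sep_mor_eq\<close>, and this form is inherited by tensor products, coproducts and unions of
  chains.\<close>

definition sep :: "pcs \<Rightarrow> vec set \<Rightarrow> bool" where
  "sep X A \<longleftrightarrow> A \<subseteq> pts X \<and>
     (\<forall>s\<in>pts (dual X). \<forall>s'\<in>pts (dual X). (\<forall>u\<in>A. pairing u s = pairing u s') \<longrightarrow> s = s')"

lemma sepD:
  "sep X A \<Longrightarrow> s \<in> pts (dual X) \<Longrightarrow> s' \<in> pts (dual X) \<Longrightarrow> (\<And>u. u \<in> A \<Longrightarrow> pairing u s = pairing u s') \<Longrightarrow> s = s'"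
  by (auto simp: sep_def)

lemma sep_pts: "sep X A \<Longrightarrow> u \<in> A \<Longrightarrow> u \<in> pts X"
  unfolding sep_def by blast

lemma sep_mono: "sep X A \<Longrightarrow> A \<subseteq> B \<Longrightarrow> B \<subseteq> pts X \<Longrightarrow> sep X B"
  unfolding sep_def by (meson subsetD)

lemma ennreal_mult_cancel: "(c::ennreal) * x = c * y \<Longrightarrow> 0 < c \<Longrightarrow> c < \<infinity> \<Longrightarrow> x = y"
  by (metis ennreal_mult_cancel_left infinity_ennreal_def less_irrefl)

text \<open>A column of a morphism, suitably scaled, is a functional on \<open>X\<close>, so two
  morphisms are compared column by column.\<close>

lemma sep_mor_eq:
  assumes X: "is_pcs X" and Y: "is_pcs Y" and A: "sep X A"
    and S: "mor X Y S" and T: "mor X Y T"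
    and eq: "\<And>u. u \<in> A \<Longrightarrow> S \<odot> u = T \<odot> u" and a: "a \<in> web X"
  shows "S a = T a"
proof
  fix b
  show "S a b = T a b"
  proof (cases "b \<in> web Y")
    case True
    then obtain z where z: "z \<in> pts (dual Y)" "z b > 0"
      using pts_pos[OF is_pcs_dual[OF Y]] by auto
    \<comment> \<open>Scaling column \<open>b\<close> by \<open>z b\<close> places it below the
      pullback of the functional \<open>z\<close>, hence into the dual of \<open>X\<close>; as
      \<open>z b\<close> is positive and finite it can be cancelled at the end.\<close>
    define R where "R T = rst (web X) (\<lambda>a. z b * T a b)" for T :: mat
    have R: "R T \<in> pts (dual X)" if "mor X Y T" for T
    proof (rule pts_down[OF is_pcs_dual[OF X] mor_transpose[OF X Y that z(1)]])
      have "z b * T a b \<le> pairing (T a) z" for a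
        using mult_le_pairing[of "T a" b z] by (simp add: mult.commute)
      then show "R T \<le> rst (web X) (\<lambda>a. pairing (T a) z)"
        by (auto simp: R_def rst_def le_fun_def)
    qed
    have pair: "pairing u (R T) = z b * (T \<odot> u) b" if "u \<in> pts X" for u T
    proof -
      have "rst (web X) u = u" using pts_support[OF X that] by (rule rst_id)
      then have "pairing u (R T) = pairing u (\<lambda>a. z b * T a b)"
        by (simp add: R_def pairing_rst[symmetric])
      also have "\<dots> = z b * (T \<odot> u) b"
        by (simp add: pairing_cmult_right) (simp add: pairing_def mapp_def mult.commute)
      finally show ?thesis .
    qed
    have "R S = R T"
    proof (rule sepD[OF A R[OF S] R[OF T]])
      fix u assume "u \<in> A"
      moreover from this have "u \<in> pts X" by (rule sep_pts[OF A])
      ultimately show "pairing u (R S) = pairing u (R T)" by (simp add: pair eq)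
    qed
    then have "z b * S a b = z b * T a b" using a by (auto simp: R_def rst_def fun_eq_iff split: if_splits)
    moreover have "z b < \<infinity>" using pts_finite[OF is_pcs_dual[OF Y] z(1)] .
    ultimately show ?thesis using z(2) using ennreal_mult_cancel by blast
  next
    case False
    then show ?thesis using mor_support[OF X Y S a] mor_support[OF X Y T a] by simp
  qed
qed


section \<open>Tensor product and linear function space\<close>

definition tweb :: "pt set \<Rightarrow> pt set \<Rightarrow> pt set" where
  "tweb I J = {Pair a b |a b. a \<in> I \<and> b \<in> J}"

lemma Pair_tweb [simp]: "Pair a b \<in> tweb I J \<longleftrightarrow> a \<in> I \<and> b \<in> J"
  by (auto simp: tweb_def)

lemma tensor_gen: "tensor X Y = gen_pcs (tweb (web X) (web Y)) {u \<otimes>\<^sub>v v |u v. u \<in> pts X \<and> v \<in> pts Y}"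
  unfolding tensor_def gen_pcs_def tweb_def Let_def ..

lemma web_tensor [simp]: "web (tensor X Y) = tweb (web X) (web Y)"
  by (simp add: tensor_gen)

lemma tensv_vecs: "u \<in> vecs I \<Longrightarrow> v \<in> vecs J \<Longrightarrow> u \<otimes>\<^sub>v v \<in> vecs (tweb I J)"
  by (auto simp: vecs_def tensv_def tweb_def ennreal_mult_less_top split: pt.splits)

lemma covered_tensor:
  assumes X: "is_pcs X" and Y: "is_pcs Y"
  shows "covered (tweb (web X) (web Y)) {u \<otimes>\<^sub>v v |u v. u \<in> pts X \<and> v \<in> pts Y}"
  unfolding covered_def
proof (intro conjI ballI)
  show "{u \<otimes>\<^sub>v v |u v. u \<in> pts X \<and> v \<in> pts Y} \<subseteq> vecs (tweb (web X) (web Y))"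
    using pts_vecs[OF X] pts_vecs[OF Y] by (auto intro: tensv_vecs)
next
  fix c assume "c \<in> tweb (web X) (web Y)"
  then obtain a b where c: "c = Pair a b" "a \<in> web X" "b \<in> web Y" by (auto simp: tweb_def)
  obtain u v where "u \<in> pts X" "u a > 0" "v \<in> pts Y" "v b > 0"
    using pts_pos[OF X c(2)] pts_pos[OF Y c(3)] by blast
  then show "\<exists>w\<in>{u \<otimes>\<^sub>v v |u v. u \<in> pts X \<and> v \<in> pts Y}. w c > 0"
    by (intro bexI[of _ "u \<otimes>\<^sub>v v"]) (auto simp: c ennreal_zero_less_mult_iff)
next
  fix c assume "c \<in> tweb (web X) (web Y)"
  then obtain a b where c: "c = Pair a b" "a \<in> web X" "b \<in> web Y" by (auto simp: tweb_def)
  obtain A where A: "A < \<infinity>" "\<And>u. u \<in> pts X \<Longrightarrow> u a \<le> A" using pts_bound[OF X c(2)] by auto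
  obtain B where B: "B < \<infinity>" "\<And>v. v \<in> pts Y \<Longrightarrow> v b \<le> B" using pts_bound[OF Y c(3)] by auto
  have "u a * v b \<le> A * B" if "u \<in> pts X" "v \<in> pts Y" for u v
    by (rule mult_mono[OF A(2)[OF that(1)] B(2)[OF that(2)]]) simp_all
  moreover have "A * B < \<infinity>" using A(1) B(1) by (simp add: ennreal_mult_less_top)
  ultimately show "\<exists>A<\<infinity>. \<forall>w\<in>{u \<otimes>\<^sub>v v |u v. u \<in> pts X \<and> v \<in> pts Y}. w c \<le> A"
    by (intro exI[of _ "A * B"]) (auto simp: c)
qed

lemma is_pcs_tensor: "is_pcs X \<Longrightarrow> is_pcs Y \<Longrightarrow> is_pcs (tensor X Y)"
  unfolding tensor_gen by (intro is_pcs_gen covered_tensor)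

lemma tensv_pts: "is_pcs X \<Longrightarrow> is_pcs Y \<Longrightarrow> u \<in> pts X \<Longrightarrow> v \<in> pts Y \<Longrightarrow> u \<otimes>\<^sub>v v \<in> pts (tensor X Y)"
  unfolding tensor_gen by (rule gen_pcs_generator[OF covered_tensor]) blast+

lemma mor_tensorI:
  assumes "is_pcs X" "is_pcs Y" "is_pcs Z"
    and "\<And>u v. u \<in> pts X \<Longrightarrow> v \<in> pts Y \<Longrightarrow> T \<odot> (u \<otimes>\<^sub>v v) \<in> pts Z"
  shows "mor (tensor X Y) Z T"
  unfolding tensor_gen by (rule mor_gen_pcs[OF covered_tensor[OF assms(1,2)] assms(3)]) (use assms(4) in blast)

lemma mor_tensm:
  assumes "is_pcs X" "is_pcs Y" "is_pcs X'" "is_pcs Y'" "mor X X' S" "mor Y Y' T"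
  shows "mor (tensor X Y) (tensor X' Y') (S \<otimes>\<^sub>m T)"
  using assms(1-4)
proof (intro mor_tensorI is_pcs_tensor)
  fix u v assume "u \<in> pts X" "v \<in> pts Y"
  then show "(S \<otimes>\<^sub>m T) \<odot> (u \<otimes>\<^sub>v v) \<in> pts (tensor X' Y')"
    unfolding mapp_tensm
    by (intro tensv_pts assms(3,4) morD[OF assms(5)] morD[OF assms(6)])
qed

text \<open>Two rounds of separation: with the second argument frozen in \<open>B\<close> the set
  \<open>A\<close> determines the partial functional \<open>D s v\<close>, and then \<open>B\<close>
  determines the dependence on \<open>v\<close>.\<close>

lemma sep_tensor:
  assumes X: "is_pcs X" and Y: "is_pcs Y" and A: "sep X A" and B: "sep Y B"
  shows "sep (tensor X Y) {u \<otimes>\<^sub>v v |u v. u \<in> A \<and> v \<in> B}"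
  unfolding sep_def
proof (intro conjI ballI impI)
  show "{u \<otimes>\<^sub>v v |u v. u \<in> A \<and> v \<in> B} \<subseteq> pts (tensor X Y)"
    using sep_pts[OF A] sep_pts[OF B] tensv_pts[OF X Y] by blast
next
  fix s s' assume s: "s \<in> pts (dual (tensor X Y))" and s': "s' \<in> pts (dual (tensor X Y))"
    and eq: "\<forall>w\<in>{u \<otimes>\<^sub>v v |u v. u \<in> A \<and> v \<in> B}. pairing w s = pairing w s'"
  have XY: "is_pcs (dual (tensor X Y))" using X Y by (intro is_pcs_dual is_pcs_tensor)
  \<comment> \<open>The functional on \<open>X\<close> obtained by feeding \<open>v\<close> to the
    second argument of \<open>s\<close>.\<close>
  define D where "D s v = (\<lambda>a. \<Sum>\<^sub>\<infinity>b. s (Pair a b) * v b)" for s v :: vec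
  have pD: "pairing u (D s v) = pairing (u \<otimes>\<^sub>v v) s" for s u v
    unfolding pairing_commute[of _ s] pairing_tensv
    by (simp add: pairing_def D_def infsum_cmult_ennreal[symmetric] mult_ac)
  have supp: "s c = 0" if "s \<in> pts (dual (tensor X Y))" "c \<notin> tweb (web X) (web Y)" for s c
    using pts_support[OF XY that(1)] that(2) by simp
  have D: "D s v \<in> pts (dual X)" if "s \<in> pts (dual (tensor X Y))" "v \<in> pts Y" for s v
  proof (rule dualI[OF X])
    show "D s v a = 0" if "a \<notin> web X" for a
      using that by (simp add: D_def supp[OF \<open>s \<in> pts (dual (tensor X Y))\<close>])
    show "pairing u (D s v) \<le> 1" if "u \<in> pts X" for u
      unfolding pD
      by (rule dualD[OF \<open>s \<in> pts (dual (tensor X Y))\<close> tensv_pts[OF X Y that \<open>v \<in> pts Y\<close>]])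
  qed
  have D_eq: "D s v = D s' v" if "v \<in> B" for v
  proof (rule sepD[OF A])
    show "D s v \<in> pts (dual X)" "D s' v \<in> pts (dual X)"
      using D[OF s sep_pts[OF B that]] D[OF s' sep_pts[OF B that]] by blast+
    show "pairing u (D s v) = pairing u (D s' v)" if "u \<in> A" for u
      using eq that \<open>v \<in> B\<close> unfolding pD by blast
  qed
  show "s = s'"
  proof
    fix c
    show "s c = s' c"
    proof (cases "c \<in> tweb (web X) (web Y)")
      case True
      then obtain a b where c: "c = Pair a b" "a \<in> web X" "b \<in> web Y" by (auto simp: tweb_def)
      obtain u where u: "u \<in> pts X" "u a > 0" using pts_pos[OF X c(2)] by blast
      \<comment> \<open>One row of \<open>s\<close> as a functional on \<open>Y\<close>. The factor
        \<open>u a\<close> keeps it below the value of \<open>s\<close> on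
        \<open>u \<otimes>\<^sub>v v\<close>, which is at most \<open>1\<close>.\<close>
      define R where "R s = (\<lambda>b. u a * s (Pair a b))" for s :: vec
      have pR: "pairing v (R s) = u a * D s v a" for v s
        by (simp add: R_def pairing_cmult_right) (simp add: pairing_def D_def mult.commute)
      have R: "R s \<in> pts (dual Y)" if "s \<in> pts (dual (tensor X Y))" for s
      proof (rule dualI[OF Y])
        fix v assume v: "v \<in> pts Y"
        have "pairing v (R s) \<le> pairing u (D s v)" unfolding pR by (rule mult_le_pairing)
        also have "\<dots> \<le> 1" using dualD[OF D[OF that v] u(1)] .
        finally show "pairing v (R s) \<le> 1" .
      qed (simp add: R_def supp[OF that])
      have "R s = R s'"
        by (rule sepD[OF B R[OF s] R[OF s']]) (simp add: pR D_eq)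
      then have "u a * s c = u a * s' c" by (auto simp: R_def c fun_eq_iff)
      then show ?thesis using u(2) pts_finite[OF X u(1)] by (rule ennreal_mult_cancel)
    qed (simp add: supp s s')
  qed
qed

lemma web_lolli [simp]: "web (lolli X Y) = tweb (web X) (web Y)"
  by (simp add: lolli_def)

lemma is_pcs_lolli: "is_pcs X \<Longrightarrow> is_pcs Y \<Longrightarrow> is_pcs (lolli X Y)"
  unfolding lolli_def by (intro is_pcs_dual is_pcs_tensor)

lemma pairing_mat_of: "pairing (mat_of w \<odot> u) z = pairing (u \<otimes>\<^sub>v z) w"
  unfolding pairing_commute[of _ w] pairing_tensv pairing_mapp
  by (simp add: pairing_def mat_of_def infsum_cmult_ennreal[symmetric] mult_ac)

text \<open>Identifies the space defined by duality with the space of morphisms;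
  \<open>pairing_mat_of\<close> translates a functional on the tensor product into a matrix and
  back.\<close>

lemma pts_lolli_iff:
  assumes X: "is_pcs X" and Y: "is_pcs Y"
  shows "w \<in> pts (lolli X Y) \<longleftrightarrow> (\<forall>c. c \<notin> tweb (web X) (web Y) \<longrightarrow> w c = 0) \<and> mor X Y (mat_of w)"
proof
  assume w: "w \<in> pts (lolli X Y)"
  have supp: "w c = 0" if "c \<notin> tweb (web X) (web Y)" for c
    using pts_support[OF is_pcs_lolli[OF X Y] w] that by simp
  have "mor X Y (mat_of w)"
    unfolding mor_def
  proof (intro ballI ptsI[OF Y])
    fix u assume u: "u \<in> pts X"
    show "(mat_of w \<odot> u) b = 0" if "b \<notin> web Y" for b
      using that by (simp add: mapp_def mat_of_def supp)
    show "pairing (mat_of w \<odot> u) z \<le> 1" if "z \<in> pts (dual Y)" for z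
      unfolding pairing_mat_of
      using w tensv_pts[OF X is_pcs_dual[OF Y] u that] unfolding lolli_def by (rule dualD)
  qed
  then show "(\<forall>c. c \<notin> tweb (web X) (web Y) \<longrightarrow> w c = 0) \<and> mor X Y (mat_of w)" using supp by blast
next
  assume r: "(\<forall>c. c \<notin> tweb (web X) (web Y) \<longrightarrow> w c = 0) \<and> mor X Y (mat_of w)"
  let ?F = "{u \<otimes>\<^sub>v v |u v. u \<in> pts X \<and> v \<in> pts (dual Y)}"
  have cov: "covered (tweb (web X) (web Y)) ?F"
    using covered_tensor[OF X is_pcs_dual[OF Y]] by simp
  have "w c < \<infinity>" for c
  proof (cases "c \<in> tweb (web X) (web Y)")
    case True
    then show ?thesis using mor_finite[OF X Y, of "mat_of w"] r by (auto simp: tweb_def mat_of_def)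
  qed (use r in auto)
  then have "w \<in> orth (tweb (web X) (web Y)) ?F"
    using r dualD morD by (auto simp: orth_def vecs_def pairing_mat_of[symmetric])
  then show "w \<in> pts (lolli X Y)"
    using pts_dual_gen[OF cov] by (simp add: lolli_def tensor_gen)
qed

text \<open>Extensionality of functions on a separating set. The semantics of \<open>Lam\<close>
  prescribes values at coalgebraic arguments only, and this makes the prescription
  unambiguous.\<close>

lemma lolli_eqI:
  assumes X: "is_pcs X" and Y: "is_pcs Y" and A: "sep X A"
    and w: "w \<in> pts (lolli X Y)" and w': "w' \<in> pts (lolli X Y)"
    and eq: "\<And>u. u \<in> A \<Longrightarrow> mat_of w \<odot> u = mat_of w' \<odot> u"
  shows "w = w'"
proof
  fix c
  show "w c = w' c"
  proof (cases "c \<in> tweb (web X) (web Y)")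
    case True
    then obtain a b where c: "c = Pair a b" "a \<in> web X" by (auto simp: tweb_def)
    have "mat_of w a = mat_of w' a"
      using w w' eq c(2) unfolding pts_lolli_iff[OF X Y] by (blast intro: sep_mor_eq[OF X Y A])
    then show ?thesis by (simp add: mat_of_def c fun_eq_iff)
  next
    case False
    then show ?thesis using w w' unfolding pts_lolli_iff[OF X Y] by simp
  qed
qed


section \<open>The unit and the coproduct\<close>

lemma web_one [simp]: "web one_pcs = {Star}"
  by (simp add: one_pcs_def)

lemma unit_vec_one [simp]: "unit_vec Star \<in> pts one_pcs"
  by (auto simp: one_pcs_def vecs_def unit_vec_def)

lemma one_pcs_orth: "one_pcs = \<lparr>web = {Star}, pts = orth {Star} {unit_vec Star}\<rparr>"
  by (auto simp: one_pcs_def orth_def pairing_commute[of "unit_vec Star"])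

lemma is_pcs_one: "is_pcs one_pcs"
  unfolding one_pcs_orth
  by (rule is_pcs_orth) (auto simp: covered_def vecs_def unit_vec_def intro!: exI[of _ 1])

lemma pts_one: "u \<in> pts one_pcs \<Longrightarrow> u = (\<lambda>a. u Star * unit_vec Star a) \<and> u Star \<le> 1"
  by (auto simp: one_pcs_def vecs_def unit_vec_def)

lemma mor_oneI: "is_pcs Y \<Longrightarrow> T Star \<in> pts Y \<Longrightarrow> mor one_pcs Y T"
proof -
  assume Y: "is_pcs Y" and T: "T Star \<in> pts Y"
  have "T \<odot> u = (\<lambda>b. u Star * T Star b)" if "u \<in> pts one_pcs" for u
    using pts_one[OF that] mapp_cmult[of T "u Star" "unit_vec Star"] by simp
  then show ?thesis using pts_one pts_scale[OF Y T] by (auto simp: mor_def)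
qed

lemma sep_one: "sep one_pcs {unit_vec Star}"
  unfolding sep_def
proof (intro conjI ballI impI)
  fix s s' assume s: "s \<in> pts (dual one_pcs)" "s' \<in> pts (dual one_pcs)"
    and "\<forall>u\<in>{unit_vec Star}. pairing u s = pairing u s'"
  then have "s Star = s' Star" by (simp add: pairing_commute[of "unit_vec Star"])
  moreover have "s a = 0" "s' a = 0" if "a \<noteq> Star" for a
    using that pts_support[OF is_pcs_dual[OF is_pcs_one]] s by auto
  ultimately show "s = s'" by (metis ext)
qed simp

section \<open>Coproducts\<close>

definition oweb :: "pt set \<Rightarrow> pt set \<Rightarrow> pt set" where
  "oweb I J = In Lft ` I \<union> In Rgt ` J"

lemma In_oweb [simp]: "In Lft a \<in> oweb I J \<longleftrightarrow> a \<in> I" "In Rgt a \<in> oweb I J \<longleftrightarrow> a \<in> J"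
  by (auto simp: oweb_def)

definition copair :: "mat \<Rightarrow> mat \<Rightarrow> mat" where
  "copair S T = (\<lambda>c. case c of In Lft a \<Rightarrow> S a | In Rgt b \<Rightarrow> T b | _ \<Rightarrow> (\<lambda>_. 0))"

definition cotup :: "vec \<Rightarrow> vec \<Rightarrow> vec" where
  "cotup u v = (\<lambda>c. case c of In Lft a \<Rightarrow> u a | In Rgt b \<Rightarrow> v b | _ \<Rightarrow> 0)"

definition InjU :: "side \<Rightarrow> mat" where
  "InjU i = (\<lambda>a. unit_vec (In i a))"

lemma copair_In [simp]: "copair S T (In Lft a) = S a" "copair S T (In Rgt a) = T a"
  by (auto simp: copair_def)

lemma copair_row_0: "(\<And>i a. c \<noteq> In i a) \<Longrightarrow> copair S T c = (\<lambda>_. 0)"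
  by (cases c) (auto simp: copair_def split: side.splits)

lemma cotup_In [simp]: "cotup u v (In Lft a) = u a" "cotup u v (In Rgt a) = v a"
  by (auto simp: cotup_def)

lemma cotup_eq_0: "(\<And>i a. c \<noteq> In i a) \<Longrightarrow> cotup u v c = 0"
  by (cases c) (auto simp: cotup_def split: side.splits)

lemma component_cotup [simp]: "component Lft (cotup u v) = u" "component Rgt (cotup u v) = v"
  by (auto simp: component_def)

lemma cotup_vecs: "u \<in> vecs I \<Longrightarrow> v \<in> vecs J \<Longrightarrow> cotup u v \<in> vecs (oweb I J)"
  by (auto simp: vecs_def cotup_def oweb_def split: pt.splits side.splits)

lemma component_vecs: "u \<in> vecs (oweb I J) \<Longrightarrow> component Lft u \<in> vecs I"
  "u \<in> vecs (oweb I J) \<Longrightarrow> component Rgt u \<in> vecs J"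
  by (auto simp: vecs_def component_def)

lemma oweb_cases: "c \<in> oweb I J \<Longrightarrow> (\<And>a. c = In Lft a \<Longrightarrow> a \<in> I \<Longrightarrow> P) \<Longrightarrow> (\<And>a. c = In Rgt a \<Longrightarrow> a \<in> J \<Longrightarrow> P) \<Longrightarrow> P"
  by (auto simp: oweb_def)

lemma pairing_cotup_left: "pairing (cotup u v) w = pairing u (component Lft w) + pairing v (component Rgt w)"
  unfolding pairing_def by (subst infsum_In) (auto simp: component_def cotup_eq_0)

lemma cotup_component: "u \<in> vecs (oweb I J) \<Longrightarrow> cotup (component Lft u) (component Rgt u) = u"
  by (auto simp: vecs_def cotup_def oweb_def component_def fun_eq_iff split: pt.splits side.splits)

lemma copair_cotup: "copair S T \<odot> cotup u v = (\<lambda>b. (S \<odot> u) b + (T \<odot> v) b)"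
  unfolding mapp_def by (rule ext, subst infsum_In) (auto simp: cotup_eq_0)

lemma InjU_mapp: "InjU Lft \<odot> u = cotup u (\<lambda>_. 0)" "InjU Rgt \<odot> u = cotup (\<lambda>_. 0) u"
proof -
  have "(InjU i \<odot> u) c = (if \<exists>a. c = In i a then u (THE a. c = In i a) else 0)" for i c
  proof (cases "\<exists>a. c = In i a")
    case True
    then obtain a where "c = In i a" by blast
    then show ?thesis
      unfolding mapp_def by (subst infsum_single_point[where a = a]) (auto simp: InjU_def unit_vec_def)
  qed (auto simp: mapp_def InjU_def unit_vec_def)
  then show "InjU Lft \<odot> u = cotup u (\<lambda>_. 0)" "InjU Rgt \<odot> u = cotup (\<lambda>_. 0) u"
    by (auto simp: cotup_def fun_eq_iff split: pt.splits side.splits)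
qed

text \<open>Turns the bound on the sum of two norms into a condition on pairs of dual
  points.\<close>

lemma ennreal_SUP_add_SUP_le:
  fixes f :: "'a \<Rightarrow> ennreal" and g :: "'b \<Rightarrow> ennreal"
  assumes "A \<noteq> {}" "B \<noteq> {}"
  shows "(SUP x\<in>A. f x) + (SUP y\<in>B. g y) \<le> c \<longleftrightarrow> (\<forall>x\<in>A. \<forall>y\<in>B. f x + g y \<le> c)"
proof -
  have "(SUP x\<in>A. f x) + (SUP y\<in>B. g y) = (SUP x\<in>A. f x + (SUP y\<in>B. g y))"
    by (rule ennreal_SUP_add_left[symmetric]) fact
  also have "\<dots> = (SUP x\<in>A. SUP y\<in>B. f x + g y)"
    unfolding ennreal_SUP_add_right[OF assms(2)] ..
  finally show ?thesis by (simp only: SUP_le_iff)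
qed

text \<open>The dual of a coproduct is the cartesian product of the duals: pairs of functionals
  without a joint bound.\<close>

definition oduals :: "pcs \<Rightarrow> pcs \<Rightarrow> vec set" where
  "oduals X Y = {cotup u v |u v. u \<in> pts (dual X) \<and> v \<in> pts (dual Y)}"

lemma covered_oduals:
  assumes X: "is_pcs X" and Y: "is_pcs Y"
  shows "covered (oweb (web X) (web Y)) (oduals X Y)"
  unfolding covered_def oduals_def
proof (intro conjI ballI)
  note X' = is_pcs_dual[OF X] and Y' = is_pcs_dual[OF Y]
  show "{cotup u v |u v. u \<in> pts (dual X) \<and> v \<in> pts (dual Y)} \<subseteq> vecs (oweb (web X) (web Y))"
    using pts_vecs[OF X'] pts_vecs[OF Y'] by (auto intro: cotup_vecs)
  fix c assume c: "c \<in> oweb (web X) (web Y)"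
  from c show "\<exists>u\<in>{cotup u v |u v. u \<in> pts (dual X) \<and> v \<in> pts (dual Y)}. 0 < u c"
  proof (rule oweb_cases)
    fix a assume "c = In Lft a" "a \<in> web X"
    then show ?thesis using pts_pos[OF X', of a] pts_zero[OF Y'] by force
  next
    fix a assume "c = In Rgt a" "a \<in> web Y"
    then show ?thesis using pts_pos[OF Y', of a] pts_zero[OF X'] by force
  qed
  from c show "\<exists>A<\<infinity>. \<forall>u\<in>{cotup u v |u v. u \<in> pts (dual X) \<and> v \<in> pts (dual Y)}. u c \<le> A"
  proof (rule oweb_cases)
    fix a assume "c = In Lft a" "a \<in> web X"
    then show ?thesis using pts_bound[OF X', of a] by force
  next
    fix a assume "c = In Rgt a" "a \<in> web Y"
    then show ?thesis using pts_bound[OF Y', of a] by force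
  qed
qed

text \<open>The bound on the norms says that every pair of dual points is at most \<open>1\<close>
  on the vector. So the coproduct is an orthogonal, which makes it a probabilistic coherence space
  at once. Membership of one component follows by pairing the other with the zero
  functional.\<close>

lemma oplus_orth:
  assumes X: "is_pcs X" and Y: "is_pcs Y"
  shows "oplus X Y = \<lparr>web = oweb (web X) (web Y), pts = orth (oweb (web X) (web Y)) (oduals X Y)\<rparr>"
proof -
  have ne: "pts (dual X) \<noteq> {}" "pts (dual Y) \<noteq> {}"
    using pts_zero[OF is_pcs_dual[OF X]] pts_zero[OF is_pcs_dual[OF Y]] by auto
  have "(component Lft u \<in> pts X \<and> component Rgt u \<in> pts Y \<and>
      norm_pcs X (component Lft u) + norm_pcs Y (component Rgt u) \<le> 1) \<longleftrightarrow>
      (\<forall>w\<in>oduals X Y. pairing w u \<le> 1)" if u: "u \<in> vecs (oweb (web X) (web Y))" for u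
  proof -
    let ?l = "component Lft u" and ?r = "component Rgt u"
    have norm: "norm_pcs X ?l + norm_pcs Y ?r \<le> 1 \<longleftrightarrow>
        (\<forall>w\<in>pts (dual X). \<forall>z\<in>pts (dual Y). pairing ?l w + pairing ?r z \<le> 1)"
      unfolding norm_pcs_def using ne by (rule ennreal_SUP_add_SUP_le)
    have "?l \<in> pts X \<and> ?r \<in> pts Y"
      if le: "\<forall>w\<in>pts (dual X). \<forall>z\<in>pts (dual Y). pairing ?l w + pairing ?r z \<le> 1"
    proof
      show "?l \<in> pts X"
      proof (rule ptsI[OF X])
        show "?l a = 0" if "a \<notin> web X" for a
          using component_vecs(1)[OF u] that by (auto simp: vecs_def)
        fix w assume "w \<in> pts (dual X)"
        then have "pairing ?l w + pairing ?r (\<lambda>_. 0) \<le> 1"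
          using le pts_zero[OF is_pcs_dual[OF Y]] by blast
        then show "pairing ?l w \<le> 1" by (simp add: pairing_def)
      qed
      show "?r \<in> pts Y"
      proof (rule ptsI[OF Y])
        show "?r a = 0" if "a \<notin> web Y" for a
          using component_vecs(2)[OF u] that by (auto simp: vecs_def)
        fix w assume "w \<in> pts (dual Y)"
        then have "pairing ?l (\<lambda>_. 0) + pairing ?r w \<le> 1"
          using le pts_zero[OF is_pcs_dual[OF X]] by blast
        then show "pairing ?r w \<le> 1" by (simp add: pairing_def)
      qed
    qed
    moreover have "(\<forall>w\<in>oduals X Y. pairing w u \<le> 1) \<longleftrightarrow>
        (\<forall>w\<in>pts (dual X). \<forall>z\<in>pts (dual Y). pairing ?l w + pairing ?r z \<le> 1)"
    proof -
      have pc: "pairing ?l w + pairing ?r z = pairing (cotup w z) u" for w z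
        by (simp only: pairing_cotup_left pairing_commute[of w] pairing_commute[of z])
      show ?thesis unfolding oduals_def pc by blast
    qed
    ultimately show ?thesis using norm by blast
  qed
  then show ?thesis unfolding oplus_def orth_def oweb_def[symmetric] Let_def by auto
qed

lemma web_oplus [simp]: "web (oplus X Y) = oweb (web X) (web Y)"
  by (simp add: oplus_def oweb_def Let_def)

lemma is_pcs_oplus: "is_pcs X \<Longrightarrow> is_pcs Y \<Longrightarrow> is_pcs (oplus X Y)"
  by (simp add: oplus_orth is_pcs_orth covered_oduals)

lemma mor_InjU:
  assumes X: "is_pcs X" and Y: "is_pcs Y"
  shows "mor X (oplus X Y) (InjU Lft)" "mor Y (oplus X Y) (InjU Rgt)"
proof -
  have "cotup u v \<in> pts (oplus X Y)"
    if uv: "u \<in> pts X" "v \<in> pts Y" "u = (\<lambda>_. 0) \<or> v = (\<lambda>_. 0)" for u v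
  proof -
    have "pairing w (cotup u v) \<le> 1" if w: "w \<in> oduals X Y" for w
    proof -
      obtain p q where w: "w = cotup p q" "p \<in> pts (dual X)" "q \<in> pts (dual Y)"
        using w by (auto simp: oduals_def)
      have "pairing w (cotup u v) = pairing u p + pairing v q"
        by (simp only: w pairing_cotup_left component_cotup pairing_commute[of p] pairing_commute[of q])
      then show ?thesis using uv dualD[OF w(2) uv(1)] dualD[OF w(3) uv(2)] by (auto simp: pairing_def)
    qed
    then show ?thesis
      using cotup_vecs[OF pts_vecs[OF X uv(1)] pts_vecs[OF Y uv(2)]] by (simp add: oplus_orth[OF X Y] orth_def)
  qed
  then show "mor X (oplus X Y) (InjU Lft)" "mor Y (oplus X Y) (InjU Rgt)"
    using pts_zero[OF X] pts_zero[OF Y] by (auto simp: mor_def InjU_mapp)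
qed

lemma pts_oplus:
  assumes X: "is_pcs X" and Y: "is_pcs Y" and w: "w \<in> pts (oplus X Y)"
  shows "\<exists>u v. u \<in> pts X \<and> v \<in> pts Y \<and> w = cotup u v"
proof -
  have "w \<in> vecs (oweb (web X) (web Y))" using w by (simp add: oplus_def oweb_def Let_def)
  then have "w = cotup (component Lft w) (component Rgt w)" by (simp add: cotup_component)
  moreover have "component Lft w \<in> pts X" "component Rgt w \<in> pts Y"
    using w by (simp_all add: oplus_def Let_def)
  ultimately show ?thesis by blast
qed

text \<open>The pullbacks of a functional along \<open>S\<close> and \<open>T\<close> form one of
  the pairs in \<open>oduals\<close>, so the two contributions together stay below
  \<open>1\<close>.\<close>

lemma mor_copair:
  assumes X: "is_pcs X" and Y: "is_pcs Y" and Z: "is_pcs Z" and S: "mor X Z S" and T: "mor Y Z T"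
  shows "mor (oplus X Y) Z (copair S T)"
  unfolding mor_def
proof (intro ballI ptsI[OF Z])
  fix w assume w: "w \<in> pts (oplus X Y)"
  then obtain u v where uv: "u \<in> pts X" "v \<in> pts Y" "w = cotup u v" using pts_oplus[OF X Y] by blast
  show "(copair S T \<odot> w) b = 0" if "b \<notin> web Z" for b
    using pts_support[OF Z morD[OF S uv(1)] that] pts_support[OF Z morD[OF T uv(2)] that]
    by (simp add: uv(3) copair_cotup)
  fix z assume z: "z \<in> pts (dual Z)"
  let ?s = "rst (web X) (\<lambda>a. pairing (S a) z)" and ?t = "rst (web Y) (\<lambda>a. pairing (T a) z)"
  have "pairing (copair S T \<odot> w) z = pairing (S \<odot> u) z + pairing (T \<odot> v) z"
    by (simp add: uv(3) copair_cotup pairing_add_left)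
  also have "pairing (S \<odot> u) z = pairing ?s u"
    using rst_id[of "web X" u] pts_support[OF X uv(1)] by (simp add: pairing_mapp pairing_rst pairing_commute[of u])
  also have "pairing (T \<odot> v) z = pairing ?t v"
    using rst_id[of "web Y" v] pts_support[OF Y uv(2)] by (simp add: pairing_mapp pairing_rst pairing_commute[of v])
  also have "pairing ?s u + pairing ?t v = pairing (cotup ?s ?t) w"
    by (simp add: uv(3) pairing_cotup_left)
  also have "\<dots> \<le> 1"
    using w mor_transpose[OF X Z S z] mor_transpose[OF Y Z T z]
    by (auto simp: oplus_orth[OF X Y] orth_def oduals_def)
  finally show "pairing (copair S T \<odot> w) z \<le> 1" .
qed

text \<open>A functional on the coproduct is a pair of functionals, and composing it with an
  injection extracts one of them.\<close>

lemma sep_oplus: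
  assumes X: "is_pcs X" and Y: "is_pcs Y" and A: "sep X A" and B: "sep Y B"
  shows "sep (oplus X Y) (((\<odot>) (InjU Lft)) ` A \<union> ((\<odot>) (InjU Rgt)) ` B)"
  unfolding sep_def
proof (intro conjI ballI impI)
  show "((\<odot>) (InjU Lft)) ` A \<union> ((\<odot>) (InjU Rgt)) ` B \<subseteq> pts (oplus X Y)"
    using sep_pts[OF A] sep_pts[OF B] morD[OF mor_InjU(1)[OF X Y]] morD[OF mor_InjU(2)[OF X Y]] by blast
next
  fix s s' assume s: "s \<in> pts (dual (oplus X Y))" and s': "s' \<in> pts (dual (oplus X Y))"
    and eq: "\<forall>u\<in>((\<odot>) (InjU Lft)) ` A \<union> ((\<odot>) (InjU Rgt)) ` B. pairing u s = pairing u s'"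
  note P = is_pcs_dual[OF is_pcs_oplus[OF X Y]]
  have p: "pairing (InjU i \<odot> u) s = pairing u (component i s)" for i u s
    by (cases i) (auto simp: InjU_mapp pairing_cotup_left, simp_all add: pairing_def)
  have comp: "component Lft s \<in> pts (dual X)" "component Rgt s \<in> pts (dual Y)"
    if "s \<in> pts (dual (oplus X Y))" for s
  proof -
    have v: "s \<in> vecs (oweb (web X) (web Y))" using pts_vecs[OF P that] by simp
    show "component Lft s \<in> pts (dual X)"
    proof (rule dualI[OF X])
      show "component Lft s a = 0" if "a \<notin> web X" for a
        using component_vecs(1)[OF v] that by (simp add: vecs_def)
      show "pairing u (component Lft s) \<le> 1" if "u \<in> pts X" for u
        using dualD[OF \<open>s \<in> pts (dual (oplus X Y))\<close> morD[OF mor_InjU(1)[OF X Y] that]] by (simp only: p)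
    qed
    show "component Rgt s \<in> pts (dual Y)"
    proof (rule dualI[OF Y])
      show "component Rgt s a = 0" if "a \<notin> web Y" for a
        using component_vecs(2)[OF v] that by (simp add: vecs_def)
      show "pairing u (component Rgt s) \<le> 1" if "u \<in> pts Y" for u
        using dualD[OF \<open>s \<in> pts (dual (oplus X Y))\<close> morD[OF mor_InjU(2)[OF X Y] that]] by (simp only: p)
    qed
  qed
  have "component Lft s = component Lft s'"
    by (rule sepD[OF A comp(1)[OF s] comp(1)[OF s']]) (use eq in \<open>simp add: p ball_Un\<close>)
  moreover have "component Rgt s = component Rgt s'"
    by (rule sepD[OF B comp(2)[OF s] comp(2)[OF s']]) (use eq in \<open>simp add: p ball_Un\<close>)
  ultimately show "s = s'"
    using cotup_component[of s "web X" "web Y"] cotup_component[of s' "web X" "web Y"]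
      pts_vecs[OF P s] pts_vecs[OF P s'] unfolding web_dual web_oplus by argo
qed

section \<open>The exponential\<close>

definition bweb :: "pt set \<Rightarrow> pt set" where
  "bweb I = {Bag b |b. set_mset b \<subseteq> I}"

lemma Bag_bweb [simp]: "Bag b \<in> bweb I \<longleftrightarrow> set_mset b \<subseteq> I"
  by (auto simp: bweb_def)

lemma bang_gen: "bang X = gen_pcs (bweb (web X)) {prom u |u. u \<in> pts X}"
  unfolding bang_def gen_pcs_def bweb_def Let_def ..

lemma web_bang [simp]: "web (bang X) = bweb (web X)"
  by (simp add: bang_gen)

lemma prod_mset_pos_ennreal:
  fixes f :: "'a \<Rightarrow> ennreal"
  shows "(\<And>a. a \<in># b \<Longrightarrow> f a > 0) \<Longrightarrow> (\<Prod>a\<in>#b. f a) > 0"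
  by (induction b) (auto simp: ennreal_zero_less_mult_iff)

lemma prod_mset_finite_ennreal:
  fixes f :: "'a \<Rightarrow> ennreal"
  shows "(\<And>a. a \<in># b \<Longrightarrow> f a < \<infinity>) \<Longrightarrow> (\<Prod>a\<in>#b. f a) < \<infinity>"
  by (induction b) (auto simp: ennreal_mult_less_top)

lemma prod_mset_0_ennreal:
  fixes f :: "'a \<Rightarrow> ennreal"
  shows "a \<in># b \<Longrightarrow> f a = 0 \<Longrightarrow> (\<Prod>a\<in>#b. f a) = 0"
  by (induction b) auto

lemma prom_vecs:
  assumes "u \<in> vecs I"
  shows "prom u \<in> vecs (bweb I)"
  unfolding vecs_def
proof (intro CollectI conjI allI impI)
  fix c
  show "prom u c < \<infinity>"
  proof (cases "\<exists>b. c = Bag b")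
    case True
    then obtain b where "c = Bag b" by blast
    then show ?thesis using assms by (simp add: vecs_def prod_mset_finite_ennreal[simplified])
  qed (simp add: prom_eq_0)
  assume "c \<notin> bweb I"
  show "prom u c = 0"
  proof (cases "\<exists>b. c = Bag b")
    case True
    then obtain b where b: "c = Bag b" by blast
    with \<open>c \<notin> bweb I\<close> obtain a where "a \<in># b" "a \<notin> I" by auto
    then show ?thesis using assms prod_mset_0_ennreal[of a b u] by (simp add: vecs_def b)
  qed (simp add: prom_eq_0)
qed

text \<open>An entry of a promotion is a finite product, so both conditions reduce to the
  coordinates occurring in one bag. For positivity they must be positive in the same point.\<close>

lemma covered_bang:
  assumes X: "is_pcs X"
  shows "covered (bweb (web X)) {prom u |u. u \<in> pts X}"
  unfolding covered_def
proof (intro conjI ballI)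
  show "{prom u |u. u \<in> pts X} \<subseteq> vecs (bweb (web X))"
    using prom_vecs[OF pts_vecs[OF X]] by blast
next
  fix c assume "c \<in> bweb (web X)"
  then obtain b where b: "c = Bag b" "set_mset b \<subseteq> web X" by (auto simp: bweb_def)
  obtain u where u: "u \<in> pts X" "\<forall>a\<in>set_mset b. u a > 0"
    using pts_pos_finite[OF X _ b(2)] by auto
  have "prom u c > 0" using u(2) prod_mset_pos_ennreal[of b u] by (simp add: b)
  then show "\<exists>v\<in>{prom u |u. u \<in> pts X}. v c > 0" using u(1) by blast
next
  fix c assume "c \<in> bweb (web X)"
  then obtain b where b: "c = Bag b" "set_mset b \<subseteq> web X" by (auto simp: bweb_def)
  have "\<forall>a\<in>web X. \<exists>A<\<infinity>. \<forall>u\<in>pts X. u a \<le> A" using pts_bound[OF X] by blast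
  then obtain A where A: "\<And>a. a \<in> web X \<Longrightarrow> A a < \<infinity>" "\<And>a u. a \<in> web X \<Longrightarrow> u \<in> pts X \<Longrightarrow> u a \<le> A a"
    by metis
  have "prom u c \<le> (\<Prod>a\<in>#b. A a)" if "u \<in> pts X" for u
    using A(2)[OF _ that] b(2) unfolding b(1) prom_Bag by (intro prod_mset_mono_ennreal) auto
  moreover have "(\<Prod>a\<in>#b. A a) < \<infinity>" by (rule prod_mset_finite_ennreal) (use A(1) b(2) in blast)
  ultimately show "\<exists>A<\<infinity>. \<forall>v\<in>{prom u |u. u \<in> pts X}. v c \<le> A" by blast
qed

lemma is_pcs_bang: "is_pcs X \<Longrightarrow> is_pcs (bang X)"
  unfolding bang_gen by (intro is_pcs_gen covered_bang)

lemma prom_pts: "is_pcs X \<Longrightarrow> u \<in> pts X \<Longrightarrow> prom u \<in> pts (bang X)"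
  unfolding bang_gen by (rule gen_pcs_generator[OF covered_bang]) blast+

lemma mor_bangI:
  assumes X: "is_pcs X" and Y: "is_pcs Y" and T: "\<And>u. u \<in> pts X \<Longrightarrow> T \<odot> prom u \<in> pts Y"
  shows "mor (bang X) Y T"
  unfolding bang_gen by (rule mor_gen_pcs[OF covered_bang[OF X] Y]) (use T in blast)

lemma pairing_prom: "pairing (prom u) s = (\<Sum>\<^sub>\<infinity>b. s (Bag b) * (\<Prod>a\<in>#b. u a))"
  unfolding pairing_def by (subst infsum_Bag) (simp_all add: prom_eq_0 mult.commute)

text \<open>
  The coefficients of a power series in infinitely many variables are determined one variable at
  a time, by rescaling that variable in a given point.
\<close>

lemma sep_bang:
  assumes X: "is_pcs X"
  shows "sep (bang X) {prom u |u. u \<in> pts X}"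
  unfolding sep_def
proof (intro conjI ballI impI)
  show "{prom u |u. u \<in> pts X} \<subseteq> pts (bang X)" using prom_pts[OF X] by blast
next
  fix s s' assume s: "s \<in> pts (dual (bang X))" and s': "s' \<in> pts (dual (bang X))"
    and "\<forall>v\<in>{prom u |u. u \<in> pts X}. pairing v s = pairing v s'"
  then have eq: "pairing (prom u) s = pairing (prom u) s'" if "u \<in> pts X" for u using that by blast
  \<comment> \<open>The part of the series formed by the monomials in which each variable of
    \<open>J\<close> has the exponent given by \<open>n\<close>. With \<open>J\<close> empty this is
    the whole series; enlarging \<open>J\<close> narrows it down towards a single monomial.\<close>
  define G where "G s J n u = (\<Sum>\<^sub>\<infinity>b. if \<forall>a\<in>J. count b a = n a then s (Bag b) * (\<Prod>a\<in>#b. u a) else 0)"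
    for s :: vec and J :: "pt set" and n :: "pt \<Rightarrow> nat" and u :: vec
  have G_le: "G s J n u \<le> 1" if "s \<in> pts (dual (bang X))" "u \<in> pts X" for s J n u
  proof -
    have "G s J n u \<le> pairing (prom u) s"
      unfolding G_def pairing_prom by (rule infsum_mono_ennreal) simp
    also have "\<dots> \<le> 1" using dualD[OF that(1) prom_pts[OF X that(2)]] .
    finally show ?thesis .
  qed
  \<comment> \<open>Rescaling the variable \<open>a\<close> by \<open>y\<close> multiplies a
    monomial by \<open>y\<close> to the power of its exponent, so the left side is a power series in
    \<open>y\<close> whose coefficients prescribe one more exponent.\<close>
  have G_insert: "G s J n (u(a := y * u a)) = (\<Sum>\<^sub>\<infinity>k. G s (insert a J) (n(a := k)) u * y ^ k)"
    if a: "a \<notin> J" for s J n u a and y :: ennreal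
  proof -
    have scale: "(\<Prod>x\<in>#b. (u(a := y * u a)) x) = y ^ count b a * (\<Prod>x\<in>#b. u x)" for b
      by (induction b) (auto simp: mult_ac)
    have "(\<Sum>\<^sub>\<infinity>k. G s (insert a J) (n(a := k)) u * y ^ k) =
        (\<Sum>\<^sub>\<infinity>k. \<Sum>\<^sub>\<infinity>b. if count b a = k then (if \<forall>a\<in>J. count b a = n a then s (Bag b) * (\<Prod>a\<in>#b. u a) * y ^ count b a else 0) else 0)"
      unfolding G_def infsum_multc_ennreal[symmetric]
      by (intro infsum_cong) (use a in auto)
    also have "\<dots> = (\<Sum>\<^sub>\<infinity>b. if \<forall>a\<in>J. count b a = n a then s (Bag b) * (\<Prod>a\<in>#b. u a) * y ^ count b a else 0)"
      by (rule infsum_fibers)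
    also have "\<dots> = G s J n (u(a := y * u a))"
      unfolding G_def scale by (intro infsum_cong) (simp add: mult_ac)
    finally show ?thesis by simp
  qed
  have G_eq: "G s J n u = G s' J n u" if "finite J" "u \<in> pts X" for J n u
    using that
  proof (induction J arbitrary: n u rule: finite_induct)
    case empty
    then show ?case using eq[of u] unfolding pairing_prom by (simp add: G_def)
  next
    case (insert a J)
    have scaled: "u(a := y * u a) \<in> pts X" if "y \<le> 1" for y
    proof (rule pts_down[OF X insert.prems])
      show "u(a := y * u a) \<le> u"
        using mult_right_mono[OF that, of "u a"] by (simp add: le_fun_def)
    qed
    have fin: "(\<Sum>\<^sub>\<infinity>k. G s (insert a J) (n(a := k)) u) < \<infinity>" if "s \<in> pts (dual (bang X))" for s
    proof -
      have "(\<Sum>\<^sub>\<infinity>k. G s (insert a J) (n(a := k)) u) = G s J n u"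
        using G_insert[OF insert.hyps(2), of s n u 1] by simp
      also have "\<dots> \<le> 1" using G_le[OF that insert.prems] .
      finally show ?thesis by (rule order_le_less_trans) simp
    qed
    have "G s (insert a J) (n(a := n a)) u = G s' (insert a J) (n(a := n a)) u"
    proof (rule power_series_coefficients_eq[where f = "\<lambda>k. G s (insert a J) (n(a := k)) u"])
      fix y :: ennreal assume "0 < y" "y < 1"
      then have "u(a := y * u a) \<in> pts X" by (intro scaled) simp
      from insert.IH[OF this]
      show "(\<Sum>\<^sub>\<infinity>k. G s (insert a J) (n(a := k)) u * y ^ k) = (\<Sum>\<^sub>\<infinity>k. G s' (insert a J) (n(a := k)) u * y ^ k)"
        unfolding G_insert[OF insert.hyps(2), symmetric] .
    qed (use fin s s' in blast)+
    then show ?case by simp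
  qed
  note P = is_pcs_dual[OF is_pcs_bang[OF X]]
  show "s = s'"
  proof
    fix c
    show "s c = s' c"
    proof (cases "c \<in> bweb (web X)")
      case True
      then obtain b where b: "c = Bag b" "set_mset b \<subseteq> web X" by (auto simp: bweb_def)
      obtain u0 where u0: "u0 \<in> pts X" "\<forall>a\<in>set_mset b. u0 a > 0"
        using pts_pos_finite[OF X _ b(2)] by auto
      \<comment> \<open>Deleting all variables outside \<open>b\<close> annihilates every monomial
        containing one of them, hence prescribing the finitely many exponents of \<open>b\<close>
        leaves only the monomial \<open>b\<close>.\<close>
      define u where "u = rst (set_mset b) u0"
      have u: "u \<in> pts X" unfolding u_def by (rule pts_down[OF X u0(1) rst_le])
      have G_single: "G s (set_mset b) (count b) u = (\<Prod>a\<in>#b. u a) * s c" for s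
      proof -
        have "(if \<forall>a\<in>set_mset b. count b' a = count b a then s (Bag b') * (\<Prod>a\<in>#b'. u a) else 0) = 0"
          if ne: "b' \<noteq> b" for b'
        proof (cases "\<forall>a\<in>set_mset b. count b' a = count b a")
          case True
          obtain x where x: "count b' x \<noteq> count b x" using ne unfolding multiset_eq_iff by blast
          then have "x \<notin># b" using True by blast
          then have "x \<in># b'" using x by (metis count_eq_zero_iff)
          then have "(\<Prod>a\<in>#b'. u a) = 0"
            by (rule prod_mset_0_ennreal) (simp add: u_def rst_def \<open>x \<notin># b\<close>)
          then show ?thesis by simp
        next
          case False
          then show ?thesis by (rule if_not_P)
        qed
        then have "G s (set_mset b) (count b) u =
            (if \<forall>a\<in>set_mset b. count b a = count b a then s (Bag b) * (\<Prod>a\<in>#b. u a) else 0)"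
          unfolding G_def by (rule infsum_single_point)
        then show ?thesis by (simp add: b(1) mult.commute)
      qed
      have "(\<Prod>a\<in>#b. u a) * s c = (\<Prod>a\<in>#b. u a) * s' c"
        using G_eq[OF _ u, of "set_mset b" "count b"] by (simp add: G_single)
      moreover have "(\<Prod>a\<in>#b. u a) > 0"
        by (rule prod_mset_pos_ennreal) (use u0(2) in \<open>simp add: u_def rst_def\<close>)
      moreover have "(\<Prod>a\<in>#b. u a) < \<infinity>"
        by (rule prod_mset_finite_ennreal) (rule pts_finite[OF X u])
      ultimately show ?thesis by (rule ennreal_mult_cancel)
    next
      case False
      then show ?thesis using pts_support[OF P s] pts_support[OF P s'] by simp
    qed
  qed
qed

text \<open>Diagrams starting from \<open>!X\<close> are checked on promotions, where the structural
  matrices have simple closed forms.\<close>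

lemma bang_mor_eq:
  assumes "is_pcs X" "is_pcs Y" "mor (bang X) Y S" "mor (bang X) Y T"
    and "\<And>u. u \<in> pts X \<Longrightarrow> S \<odot> prom u = T \<odot> prom u" and "a \<in> bweb (web X)"
  shows "S a = T a"
proof (rule sep_mor_eq[OF is_pcs_bang[OF assms(1)] assms(2) sep_bang[OF assms(1)] assms(3,4)])
  show "a \<in> web (bang X)" using assms(6) by simp
qed (use assms(5) in blast)

text \<open>The version in two variables, for the diagrams of the monoidal matrix.\<close>

lemma bang_tensor_mor_eq:
  assumes X: "is_pcs X" and Y: "is_pcs Y" and "is_pcs Z" "mor (tensor (bang X) (bang Y)) Z S" "mor (tensor (bang X) (bang Y)) Z T"
    and "\<And>u v. u \<in> pts X \<Longrightarrow> v \<in> pts Y \<Longrightarrow> S \<odot> (prom u \<otimes>\<^sub>v prom v) = T \<odot> (prom u \<otimes>\<^sub>v prom v)"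
    and "a \<in> tweb (bweb (web X)) (bweb (web Y))"
  shows "S a = T a"
proof (rule sep_mor_eq[OF _ assms(3) sep_tensor assms(4,5)])
  show "sep (bang X) {prom u |u. u \<in> pts X}" "sep (bang Y) {prom u |u. u \<in> pts Y}"
    by (rule sep_bang[OF X], rule sep_bang[OF Y])
  show "a \<in> web (tensor (bang X) (bang Y))" using assms(7) by simp
qed (use assms(6) in \<open>blast intro: is_pcs_tensor is_pcs_bang X Y\<close>)+


section \<open>The structural matrices of the exponential\<close>

definition DER :: mat where
  "DER = (\<lambda>c a. if c = Bag {#a#} then 1 else 0)"

definition DIG :: mat where
  "DIG = (\<lambda>c d. if \<exists>B. c = Bag (\<Sum>\<^sub># B) \<and> d = Bag (image_mset Bag B) then 1 else 0)"

text \<open>A multiset \<open>R\<close> of pairs and its two marginals. The column index determines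
  \<open>R\<close>, so every column has at most one nonzero entry; it matches the factorisation of a
  monomial in \<open>u \<otimes>\<^sub>v v\<close> into a monomial in \<open>u\<close> and one in
  \<open>v\<close>.\<close>

definition MON :: mat where
  "MON = (\<lambda>c d. if \<exists>R. c = Pair (Bag (image_mset fst R)) (Bag (image_mset snd R)) \<and>
     d = Bag (image_mset (\<lambda>(a, b). Pair a b) R) then 1 else 0)"

fun list_entry :: "mat \<Rightarrow> pt list \<Rightarrow> pt list \<Rightarrow> ennreal" where
  "list_entry t [] [] = 1"
| "list_entry t (a # as) (c # cs) = t a c * list_entry t as cs"
| "list_entry t _ _ = 0"

text \<open>
  Expanding the product over \<open>c \<in># m\<close> of the sums \<open>\<Sum>a. t a c * u a\<close> gives one monomial for each
  way of listing its variables along a fixed enumeration of \<open>m\<close>.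
\<close>

definition bangu :: "mat \<Rightarrow> mat" where
  "bangu t = (\<lambda>c d. case (c, d) of
      (Bag b, Bag m) \<Rightarrow> (\<Sum>\<^sub>\<infinity>as. if mset as = b then list_entry t as (SOME cs. mset cs = m) else 0)
    | _ \<Rightarrow> 0)"

lemma DER_prom: "DER \<odot> prom u = u"
proof
  fix a
  show "(DER \<odot> prom u) a = u a"
    unfolding mapp_def by (subst infsum_single_point[where a = "Bag {#a#}"]) (simp_all add: DER_def)
qed

lemma mor_DER: "is_pcs X \<Longrightarrow> mor (bang X) X DER"
  by (rule mor_bangI) (simp_all add: DER_prom)

lemma der_eq: "der X = rowr (bweb (web X)) DER"
  by (auto simp: der_def rowr_def DER_def fun_eq_iff)

lemma dig_eq: "dig X = rowr (bweb (web X)) DIG"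
  by (auto simp: dig_def rowr_def DIG_def fun_eq_iff)

lemma image_mset_right_inverse:
  assumes "\<forall>x\<in>#M. g (f x) = x"
  shows "image_mset g (image_mset f M) = M"
  using assms by (induction M) auto

lemma prod_mset_Union:
  fixes u :: "'a \<Rightarrow> ennreal"
  shows "(\<Prod>a\<in>#\<Sum>\<^sub># B. u a) = (\<Prod>b\<in>#B. \<Prod>a\<in>#b. u a)"
  by (induction B) auto

text \<open>In each column of \<open>DIG\<close> at most one entry is nonzero. Columns that are not
  bags of bags give zero on both sides, because a promotion is zero off the bags.\<close>

lemma DIG_prom: "DIG \<odot> prom u = prom (prom u)"
proof
  fix d
  consider (bags) B where "d = Bag (image_mset Bag B)" | (other) M x where "d = Bag M" "x \<in># M" "\<And>b. x \<noteq> Bag b"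
    | (nobag) "\<And>M. d \<noteq> Bag M"
  proof -
    have "(\<exists>B. M = image_mset Bag B) \<or> (\<exists>x\<in>#M. \<forall>b. x \<noteq> Bag b)" for M
    proof (rule disjCI)
      assume "\<not> (\<exists>x\<in>#M. \<forall>b. x \<noteq> Bag b)"
      then have "\<forall>x\<in>#M. Bag (case x of Bag b \<Rightarrow> b) = x" by force
      then show "\<exists>B. M = image_mset Bag B" using image_mset_right_inverse by metis
    qed
    then show ?thesis using that by metis
  qed
  then show "(DIG \<odot> prom u) d = prom (prom u) d"
  proof cases
    case bags
    have inj: "image_mset Bag B = image_mset Bag B' \<longleftrightarrow> B = B'" for B'
      by (rule inj_eq, rule multiset.inj_map) (simp add: inj_def)
    have "(DIG \<odot> prom u) d = prom u (Bag (\<Sum>\<^sub># B))"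
      unfolding mapp_def
      by (subst infsum_single_point[where a = "Bag (\<Sum>\<^sub># B)"]) (auto simp: DIG_def bags inj)
    also have "\<dots> = prom (prom u) d"
      by (simp add: bags prod_mset_Union image_mset.compositionality comp_def)
    finally show ?thesis .
  next
    case other
    have "d \<noteq> Bag (image_mset Bag B)" for B
    proof
      assume "d = Bag (image_mset Bag B)"
      then have "x \<in> Bag ` set_mset B" using other(1,2) by simp
      then show False using other(3) by blast
    qed
    then have "DIG c d = 0" for c unfolding DIG_def by (intro if_not_P) blast
    moreover have "(\<Prod>a\<in>#M. prom u a) = 0"
      by (rule prod_mset_0_ennreal[OF other(2)]) (rule prom_eq_0[OF other(3)])
    ultimately show ?thesis by (simp add: mapp_def other(1))
  next
    case nobag
    then have "DIG c d = 0" for c unfolding DIG_def by (intro if_not_P) blast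
    then show ?thesis by (simp add: mapp_def prom_eq_0[OF nobag])
  qed
qed

lemma mor_DIG: "is_pcs X \<Longrightarrow> mor (bang X) (bang (bang X)) DIG"
  by (rule mor_bangI) (simp_all add: DIG_prom prom_pts is_pcs_bang)

lemma MON_prom: "MON \<odot> (prom u \<otimes>\<^sub>v prom v) = prom (u \<otimes>\<^sub>v v)"
proof
  fix d
  let ?P = "\<lambda>(a, b). Pair a b"
  consider (pairs) R where "d = Bag (image_mset ?P R)" | (other) M x where "d = Bag M" "x \<in># M" "\<And>a b. x \<noteq> Pair a b"
    | (nobag) "\<And>M. d \<noteq> Bag M"
  proof -
    have "(\<exists>R. M = image_mset ?P R) \<or> (\<exists>x\<in>#M. \<forall>a b. x \<noteq> Pair a b)" for M
    proof (rule disjCI)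
      assume "\<not> (\<exists>x\<in>#M. \<forall>a b. x \<noteq> Pair a b)"
      then have "\<forall>x\<in>#M. ?P (case x of Pair a b \<Rightarrow> (a, b)) = x" by force
      then show "\<exists>R. M = image_mset ?P R" using image_mset_right_inverse by metis
    qed
    then show ?thesis using that by metis
  qed
  then show "(MON \<odot> (prom u \<otimes>\<^sub>v prom v)) d = prom (u \<otimes>\<^sub>v v) d"
  proof cases
    case pairs
    have "inj ?P" by (auto simp: inj_def)
    then have inj: "image_mset ?P R = image_mset ?P R' \<longleftrightarrow> R = R'" for R'
      by (intro inj_eq multiset.inj_map)
    let ?c = "Pair (Bag (image_mset fst R)) (Bag (image_mset snd R))"
    have "(MON \<odot> (prom u \<otimes>\<^sub>v prom v)) d = (prom u \<otimes>\<^sub>v prom v) ?c"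
      unfolding mapp_def
      by (subst infsum_single_point[where a = ?c]) (auto simp: MON_def pairs inj)
    also have "\<dots> = (\<Prod>r\<in>#R. u (fst r) * v (snd r))"
      by (simp add: image_mset.compositionality comp_def prod_mset.distrib)
    also have "\<dots> = prom (u \<otimes>\<^sub>v v) d"
      by (simp add: pairs image_mset.compositionality comp_def case_prod_beta)
    finally show ?thesis .
  next
    case other
    have "d \<noteq> Bag (image_mset ?P R)" for R
    proof
      assume "d = Bag (image_mset ?P R)"
      then have "x \<in> ?P ` set_mset R" using other(1,2) by simp
      then show False using other(3) by auto
    qed
    then have "MON c d = 0" for c unfolding MON_def by (intro if_not_P) blast
    moreover have "(\<Prod>a\<in>#M. (u \<otimes>\<^sub>v v) a) = 0"
      by (rule prod_mset_0_ennreal[OF other(2)]) (rule tensv_eq_0[OF other(3)])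
    ultimately show ?thesis by (simp add: mapp_def other(1))
  next
    case nobag
    then have "MON c d = 0" for c unfolding MON_def by (intro if_not_P) blast
    then show ?thesis by (simp add: mapp_def prom_eq_0[OF nobag])
  qed
qed

text \<open>\<open>tensor\<close> is generated by tensors of arbitrary points of \<open>!X\<close>
  and \<open>!Y\<close>, whereas \<open>MON_prom\<close> speaks of promotions. One argument is
  therefore frozen at a time, and the other is extended from promotions.\<close>

lemma mor_MON:
  assumes X: "is_pcs X" and Y: "is_pcs Y"
  shows "mor (tensor (bang X) (bang Y)) (bang (tensor X Y)) MON"
proof -
  note B = is_pcs_bang[OF is_pcs_tensor[OF X Y]]
  have 1: "mor (bang Y) (bang (tensor X Y)) (\<lambda>d. MON \<odot> (prom u \<otimes>\<^sub>v unit_vec d))" if u: "u \<in> pts X" for u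
  proof (rule mor_bangI[OF Y B])
    fix v assume v: "v \<in> pts Y"
    have "(\<lambda>d. MON \<odot> (prom u \<otimes>\<^sub>v unit_vec d)) \<odot> prom v = MON \<odot> (prom u \<otimes>\<^sub>v prom v)"
      by (rule tensv_mat_right)
    then show "(\<lambda>d. MON \<odot> (prom u \<otimes>\<^sub>v unit_vec d)) \<odot> prom v \<in> pts (bang (tensor X Y))"
      by (simp add: MON_prom prom_pts tensv_pts is_pcs_tensor X Y u v)
  qed
  show ?thesis
  proof (rule mor_tensorI[OF is_pcs_bang[OF X] is_pcs_bang[OF Y] B])
    fix p q assume p: "p \<in> pts (bang X)" and q: "q \<in> pts (bang Y)"
    have "mor (bang X) (bang (tensor X Y)) (\<lambda>c. MON \<odot> (unit_vec c \<otimes>\<^sub>v q))"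
    proof (rule mor_bangI[OF X B])
      fix u assume u: "u \<in> pts X"
      have "(\<lambda>c. MON \<odot> (unit_vec c \<otimes>\<^sub>v q)) \<odot> prom u = MON \<odot> (prom u \<otimes>\<^sub>v q)"
        by (rule tensv_mat_left)
      also have "\<dots> = (\<lambda>d. MON \<odot> (prom u \<otimes>\<^sub>v unit_vec d)) \<odot> q"
        by (rule tensv_mat_right[symmetric])
      finally show "(\<lambda>c. MON \<odot> (unit_vec c \<otimes>\<^sub>v q)) \<odot> prom u \<in> pts (bang (tensor X Y))"
        using morD[OF 1[OF u] q] by simp
    qed
    from morD[OF this p] show "MON \<odot> (p \<otimes>\<^sub>v q) \<in> pts (bang (tensor X Y))"
      by (simp only: tensv_mat_left)
  qed
qed

text \<open>Distributivity for a product of infinite sums, with one factor for each element of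
  \<open>cs\<close>.\<close>

lemma list_entry_sum:
  "(\<Sum>\<^sub>\<infinity>as. list_entry t as cs * prod_list (map u as)) = prod_list (map (t \<odot> u) cs)"
proof (induction cs)
  case Nil
  have "list_entry t as [] * prod_list (map u as) = 0" if "as \<noteq> []" for as
    using that by (cases as) auto
  then have "(\<Sum>\<^sub>\<infinity>as. list_entry t as [] * prod_list (map u as)) = list_entry t [] [] * prod_list (map u [])"
    by (rule infsum_single_point)
  then show ?case by simp
next
  case (Cons c cs)
  have "(\<Sum>\<^sub>\<infinity>as. list_entry t as (c # cs) * prod_list (map u as)) =
      (\<Sum>\<^sub>\<infinity>a. \<Sum>\<^sub>\<infinity>as. list_entry t (a # as) (c # cs) * prod_list (map u (a # as)))"
  proof (rule infsum_support_range2)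
    fix as :: "pt list" assume "\<And>a bs. as \<noteq> a # bs"
    then have "as = []" by (cases as) blast+
    then show "list_entry t as (c # cs) * prod_list (map u as) = 0" by simp
  qed simp
  also have "\<dots> = (\<Sum>\<^sub>\<infinity>a. \<Sum>\<^sub>\<infinity>as. (t a c * u a) * (list_entry t as cs * prod_list (map u as)))"
    by (simp add: mult_ac)
  also have "\<dots> = (t \<odot> u) c * prod_list (map (t \<odot> u) cs)"
    by (simp only: infsum_cmult_ennreal infsum_multc_ennreal Cons.IH mapp_def)
  finally show ?case by simp
qed

text \<open>The chosen enumeration of the target bag does not affect the value, as the product is
  commutative; lists of variables with the same multiset are collected by
  \<open>infsum_fibers\<close>.\<close>

lemma bangu_prom: "bangu t \<odot> prom u = prom (t \<odot> u)"
proof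
  fix d
  show "(bangu t \<odot> prom u) d = prom (t \<odot> u) d"
  proof (cases "\<exists>m. d = Bag m")
    case True
    then obtain m where d: "d = Bag m" by blast
    define cs where "cs = (SOME cs. mset cs = m)"
    have cs: "mset cs = m" unfolding cs_def by (rule someI_ex) (rule ex_mset)
    have prod: "(\<Prod>a\<in>#mset as. f a) = prod_list (map f as)" for as and f :: "pt \<Rightarrow> ennreal"
      by (induction as) auto
    have "(bangu t \<odot> prom u) d = (\<Sum>\<^sub>\<infinity>b. bangu t (Bag b) d * prom u (Bag b))"
      unfolding mapp_def by (rule infsum_Bag) (simp add: prom_eq_0)
    also have "\<dots> = (\<Sum>\<^sub>\<infinity>b. \<Sum>\<^sub>\<infinity>as. if mset as = b then list_entry t as cs * prod_list (map u as) else 0)"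
      unfolding bangu_def d cs_def[symmetric] prod.case pt.case infsum_multc_ennreal[symmetric] prom_Bag
      by (intro infsum_cong) (auto simp: prod)
    also have "\<dots> = (\<Sum>\<^sub>\<infinity>as. list_entry t as cs * prod_list (map u as))"
      by (rule infsum_fibers)
    also have "\<dots> = prom (t \<odot> u) d"
      unfolding list_entry_sum d prom_Bag cs[symmetric] by (rule prod[symmetric])
    finally show ?thesis .
  next
    case False
    then have "bangu t c d = 0" for c by (cases d) (simp_all add: bangu_def split: pt.split)
    then show ?thesis using False by (simp add: mapp_def prom_eq_0)
  qed
qed

lemma list_entry_cong: "(\<And>a. a \<in> set as \<Longrightarrow> s a = t a) \<Longrightarrow> list_entry s as cs = list_entry t as cs"
  by (induction t as cs rule: list_entry.induct) simp_all

lemma list_entry_mono: "s \<le> t \<Longrightarrow> list_entry s as cs \<le> list_entry t as cs"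
  by (induction t as cs rule: list_entry.induct) (auto intro!: mult_mono simp: le_fun_def)

text \<open>The row of a bag involves only the rows of its elements. So on bags over a web
  \<open>bangu\<close> does not see how a matrix continues outside that web.\<close>

lemma bangu_row_cong:
  assumes "\<And>a. a \<in># b \<Longrightarrow> s a = t a"
  shows "bangu s (Bag b) = bangu t (Bag b)"
proof
  fix d
  have "(if mset as = b then list_entry s as cs else 0) = (if mset as = b then list_entry t as cs else 0)" for as cs
  proof (cases "mset as = b")
    case True
    have "s a = t a" if "a \<in> set as" for a using assms that True by (metis set_mset_mset)
    then show ?thesis by (simp add: list_entry_cong[of as s t])
  qed simp
  then show "bangu s (Bag b) d = bangu t (Bag b) d"
    unfolding bangu_def by (cases d) simp_all
qed

lemma bangu_mono: "s \<le> t \<Longrightarrow> bangu s \<le> bangu t"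
proof (intro le_funI)
  fix c d assume "s \<le> t"
  then have "list_entry s as cs \<le> list_entry t as cs" for as cs by (rule list_entry_mono)
  then show "bangu s c d \<le> bangu t c d"
    unfolding bangu_def by (auto split: pt.splits intro!: infsum_mono_ennreal)
qed

lemma mor_bangu:
  assumes "is_pcs X" "is_pcs Y" "mor X Y t"
  shows "mor (bang X) (bang Y) (bangu t)"
  using assms(1,2) by (intro mor_bangI is_pcs_bang) (simp_all add: bangu_prom prom_pts morD[OF assms(3)])

lemma rowr_row: "a \<in> I \<Longrightarrow> rowr I T a = T a"
  by (simp add: rowr_def)

lemma rowr_row_0: "a \<notin> I \<Longrightarrow> rowr I T a = (\<lambda>_. 0)"
  by (simp add: rowr_def)

lemma rowr_cong: "(\<And>a. a \<in> I \<Longrightarrow> S a = T a) \<Longrightarrow> rowr I S = rowr I T"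
  by (auto simp: rowr_def fun_eq_iff)

lemma rowr_id: "(\<And>a. a \<notin> I \<Longrightarrow> T a = (\<lambda>_. 0)) \<Longrightarrow> rowr I T = T"
  by (auto simp: rowr_def fun_eq_iff)

lemma mapp_eq_on:
  assumes "u \<in> vecs I" "\<And>a. a \<in> I \<Longrightarrow> S a = T a"
  shows "S \<odot> u = T \<odot> u"
proof (rule mapp_cong)
  fix a assume "u a \<noteq> 0"
  then have "a \<in> I" using assms(1) unfolding vecs_def by blast
  then show "S a = T a" by (rule assms(2))
qed

text \<open>Resolves the description in \<open>bangm\<close>: \<open>bangu\<close> supplies a
  solution, and separation by promotions makes it unique.\<close>

lemma bangm_eq:
  assumes X: "is_pcs X" and Y: "is_pcs Y" and t: "mor X Y t"
  shows "bangm X Y t = rowr (bweb (web X)) (bangu t)"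
  unfolding bangm_def
proof (rule the_equality)
  note B = is_pcs_bang[OF X] is_pcs_bang[OF Y]
  have app: "rowr (bweb (web X)) (bangu t) \<odot> prom u = prom (t \<odot> u)" if "u \<in> pts X" for u
    using rowr_mapp[OF prom_vecs[OF pts_vecs[OF X that]]] by (simp add: bangu_prom)
  show "rowr (bweb (web X)) (bangu t) \<in> Pcoh (bang X) (bang Y) \<and>
      (\<forall>u\<in>pts X. rowr (bweb (web X)) (bangu t) \<odot> prom u = prom (t \<odot> u))"
    using rowr_Pcoh[OF B mor_bangu[OF X Y t]] app by simp
  fix s assume s: "s \<in> Pcoh (bang X) (bang Y) \<and> (\<forall>u\<in>pts X. s \<odot> prom u = prom (t \<odot> u))"
  then have "mor (bang X) (bang Y) s" and s0: "\<And>a. a \<notin> bweb (web X) \<Longrightarrow> s a = (\<lambda>_. 0)"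
    by (simp_all add: Pcoh_iff[OF B])
  then have "s a = bangu t a" if "a \<in> bweb (web X)" for a
    using bang_mor_eq[OF X B(2) _ mor_bangu[OF X Y t] _ that] s by (simp add: bangu_prom)
  then have "rowr (bweb (web X)) s = rowr (bweb (web X)) (bangu t)" by (rule rowr_cong)
  then show "s = rowr (bweb (web X)) (bangu t)" using rowr_id[OF s0] by simp
qed

lemma monm_eq:
  assumes X: "is_pcs X" and Y: "is_pcs Y"
  shows "monm X Y = rowr (tweb (bweb (web X)) (bweb (web Y))) MON"
  unfolding monm_def
proof (rule the_equality)
  let ?I = "tweb (bweb (web X)) (bweb (web Y))"
  note T = is_pcs_tensor[OF is_pcs_bang[OF X] is_pcs_bang[OF Y]]
  note B = is_pcs_bang[OF is_pcs_tensor[OF X Y]]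
  have app: "rowr ?I MON \<odot> (prom u \<otimes>\<^sub>v prom v) = prom (u \<otimes>\<^sub>v v)" if "u \<in> pts X" "v \<in> pts Y" for u v
    using rowr_mapp[OF tensv_vecs[OF prom_vecs[OF pts_vecs[OF X that(1)]] prom_vecs[OF pts_vecs[OF Y that(2)]]]]
    by (simp add: MON_prom)
  show "rowr ?I MON \<in> Pcoh (tensor (bang X) (bang Y)) (bang (tensor X Y)) \<and>
      (\<forall>u\<in>pts X. \<forall>v\<in>pts Y. rowr ?I MON \<odot> (prom u \<otimes>\<^sub>v prom v) = prom (u \<otimes>\<^sub>v v))"
    using rowr_Pcoh[OF T B mor_MON[OF X Y]] app by simp
  fix s assume s: "s \<in> Pcoh (tensor (bang X) (bang Y)) (bang (tensor X Y)) \<and>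
      (\<forall>u\<in>pts X. \<forall>v\<in>pts Y. s \<odot> (prom u \<otimes>\<^sub>v prom v) = prom (u \<otimes>\<^sub>v v))"
  then have "mor (tensor (bang X) (bang Y)) (bang (tensor X Y)) s" and s0: "\<And>a. a \<notin> ?I \<Longrightarrow> s a = (\<lambda>_. 0)"
    by (simp_all add: Pcoh_iff[OF T B])
  then have "s a = MON a" if "a \<in> ?I" for a
    using bang_tensor_mor_eq[OF X Y B _ mor_MON[OF X Y] _ that] s by (simp add: MON_prom)
  then have "rowr ?I s = rowr ?I MON" by (rule rowr_cong)
  then show "s = rowr ?I MON" using rowr_id[OF s0] by simp
qed

text \<open>Functoriality, obtained from the action on promotions and thus for the rows inside the
  web.\<close>

lemma bangu_mcomp:
  assumes "is_pcs X" "is_pcs Y" "is_pcs Z" "mor X Y t" "mor Y Z s" "c \<in> bweb (web X)"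
  shows "bangu (s \<circ>\<^sub>m t) c = (bangu s \<circ>\<^sub>m bangu t) c"
proof (rule bang_mor_eq[OF assms(1) is_pcs_bang[OF assms(3)] _ _ _ assms(6)])
  show "mor (bang X) (bang Z) (bangu (s \<circ>\<^sub>m t))"
    using assms by (intro mor_bangu mor_mcomp[OF assms(4,5)])
  show "mor (bang X) (bang Z) (bangu s \<circ>\<^sub>m bangu t)"
    by (rule mor_mcomp[OF mor_bangu[OF assms(1,2,4)] mor_bangu[OF assms(2,3,5)]])
qed (simp add: bangu_prom mapp_mcomp)


section \<open>Coalgebras\<close>

lemma mor_rowr: "is_pcs X \<Longrightarrow> mor X Y (rowr (web X) T) \<longleftrightarrow> mor X Y T"
  unfolding mor_def using rowr_mapp[OF pts_vecs] by simp

text \<open>Replaces the matrices attached to individual spaces by universal ones and splits the two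
  coalgebra laws into rows. The verifications below start from this form.\<close>

lemma is_coalg_iff:
  "is_coalg (X, h) \<longleftrightarrow> is_pcs X \<and> mor X (bang X) h \<and> (\<forall>a. a \<notin> web X \<longrightarrow> h a = (\<lambda>_. 0)) \<and>
     (\<forall>a\<in>web X. DER \<odot> h a = unit_vec a) \<and> (\<forall>a\<in>web X. DIG \<odot> h a = bangu h \<odot> h a)"
proof (cases "is_pcs X \<and> mor X (bang X) h \<and> (\<forall>a. a \<notin> web X \<longrightarrow> h a = (\<lambda>_. 0))")
  case True
  then have X: "is_pcs X" and h: "mor X (bang X) h" and h0: "\<And>a. a \<notin> web X \<Longrightarrow> h a = (\<lambda>_. 0)" by auto
  have row: "h a \<in> vecs (bweb (web X))" for a
  proof (cases "a \<in> web X")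
    case True
    then show ?thesis using mor_row_vecs[OF X is_pcs_bang[OF X] h] by simp
  next
    case False
    then show ?thesis using h0 by (simp add: vecs_def)
  qed
  have ext: "S = T \<longleftrightarrow> (\<forall>a\<in>web X. S a = T a)" if "\<And>a. a \<notin> web X \<Longrightarrow> S a = T a" for S T :: mat
  proof
    assume "\<forall>a\<in>web X. S a = T a"
    then show "S = T" using that by blast
  qed simp
  have idm: "idm (web X) a = (if a \<in> web X then unit_vec a else (\<lambda>_. 0))" for a
    by (auto simp: idm_def unit_vec_def)
  have der: "(der X \<circ>\<^sub>m h) a = DER \<odot> h a" for a
    unfolding mcomp_row der_eq by (rule rowr_mapp[OF row])
  have 1: "der X \<circ>\<^sub>m h = idm (web X) \<longleftrightarrow> (\<forall>a\<in>web X. DER \<odot> h a = unit_vec a)"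
    by (subst ext) (simp_all add: idm der h0)
  have dig: "(dig X \<circ>\<^sub>m h) a = DIG \<odot> h a" "(bangm X (bang X) h \<circ>\<^sub>m h) a = bangu h \<odot> h a" for a
    unfolding mcomp_row dig_eq bangm_eq[OF X is_pcs_bang[OF X] h] by (rule rowr_mapp[OF row])+
  have 2: "dig X \<circ>\<^sub>m h = bangm X (bang X) h \<circ>\<^sub>m h \<longleftrightarrow> (\<forall>a\<in>web X. DIG \<odot> h a = bangu h \<odot> h a)"
    by (subst ext) (simp_all add: dig h0)
  show ?thesis
    unfolding is_coalg_def prod.case 1 2 Pcoh_iff[OF X is_pcs_bang[OF X]] using X by blast
next
  case False
  then show ?thesis
    unfolding is_coalg_def prod.case using Pcoh_iff[OF _ is_pcs_bang, of X X h] by blast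
qed

lemma is_coalg_pcs: "is_coalg C \<Longrightarrow> is_pcs (fst C)"
  by (cases C) (simp add: is_coalg_iff)

text \<open>The bags \<open>k[*]\<close> are exactly those at which the promotion of the unit vector
  is \<open>1\<close>; at any other bag it has a factor zero.\<close>

lemma one_coalg_eq: "one_coalg = (one_pcs, \<lambda>a. if a = Star then prom (unit_vec Star) else (\<lambda>_. 0))"
proof -
  have "prom (unit_vec Star) c = (if \<exists>k. c = Bag (replicate_mset k Star) then 1 else 0)" for c
  proof (cases "\<exists>b. c = Bag b")
    case True
    then obtain b where c: "c = Bag b" by blast
    show ?thesis
    proof (cases "\<exists>k. b = replicate_mset k Star")
      case True
      then obtain k where "b = replicate_mset k Star" by blast
      then show ?thesis by (auto simp: c unit_vec_def)
    next
      case False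
      then have "\<not> set_mset b \<subseteq> {Star}" by (metis set_mset_subset_singletonD)
      then obtain a where "a \<in># b" "a \<noteq> Star" by blast
      then have "(\<Prod>a\<in>#b. unit_vec Star a) = 0"
        by (intro prod_mset_0_ennreal[of a]) (simp_all add: unit_vec_def)
      then show ?thesis using False by (simp add: c)
    qed
  next
    case False
    then have "prom (unit_vec Star) c = 0" by (intro prom_eq_0) blast
    then show ?thesis using False by auto
  qed
  then show ?thesis unfolding one_coalg_def by (auto simp: fun_eq_iff)
qed

lemma is_coalg_one: "is_coalg one_coalg"
proof -
  let ?h = "\<lambda>a. if a = Star then prom (unit_vec Star) else (\<lambda>_. 0)"
  have "mor one_pcs (bang one_pcs) ?h"
    by (rule mor_oneI) (simp_all add: is_pcs_bang is_pcs_one prom_pts)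
  moreover have "bangu ?h \<odot> prom (unit_vec Star) = DIG \<odot> prom (unit_vec Star)"
    unfolding bangu_prom DIG_prom mapp_unit_vec by simp
  ultimately show ?thesis
    unfolding one_coalg_eq is_coalg_iff by (simp add: is_pcs_one DER_prom)
qed

text \<open>Both laws are comonad laws of \<open>!\<close>, and on promotions they are immediate
  from \<open>DER_prom\<close> and \<open>DIG_prom\<close>.\<close>

lemma is_coalg_bang:
  assumes X: "is_pcs X"
  shows "is_coalg (bang_coalg X)"
proof -
  note B = is_pcs_bang[OF X]
  note BB = is_pcs_bang[OF B]
  have mor: "mor (bang X) (bang (bang X)) (dig X)"
    using mor_DIG[OF X] mor_rowr[OF B] unfolding dig_eq web_bang[symmetric] by blast
  have der: "(DER \<circ>\<^sub>m DIG) c = IDU c" if "c \<in> bweb (web X)" for c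
  proof (rule bang_mor_eq[OF X B mor_mcomp[OF mor_DIG[OF X] mor_DER[OF B]] mor_IDU _ that])
    show "(DER \<circ>\<^sub>m DIG) \<odot> prom u = IDU \<odot> prom u" for u
      by (simp add: mapp_mcomp DIG_prom DER_prom)
  qed
  have dig: "(DIG \<circ>\<^sub>m DIG) c = (bangu (dig X) \<circ>\<^sub>m DIG) c" if "c \<in> bweb (web X)" for c
  proof (rule bang_mor_eq[OF X is_pcs_bang[OF BB] mor_mcomp[OF mor_DIG[OF X] mor_DIG[OF B]]
        mor_mcomp[OF mor_DIG[OF X] mor_bangu[OF B BB mor]] _ that])
    fix u assume "u \<in> pts X"
    then have "dig X \<odot> prom u = DIG \<odot> prom u"
      unfolding dig_eq by (intro rowr_mapp prom_vecs pts_vecs[OF X])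
    then show "(DIG \<circ>\<^sub>m DIG) \<odot> prom u = (bangu (dig X) \<circ>\<^sub>m DIG) \<odot> prom u"
      by (simp add: mapp_mcomp DIG_prom bangu_prom)
  qed
  have row: "dig X c = DIG c" if "c \<in> bweb (web X)" for c using that by (simp add: dig_eq rowr_row)
  show ?thesis
    unfolding bang_coalg_def is_coalg_iff
  proof (intro conjI ballI allI impI)
    show "dig X c = (\<lambda>_. 0)" if "c \<notin> web (bang X)" for c using that by (simp add: dig_eq rowr_row_0)
    show "DER \<odot> dig X c = unit_vec c" if "c \<in> web (bang X)" for c
      using der[of c] that by (simp add: row mcomp_row IDU_def)
    show "DIG \<odot> dig X c = bangu (dig X) \<odot> dig X c" if "c \<in> web (bang X)" for c
      using dig[of c] that by (simp add: row mcomp_row)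
  qed (fact B mor)+
qed

lemma tensor_coalg_eq:
  assumes "is_coalg (X, h)" "is_coalg (Y, k)"
  shows "tensor_coalg (X, h) (Y, k) = (tensor X Y, MON \<circ>\<^sub>m (h \<otimes>\<^sub>m k))"
proof -
  have X: "is_pcs X" "mor X (bang X) h" "\<And>a. a \<notin> web X \<Longrightarrow> h a = (\<lambda>_. 0)"
    and Y: "is_pcs Y" "mor Y (bang Y) k" "\<And>a. a \<notin> web Y \<Longrightarrow> k a = (\<lambda>_. 0)"
    using assms by (auto simp: is_coalg_iff)
  have "(monm X Y \<circ>\<^sub>m (h \<otimes>\<^sub>m k)) c = (MON \<circ>\<^sub>m (h \<otimes>\<^sub>m k)) c" for c
  proof (cases "c \<in> tweb (web X) (web Y)")
    case True
    then obtain a b where c: "c = Pair a b" "a \<in> web X" "b \<in> web Y" by (auto simp: tweb_def)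
    have "h a \<in> vecs (bweb (web X))" "k b \<in> vecs (bweb (web Y))"
      using mor_row_vecs[OF X(1) is_pcs_bang[OF X(1)] X(2) c(2)]
        mor_row_vecs[OF Y(1) is_pcs_bang[OF Y(1)] Y(2) c(3)] by simp_all
    then show ?thesis
      unfolding mcomp_row c(1) tensm_row monm_eq[OF X(1) Y(1)] by (intro rowr_mapp tensv_vecs)
  next
    case False
    have "(h \<otimes>\<^sub>m k) c = (\<lambda>_. 0)"
    proof (cases "\<exists>a b. c = Pair a b")
      case True
      then obtain a b where c: "c = Pair a b" by blast
      with False have "h a = (\<lambda>_. 0) \<or> k b = (\<lambda>_. 0)" using X(3) Y(3) by auto
      then show ?thesis by (auto simp: c)
    next
      case False
      then show ?thesis by (intro tensm_row_0) blast
    qed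
    then show ?thesis by (simp add: mcomp_row)
  qed
  then show ?thesis by (auto simp: tensor_coalg_def)
qed

lemma is_coalg_tensor:
  assumes C: "is_coalg C" and D: "is_coalg D"
  shows "is_coalg (tensor_coalg C D)"
proof -
  obtain X h Y k where CD: "C = (X, h)" "D = (Y, k)" by fastforce
  have X: "is_pcs X" and h: "mor X (bang X) h" and h0: "\<And>a. a \<notin> web X \<Longrightarrow> h a = (\<lambda>_. 0)"
    and h_der: "\<And>a. a \<in> web X \<Longrightarrow> DER \<odot> h a = unit_vec a"
    and h_dig: "\<And>a. a \<in> web X \<Longrightarrow> DIG \<odot> h a = bangu h \<odot> h a"
    and Y: "is_pcs Y" and k: "mor Y (bang Y) k" and k0: "\<And>a. a \<notin> web Y \<Longrightarrow> k a = (\<lambda>_. 0)"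
    and k_der: "\<And>a. a \<in> web Y \<Longrightarrow> DER \<odot> k a = unit_vec a"
    and k_dig: "\<And>a. a \<in> web Y \<Longrightarrow> DIG \<odot> k a = bangu k \<odot> k a"
    using C D unfolding CD is_coalg_iff by auto
  note BX = is_pcs_bang[OF X] and BY = is_pcs_bang[OF Y]
  note XY = is_pcs_tensor[OF X Y] and BXBY = is_pcs_tensor[OF BX BY]
  note BXY = is_pcs_bang[OF XY]
  note hk = mor_tensm[OF X Y BX BY h k]
  note M = mor_MON[OF X Y]
  let ?l = "MON \<circ>\<^sub>m (h \<otimes>\<^sub>m k)"
  have l: "mor (tensor X Y) (bang (tensor X Y)) ?l" by (rule mor_mcomp[OF hk M])
  \<comment> \<open>Compatibility of the monoidal matrix with dereliction; the next two facts
    concern digging and naturality. All three hold because they hold on tensors of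
    promotions.\<close>
  have der: "(DER \<circ>\<^sub>m MON) c = (DER \<otimes>\<^sub>m DER) c" if "c \<in> tweb (bweb (web X)) (bweb (web Y))" for c
    by (rule bang_tensor_mor_eq[OF X Y XY mor_mcomp[OF M mor_DER[OF XY]]
          mor_tensm[OF BX BY X Y mor_DER[OF X] mor_DER[OF Y]] _ that])
      (simp add: mapp_mcomp MON_prom DER_prom mapp_tensm)
  have dig: "(DIG \<circ>\<^sub>m MON) c = (bangu MON \<circ>\<^sub>m (MON \<circ>\<^sub>m (DIG \<otimes>\<^sub>m DIG))) c"
    if "c \<in> tweb (bweb (web X)) (bweb (web Y))" for c
    by (rule bang_tensor_mor_eq[OF X Y is_pcs_bang[OF BXY] mor_mcomp[OF M mor_DIG[OF XY]]
          mor_mcomp[OF mor_mcomp[OF mor_tensm[OF BX BY is_pcs_bang[OF BX] is_pcs_bang[OF BY] mor_DIG[OF X] mor_DIG[OF Y]]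
              mor_MON[OF BX BY]] mor_bangu[OF BXBY BXY M]] _ that])
      (simp add: mapp_mcomp MON_prom DIG_prom mapp_tensm bangu_prom)
  have nat: "(MON \<circ>\<^sub>m (bangu h \<otimes>\<^sub>m bangu k)) c = (bangu (h \<otimes>\<^sub>m k) \<circ>\<^sub>m MON) c"
    if "c \<in> tweb (bweb (web X)) (bweb (web Y))" for c
    by (rule bang_tensor_mor_eq[OF X Y is_pcs_bang[OF BXBY]
          mor_mcomp[OF mor_tensm[OF BX BY is_pcs_bang[OF BX] is_pcs_bang[OF BY] mor_bangu[OF X BX h] mor_bangu[OF Y BY k]] mor_MON[OF BX BY]]
          mor_mcomp[OF M mor_bangu[OF XY BXBY hk]] _ that])
      (simp add: mapp_mcomp MON_prom mapp_tensm bangu_prom)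
  show ?thesis
    unfolding CD tensor_coalg_eq[OF C[unfolded CD] D[unfolded CD]] is_coalg_iff
  proof (intro conjI ballI allI impI)
    fix c assume "c \<notin> web (tensor X Y)"
    then have "(h \<otimes>\<^sub>m k) c = (\<lambda>_. 0)"
    proof (cases "\<exists>a b. c = Pair a b")
      case True
      then obtain a b where c: "c = Pair a b" by blast
      with \<open>c \<notin> web (tensor X Y)\<close> have "h a = (\<lambda>_. 0) \<or> k b = (\<lambda>_. 0)" using h0 k0 by auto
      then show ?thesis by (auto simp: c)
    next
      case False
      then show ?thesis by (intro tensm_row_0) blast
    qed
    then show "?l c = (\<lambda>_. 0)" by (simp add: mcomp_row)
  next
    fix c assume "c \<in> web (tensor X Y)"
    then obtain a b where c: "c = Pair a b" "a \<in> web X" "b \<in> web Y" by (auto simp: tweb_def)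
    let ?w = "h a \<otimes>\<^sub>v k b"
    have lc: "?l c = MON \<odot> ?w" by (simp add: mcomp_row c(1))
    have w: "?w \<in> vecs (tweb (bweb (web X)) (bweb (web Y)))"
      using mor_row_vecs[OF X BX h c(2)] mor_row_vecs[OF Y BY k c(3)] by (simp add: tensv_vecs)
    have "DER \<odot> ?l c = (DER \<circ>\<^sub>m MON) \<odot> ?w" by (simp add: lc mapp_mcomp)
    also have "\<dots> = (DER \<otimes>\<^sub>m DER) \<odot> ?w" by (rule mapp_eq_on[OF w der])
    also have "\<dots> = unit_vec a \<otimes>\<^sub>v unit_vec b" by (simp add: mapp_tensm h_der k_der c)
    also have "\<dots> = unit_vec c" by (auto simp: tensv_def unit_vec_def c(1) split: pt.splits)
    finally show "DER \<odot> ?l c = unit_vec c" .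
    have lc_vecs: "MON \<odot> ?w \<in> vecs (bweb (web (tensor X Y)))"
      using mor_row_vecs[OF XY BXY l \<open>c \<in> web (tensor X Y)\<close>] unfolding lc by simp
    have "DIG \<odot> ?l c = (DIG \<circ>\<^sub>m MON) \<odot> ?w" by (simp add: lc mapp_mcomp)
    also have "\<dots> = (bangu MON \<circ>\<^sub>m (MON \<circ>\<^sub>m (DIG \<otimes>\<^sub>m DIG))) \<odot> ?w" by (rule mapp_eq_on[OF w dig])
    also have "\<dots> = bangu MON \<odot> (MON \<circ>\<^sub>m (bangu h \<otimes>\<^sub>m bangu k)) \<odot> ?w"
      by (simp add: mapp_mcomp mapp_tensm h_dig k_dig c)
    also have "(MON \<circ>\<^sub>m (bangu h \<otimes>\<^sub>m bangu k)) \<odot> ?w = (bangu (h \<otimes>\<^sub>m k) \<circ>\<^sub>m MON) \<odot> ?w"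
      by (rule mapp_eq_on[OF w nat])
    also have "bangu MON \<odot> (bangu (h \<otimes>\<^sub>m k) \<circ>\<^sub>m MON) \<odot> ?w = (bangu MON \<circ>\<^sub>m bangu (h \<otimes>\<^sub>m k)) \<odot> (MON \<odot> ?w)"
      by (simp add: mapp_mcomp)
    \<comment> \<open>Functoriality folds the two promoted factors into the promotion of the new
      structure \<open>?l\<close>.\<close>
    also have "\<dots> = bangu ?l \<odot> (MON \<odot> ?w)"
      by (rule mapp_eq_on[OF lc_vecs, symmetric]) (rule bangu_mcomp[OF XY BXBY BXY hk M])
    finally show "DIG \<odot> ?l c = bangu ?l \<odot> ?l c" by (simp only: lc)
  qed (fact XY l)+
qed

lemma injm_eq: "injm i X = rowr (web X) (InjU i)"
  by (auto simp: injm_def rowr_def InjU_def unit_vec_def fun_eq_iff)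

lemma copair_curried:
  "(\<lambda>c d. case c of In Lft a \<Rightarrow> S a d | In Rgt b \<Rightarrow> T b d | _ \<Rightarrow> 0) = copair S T"
proof (intro ext)
  fix c d
  show "(case c of In Lft a \<Rightarrow> S a d | In Rgt b \<Rightarrow> T b d | _ \<Rightarrow> 0) = copair S T c d"
    by (cases c) (simp_all add: copair_def split: side.split)
qed

lemma oplus_coalg_eq:
  assumes "is_coalg (X, h)" "is_coalg (Y, k)"
  shows "oplus_coalg (X, h) (Y, k) =
    (oplus X Y, copair (bangu (InjU Lft) \<circ>\<^sub>m h) (bangu (InjU Rgt) \<circ>\<^sub>m k))"
proof -
  have X: "is_pcs X" "mor X (bang X) h" "\<And>a. a \<notin> web X \<Longrightarrow> h a = (\<lambda>_. 0)"
    and Y: "is_pcs Y" "mor Y (bang Y) k" "\<And>a. a \<notin> web Y \<Longrightarrow> k a = (\<lambda>_. 0)"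
    using assms by (auto simp: is_coalg_iff)
  note P = is_pcs_oplus[OF X(1) Y(1)]
  have gen: "bangm Z (oplus X Y) (injm i Z) \<circ>\<^sub>m t = bangu (InjU i) \<circ>\<^sub>m t"
    if Z: "is_pcs Z" "mor Z (bang Z) t" "\<And>a. a \<notin> web Z \<Longrightarrow> t a = (\<lambda>_. 0)"
      and i: "mor Z (oplus X Y) (InjU i)" for Z i t
  proof
    fix a
    have "mor Z (oplus X Y) (injm i Z)" using i mor_rowr[OF Z(1)] by (simp add: injm_eq)
    then have eq: "bangm Z (oplus X Y) (injm i Z) = rowr (bweb (web Z)) (bangu (injm i Z))"
      by (rule bangm_eq[OF Z(1) P])
    show "(bangm Z (oplus X Y) (injm i Z) \<circ>\<^sub>m t) a = (bangu (InjU i) \<circ>\<^sub>m t) a"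
    proof (cases "a \<in> web Z")
      case True
      then have "t a \<in> vecs (bweb (web Z))"
        using mor_row_vecs[OF Z(1) is_pcs_bang[OF Z(1)] Z(2)] by simp
      then show ?thesis
        unfolding mcomp_row
      proof (rule mapp_eq_on)
        fix c assume "c \<in> bweb (web Z)"
        then obtain b where b: "c = Bag b" "set_mset b \<subseteq> web Z" by (auto simp: bweb_def)
        \<comment> \<open>A bag over the web of \<open>Z\<close> meets only rows at which
          \<open>injm i Z\<close> and \<open>InjU i\<close> agree.\<close>
        have "bangu (injm i Z) (Bag b) = bangu (InjU i) (Bag b)"
          by (rule bangu_row_cong) (use b(2) in \<open>auto simp: injm_eq rowr_row\<close>)
        then show "bangm Z (oplus X Y) (injm i Z) c = bangu (InjU i) c"
          using b by (simp add: eq rowr_row)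
      qed
    qed (simp add: mcomp_row Z(3))
  qed
  have l: "bangm X (oplus X Y) (injm Lft X) \<circ>\<^sub>m h = bangu (InjU Lft) \<circ>\<^sub>m h"
    by (rule gen[OF X(1,2) _ mor_InjU(1)[OF X(1) Y(1)]]) (rule X(3))
  have r: "bangm Y (oplus X Y) (injm Rgt Y) \<circ>\<^sub>m k = bangu (InjU Rgt) \<circ>\<^sub>m k"
    by (rule gen[OF Y(1,2) _ mor_InjU(2)[OF X(1) Y(1)]]) (rule Y(3))
  show ?thesis
    by (simp only: oplus_coalg_def prod.case l r copair_curried)
qed

text \<open>On each side the new structure is the old one followed by the promoted injection.
  Naturality of dereliction and digging moves the injection across, and the law of the summand
  remains.\<close>

lemma is_coalg_oplus:
  assumes C: "is_coalg C" and D: "is_coalg D"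
  shows "is_coalg (oplus_coalg C D)"
proof -
  obtain X h Y k where CD: "C = (X, h)" "D = (Y, k)" by fastforce
  have X: "is_pcs X" and h: "mor X (bang X) h" and h0: "\<And>a. a \<notin> web X \<Longrightarrow> h a = (\<lambda>_. 0)"
    and h_der: "\<And>a. a \<in> web X \<Longrightarrow> DER \<odot> h a = unit_vec a"
    and h_dig: "\<And>a. a \<in> web X \<Longrightarrow> DIG \<odot> h a = bangu h \<odot> h a"
    and Y: "is_pcs Y" and k: "mor Y (bang Y) k" and k0: "\<And>a. a \<notin> web Y \<Longrightarrow> k a = (\<lambda>_. 0)"
    and k_der: "\<And>a. a \<in> web Y \<Longrightarrow> DER \<odot> k a = unit_vec a"
    and k_dig: "\<And>a. a \<in> web Y \<Longrightarrow> DIG \<odot> k a = bangu k \<odot> k a"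
    using C D unfolding CD is_coalg_iff by auto
  note P = is_pcs_oplus[OF X Y]
  note BP = is_pcs_bang[OF P]
  note J = mor_InjU[OF X Y]
  let ?l = "copair (bangu (InjU Lft) \<circ>\<^sub>m h) (bangu (InjU Rgt) \<circ>\<^sub>m k)"
  have l: "mor (oplus X Y) (bang (oplus X Y)) ?l"
    by (rule mor_copair[OF X Y BP mor_mcomp[OF h mor_bangu[OF X P J(1)]] mor_mcomp[OF k mor_bangu[OF Y P J(2)]]])
  have lJ: "?l \<circ>\<^sub>m InjU Lft = bangu (InjU Lft) \<circ>\<^sub>m h" "?l \<circ>\<^sub>m InjU Rgt = bangu (InjU Rgt) \<circ>\<^sub>m k"
    by (simp_all add: fun_eq_iff mcomp_row InjU_def)
  \<comment> \<open>\<open>Z\<close>, \<open>t\<close> and \<open>i\<close> stand for either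
    summand; \<open>li\<close> says that \<open>?l\<close> after the injection is the structure of
    \<open>Z\<close> followed by the promoted injection.\<close>
  have step: "DER \<odot> bangu (InjU i) \<odot> t a = unit_vec (In i a) \<and>
      DIG \<odot> bangu (InjU i) \<odot> t a = bangu ?l \<odot> bangu (InjU i) \<odot> t a"
    if Z: "is_pcs Z" and t: "mor Z (bang Z) t" and a: "a \<in> web Z"
      and t_der: "DER \<odot> t a = unit_vec a" and t_dig: "DIG \<odot> t a = bangu t \<odot> t a"
      and i: "mor Z (oplus X Y) (InjU i)" and li: "?l \<circ>\<^sub>m InjU i = bangu (InjU i) \<circ>\<^sub>m t" for Z i t a
  proof -
    note BZ = is_pcs_bang[OF Z]
    have w: "t a \<in> vecs (bweb (web Z))" using mor_row_vecs[OF Z BZ t a] by simp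
    have "DER \<odot> bangu (InjU i) \<odot> t a = (DER \<circ>\<^sub>m bangu (InjU i)) \<odot> t a" by (simp add: mapp_mcomp)
    also have "\<dots> = (InjU i \<circ>\<^sub>m DER) \<odot> t a"
      by (rule mapp_eq_on[OF w], rule bang_mor_eq[OF Z P mor_mcomp[OF mor_bangu[OF Z P i] mor_DER[OF P]]
            mor_mcomp[OF mor_DER[OF Z] i]]) (simp_all add: mapp_mcomp bangu_prom DER_prom)
    also have "\<dots> = unit_vec (In i a)" by (simp add: mapp_mcomp t_der InjU_def)
    finally have 1: "DER \<odot> bangu (InjU i) \<odot> t a = unit_vec (In i a)" .
    have "DIG \<odot> bangu (InjU i) \<odot> t a = (DIG \<circ>\<^sub>m bangu (InjU i)) \<odot> t a" by (simp add: mapp_mcomp)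
    also have "\<dots> = (bangu (bangu (InjU i)) \<circ>\<^sub>m DIG) \<odot> t a"
      by (rule mapp_eq_on[OF w], rule bang_mor_eq[OF Z is_pcs_bang[OF BP] mor_mcomp[OF mor_bangu[OF Z P i] mor_DIG[OF P]]
            mor_mcomp[OF mor_DIG[OF Z] mor_bangu[OF BZ BP mor_bangu[OF Z P i]]]])
        (simp_all add: mapp_mcomp bangu_prom DIG_prom)
    also have "\<dots> = (bangu (bangu (InjU i)) \<circ>\<^sub>m bangu t) \<odot> t a" by (simp add: mapp_mcomp t_dig)
    also have "\<dots> = bangu (bangu (InjU i) \<circ>\<^sub>m t) \<odot> t a"
      by (rule mapp_eq_on[OF w, symmetric]) (rule bangu_mcomp[OF Z BZ BP t mor_bangu[OF Z P i]])
    also have "\<dots> = bangu (?l \<circ>\<^sub>m InjU i) \<odot> t a" by (simp only: li)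
    also have "\<dots> = (bangu ?l \<circ>\<^sub>m bangu (InjU i)) \<odot> t a"
      by (rule mapp_eq_on[OF w]) (rule bangu_mcomp[OF Z P BP i l])
    finally show ?thesis using 1 by (simp add: mapp_mcomp)
  qed
  show ?thesis
    unfolding CD oplus_coalg_eq[OF C[unfolded CD] D[unfolded CD]] is_coalg_iff
  proof (intro conjI ballI allI impI)
    fix c assume c: "c \<notin> web (oplus X Y)"
    show "?l c = (\<lambda>_. 0)"
    proof (cases "\<exists>i a. c = In i a")
      case True
      then obtain i a where "c = In i a" by blast
      then show ?thesis using c h0 k0 by (cases i) (simp_all add: mcomp_row)
    next
      case False
      then show ?thesis by (intro copair_row_0) blast
    qed
  next
    fix c assume "c \<in> web (oplus X Y)"
    then have "c \<in> oweb (web X) (web Y)" by simp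
    then have "DER \<odot> ?l c = unit_vec c \<and> DIG \<odot> ?l c = bangu ?l \<odot> ?l c"
    proof (rule oweb_cases)
      fix a assume a: "c = In Lft a" "a \<in> web X"
      show ?thesis using step[OF X h a(2) h_der[OF a(2)] h_dig[OF a(2)] J(1) lJ(1)]
        by (simp only: a(1) copair_In mcomp_row)
    next
      fix a assume a: "c = In Rgt a" "a \<in> web Y"
      show ?thesis using step[OF Y k a(2) k_der[OF a(2)] k_dig[OF a(2)] J(2) lJ(2)]
        by (simp only: a(1) copair_In mcomp_row)
    qed
    then show "DER \<odot> ?l c = unit_vec c" "DIG \<odot> ?l c = bangu ?l \<odot> ?l c" by blast+
  qed (fact P l)+
qed

section \<open>Substructures and their directed unions\<close>

definition le_pcs :: "pcs \<Rightarrow> pcs \<Rightarrow> bool" where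
  "le_pcs X Y \<longleftrightarrow> web X \<subseteq> web Y \<and> pts X = pts Y \<inter> vecs (web X)"

lemma le_pcsD: "le_pcs X Y \<Longrightarrow> web X \<subseteq> web Y" "le_pcs X Y \<Longrightarrow> u \<in> pts X \<Longrightarrow> u \<in> pts Y"
  by (auto simp: le_pcs_def)

lemma vecs_mono: "I \<subseteq> J \<Longrightarrow> vecs I \<subseteq> vecs J"
  by (auto simp: vecs_def)

lemma rst_vecs_id: "u \<in> vecs J \<Longrightarrow> rst J u = u"
  by (rule rst_id) (simp add: vecs_def)

lemma le_pcs_rst:
  assumes "is_pcs Y" "le_pcs X Y" "u \<in> pts Y"
  shows "rst (web X) u \<in> pts X"
proof -
  have "rst (web X) u \<in> pts Y" by (rule pts_down[OF assms(1,3) rst_le])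
  moreover have "rst (web X) u \<in> vecs (web X)"
    using vecs_rst[OF pts_vecs[OF assms(1,3)] le_pcsD(1)[OF assms(2)]] .
  ultimately show ?thesis using assms(2) by (simp add: le_pcs_def)
qed

lemma le_pcs_refl: "is_pcs X \<Longrightarrow> le_pcs X X"
  using pts_vecs by (auto simp: le_pcs_def)

lemma le_pcs_trans: "le_pcs X Y \<Longrightarrow> le_pcs Y Z \<Longrightarrow> le_pcs X Z"
  using vecs_mono by (auto simp: le_pcs_def)

text \<open>Extension by zero leaves a vector unchanged, and restriction cuts it down to the web of
  \<open>X\<close>. The two morphism conditions therefore say that \<open>X\<close> consists of the
  points of \<open>Y\<close> supported on its web.\<close>

lemma sub_pcs_iff:
  assumes X: "is_pcs X" and Y: "is_pcs Y"
  shows "sub_pcs X Y \<longleftrightarrow> le_pcs X Y"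
proof
  assume s: "sub_pcs X Y"
  then have m: "mor X Y (idm (web X))" "mor Y X (idm (web X))" and w: "web X \<subseteq> web Y"
    unfolding sub_pcs_def Pcoh_iff[OF X Y] Pcoh_iff[OF Y X] by blast+
  have "u \<in> pts X \<longleftrightarrow> u \<in> pts Y \<inter> vecs (web X)" for u
  proof
    assume u: "u \<in> pts X"
    then show "u \<in> pts Y \<inter> vecs (web X)"
      using morD[OF m(1) u] pts_vecs[OF X u] unfolding idm_mapp rst_vecs_id[OF pts_vecs[OF X u]] by blast
  next
    assume u: "u \<in> pts Y \<inter> vecs (web X)"
    then have "rst (web X) u = u" by (intro rst_vecs_id) blast
    then show "u \<in> pts X" using morD[OF m(2), of u] u unfolding idm_mapp by simp
  qed
  then show "le_pcs X Y" unfolding le_pcs_def using w by blast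
next
  assume l: "le_pcs X Y"
  have "mor X Y (idm (web X))"
    unfolding mor_def idm_mapp using rst_vecs_id[OF pts_vecs[OF X]] le_pcsD(2)[OF l] by simp
  moreover have "mor Y X (idm (web X))"
    unfolding mor_def idm_mapp using le_pcs_rst[OF Y l] by blast
  moreover have "idm (web X) a = (\<lambda>_. 0)" if "a \<notin> web X" for a using that by (simp add: idm_def)
  ultimately show "sub_pcs X Y"
    unfolding sub_pcs_def Pcoh_iff[OF X Y] Pcoh_iff[OF Y X] using le_pcsD(1)[OF l] by blast
qed

text \<open>Against a vector supported on \<open>J\<close> only the part of \<open>u\<close> in
  \<open>J\<close> counts. Applied twice, this shows that biorthogonal closure commutes with
  restriction to a smaller web.\<close>

lemma orth_restrict:
  assumes "G \<subseteq> F" "G \<subseteq> vecs J" "J \<subseteq> I" and rst: "\<And>u. u \<in> F \<Longrightarrow> rst J u \<in> G"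
  shows "orth J G = orth I F \<inter> vecs J"
proof -
  have "(\<forall>u\<in>G. pairing u w \<le> 1) \<longleftrightarrow> (\<forall>u\<in>F. pairing u w \<le> 1)" if "w \<in> vecs J" for w
  proof -
    have "pairing u w = pairing (rst J u) w" for u
      unfolding pairing_rst rst_vecs_id[OF that] ..
    then show ?thesis using assms(1) rst by (metis subsetD)
  qed
  then show ?thesis using vecs_mono[OF assms(3)] unfolding orth_def by blast
qed

lemma orth_rst: "w \<in> orth I F \<Longrightarrow> J \<subseteq> I \<Longrightarrow> rst J w \<in> orth I F \<inter> vecs J"
proof -
  assume w: "w \<in> orth I F" and J: "J \<subseteq> I"
  have v: "rst J w \<in> vecs J" using w J by (intro vecs_rst) (auto simp: orth_def)
  have "pairing u (rst J w) \<le> pairing u w" for u by (rule pairing_mono[OF order_refl rst_le])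
  then show ?thesis using w v vecs_mono[OF J] unfolding orth_def by (auto intro: order_trans)
qed

lemma le_gen_pcs:
  assumes "G \<subseteq> F" "G \<subseteq> vecs J" "J \<subseteq> I" "\<And>u. u \<in> F \<Longrightarrow> rst J u \<in> G"
  shows "le_pcs (gen_pcs J G) (gen_pcs I F)"
proof -
  have "orth J G = orth I F \<inter> vecs J" by (rule orth_restrict[OF assms])
  then have "orth J (orth J G) = orth I (orth I F) \<inter> vecs J"
    using orth_rst[OF _ assms(3)] assms(3) by (intro orth_restrict) auto
  then show ?thesis using assms(3) by (simp add: le_pcs_def gen_pcs_def)
qed

text \<open>Duality preserves the direction of this order, because extension and restriction are
  both morphisms and trade places. Function types are thus monotone in their argument type, so
  recursion may pass to the left of an arrow.\<close>

lemma le_dual: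
  assumes "is_pcs Y" "le_pcs X Y"
  shows "le_pcs (dual X) (dual Y)"
proof -
  have "orth (web X) (pts X) = orth (web Y) (pts Y) \<inter> vecs (web X)"
    using assms(2) le_pcs_rst[OF assms] by (intro orth_restrict) (auto simp: le_pcs_def)
  then show ?thesis using le_pcsD(1)[OF assms(2)] by (simp add: le_pcs_def dual_def)
qed

lemma tweb_mono: "I \<subseteq> I' \<Longrightarrow> J \<subseteq> J' \<Longrightarrow> tweb I J \<subseteq> tweb I' J'"
  by (auto simp: tweb_def)

lemma rst_tensv: "rst (tweb I J) (u \<otimes>\<^sub>v v) = rst I u \<otimes>\<^sub>v rst J v"
proof
  fix c show "rst (tweb I J) (u \<otimes>\<^sub>v v) c = (rst I u \<otimes>\<^sub>v rst J v) c"
    by (cases c) (auto simp: rst_def tensv_def tweb_def)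
qed

lemma le_tensor:
  assumes "is_pcs X" "is_pcs X'" "is_pcs Y" "is_pcs Y'" and X: "le_pcs X X'" and Y: "le_pcs Y Y'"
  shows "le_pcs (tensor X Y) (tensor X' Y')"
  unfolding tensor_gen
proof (rule le_gen_pcs)
  show "{u \<otimes>\<^sub>v v |u v. u \<in> pts X \<and> v \<in> pts Y} \<subseteq> {u \<otimes>\<^sub>v v |u v. u \<in> pts X' \<and> v \<in> pts Y'}"
    using le_pcsD(2)[OF X] le_pcsD(2)[OF Y] by blast
  show "{u \<otimes>\<^sub>v v |u v. u \<in> pts X \<and> v \<in> pts Y} \<subseteq> vecs (tweb (web X) (web Y))"
    using tensv_vecs[OF pts_vecs[OF assms(1)] pts_vecs[OF assms(3)]] by blast
  show "tweb (web X) (web Y) \<subseteq> tweb (web X') (web Y')"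
    by (rule tweb_mono[OF le_pcsD(1)[OF X] le_pcsD(1)[OF Y]])
  fix w assume "w \<in> {u \<otimes>\<^sub>v v |u v. u \<in> pts X' \<and> v \<in> pts Y'}"
  then obtain u v where "w = u \<otimes>\<^sub>v v" "u \<in> pts X'" "v \<in> pts Y'" by blast
  then show "rst (tweb (web X) (web Y)) w \<in> {u \<otimes>\<^sub>v v |u v. u \<in> pts X \<and> v \<in> pts Y}"
    using le_pcs_rst[OF assms(2) X] le_pcs_rst[OF assms(4) Y] rst_tensv by blast
qed

lemma le_lolli:
  assumes "is_pcs X" "is_pcs X'" "is_pcs Y" "is_pcs Y'" "le_pcs X X'" "le_pcs Y Y'"
  shows "le_pcs (lolli X Y) (lolli X' Y')"
  unfolding lolli_def using assms by (intro le_dual le_tensor is_pcs_tensor is_pcs_dual)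

lemma bweb_mono: "I \<subseteq> J \<Longrightarrow> bweb I \<subseteq> bweb J"
  by (auto simp: bweb_def)

text \<open>Cutting \<open>u\<close> down to \<open>J\<close> annihilates the monomials with a
  variable outside \<open>J\<close> and leaves the others alone.\<close>

lemma rst_prom: "rst (bweb J) (prom u) = prom (rst J u)"
proof
  fix c
  show "rst (bweb J) (prom u) c = prom (rst J u) c"
  proof (cases "\<exists>b. c = Bag b")
    case True
    then obtain b where c: "c = Bag b" by blast
    show ?thesis
    proof (cases "set_mset b \<subseteq> J")
      case True
      then have "image_mset (rst J u) b = image_mset u b"
        by (intro image_mset_cong) (auto simp: rst_def)
      then show ?thesis using True by (simp add: c) (simp add: rst_def)
    next
      case False
      then obtain a where "a \<in># b" "a \<notin> J" by blast
      then have "(\<Prod>a\<in>#b. rst J u a) = 0" by (intro prod_mset_0_ennreal[of a]) (simp_all add: rst_def)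
      then show ?thesis using False by (simp add: c rst_def[of "bweb J"])
    qed
  next
    case False
    then have "prom v c = 0" for v by (intro prom_eq_0) blast
    then show ?thesis by (simp add: rst_def[of "bweb J"])
  qed
qed

lemma le_bang:
  assumes "is_pcs X" "is_pcs Y" and le: "le_pcs X Y"
  shows "le_pcs (bang X) (bang Y)"
  unfolding bang_gen
proof (rule le_gen_pcs)
  show "{prom u |u. u \<in> pts X} \<subseteq> {prom u |u. u \<in> pts Y}" using le_pcsD(2)[OF le] by blast
  show "{prom u |u. u \<in> pts X} \<subseteq> vecs (bweb (web X))"
    using prom_vecs[OF pts_vecs[OF assms(1)]] by blast
  show "bweb (web X) \<subseteq> bweb (web Y)" by (rule bweb_mono[OF le_pcsD(1)[OF le]])
  fix w assume "w \<in> {prom u |u. u \<in> pts Y}"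
  then show "rst (bweb (web X)) w \<in> {prom u |u. u \<in> pts X}"
    using le_pcs_rst[OF assms(2) le] rst_prom by blast
qed

lemma oweb_mono: "I \<subseteq> I' \<Longrightarrow> J \<subseteq> J' \<Longrightarrow> oweb I J \<subseteq> oweb I' J'"
  by (auto simp: oweb_def)

lemma rst_cotup: "rst (oweb I J) (cotup u v) = cotup (rst I u) (rst J v)"
proof
  fix c show "rst (oweb I J) (cotup u v) c = cotup (rst I u) (rst J v) c"
    by (cases c) (auto simp: rst_def cotup_def oweb_def split: side.splits)
qed

lemma le_oplus:
  assumes X: "is_pcs X" "is_pcs X'" "le_pcs X X'" and Y: "is_pcs Y" "is_pcs Y'" "le_pcs Y Y'"
  shows "le_pcs (oplus X Y) (oplus X' Y')"
proof -
  note dX = le_dual[OF X(2,3)] and dY = le_dual[OF Y(2,3)]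
  have sub: "oweb (web X) (web Y) \<subseteq> oweb (web X') (web Y')"
    by (rule oweb_mono[OF le_pcsD(1)[OF X(3)] le_pcsD(1)[OF Y(3)]])
  have "orth (oweb (web X) (web Y)) (oduals X Y) =
      orth (oweb (web X') (web Y')) (oduals X' Y') \<inter> vecs (oweb (web X) (web Y))"
  proof (rule orth_restrict[OF _ _ sub])
    show "oduals X Y \<subseteq> oduals X' Y'"
      using le_pcsD(2)[OF dX] le_pcsD(2)[OF dY] unfolding oduals_def by blast
    show "oduals X Y \<subseteq> vecs (oweb (web X) (web Y))"
      using covered_oduals[OF X(1) Y(1)] by (simp add: covered_def)
    fix w assume "w \<in> oduals X' Y'"
    then show "rst (oweb (web X) (web Y)) w \<in> oduals X Y"
      using le_pcs_rst[OF is_pcs_dual[OF X(2)] dX] le_pcs_rst[OF is_pcs_dual[OF Y(2)] dY] rst_cotup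
      unfolding oduals_def web_dual by blast
  qed
  then show ?thesis using sub by (simp add: le_pcs_def oplus_orth X Y)
qed

section \<open>The substructure order on coalgebras\<close>

definition le_coalg :: "coalg \<Rightarrow> coalg \<Rightarrow> bool" where
  "le_coalg C D \<longleftrightarrow> le_pcs (fst C) (fst D) \<and> (\<forall>a\<in>web (fst C). snd C a = snd D a)"

lemma le_coalg_web: "le_coalg C D \<Longrightarrow> web (fst C) \<subseteq> web (fst D)"
  by (simp add: le_coalg_def le_pcs_def)

lemma le_coalg_refl: "is_coalg C \<Longrightarrow> le_coalg C C"
  by (simp add: le_coalg_def le_pcs_refl is_coalg_pcs)

lemma le_coalg_trans: "le_coalg C D \<Longrightarrow> le_coalg D E \<Longrightarrow> le_coalg C E"
  unfolding le_coalg_def using le_pcs_trans le_pcsD(1) by (metis subsetD)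

lemma is_coalg_off: "is_coalg C \<Longrightarrow> a \<notin> web (fst C) \<Longrightarrow> snd C a = (\<lambda>_. 0)"
  by (cases C) (simp add: is_coalg_iff)

lemma is_coalg_mor: "is_coalg C \<Longrightarrow> mor (fst C) (bang (fst C)) (snd C)"
  by (cases C) (simp add: is_coalg_iff)

text \<open>A coalgebra structure vanishes off its web, so mutual inclusion yields literal equality,
  as the definite descriptions require.\<close>

lemma le_coalg_antisym:
  assumes C: "is_coalg C" and D: "is_coalg D" and "le_coalg C D" "le_coalg D C"
  shows "C = D"
proof -
  have w: "web (fst C) = web (fst D)"
    using le_coalg_web assms(3,4) by blast
  have "pts (fst C) \<subseteq> pts (fst D)" "pts (fst D) \<subseteq> pts (fst C)"
    using assms(3,4) unfolding le_coalg_def le_pcs_def by blast+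
  then have "fst C = fst D" using w by (intro pcs.equality) auto
  moreover have "snd C = snd D"
  proof
    fix a show "snd C a = snd D a"
      using assms(3) is_coalg_off[OF C] is_coalg_off[OF D] w
      by (cases "a \<in> web (fst C)") (simp_all add: le_coalg_def)
  qed
  ultimately show ?thesis by (rule prod_eqI)
qed

lemma idm_row: "a \<in> I \<Longrightarrow> idm I a = unit_vec a"
  by (auto simp: idm_def unit_vec_def)

lemma bangu_idm:
  assumes X: "is_pcs X" and c: "c \<in> bweb (web X)"
  shows "bangu (idm (web X)) c = IDU c"
proof (rule bang_mor_eq[OF X is_pcs_bang[OF X] _ mor_IDU _ c])
  have idm: "idm (web X) \<odot> u = u" if "u \<in> pts X" for u
    unfolding idm_mapp by (rule rst_vecs_id[OF pts_vecs[OF X that]])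
  show "mor (bang X) (bang X) (bangu (idm (web X)))"
    by (rule mor_bangu[OF X X]) (simp add: mor_def idm)
  show "bangu (idm (web X)) \<odot> prom u = IDU \<odot> prom u" if "u \<in> pts X" for u
    by (simp add: bangu_prom idm that)
qed

text \<open>Promotion sends extension by zero to extension by zero (\<open>bangu_idm\<close>), so
  the square of a coalgebra morphism says that the two structures have the same rows on the smaller
  web.\<close>

lemma sub_coalg_iff:
  assumes C: "is_coalg C" and D: "is_coalg D"
  shows "sub_coalg C D \<longleftrightarrow> le_coalg C D"
proof -
  obtain X h Y k where CD: "C = (X, h)" "D = (Y, k)" by fastforce
  have X: "is_pcs X" and h: "mor X (bang X) h" and h0: "\<And>a. a \<notin> web X \<Longrightarrow> h a = (\<lambda>_. 0)" and Y: "is_pcs Y"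
    using C D by (auto simp: CD is_coalg_iff)
  have "(k \<circ>\<^sub>m idm (web X) = bangm X Y (idm (web X)) \<circ>\<^sub>m h) \<longleftrightarrow> (\<forall>a\<in>web X. h a = k a)"
    if le: "le_pcs X Y"
  proof -
    have id: "mor X Y (idm (web X))"
      unfolding mor_def idm_mapp using rst_vecs_id[OF pts_vecs[OF X]] le_pcsD(2)[OF le] by simp
    have l: "(k \<circ>\<^sub>m idm (web X)) a = (if a \<in> web X then k a else (\<lambda>_. 0))" for a
    proof -
      have "idm (web X) a = (if a \<in> web X then unit_vec a else (\<lambda>_. 0))"
        by (auto simp: idm_def unit_vec_def)
      then show ?thesis by (simp add: mcomp_row)
    qed
    have r: "(bangm X Y (idm (web X)) \<circ>\<^sub>m h) a = h a" for a
    proof (cases "a \<in> web X")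
      case True
      have w: "h a \<in> vecs (bweb (web X))" using mor_row_vecs[OF X is_pcs_bang[OF X] h True] by simp
      have "(bangm X Y (idm (web X)) \<circ>\<^sub>m h) a = idm (bweb (web X)) \<odot> h a"
        unfolding mcomp_row
        by (rule mapp_eq_on[OF w])
          (simp add: bangm_eq[OF X Y id] rowr_row bangu_idm[OF X] idm_row IDU_def)
      then show ?thesis unfolding idm_mapp rst_vecs_id[OF w] .
    qed (simp add: mcomp_row h0)
    show ?thesis
    proof
      assume e: "k \<circ>\<^sub>m idm (web X) = bangm X Y (idm (web X)) \<circ>\<^sub>m h"
      show "\<forall>a\<in>web X. h a = k a"
      proof
        fix a assume "a \<in> web X"
        then show "h a = k a" using fun_cong[OF e, of a] by (simp only: l r if_True)
      qed
    next
      assume e: "\<forall>a\<in>web X. h a = k a"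
      show "k \<circ>\<^sub>m idm (web X) = bangm X Y (idm (web X)) \<circ>\<^sub>m h"
      proof
        fix a show "(k \<circ>\<^sub>m idm (web X)) a = (bangm X Y (idm (web X)) \<circ>\<^sub>m h) a"
          unfolding l r using e h0 by simp
      qed
    qed
  qed
  then show ?thesis
    unfolding sub_coalg_def le_coalg_def CD prod.case fst_conv snd_conv sub_pcs_iff[OF X Y] by blast
qed

lemma le_tensor_coalg:
  assumes "is_coalg C" "is_coalg C'" "is_coalg D" "is_coalg D'" "le_coalg C C'" "le_coalg D D'"
  shows "le_coalg (tensor_coalg C D) (tensor_coalg C' D')"
proof -
  obtain X h X' h' Y k Y' k' where CD: "C = (X, h)" "C' = (X', h')" "D = (Y, k)" "D' = (Y', k')"
    by (metis surj_pair)
  have "le_pcs (tensor X Y) (tensor X' Y')"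
    using assms is_coalg_pcs[OF assms(1)] is_coalg_pcs[OF assms(2)] is_coalg_pcs[OF assms(3)] is_coalg_pcs[OF assms(4)]
    by (intro le_tensor) (simp_all add: CD le_coalg_def)
  moreover have "(MON \<circ>\<^sub>m (h \<otimes>\<^sub>m k)) c = (MON \<circ>\<^sub>m (h' \<otimes>\<^sub>m k')) c" if "c \<in> tweb (web X) (web Y)" for c
    using that assms(5,6) by (auto simp: CD le_coalg_def tweb_def mcomp_row)
  ultimately show ?thesis
    unfolding CD tensor_coalg_eq[OF assms(1,3)[unfolded CD]] tensor_coalg_eq[OF assms(2,4)[unfolded CD]]
    by (simp add: le_coalg_def)
qed

lemma le_oplus_coalg:
  assumes "is_coalg C" "is_coalg C'" "is_coalg D" "is_coalg D'" "le_coalg C C'" "le_coalg D D'"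
  shows "le_coalg (oplus_coalg C D) (oplus_coalg C' D')"
proof -
  obtain X h X' h' Y k Y' k' where CD: "C = (X, h)" "C' = (X', h')" "D = (Y, k)" "D' = (Y', k')"
    by (metis surj_pair)
  have "le_pcs (oplus X Y) (oplus X' Y')"
    using assms is_coalg_pcs[OF assms(1)] is_coalg_pcs[OF assms(2)] is_coalg_pcs[OF assms(3)] is_coalg_pcs[OF assms(4)]
    by (intro le_oplus) (simp_all add: CD le_coalg_def)
  moreover have "copair (bangu (InjU Lft) \<circ>\<^sub>m h) (bangu (InjU Rgt) \<circ>\<^sub>m k) c =
      copair (bangu (InjU Lft) \<circ>\<^sub>m h') (bangu (InjU Rgt) \<circ>\<^sub>m k') c" if "c \<in> oweb (web X) (web Y)" for c
    using that assms(5,6) by (auto simp: CD le_coalg_def oweb_def mcomp_row)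
  ultimately show ?thesis
    unfolding CD oplus_coalg_eq[OF assms(1,3)[unfolded CD]] oplus_coalg_eq[OF assms(2,4)[unfolded CD]]
    by (simp add: le_coalg_def)
qed

lemma le_bang_coalg:
  assumes "is_pcs X" "is_pcs Y" "le_pcs X Y"
  shows "le_coalg (bang_coalg X) (bang_coalg Y)"
  using le_bang[OF assms] bweb_mono[OF le_pcsD(1)[OF assms(3)]]
  by (auto simp: bang_coalg_def le_coalg_def dig_eq rowr_row subset_iff)

section \<open>Unions of chains of coalgebras\<close>

definition lim_coalg :: "(nat \<Rightarrow> coalg) \<Rightarrow> coalg \<Rightarrow> bool" where
  "lim_coalg S L \<longleftrightarrow> (\<forall>n. le_coalg (S n) (S (Suc n))) \<and> (\<forall>n. le_coalg (S n) L) \<and>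
     web (fst L) \<subseteq> (\<Union>n. web (fst (S n)))"

lemma chain_le:
  assumes "\<And>n. is_coalg (S n)" "\<And>n. le_coalg (S n) (S (Suc n))" "n \<le> m"
  shows "le_coalg (S n) (S m)"
  using assms(3)
proof (induction m)
  case 0
  then show ?case using le_coalg_refl[OF assms(1)] by simp
next
  case (Suc m)
  then show ?case
    using le_coalg_trans[OF _ assms(2)] le_coalg_refl[OF assms(1)] by (cases "n = Suc m") auto
qed

lemma SUP_rst_chain:
  fixes W :: "nat \<Rightarrow> pt set"
  assumes "\<And>a. a \<notin> (\<Union>n. W n) \<Longrightarrow> u a = 0"
  shows "(\<lambda>a. SUP n. rst (W n) u a) = u"
proof
  fix a
  show "(SUP n. rst (W n) u a) = u a"
  proof (cases "a \<in> (\<Union>n. W n)")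
    case True
    then obtain n where n: "a \<in> W n" by blast
    show ?thesis
    proof (rule antisym)
      show "(SUP n. rst (W n) u a) \<le> u a" by (rule SUP_least) (simp add: rst_def)
      show "u a \<le> (SUP n. rst (W n) u a)"
        by (rule SUP_upper2[of n]) (use n in \<open>simp_all add: rst_def\<close>)
    qed
  next
    case False
    then have "u a = 0" by (rule assms)
    then have "rst (W n) u a = 0" for n by (simp add: rst_def)
    then show ?thesis using \<open>u a = 0\<close> by (simp add: bot_ennreal)
  qed
qed

text \<open>A vector on the union of the webs is the supremum of its restrictions, and the points of
  \<open>Y\<close> are closed under such suprema.\<close>

lemma pts_via_chain:
  assumes Y: "is_pcs Y" and le: "\<And>n. le_pcs (X n) Y" and inc: "\<And>n. web (X n) \<subseteq> web (X (Suc n))"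
    and u: "u \<in> vecs (\<Union>n. web (X n))"
  shows "u \<in> pts Y \<longleftrightarrow> (\<forall>n. rst (web (X n)) u \<in> pts (X n))"
proof
  assume "u \<in> pts Y"
  then show "\<forall>n. rst (web (X n)) u \<in> pts (X n)" using le_pcs_rst[OF Y le] by blast
next
  assume r: "\<forall>n. rst (web (X n)) u \<in> pts (X n)"
  have "incseq (\<lambda>n. rst (web (X n)) u)"
    using inc by (intro incseq_SucI) (auto simp: rst_def le_fun_def)
  then have "(\<lambda>a. SUP n. rst (web (X n)) u a) \<in> pts Y"
    using r le_pcsD(2)[OF le] by (intro pts_SUP[OF Y]) auto
  moreover have "(\<lambda>a. SUP n. rst (web (X n)) u a) = u"
    using u by (intro SUP_rst_chain) (simp add: vecs_def)
  ultimately show "u \<in> pts Y" by simp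
qed

text \<open>\<open>lim_coalg\<close> asks of \<open>L\<close> that it bounds the chain and that its
  web contains nothing beyond the webs of the stages. This determines the rest: the chain decides
  which vectors are points, and the structure rows are those of the stages.\<close>

lemma lim_coalg_lub:
  assumes S: "\<And>n. is_coalg (S n)" and L: "is_coalg L" and D: "is_coalg D"
    and lim: "lim_coalg S L" and le: "\<And>n. le_coalg (S n) D"
  shows "le_coalg L D"
proof -
  have SL: "\<And>n. le_coalg (S n) L" and SS: "\<And>n. le_coalg (S n) (S (Suc n))"
    and w: "web (fst L) = (\<Union>n. web (fst (S n)))"
    using lim le_coalg_web unfolding lim_coalg_def by blast+
  have char: "u \<in> pts (fst E) \<longleftrightarrow> (\<forall>n. rst (web (fst (S n))) u \<in> pts (fst (S n)))"
    if E: "is_coalg E" "\<And>n. le_coalg (S n) E" and u: "u \<in> vecs (web (fst L))" for E u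
    by (rule pts_via_chain[OF is_coalg_pcs[OF E(1)]])
      (use E(2) le_coalg_web[OF SS] u w in \<open>auto simp: le_coalg_def\<close>)
  have "pts (fst L) = pts (fst D) \<inter> vecs (web (fst L))"
    using char[OF L SL] char[OF D le] pts_vecs[OF is_coalg_pcs[OF L]] by blast
  moreover have "web (fst L) \<subseteq> web (fst D)" using w le_coalg_web[OF le] by blast
  moreover have "snd L a = snd D a" if a: "a \<in> web (fst L)" for a
  proof -
    obtain n where "a \<in> web (fst (S n))" using a w by blast
    then show ?thesis using SL[of n] le[of n] by (simp add: le_coalg_def)
  qed
  ultimately show ?thesis by (simp add: le_coalg_def le_pcs_def)
qed

lemma lim_coalg_unique:
  assumes "\<And>n. is_coalg (S n)" "is_coalg L" "is_coalg L'" "lim_coalg S L" "lim_coalg S L'"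
  shows "L = L'"
proof (rule le_coalg_antisym[OF assms(2,3)])
  show "le_coalg L L'"
    by (rule lim_coalg_lub[OF assms(1-4)]) (use assms(5) in \<open>simp add: lim_coalg_def\<close>)
  show "le_coalg L' L"
    by (rule lim_coalg_lub[OF assms(1,3,2,5)]) (use assms(4) in \<open>simp add: lim_coalg_def\<close>)
qed

text \<open>The union is defined as the orthogonal of all functionals of the stages, which makes
  biorthogonality automatic; a vector is then a point exactly when all its restrictions are.\<close>

lemma lim_coalg_exists:
  assumes S: "\<And>n. is_coalg (S n)" and SS: "\<And>n. le_coalg (S n) (S (Suc n))"
  shows "\<exists>L. is_coalg L \<and> lim_coalg S L"
proof -
  define W where "W = (\<Union>n. web (fst (S n)))"
  define G where "G = (\<Union>n. pts (dual (fst (S n))))"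
  define U where "U = \<lparr>web = W, pts = orth W G\<rparr>"
  \<comment> \<open>The first stage containing \<open>a\<close> is chosen; since the chain is
    increasing, every later stage has the same row.\<close>
  define h where "h a = (if a \<in> W then snd (S (LEAST n. a \<in> web (fst (S n)))) a else (\<lambda>_. 0))" for a
  note P = is_coalg_pcs[OF S]
  note dP = is_pcs_dual[OF P]
  note le = chain_le[of S, OF S SS]
  have rst_S: "rst (web (fst (S m))) u \<in> pts (fst (S m))" if u: "u \<in> pts (fst (S n))" for u n m
  proof (cases "n \<le> m")
    case True
    then have "u \<in> pts (fst (S m))" using le_pcsD(2) u le[OF True] unfolding le_coalg_def by blast
    then show ?thesis by (rule pts_down[OF P _ rst_le])
  next
    case False
    then have "le_pcs (fst (S m)) (fst (S n))" using le[of m n] by (simp add: le_coalg_def)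
    then show ?thesis using le_pcs_rst[OF P _ u] by blast
  qed
  have sub: "web (fst (S n)) \<subseteq> W" for n unfolding W_def by blast
  have "covered W G"
    unfolding covered_def
  proof (intro conjI ballI)
    show "G \<subseteq> vecs W"
    proof
      fix w assume "w \<in> G"
      then obtain n where "w \<in> pts (dual (fst (S n)))" unfolding G_def by blast
      then have "w \<in> vecs (web (fst (S n)))" using pts_vecs[OF dP] by fastforce
      then show "w \<in> vecs W" using vecs_mono[OF sub] by blast
    qed
    fix a assume "a \<in> W"
    then obtain n where n: "a \<in> web (fst (S n))" unfolding W_def by blast
    then obtain w where "w \<in> pts (dual (fst (S n)))" "w a > 0" using pts_pos[OF dP, of a n] by auto
    then show "\<exists>w\<in>G. w a > 0" unfolding G_def by blast
    obtain u where u: "u \<in> pts (fst (S n))" "u a > 0" using pts_pos[OF P n] by blast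
    have "w a \<le> inverse (u a)" if w: "w \<in> G" for w
    proof -
      obtain m where m: "w \<in> pts (dual (fst (S m)))" using w unfolding G_def by blast
      show ?thesis
      proof (cases "a \<in> web (fst (S m))")
        case True
        have "w a * u a = rst (web (fst (S m))) u a * w a" using True by (simp add: rst_def mult.commute)
        also have "\<dots> \<le> pairing (rst (web (fst (S m))) u) w" by (rule mult_le_pairing)
        also have "\<dots> \<le> 1" by (rule dualD[OF m rst_S[OF u(1)]])
        finally show ?thesis using u(2) by (rule ennreal_le_inverse)
      next
        case False
        then have "w a = 0" using pts_support[OF dP m] by simp
        then show ?thesis by simp
      qed
    qed
    moreover have "inverse (u a) < \<infinity>" using u(2) by (simp add: inverse_less_top)
    ultimately show "\<exists>A<\<infinity>. \<forall>w\<in>G. w a \<le> A" by blast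
  qed
  then have U: "is_pcs U" unfolding U_def by (rule is_pcs_orth)
  have webU: "web U = W" by (simp add: U_def)
  have char: "u \<in> pts U \<longleftrightarrow> (\<forall>n. rst (web (fst (S n))) u \<in> pts (fst (S n)))" if u: "u \<in> vecs W" for u
  proof -
    have *: "(\<forall>w\<in>pts (dual (fst (S n))). pairing w u \<le> 1) \<longleftrightarrow> rst (web (fst (S n))) u \<in> pts (fst (S n))" for n
    proof -
      have p: "pairing (rst (web (fst (S n))) u) w = pairing w u" if "w \<in> pts (dual (fst (S n)))" for w
        using rst_vecs_id[OF pts_vecs[OF dP that]] unfolding pairing_rst by (simp add: pairing_commute[of u])
      show ?thesis
      proof
        assume "\<forall>w\<in>pts (dual (fst (S n))). pairing w u \<le> 1"
        then show "rst (web (fst (S n))) u \<in> pts (fst (S n))"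
          using p by (intro ptsI[OF P]) (simp_all add: rst_def[of _ u])
      next
        assume "rst (web (fst (S n))) u \<in> pts (fst (S n))"
        then show "\<forall>w\<in>pts (dual (fst (S n))). pairing w u \<le> 1" using dualD p by metis
      qed
    qed
    have "u \<in> pts U \<longleftrightarrow> (\<forall>n. \<forall>w\<in>pts (dual (fst (S n))). pairing w u \<le> 1)"
      using u unfolding U_def orth_def G_def by auto
    then show ?thesis using * by simp
  qed
  have leU: "le_pcs (fst (S n)) U" for n
    unfolding le_pcs_def webU
  proof (intro conjI sub set_eqI iffI)
    fix u assume u: "u \<in> pts (fst (S n))"
    have v: "u \<in> vecs (web (fst (S n)))" by (rule pts_vecs[OF P u])
    then have "u \<in> vecs W" using vecs_mono[OF sub] by blast
    then show "u \<in> pts U \<inter> vecs (web (fst (S n)))" using char rst_S[OF u] v by blast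
  next
    fix u assume "u \<in> pts U \<inter> vecs (web (fst (S n)))"
    then have u: "u \<in> pts U" and v: "u \<in> vecs (web (fst (S n)))" by auto
    have "u \<in> vecs W" using v vecs_mono[OF sub] by blast
    then have "rst (web (fst (S n))) u \<in> pts (fst (S n))" using char u by blast
    then show "u \<in> pts (fst (S n))" using rst_vecs_id[OF v] by simp
  qed
  have h_row: "h a = snd (S n) a" if a: "a \<in> web (fst (S n))" for a n
  proof -
    let ?m = "LEAST n. a \<in> web (fst (S n))"
    have m: "a \<in> web (fst (S ?m))" "?m \<le> n" using a by (auto intro: LeastI Least_le)
    then have "snd (S ?m) a = snd (S n) a" using le[OF m(2)] by (simp add: le_coalg_def)
    moreover have "a \<in> W" using a unfolding W_def by blast
    ultimately show ?thesis by (simp add: h_def)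
  qed
  note BU = is_pcs_bang[OF U]
  have "mor U (bang U) h"
    unfolding mor_def
  proof
    fix u assume u: "u \<in> pts U"
    \<comment> \<open>Each restriction of \<open>u\<close> lives in a stage, where the structure is
      known to be a morphism; \<open>u\<close> itself is reached by continuity.\<close>
    let ?u = "\<lambda>n. rst (web (fst (S n))) u"
    have inc: "incseq ?u"
      using le_coalg_web[OF SS] by (intro incseq_SucI) (auto simp: rst_def le_fun_def)
    have "(\<lambda>a. SUP n. ?u n a) = u"
      using pts_support[OF U u] by (intro SUP_rst_chain) (simp add: webU W_def)
    then have "h \<odot> u = (\<lambda>b. SUP n. (h \<odot> ?u n) b)" using mapp_SUP_right[OF inc, of h] by simp
    moreover have "h \<odot> ?u n \<in> pts (bang U)" for n
    proof -
      have un: "?u n \<in> pts (fst (S n))" by (rule le_pcs_rst[OF U leU u])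
      have "h \<odot> ?u n = snd (S n) \<odot> ?u n" by (rule mapp_eq_on[OF pts_vecs[OF P un] h_row])
      also have "\<dots> \<in> pts (bang (fst (S n)))" by (rule morD[OF is_coalg_mor[OF S] un])
      finally show ?thesis by (rule le_pcsD(2)[OF le_bang[OF P U leU]])
    qed
    moreover have "incseq (\<lambda>n. h \<odot> ?u n)"
      using inc unfolding incseq_def by (blast intro: mapp_mono)
    ultimately show "h \<odot> u \<in> pts (bang U)" using pts_SUP[OF BU] by simp
  qed
  moreover have "DER \<odot> h a = unit_vec a \<and> DIG \<odot> h a = bangu h \<odot> h a" if aW: "a \<in> W" for a
  proof -
    obtain n where n: "a \<in> web (fst (S n))" using aW unfolding W_def by blast
    have c: "is_coalg (fst (S n), snd (S n))" using S by simp
    then have "DER \<odot> snd (S n) a = unit_vec a" "DIG \<odot> snd (S n) a = bangu (snd (S n)) \<odot> snd (S n) a"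
      using n unfolding is_coalg_iff by blast+
    \<comment> \<open>The row of \<open>a\<close> is supported on bags over the web of the stage,
      where \<open>bangu h\<close> agrees with the promoted structure of the stage.\<close>
    moreover have "bangu (snd (S n)) \<odot> snd (S n) a = bangu h \<odot> snd (S n) a"
    proof (rule mapp_eq_on)
      show "snd (S n) a \<in> vecs (bweb (web (fst (S n))))"
        using mor_row_vecs[OF P is_pcs_bang[OF P] is_coalg_mor[OF S] n] by simp
      fix c assume "c \<in> bweb (web (fst (S n)))"
      then obtain b where b: "c = Bag b" "set_mset b \<subseteq> web (fst (S n))" by (auto simp: bweb_def)
      show "bangu (snd (S n)) c = bangu h c"
        unfolding b(1) by (rule bangu_row_cong) (use b(2) h_row in auto)
    qed
    ultimately show ?thesis using h_row[OF n] by simp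
  qed
  ultimately have "is_coalg (U, h)"
    unfolding is_coalg_iff using U webU by (simp add: h_def)
  moreover have "lim_coalg S (U, h)"
    unfolding lim_coalg_def le_coalg_def[of _ "(U, h)"] using SS leU h_row webU by (simp add: W_def)
  ultimately show ?thesis by blast
qed

section \<open>Least fixpoints and the interpretation of types\<close>

text \<open>The bottom of the substructure order and the start of all iterations.\<close>

definition zero_coalg :: coalg where
  "zero_coalg = (\<lparr>web = {}, pts = {\<lambda>_. 0}\<rparr>, \<lambda>_ _. 0)"

lemma vecs_empty: "vecs {} = {\<lambda>_. 0}"
  by (auto simp: vecs_def)

lemma is_coalg_zero: "is_coalg zero_coalg"
proof -
  have "orth {} F = {\<lambda>_. 0}" for F
    by (auto simp: orth_def vecs_empty pairing_def)
  then have "is_pcs \<lparr>web = {}, pts = {\<lambda>_. 0}\<rparr>"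
    by (simp add: is_pcs_iff covered_def vecs_empty)
  then show ?thesis
    unfolding zero_coalg_def is_coalg_iff by (simp add: mor_def pts_zero is_pcs_bang)
qed

lemma web_zero_coalg [simp]: "web (fst zero_coalg) = {}"
  by (simp add: zero_coalg_def)

lemma le_zero_coalg: "is_coalg C \<Longrightarrow> le_coalg zero_coalg C"
  using pts_zero[OF is_coalg_pcs] by (auto simp: le_coalg_def le_pcs_def zero_coalg_def vecs_empty)

lemma lim_coalgD:
  assumes "lim_coalg S L"
  shows "le_coalg (S n) (S (Suc n))" "le_coalg (S n) L" "a \<in> web (fst L) \<Longrightarrow> \<exists>n. a \<in> web (fst (S n))"
  using assms unfolding lim_coalg_def by auto

lemma lim_coalg_Suc:
  assumes "lim_coalg S L"
  shows "lim_coalg (\<lambda>n. S (Suc n)) L"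
proof -
  have "web (fst (S n)) \<subseteq> web (fst (S (Suc n)))" for n
    using assms le_coalg_web unfolding lim_coalg_def by blast
  then show ?thesis using assms unfolding lim_coalg_def by blast
qed

text \<open>Kleene iteration. Continuity is asked for webs: by monotonicity \<open>F L\<close>
  bounds the image of the chain, and a bound with no larger web is already its limit. Leastness
  among all coalgebras fixed by \<open>F\<close> then resolves the description in
  \<open>lfp_coalg\<close>.\<close>

lemma lfp_coalg_props:
  assumes F: "\<And>C. is_coalg C \<Longrightarrow> is_coalg (F C)"
    and mono: "\<And>C D. is_coalg C \<Longrightarrow> is_coalg D \<Longrightarrow> le_coalg C D \<Longrightarrow> le_coalg (F C) (F D)"
    and cont: "\<And>S L. (\<And>n. is_coalg (S n)) \<Longrightarrow> is_coalg L \<Longrightarrow> lim_coalg S L \<Longrightarrow>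
      web (fst (F L)) \<subseteq> (\<Union>n. web (fst (F (S n))))"
  shows "is_coalg (lfp_coalg F)" "F (lfp_coalg F) = lfp_coalg F"
    "lim_coalg (\<lambda>n. (F ^^ n) zero_coalg) (lfp_coalg F)"
proof -
  let ?S = "\<lambda>n. (F ^^ n) zero_coalg"
  have S: "is_coalg (?S n)" for n by (induction n) (simp_all add: is_coalg_zero F)
  have SS: "le_coalg (?S n) (?S (Suc n))" for n
  proof (induction n)
    case 0
    show ?case using le_zero_coalg[OF F[OF is_coalg_zero]] by simp
  next
    case (Suc n)
    then show ?case using mono[OF S[of n] S[of "Suc n"]] by simp
  qed
  obtain L where L: "is_coalg L" "lim_coalg ?S L" using lim_coalg_exists[of ?S, OF S SS] by blast
  have SL: "le_coalg (?S n) L" for n using L(2) by (simp add: lim_coalg_def)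
  have FS: "is_coalg (F (?S n))" for n using F[OF S] .
  have "lim_coalg (\<lambda>n. F (?S n)) (F L)"
    unfolding lim_coalg_def
  proof (intro conjI allI)
    show "le_coalg (F (?S n)) (F (?S (Suc n)))" for n by (rule mono[OF S S SS])
    show "le_coalg (F (?S n)) (F L)" for n by (rule mono[OF S L(1) SL])
    show "web (fst (F L)) \<subseteq> (\<Union>n. web (fst (F (?S n))))" by (rule cont[OF S L])
  qed
  moreover have "lim_coalg (\<lambda>n. F (?S n)) L" using lim_coalg_Suc[OF L(2)] by simp
  \<comment> \<open>\<open>F L\<close> and \<open>L\<close> are both limits of the chain without its
    first member.\<close>
  ultimately have FL: "F L = L" by (rule lim_coalg_unique[of "\<lambda>n. F (?S n)", OF FS F[OF L(1)] L(1)])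
  have least: "le_coalg L D" if D: "is_coalg D" "F D = D" for D
  proof (rule lim_coalg_lub[of ?S, OF S L(1) D(1) L(2)])
    fix n show "le_coalg (?S n) D"
    proof (induction n)
      case 0
      show ?case using le_zero_coalg[OF D(1)] by simp
    next
      case (Suc n)
      then show ?case using mono[OF S D(1), of n] D(2) by simp
    qed
  qed
  have "lfp_coalg F = L"
    unfolding lfp_coalg_def
  proof (rule the_equality)
    show "is_coalg L \<and> F L = L \<and> (\<forall>D. is_coalg D \<and> F D = D \<longrightarrow> sub_coalg L D)"
      using L(1) FL least sub_coalg_iff by blast
    fix C assume C: "is_coalg C \<and> F C = C \<and> (\<forall>D. is_coalg D \<and> F D = D \<longrightarrow> sub_coalg C D)"
    then have "le_coalg C L" using L(1) FL sub_coalg_iff by blast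
    moreover have "le_coalg L C" using C least by blast
    ultimately show "C = L" using C L(1) le_coalg_antisym by blast
  qed
  then show "is_coalg (lfp_coalg F)" "F (lfp_coalg F) = lfp_coalg F" "lim_coalg ?S (lfp_coalg F)"
    using L FL by simp_all
qed

section \<open>Continuity of the type constructors\<close>

definition cont_coalg :: "((nat \<Rightarrow> coalg) \<Rightarrow> coalg) \<Rightarrow> bool" where
  "cont_coalg F \<longleftrightarrow>
     (\<forall>\<rho>. (\<forall>i. is_coalg (\<rho> i)) \<longrightarrow> is_coalg (F \<rho>)) \<and>
     (\<forall>\<rho> \<rho>'. (\<forall>i. is_coalg (\<rho> i)) \<longrightarrow> (\<forall>i. is_coalg (\<rho>' i)) \<longrightarrow> (\<forall>i. le_coalg (\<rho> i) (\<rho>' i)) \<longrightarrow>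
        le_coalg (F \<rho>) (F \<rho>')) \<and>
     (\<forall>R \<rho>. (\<forall>n i. is_coalg (R n i)) \<longrightarrow> (\<forall>i. is_coalg (\<rho> i)) \<longrightarrow> (\<forall>i. lim_coalg (\<lambda>n. R n i) (\<rho> i)) \<longrightarrow>
        web (fst (F \<rho>)) \<subseteq> (\<Union>n. web (fst (F (R n)))))"

definition cont_pcs :: "((nat \<Rightarrow> coalg) \<Rightarrow> pcs) \<Rightarrow> bool" where
  "cont_pcs F \<longleftrightarrow>
     (\<forall>\<rho>. (\<forall>i. is_coalg (\<rho> i)) \<longrightarrow> is_pcs (F \<rho>)) \<and>
     (\<forall>\<rho> \<rho>'. (\<forall>i. is_coalg (\<rho> i)) \<longrightarrow> (\<forall>i. is_coalg (\<rho>' i)) \<longrightarrow> (\<forall>i. le_coalg (\<rho> i) (\<rho>' i)) \<longrightarrow>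
        le_pcs (F \<rho>) (F \<rho>')) \<and>
     (\<forall>R \<rho>. (\<forall>n i. is_coalg (R n i)) \<longrightarrow> (\<forall>i. is_coalg (\<rho> i)) \<longrightarrow> (\<forall>i. lim_coalg (\<lambda>n. R n i) (\<rho> i)) \<longrightarrow>
        web (F \<rho>) \<subseteq> (\<Union>n. web (F (R n))))"

lemma cont_coalgD:
  assumes "cont_coalg F"
  shows "(\<And>i. is_coalg (\<rho> i)) \<Longrightarrow> is_coalg (F \<rho>)"
    and "(\<And>i. is_coalg (\<rho> i)) \<Longrightarrow> (\<And>i. is_coalg (\<rho>' i)) \<Longrightarrow> (\<And>i. le_coalg (\<rho> i) (\<rho>' i)) \<Longrightarrow> le_coalg (F \<rho>) (F \<rho>')"
    and "(\<And>n i. is_coalg (R n i)) \<Longrightarrow> (\<And>i. is_coalg (\<rho> i)) \<Longrightarrow> (\<And>i. lim_coalg (\<lambda>n. R n i) (\<rho> i)) \<Longrightarrow>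
        web (fst (F \<rho>)) \<subseteq> (\<Union>n. web (fst (F (R n))))"
  using assms unfolding cont_coalg_def by simp_all

lemma cont_pcsD:
  assumes "cont_pcs F"
  shows "(\<And>i. is_coalg (\<rho> i)) \<Longrightarrow> is_pcs (F \<rho>)"
    and "(\<And>i. is_coalg (\<rho> i)) \<Longrightarrow> (\<And>i. is_coalg (\<rho>' i)) \<Longrightarrow> (\<And>i. le_coalg (\<rho> i) (\<rho>' i)) \<Longrightarrow> le_pcs (F \<rho>) (F \<rho>')"
    and "(\<And>n i. is_coalg (R n i)) \<Longrightarrow> (\<And>i. is_coalg (\<rho> i)) \<Longrightarrow> (\<And>i. lim_coalg (\<lambda>n. R n i) (\<rho> i)) \<Longrightarrow>
        web (F \<rho>) \<subseteq> (\<Union>n. web (F (R n)))"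
  using assms unfolding cont_pcs_def by simp_all

lemma cont_coalgI:
  assumes "\<And>\<rho>. (\<And>i. is_coalg (\<rho> i)) \<Longrightarrow> is_coalg (F \<rho>)"
    and "\<And>\<rho> \<rho>'. (\<And>i. is_coalg (\<rho> i)) \<Longrightarrow> (\<And>i. is_coalg (\<rho>' i)) \<Longrightarrow> (\<And>i. le_coalg (\<rho> i) (\<rho>' i)) \<Longrightarrow> le_coalg (F \<rho>) (F \<rho>')"
    and "\<And>R \<rho>. (\<And>n i. is_coalg (R n i)) \<Longrightarrow> (\<And>i. is_coalg (\<rho> i)) \<Longrightarrow> (\<And>i. lim_coalg (\<lambda>n. R n i) (\<rho> i)) \<Longrightarrow>
        web (fst (F \<rho>)) \<subseteq> (\<Union>n. web (fst (F (R n))))"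
  shows "cont_coalg F"
  unfolding cont_coalg_def by (intro conjI allI impI; (rule assms(1) | rule assms(2) | rule assms(3)); simp)

lemma cont_pcsI:
  assumes "\<And>\<rho>. (\<And>i. is_coalg (\<rho> i)) \<Longrightarrow> is_pcs (F \<rho>)"
    and "\<And>\<rho> \<rho>'. (\<And>i. is_coalg (\<rho> i)) \<Longrightarrow> (\<And>i. is_coalg (\<rho>' i)) \<Longrightarrow> (\<And>i. le_coalg (\<rho> i) (\<rho>' i)) \<Longrightarrow> le_pcs (F \<rho>) (F \<rho>')"
    and "\<And>R \<rho>. (\<And>n i. is_coalg (R n i)) \<Longrightarrow> (\<And>i. is_coalg (\<rho> i)) \<Longrightarrow> (\<And>i. lim_coalg (\<lambda>n. R n i) (\<rho> i)) \<Longrightarrow>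
        web (F \<rho>) \<subseteq> (\<Union>n. web (F (R n)))"
  shows "cont_pcs F"
  unfolding cont_pcs_def by (intro conjI allI impI; (rule assms(1) | rule assms(2) | rule assms(3)); simp)

lemma cont_web_mono:
  assumes "cont_coalg F" "\<And>n i. is_coalg (R n i)" "\<And>i. lim_coalg (\<lambda>n. R n i) (\<rho> i)" "n \<le> m"
  shows "web (fst (F (R n))) \<subseteq> web (fst (F (R m)))"
proof (rule lift_Suc_mono_le[of "\<lambda>n. web (fst (F (R n)))", OF _ assms(4)])
  fix n
  have "le_coalg (R n i) (R (Suc n) i)" for i using assms(3)[of i] by (simp add: lim_coalg_def)
  then have "le_coalg (F (R n)) (F (R (Suc n)))"
    by (intro cont_coalgD(2)[OF assms(1)] assms(2))
  then show "web (fst (F (R n))) \<subseteq> web (fst (F (R (Suc n))))" by (rule le_coalg_web)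
qed

lemma cont_pcs_web_mono:
  assumes "cont_pcs F" "\<And>n i. is_coalg (R n i)" "\<And>i. lim_coalg (\<lambda>n. R n i) (\<rho> i)" "n \<le> m"
  shows "web (F (R n)) \<subseteq> web (F (R m))"
proof (rule lift_Suc_mono_le[of "\<lambda>n. web (F (R n))", OF _ assms(4)])
  fix n
  have "le_coalg (R n i) (R (Suc n) i)" for i using assms(3)[of i] by (simp add: lim_coalg_def)
  then have "le_pcs (F (R n)) (F (R (Suc n)))"
    by (intro cont_pcsD(2)[OF assms(1)] assms(2))
  then show "web (F (R n)) \<subseteq> web (F (R (Suc n)))" by (rule le_pcsD(1))
qed

lemma tweb_UN:
  assumes "\<And>n m::nat. n \<le> m \<Longrightarrow> W n \<subseteq> W m" "\<And>n m. n \<le> m \<Longrightarrow> V n \<subseteq> V m"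
    and "I \<subseteq> (\<Union>n. W n)" "J \<subseteq> (\<Union>n. V n)"
  shows "tweb I J \<subseteq> (\<Union>n. tweb (W n) (V n))"
proof
  fix c assume "c \<in> tweb I J"
  then obtain a b where c: "c = Pair a b" "a \<in> I" "b \<in> J" by (auto simp: tweb_def)
  then obtain n m where "a \<in> W n" "b \<in> V m" using assms(3,4) by blast
  then have "a \<in> W (max n m)" "b \<in> V (max n m)"
    using assms(1)[of n "max n m"] assms(2)[of m "max n m"] by auto
  then show "c \<in> (\<Union>n. tweb (W n) (V n))" using c(1) by auto
qed

text \<open>A bag is finite, so some stage contains all its elements; this finiteness makes
  \<open>!\<close> continuous.\<close>

lemma bweb_UN:
  assumes "\<And>n m::nat. n \<le> m \<Longrightarrow> W n \<subseteq> W m" and "I \<subseteq> (\<Union>n. W n)"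
  shows "bweb I \<subseteq> (\<Union>n. bweb (W n))"
proof
  fix c assume "c \<in> bweb I"
  then obtain b where b: "c = Bag b" "set_mset b \<subseteq> I" by (auto simp: bweb_def)
  have "\<exists>n. set_mset b \<subseteq> W n" using b(2)
  proof (induction b)
    case (add x b)
    then obtain n m where nm: "set_mset b \<subseteq> W n" "x \<in> W m" using assms(2) by auto
    have "set_mset (add_mset x b) \<subseteq> W (max n m)"
      using nm assms(1)[of n "max n m"] assms(1)[of m "max n m"] by auto
    then show ?case by blast
  qed simp
  then show "c \<in> (\<Union>n. bweb (W n))" using b(1) by auto
qed

lemma oweb_UN:
  assumes "I \<subseteq> (\<Union>n. W n)" "J \<subseteq> (\<Union>n. V n)"
  shows "oweb I J \<subseteq> (\<Union>n. oweb (W n) (V n))"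
proof
  fix c assume "c \<in> oweb I J"
  then show "c \<in> (\<Union>n. oweb (W n) (V n))"
  proof (rule oweb_cases)
    fix a assume a: "c = In Lft a" "a \<in> I"
    then obtain n where "a \<in> W n" using assms(1) by auto
    then show ?thesis using a(1) by auto
  next
    fix a assume a: "c = In Rgt a" "a \<in> J"
    then obtain n where "a \<in> V n" using assms(2) by auto
    then show ?thesis using a(1) by auto
  qed
qed

lemma web_bang_coalg [simp]: "fst (bang_coalg X) = bang X"
  by (simp add: bang_coalg_def)

lemma fst_tensor_coalg [simp]: "fst (tensor_coalg C D) = tensor (fst C) (fst D)"
  by (simp add: tensor_coalg_def case_prod_beta)

lemma fst_oplus_coalg [simp]: "fst (oplus_coalg C D) = oplus (fst C) (fst D)"
  by (simp add: oplus_coalg_def case_prod_beta)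

lemma cont_one: "cont_coalg (\<lambda>_. one_coalg)"
  by (rule cont_coalgI) (simp_all add: is_coalg_one le_coalg_refl)

lemma cont_var: "cont_coalg (\<lambda>\<rho>. \<rho> i)"
proof (rule cont_coalgI)
  fix R and \<rho> :: "nat \<Rightarrow> coalg" assume "\<And>i. lim_coalg (\<lambda>n. R n i) (\<rho> i)"
  then show "web (fst (\<rho> i)) \<subseteq> (\<Union>n. web (fst (R n i)))" unfolding lim_coalg_def by blast
qed blast+

lemma cont_fst:
  assumes "cont_coalg F"
  shows "cont_pcs (\<lambda>\<rho>. fst (F \<rho>))"
proof (rule cont_pcsI)
  show "is_pcs (fst (F \<rho>))" if "\<And>i. is_coalg (\<rho> i)" for \<rho>
    by (rule is_coalg_pcs[OF cont_coalgD(1)[OF assms that]])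
  show "le_pcs (fst (F \<rho>)) (fst (F \<rho>'))"
    if "\<And>i. is_coalg (\<rho> i)" "\<And>i. is_coalg (\<rho>' i)" "\<And>i. le_coalg (\<rho> i) (\<rho>' i)" for \<rho> \<rho>'
    using cont_coalgD(2)[OF assms that] by (simp add: le_coalg_def)
qed (rule cont_coalgD(3)[OF assms])

lemma cont_bang:
  assumes F: "cont_pcs F"
  shows "cont_coalg (\<lambda>\<rho>. bang_coalg (F \<rho>))"
proof (rule cont_coalgI)
  show "is_coalg (bang_coalg (F \<rho>))" if "\<And>i. is_coalg (\<rho> i)" for \<rho>
    by (rule is_coalg_bang[OF cont_pcsD(1)[OF F that]])
  show "le_coalg (bang_coalg (F \<rho>)) (bang_coalg (F \<rho>'))"
    if "\<And>i. is_coalg (\<rho> i)" "\<And>i. is_coalg (\<rho>' i)" "\<And>i. le_coalg (\<rho> i) (\<rho>' i)" for \<rho> \<rho>'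
    by (rule le_bang_coalg[OF cont_pcsD(1)[OF F that(1)] cont_pcsD(1)[OF F that(2)] cont_pcsD(2)[OF F that]])
  fix R and \<rho> :: "nat \<Rightarrow> coalg"
  assume R: "\<And>n i. is_coalg (R n i)" "\<And>i. is_coalg (\<rho> i)" "\<And>i. lim_coalg (\<lambda>n. R n i) (\<rho> i)"
  show "web (fst (bang_coalg (F \<rho>))) \<subseteq> (\<Union>n. web (fst (bang_coalg (F (R n)))))"
    using bweb_UN[OF cont_pcs_web_mono[OF F R(1,3)] cont_pcsD(3)[OF F R]] by simp
qed

lemma cont_tensor:
  assumes F: "cont_coalg F" and G: "cont_coalg G"
  shows "cont_coalg (\<lambda>\<rho>. tensor_coalg (F \<rho>) (G \<rho>))"
proof (rule cont_coalgI)
  show "is_coalg (tensor_coalg (F \<rho>) (G \<rho>))" if "\<And>i. is_coalg (\<rho> i)" for \<rho>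
    by (rule is_coalg_tensor[OF cont_coalgD(1)[OF F that] cont_coalgD(1)[OF G that]])
  show "le_coalg (tensor_coalg (F \<rho>) (G \<rho>)) (tensor_coalg (F \<rho>') (G \<rho>'))"
    if r: "\<And>i. is_coalg (\<rho> i)" "\<And>i. is_coalg (\<rho>' i)" "\<And>i. le_coalg (\<rho> i) (\<rho>' i)" for \<rho> \<rho>'
    by (rule le_tensor_coalg[OF cont_coalgD(1)[OF F r(1)] cont_coalgD(1)[OF F r(2)]
        cont_coalgD(1)[OF G r(1)] cont_coalgD(1)[OF G r(2)] cont_coalgD(2)[OF F r] cont_coalgD(2)[OF G r]])
  fix R and \<rho> :: "nat \<Rightarrow> coalg"
  assume R: "\<And>n i. is_coalg (R n i)" "\<And>i. is_coalg (\<rho> i)" "\<And>i. lim_coalg (\<lambda>n. R n i) (\<rho> i)"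
  show "web (fst (tensor_coalg (F \<rho>) (G \<rho>))) \<subseteq> (\<Union>n. web (fst (tensor_coalg (F (R n)) (G (R n)))))"
    using tweb_UN[OF cont_web_mono[OF F R(1,3)] cont_web_mono[OF G R(1,3)]
        cont_coalgD(3)[OF F R] cont_coalgD(3)[OF G R]] by simp
qed

lemma cont_oplus:
  assumes F: "cont_coalg F" and G: "cont_coalg G"
  shows "cont_coalg (\<lambda>\<rho>. oplus_coalg (F \<rho>) (G \<rho>))"
proof (rule cont_coalgI)
  show "is_coalg (oplus_coalg (F \<rho>) (G \<rho>))" if "\<And>i. is_coalg (\<rho> i)" for \<rho>
    by (rule is_coalg_oplus[OF cont_coalgD(1)[OF F that] cont_coalgD(1)[OF G that]])
  show "le_coalg (oplus_coalg (F \<rho>) (G \<rho>)) (oplus_coalg (F \<rho>') (G \<rho>'))"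
    if r: "\<And>i. is_coalg (\<rho> i)" "\<And>i. is_coalg (\<rho>' i)" "\<And>i. le_coalg (\<rho> i) (\<rho>' i)" for \<rho> \<rho>'
    by (rule le_oplus_coalg[OF cont_coalgD(1)[OF F r(1)] cont_coalgD(1)[OF F r(2)]
        cont_coalgD(1)[OF G r(1)] cont_coalgD(1)[OF G r(2)] cont_coalgD(2)[OF F r] cont_coalgD(2)[OF G r]])
  fix R and \<rho> :: "nat \<Rightarrow> coalg"
  assume R: "\<And>n i. is_coalg (R n i)" "\<And>i. is_coalg (\<rho> i)" "\<And>i. lim_coalg (\<lambda>n. R n i) (\<rho> i)"
  show "web (fst (oplus_coalg (F \<rho>) (G \<rho>))) \<subseteq> (\<Union>n. web (fst (oplus_coalg (F (R n)) (G (R n)))))"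
    using oweb_UN[OF cont_coalgD(3)[OF F R] cont_coalgD(3)[OF G R]] by simp
qed

lemma cont_lolli:
  assumes F: "cont_coalg F" and G: "cont_pcs G"
  shows "cont_pcs (\<lambda>\<rho>. lolli (fst (F \<rho>)) (G \<rho>))"
proof (rule cont_pcsI)
  note F' = cont_fst[OF F]
  show "is_pcs (lolli (fst (F \<rho>)) (G \<rho>))" if "\<And>i. is_coalg (\<rho> i)" for \<rho>
    by (rule is_pcs_lolli[OF cont_pcsD(1)[OF F' that] cont_pcsD(1)[OF G that]])
  show "le_pcs (lolli (fst (F \<rho>)) (G \<rho>)) (lolli (fst (F \<rho>')) (G \<rho>'))"
    if r: "\<And>i. is_coalg (\<rho> i)" "\<And>i. is_coalg (\<rho>' i)" "\<And>i. le_coalg (\<rho> i) (\<rho>' i)" for \<rho> \<rho>'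
    by (rule le_lolli[OF cont_pcsD(1)[OF F' r(1)] cont_pcsD(1)[OF F' r(2)]
        cont_pcsD(1)[OF G r(1)] cont_pcsD(1)[OF G r(2)] cont_pcsD(2)[OF F' r] cont_pcsD(2)[OF G r]])
  fix R and \<rho> :: "nat \<Rightarrow> coalg"
  assume R: "\<And>n i. is_coalg (R n i)" "\<And>i. is_coalg (\<rho> i)" "\<And>i. lim_coalg (\<lambda>n. R n i) (\<rho> i)"
  show "web (lolli (fst (F \<rho>)) (G \<rho>)) \<subseteq> (\<Union>n. web (lolli (fst (F (R n))) (G (R n))))"
    using tweb_UN[OF cont_web_mono[OF F R(1,3)] cont_pcs_web_mono[OF G R(1,3)]
        cont_coalgD(3)[OF F R] cont_pcsD(3)[OF G R]] by simp
qed

lemma is_coalg_case_nat: "is_coalg C \<Longrightarrow> (\<And>i. is_coalg (\<rho> i)) \<Longrightarrow> is_coalg (case_nat C \<rho> i)"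
  by (cases i) simp_all

lemma le_coalg_case_nat:
  "le_coalg C D \<Longrightarrow> (\<And>i. le_coalg (\<rho> i) (\<rho>' i)) \<Longrightarrow> le_coalg (case_nat C \<rho> i) (case_nat D \<rho>' i)"
  by (cases i) simp_all

lemma lim_case_nat:
  assumes "lim_coalg S L" "\<And>i. lim_coalg (\<lambda>n. R n i) (\<rho> i)"
  shows "lim_coalg (\<lambda>n. case_nat (S n) (R n) i) (case_nat L \<rho> i)"
  using assms(1) assms(2)[of "i - 1"] by (cases i) simp_all

lemma lim_const: "is_coalg C \<Longrightarrow> lim_coalg (\<lambda>_. C) C"
  by (simp add: lim_coalg_def le_coalg_refl)

lemma cont_mu_props:
  assumes F: "cont_coalg F" and \<rho>: "\<And>i. is_coalg (\<rho> i)"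
  defines "G \<equiv> \<lambda>C. F (case_nat C \<rho>)"
  shows "is_coalg (lfp_coalg G)" "G (lfp_coalg G) = lfp_coalg G"
    "lim_coalg (\<lambda>n. (G ^^ n) zero_coalg) (lfp_coalg G)"
proof -
  have 1: "is_coalg (G C)" if "is_coalg C" for C
    unfolding G_def by (intro cont_coalgD(1)[OF F] is_coalg_case_nat that \<rho>)
  have 2: "le_coalg (G C) (G D)" if "is_coalg C" "is_coalg D" "le_coalg C D" for C D
    unfolding G_def
    by (intro cont_coalgD(2)[OF F] is_coalg_case_nat le_coalg_case_nat le_coalg_refl that \<rho>)
  have 3: "web (fst (G L)) \<subseteq> (\<Union>n. web (fst (G (S n))))"
    if "\<And>n. is_coalg (S n)" "is_coalg L" "lim_coalg S L" for S L
    unfolding G_def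
  proof (rule cont_coalgD(3)[OF F])
    show "lim_coalg (\<lambda>n. case_nat (S n) \<rho> i) (case_nat L \<rho> i)" for i
      using that(3) lim_const[OF \<rho>] by (cases i) simp_all
  qed (intro is_coalg_case_nat that \<rho>)+
  show "is_coalg (lfp_coalg G)" "G (lfp_coalg G) = lfp_coalg G"
    "lim_coalg (\<lambda>n. (G ^^ n) zero_coalg) (lfp_coalg G)"
    using lfp_coalg_props[of G, OF 1 2 3] by blast+
qed

lemma cont_iterates:
  assumes "cont_coalg F" "\<And>i. is_coalg (\<rho> i)"
  shows "is_coalg (((\<lambda>C. F (case_nat C \<rho>)) ^^ n) zero_coalg)"
proof (induction n)
  case (Suc n)
  then show ?case using cont_coalgD(1)[OF assms(1) is_coalg_case_nat[OF Suc assms(2)]] by simp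
qed (simp add: is_coalg_zero)

lemma cont_iterates_mono:
  assumes F: "cont_coalg F" and r: "\<And>i. is_coalg (\<rho> i)" "\<And>i. is_coalg (\<rho>' i)" "\<And>i. le_coalg (\<rho> i) (\<rho>' i)"
  shows "le_coalg (((\<lambda>C. F (case_nat C \<rho>)) ^^ n) zero_coalg) (((\<lambda>C. F (case_nat C \<rho>')) ^^ n) zero_coalg)"
proof (induction n)
  case (Suc n)
  have "le_coalg (F (case_nat (((\<lambda>C. F (case_nat C \<rho>)) ^^ n) zero_coalg) \<rho>))
      (F (case_nat (((\<lambda>C. F (case_nat C \<rho>')) ^^ n) zero_coalg) \<rho>'))"
    by (intro cont_coalgD(2)[OF F] is_coalg_case_nat le_coalg_case_nat cont_iterates[OF F] Suc r)
  then show ?case by simp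
qed (simp add: le_coalg_refl is_coalg_zero)

text \<open>An element of the web of the fixpoint appears in some finite iterate, and each iterate
  is continuous in the environment by induction. So it already appears at some stage of the
  environment.\<close>

lemma cont_mu:
  assumes F: "cont_coalg F"
  shows "cont_coalg (\<lambda>\<rho>. lfp_coalg (\<lambda>C. F (case_nat C \<rho>)))"
proof (rule cont_coalgI)
  show "is_coalg (lfp_coalg (\<lambda>C. F (case_nat C \<rho>)))" if "\<And>i. is_coalg (\<rho> i)" for \<rho>
    by (rule cont_mu_props(1)[OF F that])
next
  fix \<rho> \<rho>' :: "nat \<Rightarrow> coalg"
  assume r: "\<And>i. is_coalg (\<rho> i)" "\<And>i. is_coalg (\<rho>' i)" "\<And>i. le_coalg (\<rho> i) (\<rho>' i)"
  show "le_coalg (lfp_coalg (\<lambda>C. F (case_nat C \<rho>))) (lfp_coalg (\<lambda>C. F (case_nat C \<rho>')))"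
  proof (rule lim_coalg_lub[OF cont_iterates[OF F r(1)] cont_mu_props(1)[OF F r(1)]
        cont_mu_props(1)[OF F r(2)] cont_mu_props(3)[OF F r(1)]])
    fix n
    have "le_coalg (((\<lambda>C. F (case_nat C \<rho>')) ^^ n) zero_coalg) (lfp_coalg (\<lambda>C. F (case_nat C \<rho>')))"
      using cont_mu_props(3)[OF F r(2)] by (simp add: lim_coalg_def)
    then show "le_coalg (((\<lambda>C. F (case_nat C \<rho>)) ^^ n) zero_coalg) (lfp_coalg (\<lambda>C. F (case_nat C \<rho>')))"
      by (rule le_coalg_trans[OF cont_iterates_mono[OF F r]])
  qed
next
  fix R and \<rho> :: "nat \<Rightarrow> coalg"
  assume R: "\<And>n i. is_coalg (R n i)" "\<And>i. is_coalg (\<rho> i)" "\<And>i. lim_coalg (\<lambda>n. R n i) (\<rho> i)"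
  let ?I = "\<lambda>\<rho> k. ((\<lambda>C. F (case_nat C \<rho>)) ^^ k) zero_coalg"
  have le: "\<And>n i. le_coalg (R n i) (R (Suc n) i)" "\<And>n i. le_coalg (R n i) (\<rho> i)"
    using R(3) by (simp_all add: lim_coalg_def)
  have lim: "lim_coalg (\<lambda>n. ?I (R n) k) (?I \<rho> k)" for k
  proof (induction k)
    case 0
    show ?case using lim_const[OF is_coalg_zero] by simp
  next
    case (Suc k)
    have "web (fst (F (case_nat (?I \<rho> k) \<rho>))) \<subseteq> (\<Union>n. web (fst (F (case_nat (?I (R n) k) (R n)))))"
    proof (rule cont_coalgD(3)[OF F])
      show "lim_coalg (\<lambda>n. case_nat (?I (R n) k) (R n) i) (case_nat (?I \<rho> k) \<rho> i)" for i
        by (rule lim_case_nat[of "\<lambda>n. ?I (R n) k" _ R, OF Suc R(3)])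
    qed (intro is_coalg_case_nat cont_iterates[OF F] R)+
    moreover have "le_coalg (?I (R n) (Suc k)) (?I (R (Suc n)) (Suc k))" for n
      by (rule cont_iterates_mono[OF F R(1) R(1) le(1)])
    moreover have "le_coalg (?I (R n) (Suc k)) (?I \<rho> (Suc k))" for n
      by (rule cont_iterates_mono[OF F R(1) R(2) le(2)])
    ultimately show ?case by (simp add: lim_coalg_def)
  qed
  show "web (fst (lfp_coalg (\<lambda>C. F (case_nat C \<rho>)))) \<subseteq> (\<Union>n. web (fst (lfp_coalg (\<lambda>C. F (case_nat C (R n))))))"
  proof
    fix a assume "a \<in> web (fst (lfp_coalg (\<lambda>C. F (case_nat C \<rho>))))"
    from lim_coalgD(3)[OF cont_mu_props(3)[OF F R(2)] this]
    obtain k where "a \<in> web (fst (?I \<rho> k))" by (rule exE)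
    from lim_coalgD(3)[OF lim this]
    obtain n where "a \<in> web (fst (?I (R n) k))" by (rule exE)
    moreover have "le_coalg (?I (R n) k) (lfp_coalg (\<lambda>C. F (case_nat C (R n))))"
      by (rule lim_coalgD(2)[OF cont_mu_props(3)[OF F R(1)]])
    ultimately show "a \<in> (\<Union>n. web (fst (lfp_coalg (\<lambda>C. F (case_nat C (R n))))))"
      using le_coalg_web by blast
  qed
qed

lemma cont_types: "cont_coalg (psem_env \<phi>)" "cont_pcs (gsem_env \<sigma>)"
proof (induction \<phi> and \<sigma>)
  case One
  then show ?case using cont_one by simp
next
  case (Bang \<sigma>)
  then show ?case using cont_bang[of "gsem_env \<sigma>"] by simp
next
  case (Tensor \<phi> \<psi>)
  then show ?case using cont_tensor[of "psem_env \<phi>" "psem_env \<psi>"] by simp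
next
  case (Plus \<phi> \<psi>)
  then show ?case using cont_oplus[of "psem_env \<phi>" "psem_env \<psi>"] by simp
next
  case (TVar n)
  then show ?case using cont_var[of n] by simp
next
  case (Mu \<phi>)
  then show ?case using cont_mu[of "psem_env \<phi>"] by simp
next
  case (Pos \<phi>)
  then show ?case using cont_fst[of "psem_env \<phi>"] by simp
next
  case (Lolli \<phi> \<sigma>)
  then show ?case using cont_lolli[of "psem_env \<phi>" "gsem_env \<sigma>"] by simp
qed

section \<open>Closed types, type substitution and unfolding\<close>

lemma sem_env_closed:
  "ptclosed k \<phi> \<Longrightarrow> (\<And>i. i < k \<Longrightarrow> \<rho> i = \<rho>' i) \<Longrightarrow> psem_env \<phi> \<rho> = psem_env \<phi> \<rho>'"
  "gtclosed k \<sigma> \<Longrightarrow> (\<And>i. i < k \<Longrightarrow> \<rho> i = \<rho>' i) \<Longrightarrow> gsem_env \<sigma> \<rho> = gsem_env \<sigma> \<rho>'"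
proof (induction \<phi> and \<sigma> arbitrary: k \<rho> \<rho>' and k \<rho> \<rho>')
  case (Mu \<phi>)
  have "psem_env \<phi> (case_nat C \<rho>) = psem_env \<phi> (case_nat C \<rho>')" for C
    using Mu.prems by (intro Mu.IH[of "Suc k"]) (auto split: nat.split)
  then show ?case by simp
next
  case (Bang \<sigma>)
  show ?case using Bang.IH[of k \<rho> \<rho>', OF _ Bang.prems(2)] Bang.prems(1) by simp
next
  case (Tensor \<phi> \<psi>)
  show ?case using Tensor.IH(1)[of k \<rho> \<rho>', OF _ Tensor.prems(2)] Tensor.IH(2)[of k \<rho> \<rho>', OF _ Tensor.prems(2)] Tensor.prems(1) by simp
next
  case (Plus \<phi> \<psi>)
  show ?case using Plus.IH(1)[of k \<rho> \<rho>', OF _ Plus.prems(2)] Plus.IH(2)[of k \<rho> \<rho>', OF _ Plus.prems(2)] Plus.prems(1) by simp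
next
  case (Pos \<phi>)
  show ?case using Pos.IH[of k \<rho> \<rho>', OF _ Pos.prems(2)] Pos.prems(1) by simp
next
  case (Lolli \<phi> \<sigma>)
  show ?case using Lolli.IH(1)[of k \<rho> \<rho>', OF _ Lolli.prems(2)] Lolli.IH(2)[of k \<rho> \<rho>', OF _ Lolli.prems(2)] Lolli.prems(1) by simp
qed simp_all

lemma sem_env_lift:
  "psem_env (ptlift k \<phi>) \<rho> = psem_env \<phi> (\<lambda>i. if i < k then \<rho> i else \<rho> (Suc i))"
  "gsem_env (gtlift k \<sigma>) \<rho> = gsem_env \<sigma> (\<lambda>i. if i < k then \<rho> i else \<rho> (Suc i))"
proof (induction \<phi> and \<sigma> arbitrary: k \<rho> and k \<rho>)
  case (Mu \<phi>)
  have "(\<lambda>i. if i < Suc k then case_nat C \<rho> i else case_nat C \<rho> (Suc i)) =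
      case_nat C (\<lambda>i. if i < k then \<rho> i else \<rho> (Suc i))" for C
    by (rule ext) (auto split: nat.split)
  then show ?case by (simp add: Mu.IH)
qed simp_all

lemma sem_env_subst:
  "psem_env (ptsubst \<phi> k \<theta>) \<rho> =
     psem_env \<phi> (\<lambda>i. if i < k then \<rho> i else if i = k then psem_env \<theta> \<rho> else \<rho> (i - 1))"
  "gsem_env (gtsubst \<sigma> k \<theta>) \<rho> =
     gsem_env \<sigma> (\<lambda>i. if i < k then \<rho> i else if i = k then psem_env \<theta> \<rho> else \<rho> (i - 1))"
proof (induction \<phi> and \<sigma> arbitrary: k \<theta> \<rho> and k \<theta> \<rho>)
  case (Mu \<phi>)
  \<comment> \<open>Under \<open>Mu\<close> the substituted type is lifted; by
    \<open>sem_env_lift\<close> it does not see the new entry \<open>C\<close>.\<close>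
  have "(\<lambda>i. if i < Suc k then case_nat C \<rho> i else if i = Suc k then psem_env (ptlift 0 \<theta>) (case_nat C \<rho>)
        else case_nat C \<rho> (i - 1)) =
      case_nat C (\<lambda>i. if i < k then \<rho> i else if i = k then psem_env \<theta> \<rho> else \<rho> (i - 1))" for C
    by (rule ext) (auto simp: sem_env_lift split: nat.split)
  then show ?case by (simp add: Mu.IH)
qed simp_all

text \<open>Nothing is known about the environment \<open>undefined\<close> in \<open>psem\<close>,
  so it is exchanged for one consisting of coalgebras.\<close>

lemma psem_closed_env: "ptclosed 0 \<phi> \<Longrightarrow> psem \<phi> = psem_env \<phi> (\<lambda>_. zero_coalg)"
  unfolding psem_def by (erule sem_env_closed(1)) simp

lemma gsem_closed_env: "gtclosed 0 \<sigma> \<Longrightarrow> gsem \<sigma> = gsem_env \<sigma> (\<lambda>_. zero_coalg)"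
  unfolding gsem_def by (erule sem_env_closed(2)) simp

lemma is_coalg_psem: "ptclosed 0 \<phi> \<Longrightarrow> is_coalg (psem \<phi>)"
  by (simp add: psem_closed_env cont_coalgD(1)[OF cont_types(1)] is_coalg_zero)

lemma is_pcs_gsem: "gtclosed 0 \<sigma> \<Longrightarrow> is_pcs (gsem \<sigma>)"
  by (simp add: gsem_closed_env cont_pcsD(1)[OF cont_types(2)] is_coalg_zero)

text \<open>An equality of coalgebras and not just an isomorphism; hence \<open>Fold\<close> and
  \<open>Unfold\<close> may leave matrices untouched.\<close>

lemma psem_unfold:
  assumes "ptclosed 0 (Mu \<psi>)"
  shows "psem (ptsubst \<psi> 0 (Mu \<psi>)) = psem (Mu \<psi>)"
proof -
  let ?z = "\<lambda>_. zero_coalg"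
  have "psem (ptsubst \<psi> 0 (Mu \<psi>)) = psem_env \<psi> (case_nat (psem (Mu \<psi>)) ?z)"
    unfolding psem_def sem_env_subst
    by (rule sem_env_closed(1)[of "Suc 0"]) (use assms in simp_all)
  also have "\<dots> = psem (Mu \<psi>)"
    unfolding psem_closed_env[OF assms] psem_env.simps
    by (rule cont_mu_props(2)[OF cont_types(1)]) (rule is_coalg_zero)
  finally show ?thesis .
qed

section \<open>The universal coalgebra structure\<close>

text \<open>
  The coalgebra structure of a closed positive type does not depend on the type: it is the
  restriction to its web of one matrix, defined by recursion on points.
\<close>

primrec H :: mat where
  "H Star = prom (unit_vec Star)"
| "H (Pair a b) = MON \<odot> (H a \<otimes>\<^sub>v H b)"
| "H (In i a) = bangu (InjU i) \<odot> H a"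
| "H (Bag m) = DIG (Bag m)"

text \<open>Coalgebraic with respect to the universal structure \<open>H\<close>, and so independent
  of any space.\<close>

definition cpt :: "vec \<Rightarrow> bool" where
  "cpt u \<longleftrightarrow> H \<odot> u = prom u"

lemma cpt_unit: "cpt (unit_vec Star)"
  by (simp add: cpt_def)

lemma cpt_prom: "cpt (prom u)"
proof -
  have "H \<odot> prom u = DIG \<odot> prom u"
  proof (rule mapp_cong)
    fix c assume "prom u c \<noteq> 0"
    then obtain b where "c = Bag b" using prom_eq_0[of c u] by blast
    then show "H c = DIG c" by simp
  qed
  then show ?thesis by (simp add: cpt_def DIG_prom)
qed

lemma cpt_tensv: "cpt u \<Longrightarrow> cpt v \<Longrightarrow> cpt (u \<otimes>\<^sub>v v)"
proof -
  assume uv: "cpt u" "cpt v"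
  have "H \<odot> (u \<otimes>\<^sub>v v) = (MON \<circ>\<^sub>m (H \<otimes>\<^sub>m H)) \<odot> (u \<otimes>\<^sub>v v)"
  proof (rule mapp_cong)
    fix c assume "(u \<otimes>\<^sub>v v) c \<noteq> 0"
    then obtain a b where "c = Pair a b" using tensv_eq_0[of c u v] by blast
    then show "H c = (MON \<circ>\<^sub>m (H \<otimes>\<^sub>m H)) c" by (simp add: mcomp_row)
  qed
  then show ?thesis using uv by (simp add: cpt_def mapp_mcomp mapp_tensm MON_prom)
qed

lemma cpt_Inj: "cpt u \<Longrightarrow> cpt (InjU i \<odot> u)"
proof -
  assume u: "cpt u"
  have "H \<circ>\<^sub>m InjU i = bangu (InjU i) \<circ>\<^sub>m H"
  proof
    fix a show "(H \<circ>\<^sub>m InjU i) a = (bangu (InjU i) \<circ>\<^sub>m H) a" by (simp add: mcomp_row InjU_def)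
  qed
  then have "H \<odot> InjU i \<odot> u = bangu (InjU i) \<odot> H \<odot> u" by (metis mapp_mcomp)
  then show ?thesis using u by (simp add: cpt_def bangu_prom)
qed

text \<open>What distinguishes the coalgebras of types from arbitrary ones: the structure is that of
  \<open>H\<close>, and the coalgebraic points are numerous enough to separate.\<close>

definition good :: "coalg \<Rightarrow> bool" where
  "good C \<longleftrightarrow> (\<forall>a\<in>web (fst C). snd C a = H a) \<and> sep (fst C) {u \<in> pts (fst C). cpt u}"

lemma good_row: "good C \<Longrightarrow> a \<in> web (fst C) \<Longrightarrow> snd C a = H a"
  by (simp add: good_def)

lemma good_sep: "good C \<Longrightarrow> sep (fst C) {u \<in> pts (fst C). cpt u}"
  by (simp add: good_def)

lemma goodI:
  assumes "\<And>a. a \<in> web (fst C) \<Longrightarrow> snd C a = H a" "sep (fst C) A" "\<And>u. u \<in> A \<Longrightarrow> cpt u"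
  shows "good C"
  unfolding good_def
proof (intro conjI ballI)
  show "sep (fst C) {u \<in> pts (fst C). cpt u}"
    by (rule sep_mono[OF assms(2)]) (use assms(3) sep_pts[OF assms(2)] in blast)+
qed (rule assms(1))

lemma good_app:
  assumes "is_coalg C" "good C" "u \<in> pts (fst C)"
  shows "snd C \<odot> u = H \<odot> u"
  by (rule mapp_eq_on[OF pts_vecs[OF is_coalg_pcs[OF assms(1)] assms(3)] good_row[OF assms(2)]])

lemma good_mor:
  assumes "is_coalg C" "good C"
  shows "mor (fst C) (bang (fst C)) H"
  using is_coalg_mor[OF assms(1)] good_app[OF assms] by (simp add: mor_def)

lemma coalgebraic_iff:
  assumes "is_coalg C" "good C"
  shows "coalgebraic C u \<longleftrightarrow> u \<in> pts (fst C) \<and> cpt u"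
  using good_app[OF assms] by (cases C) (auto simp: coalgebraic_def cpt_def)

lemma good_zero: "good zero_coalg"
proof (rule goodI)
  note Z = is_coalg_pcs[OF is_coalg_zero]
  show "sep (fst zero_coalg) {}"
    unfolding sep_def
  proof (intro conjI ballI impI)
    fix s s' assume s: "s \<in> pts (dual (fst zero_coalg))" "s' \<in> pts (dual (fst zero_coalg))"
    show "s = s'"
      using pts_support[OF is_pcs_dual[OF Z] s(1)] pts_support[OF is_pcs_dual[OF Z] s(2)] by (intro ext) simp
  qed simp
qed simp_all

lemma good_one: "good one_coalg"
proof (rule goodI)
  show "snd one_coalg a = H a" if "a \<in> web (fst one_coalg)" for a
    using that by (simp add: one_coalg_eq)
  show "sep (fst one_coalg) {unit_vec Star}" using sep_one by (simp add: one_coalg_eq)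
qed (simp add: cpt_unit)

lemma good_bang:
  assumes "is_pcs X"
  shows "good (bang_coalg X)"
proof (rule goodI)
  show "snd (bang_coalg X) c = H c" if c: "c \<in> web (fst (bang_coalg X))" for c
  proof -
    have "c \<in> bweb (web X)" using c by simp
    then obtain b where "c = Bag b" by (auto simp: bweb_def)
    then show ?thesis using \<open>c \<in> bweb (web X)\<close> by (simp add: bang_coalg_def dig_eq rowr_row)
  qed
  show "sep (fst (bang_coalg X)) {prom u |u. u \<in> pts X}" using sep_bang[OF assms] by simp
  show "cpt v" if "v \<in> {prom u |u. u \<in> pts X}" for v using that cpt_prom by blast
qed

lemma good_tensor:
  assumes C: "is_coalg C" "good C" and D: "is_coalg D" "good D"
  shows "good (tensor_coalg C D)"
proof (rule goodI)
  let ?A = "{u \<in> pts (fst C). cpt u}" and ?B = "{u \<in> pts (fst D). cpt u}"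
  have eq: "tensor_coalg C D = (tensor (fst C) (fst D), MON \<circ>\<^sub>m (snd C \<otimes>\<^sub>m snd D))"
    using tensor_coalg_eq[of "fst C" "snd C" "fst D" "snd D"] C D by simp
  show "snd (tensor_coalg C D) c = H c" if c: "c \<in> web (fst (tensor_coalg C D))" for c
  proof -
    have "c \<in> tweb (web (fst C)) (web (fst D))" using c by simp
    then obtain a b where "c = Pair a b" "a \<in> web (fst C)" "b \<in> web (fst D)" by (auto simp: tweb_def)
    then show ?thesis by (simp add: eq mcomp_row good_row[OF C(2)] good_row[OF D(2)])
  qed
  show "sep (fst (tensor_coalg C D)) {u \<otimes>\<^sub>v v |u v. u \<in> ?A \<and> v \<in> ?B}"
    using sep_tensor[OF is_coalg_pcs[OF C(1)] is_coalg_pcs[OF D(1)] good_sep[OF C(2)] good_sep[OF D(2)]] by simp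
  show "cpt w" if "w \<in> {u \<otimes>\<^sub>v v |u v. u \<in> ?A \<and> v \<in> ?B}" for w using that cpt_tensv by blast
qed

lemma good_oplus:
  assumes C: "is_coalg C" "good C" and D: "is_coalg D" "good D"
  shows "good (oplus_coalg C D)"
proof (rule goodI)
  let ?A = "{u \<in> pts (fst C). cpt u}" and ?B = "{u \<in> pts (fst D). cpt u}"
  have eq: "oplus_coalg C D = (oplus (fst C) (fst D), copair (bangu (InjU Lft) \<circ>\<^sub>m snd C) (bangu (InjU Rgt) \<circ>\<^sub>m snd D))"
    using oplus_coalg_eq[of "fst C" "snd C" "fst D" "snd D"] C D by simp
  show "snd (oplus_coalg C D) c = H c" if c: "c \<in> web (fst (oplus_coalg C D))" for c
  proof -
    have "c \<in> oweb (web (fst C)) (web (fst D))" using c by simp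
    then show ?thesis
      by (rule oweb_cases) (simp_all add: eq mcomp_row good_row[OF C(2)] good_row[OF D(2)])
  qed
  show "sep (fst (oplus_coalg C D)) (((\<odot>) (InjU Lft)) ` ?A \<union> ((\<odot>) (InjU Rgt)) ` ?B)"
    using sep_oplus[OF is_coalg_pcs[OF C(1)] is_coalg_pcs[OF D(1)] good_sep[OF C(2)] good_sep[OF D(2)]] by simp
  show "cpt w" if "w \<in> ((\<odot>) (InjU Lft)) ` ?A \<union> ((\<odot>) (InjU Rgt)) ` ?B" for w using that cpt_Inj by blast
qed

text \<open>An entry of a functional is visible at a stage whose web contains it. Restricted to this
  stage, the functional is determined by the coalgebraic points of the stage, which are also points
  of the limit.\<close>

lemma good_lim:
  assumes S: "\<And>n. is_coalg (S n)" "\<And>n. good (S n)" and L: "is_coalg L" and lim: "lim_coalg S L"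
  shows "good L"
proof (rule goodI)
  note PL = is_coalg_pcs[OF L] and PS = is_coalg_pcs[OF S(1)]
  have le: "le_pcs (fst (S n)) (fst L)" for n using lim_coalgD(2)[OF lim] by (simp add: le_coalg_def)
  show "snd L a = H a" if a: "a \<in> web (fst L)" for a
  proof -
    obtain n where n: "a \<in> web (fst (S n))" using lim_coalgD(3)[OF lim a] by (rule exE)
    then have "snd (S n) a = snd L a" using lim_coalgD(2)[OF lim, of n] by (simp add: le_coalg_def)
    then show ?thesis using good_row[OF S(2) n] by simp
  qed
  let ?A = "{u \<in> pts (fst L). cpt u}"
  show "sep (fst L) ?A"
    unfolding sep_def
  proof (intro conjI ballI impI)
    fix s s' assume s: "s \<in> pts (dual (fst L))" and s': "s' \<in> pts (dual (fst L))"
      and eq: "\<forall>u\<in>?A. pairing u s = pairing u s'"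
    show "s = s'"
    proof
      fix a
      show "s a = s' a"
      proof (cases "a \<in> web (fst L)")
        case True
        obtain n where n: "a \<in> web (fst (S n))" using lim_coalgD(3)[OF lim True] by (rule exE)
        let ?W = "web (fst (S n))"
        have r: "rst ?W t \<in> pts (dual (fst (S n)))" if "t \<in> pts (dual (fst L))" for t
          using le_pcs_rst[OF is_pcs_dual[OF PL] le_dual[OF PL le] that] by simp
        have "rst ?W s = rst ?W s'"
        proof (rule sepD[OF good_sep[OF S(2)] r[OF s] r[OF s']])
          fix u assume u: "u \<in> {u \<in> pts (fst (S n)). cpt u}"
          then have "u \<in> ?A" using le_pcsD(2)[OF le] by blast
          then have "pairing u s = pairing u s'" using eq by blast
          moreover have "rst ?W u = u" using u by (intro rst_vecs_id pts_vecs[OF PS]) simp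
          ultimately show "pairing u (rst ?W s) = pairing u (rst ?W s')"
            unfolding pairing_rst[symmetric] by simp
        qed
        from fun_cong[OF this, of a] show ?thesis using n by (simp add: rst_def)
      next
        case False
        then show ?thesis
          using pts_support[OF is_pcs_dual[OF PL] s] pts_support[OF is_pcs_dual[OF PL] s'] by simp
      qed
    qed
  qed blast
qed simp

text \<open>\<open>!X\<close> is good for every space \<open>X\<close>, so the invariant concerns
  positive types; the second claim gives the mutual induction its shape.\<close>

lemma good_types:
  "(\<And>i. is_coalg (\<rho> i)) \<Longrightarrow> (\<And>i. good (\<rho> i)) \<Longrightarrow> good (psem_env \<phi> \<rho>)"
  "\<sigma> = (\<sigma>::gty)"
proof (induction \<phi> and \<sigma> arbitrary: \<rho>)
  case One
  show ?case using good_one by simp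
next
  case (Bang \<sigma>)
  show ?case using good_bang[OF cont_pcsD(1)[OF cont_types(2) Bang.prems(1)]] by simp
next
  case (Tensor \<phi> \<psi>)
  show ?case
    using good_tensor[OF cont_coalgD(1)[OF cont_types(1) Tensor.prems(1)] Tensor.IH(1)[OF Tensor.prems]
        cont_coalgD(1)[OF cont_types(1) Tensor.prems(1)] Tensor.IH(2)[OF Tensor.prems]] by simp
next
  case (Plus \<phi> \<psi>)
  show ?case
    using good_oplus[OF cont_coalgD(1)[OF cont_types(1) Plus.prems(1)] Plus.IH(1)[OF Plus.prems]
        cont_coalgD(1)[OF cont_types(1) Plus.prems(1)] Plus.IH(2)[OF Plus.prems]] by simp
next
  case (TVar n)
  show ?case using TVar.prems(2)[of n] by simp
next
  case (Mu \<phi>)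
  let ?S = "\<lambda>n. ((\<lambda>C. psem_env \<phi> (case_nat C \<rho>)) ^^ n) zero_coalg"
  have c: "is_coalg (?S n)" for n by (rule cont_iterates[OF cont_types(1) Mu.prems(1)])
  have g: "good (?S n)" for n
  proof (induction n)
    case (Suc n)
    have "good (psem_env \<phi> (case_nat (?S n) \<rho>))"
    proof (rule Mu.IH)
      show "is_coalg (case_nat (?S n) \<rho> i)" for i by (rule is_coalg_case_nat[OF c Mu.prems(1)])
      show "good (case_nat (?S n) \<rho> i)" for i using Suc Mu.prems(2)[of "i - 1"] by (cases i) simp_all
    qed
    then show ?case by simp
  qed (simp add: good_zero)
  show ?case
    unfolding psem_env.simps
    by (rule good_lim[of ?S, OF c g cont_mu_props(1)[OF cont_types(1) Mu.prems(1)]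
          cont_mu_props(3)[OF cont_types(1) Mu.prems(1)]])
qed simp_all

lemma good_psem: "ptclosed 0 \<phi> \<Longrightarrow> good (psem \<phi>)"
  unfolding psem_closed_env by (rule good_types(1)) (simp_all add: is_coalg_zero good_zero)

lemma psem_simps:
  "psem One = one_coalg" "psem (Bang \<sigma>) = bang_coalg (gsem \<sigma>)"
  "psem (Tensor \<phi> \<psi>) = tensor_coalg (psem \<phi>) (psem \<psi>)" "psem (Plus \<phi> \<psi>) = oplus_coalg (psem \<phi>) (psem \<psi>)"
  by (simp_all add: psem_def gsem_def)

lemma gsem_simps: "gsem (Pos \<phi>) = fst (psem \<phi>)" "gsem (Lolli \<phi> \<sigma>) = lolli (fst (psem \<phi>)) (gsem \<sigma>)"
  by (simp_all add: psem_def gsem_def)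

section \<open>Contexts as coalgebras\<close>

primrec ctx_coalg :: "ctx \<Rightarrow> coalg" where
  "ctx_coalg [] = one_coalg"
| "ctx_coalg (\<phi> # \<Gamma>) = tensor_coalg (ctx_coalg \<Gamma>) (psem \<phi>)"

lemma fst_ctx_coalg [simp]: "fst (ctx_coalg \<Gamma>) = ctx_sem \<Gamma>"
  by (induction \<Gamma>) (simp_all add: one_coalg_def)

lemma wf_ctx_Cons [simp]: "wf_ctx (\<phi> # \<Gamma>) \<longleftrightarrow> ptclosed 0 \<phi> \<and> wf_ctx \<Gamma>"
  by (simp add: wf_ctx_def)

lemma ctx_coalg: "wf_ctx \<Gamma> \<Longrightarrow> is_coalg (ctx_coalg \<Gamma>) \<and> good (ctx_coalg \<Gamma>)"
  by (induction \<Gamma>) (simp_all add: is_coalg_one good_one is_coalg_tensor good_tensor is_coalg_psem good_psem)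

lemma is_pcs_ctx: "wf_ctx \<Gamma> \<Longrightarrow> is_pcs (ctx_sem \<Gamma>)"
  using is_coalg_pcs[of "ctx_coalg \<Gamma>"] ctx_coalg[of \<Gamma>] by simp

lemma mor_H_ctx: "wf_ctx \<Gamma> \<Longrightarrow> mor (ctx_sem \<Gamma>) (bang (ctx_sem \<Gamma>)) H"
  using good_mor[of "ctx_coalg \<Gamma>"] ctx_coalg[of \<Gamma>] by simp

lemma coalgebraic_psem: "ptclosed 0 \<phi> \<Longrightarrow> coalgebraic (psem \<phi>) u \<longleftrightarrow> u \<in> pts (fst (psem \<phi>)) \<and> cpt u"
  by (rule coalgebraic_iff[OF is_coalg_psem good_psem])

lemma coalgebraic_env_Cons:
  "coalgebraic_env (\<phi> # \<Gamma>) us \<longleftrightarrow> (\<exists>u us'. us = u # us' \<and> coalgebraic (psem \<phi>) u \<and> coalgebraic_env \<Gamma> us')"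
  by (cases us) (auto simp: coalgebraic_env_def)

lemma coalgebraic_env_Cons_Cons [simp]:
  "coalgebraic_env (\<phi> # \<Gamma>) (u # us) \<longleftrightarrow> coalgebraic (psem \<phi>) u \<and> coalgebraic_env \<Gamma> us"
  by (simp add: coalgebraic_env_def)

lemma coalgebraic_env_Nil [simp]: "coalgebraic_env [] us \<longleftrightarrow> us = []"
  by (simp add: coalgebraic_env_def)

lemma tens_env:
  assumes "wf_ctx \<Gamma>" "coalgebraic_env \<Gamma> us"
  shows "tens us \<in> pts (ctx_sem \<Gamma>) \<and> cpt (tens us)"
  using assms
proof (induction \<Gamma> arbitrary: us)
  case Nil
  then show ?case by (simp add: cpt_unit)
next
  case (Cons \<phi> \<Gamma>)
  then obtain u us' where us: "us = u # us'" and u: "coalgebraic (psem \<phi>) u" and e: "coalgebraic_env \<Gamma> us'"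
    by (auto simp: coalgebraic_env_Cons)
  have c: "ptclosed 0 \<phi>" "wf_ctx \<Gamma>" using Cons.prems(1) by simp_all
  have "u \<in> pts (fst (psem \<phi>))" "cpt u" using u coalgebraic_psem[OF c(1)] by blast+
  moreover have "tens us' \<in> pts (ctx_sem \<Gamma>)" "cpt (tens us')" using Cons.IH[OF c(2) e] by blast+
  ultimately show ?case
    by (simp add: us cpt_tensv tensv_pts is_pcs_ctx c is_coalg_pcs is_coalg_psem)
qed

lemma sep_ctx: "wf_ctx \<Gamma> \<Longrightarrow> sep (ctx_sem \<Gamma>) {tens us |us. coalgebraic_env \<Gamma> us}"
proof (induction \<Gamma>)
  case Nil
  show ?case using sep_one by simp
next
  case (Cons \<phi> \<Gamma>)
  have c: "ptclosed 0 \<phi>" "wf_ctx \<Gamma>" using Cons.prems by simp_all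
  have "sep (ctx_sem (\<phi> # \<Gamma>)) {u \<otimes>\<^sub>v v |u v. u \<in> {tens us |us. coalgebraic_env \<Gamma> us} \<and> v \<in> {u \<in> pts (fst (psem \<phi>)). cpt u}}"
    using sep_tensor[OF is_pcs_ctx[OF c(2)] is_coalg_pcs[OF is_coalg_psem[OF c(1)]] Cons.IH[OF c(2)]
        good_sep[OF good_psem[OF c(1)]]] by simp
  moreover have "{u \<otimes>\<^sub>v v |u v. u \<in> {tens us |us. coalgebraic_env \<Gamma> us} \<and> v \<in> {u \<in> pts (fst (psem \<phi>)). cpt u}} =
      {tens us |us. coalgebraic_env (\<phi> # \<Gamma>) us}" (is "?L = ?R")
  proof
    show "?L \<subseteq> ?R"
    proof
      fix w assume "w \<in> ?L"
      then obtain us v where "w = tens (v # us)" "coalgebraic_env (\<phi> # \<Gamma>) (v # us)"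
        using coalgebraic_psem[OF c(1)] by auto
      then show "w \<in> ?R" by blast
    qed
    show "?R \<subseteq> ?L"
    proof
      fix w assume "w \<in> ?R"
      then obtain us where us: "w = tens us" "coalgebraic_env (\<phi> # \<Gamma>) us" by blast
      then obtain u us' where "us = u # us'" "coalgebraic (psem \<phi>) u" "coalgebraic_env \<Gamma> us'"
        by (auto simp: coalgebraic_env_Cons)
      then show "w \<in> ?L" using us coalgebraic_psem[OF c(1)] by auto
    qed
  qed
  ultimately show ?case by simp
qed

text \<open>Tensors of coalgebraic points separate the context, by \<open>sep_ctx\<close>; this is
  the form in which separation enters the semantics of terms.\<close>

lemma ctx_mor_eq:
  assumes "wf_ctx \<Gamma>" "is_pcs Y" "mor (ctx_sem \<Gamma>) Y S" "mor (ctx_sem \<Gamma>) Y T"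
    and "\<And>us. coalgebraic_env \<Gamma> us \<Longrightarrow> S \<odot> tens us = T \<odot> tens us"
  shows "rowr (web (ctx_sem \<Gamma>)) S = rowr (web (ctx_sem \<Gamma>)) T"
proof (rule rowr_cong)
  fix a assume a: "a \<in> web (ctx_sem \<Gamma>)"
  show "S a = T a"
    by (rule sep_mor_eq[OF is_pcs_ctx[OF assms(1)] assms(2) sep_ctx[OF assms(1)] assms(3,4) _ a])
      (use assms(5) in blast)
qed

section \<open>Untyped interpretation of terms\<close>

text \<open>
  Since terms do not determine their typing derivations, coherence is an issue. It is settled by
  interpreting raw terms by matrices over all points; the semantics of a derivation is the
  restriction of this matrix to the web of its context.
\<close>

definition DUP :: mat where
  "DUP = (\<lambda>c d. case d of Pair a b \<Rightarrow> if c = Bag {#a, b#} then 1 else 0 | _ \<Rightarrow> 0)"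

definition EPS :: mat where
  "EPS = (\<lambda>c d. if c = Bag {#} \<and> d = Star then 1 else 0)"

text \<open>Contraction through the coalgebra structure. It duplicates coalgebraic points, but
  cannot do so for all points, as duplication is not linear.\<close>

definition CON :: mat where
  "CON = DUP \<circ>\<^sub>m H"

definition WK :: mat where
  "WK = EPS \<circ>\<^sub>m H"

definition PRL :: mat where
  "PRL = (\<lambda>c a'. case c of Pair a b \<Rightarrow> if a = a' then H b (Bag {#}) else 0 | _ \<Rightarrow> 0)"

definition PRR :: mat where
  "PRR = (\<lambda>c b'. case c of Pair a b \<Rightarrow> if b = b' then H a (Bag {#}) else 0 | _ \<Rightarrow> 0)"

definition EV :: mat where
  "EV = (\<lambda>c b'. case c of Pair d a' \<Rightarrow> if d = Pair a' b' then 1 else 0 | _ \<Rightarrow> 0)"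

definition CASE :: "mat \<Rightarrow> mat \<Rightarrow> mat" where
  "CASE S T = (\<lambda>c b. case c of Pair g d \<Rightarrow> copair (\<lambda>a. S (Pair g a)) (\<lambda>a. T (Pair g a)) d b | _ \<Rightarrow> 0)"

text \<open>Outside the web of the argument type the rows of \<open>T\<close> are arbitrary; the set
  \<open>I\<close> cuts them off. Its value comes from the annotation of \<open>Lam\<close>.\<close>

definition CUR :: "pt set \<Rightarrow> mat \<Rightarrow> mat" where
  "CUR I T = (\<lambda>g c. case c of Pair a b \<Rightarrow> if a \<in> I then T (Pair g a) b else 0 | _ \<Rightarrow> 0)"

definition COIN :: "rat \<Rightarrow> mat" where
  "COIN p = (\<lambda>_ b. ennreal (of_rat p) * unit_vec (In Lft Star) b + ennreal (1 - of_rat p) * unit_vec (In Rgt Star) b)"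

primrec vproj :: "nat \<Rightarrow> mat" where
  "vproj 0 = PRR"
| "vproj (Suc n) = vproj n \<circ>\<^sub>m PRL"

text \<open>The finite approximations of a fixpoint as matrices. The environment is duplicated: one
  copy feeds the body, the other the previous approximation.\<close>

primrec fix_iter :: "mat \<Rightarrow> nat \<Rightarrow> mat" where
  "fix_iter m 0 = (\<lambda>_ _. 0)"
| "fix_iter m (Suc k) = m \<circ>\<^sub>m ((IDU \<otimes>\<^sub>m (bangu (fix_iter m k) \<circ>\<^sub>m H)) \<circ>\<^sub>m CON)"

primrec uint :: "tm \<Rightarrow> mat" where
  "uint (Var n) = vproj n"
| "uint Unit = WK"
| "uint (Stop M) = bangu (uint M) \<circ>\<^sub>m H"
| "uint (Tup M N) = (uint M \<otimes>\<^sub>m uint N) \<circ>\<^sub>m CON"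
| "uint (Inj i M) = InjU i \<circ>\<^sub>m uint M"
| "uint (Lam \<phi> M) = CUR (web (fst (psem \<phi>))) (uint M)"
| "uint (App M N) = EV \<circ>\<^sub>m ((uint M \<otimes>\<^sub>m uint N) \<circ>\<^sub>m CON)"
| "uint (Case M N\<^sub>l N\<^sub>r) = CASE (uint N\<^sub>l) (uint N\<^sub>r) \<circ>\<^sub>m ((IDU \<otimes>\<^sub>m uint M) \<circ>\<^sub>m CON)"
| "uint (Prj i M) = (case i of Lft \<Rightarrow> PRL | Rgt \<Rightarrow> PRR) \<circ>\<^sub>m uint M"
| "uint (Go M) = DER \<circ>\<^sub>m uint M"
| "uint (Fix \<sigma> M) = (\<lambda>a b. SUP k. fix_iter (uint M) k a b)"
| "uint (Fold M) = uint M"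
| "uint (Unfold M) = uint M"
| "uint (Coin p) = COIN p \<circ>\<^sub>m WK"

section \<open>Action of the structural matrices on vectors\<close>

lemma DUP_prom: "DUP \<odot> prom u = u \<otimes>\<^sub>v u"
proof
  fix d
  show "(DUP \<odot> prom u) d = (u \<otimes>\<^sub>v u) d"
  proof (cases "\<exists>a b. d = Pair a b")
    case True
    then obtain a b where d: "d = Pair a b" by blast
    show ?thesis
      unfolding mapp_def by (subst infsum_single_point[where a = "Bag {#a, b#}"]) (simp_all add: DUP_def d)
  next
    case False
    then have "DUP c d = 0" for c by (cases d) (simp_all add: DUP_def)
    moreover have "(u \<otimes>\<^sub>v u) d = 0" by (rule tensv_eq_0) (use False in blast)
    ultimately show ?thesis by (simp add: mapp_def)
  qed
qed

lemma EPS_mapp: "EPS \<odot> u = (\<lambda>b. u (Bag {#}) * unit_vec Star b)"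
proof
  fix b show "(EPS \<odot> u) b = u (Bag {#}) * unit_vec Star b"
    unfolding mapp_def by (subst infsum_single_point[where a = "Bag {#}"]) (simp_all add: EPS_def unit_vec_def)
qed

lemma CON_cpt: "cpt u \<Longrightarrow> CON \<odot> u = u \<otimes>\<^sub>v u"
  by (simp add: CON_def mapp_mcomp cpt_def DUP_prom)

lemma WK_cpt: "cpt u \<Longrightarrow> WK \<odot> u = unit_vec Star"
  by (simp add: WK_def mapp_mcomp cpt_def EPS_mapp)

lemma H_weaken: "(\<Sum>\<^sub>\<infinity>b. H b (Bag {#}) * v b) = (H \<odot> v) (Bag {#})"
  by (simp add: mapp_def)

text \<open>Discarding \<open>v\<close> costs the factor that its structure puts on the empty bag.
  This factor is \<open>1\<close> when \<open>v\<close> is coalgebraic, so projections from pairs of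
  values are exact.\<close>

lemma PRL_mapp: "PRL \<odot> (u \<otimes>\<^sub>v v) = (\<lambda>a. (H \<odot> v) (Bag {#}) * u a)"
proof
  fix a'
  have "(PRL \<odot> (u \<otimes>\<^sub>v v)) a' = (\<Sum>\<^sub>\<infinity>a. \<Sum>\<^sub>\<infinity>b. (if a = a' then H b (Bag {#}) else 0) * (u a * v b))"
    unfolding mapp_tensv by (simp add: PRL_def)
  also have "\<dots> = (\<Sum>\<^sub>\<infinity>b. H b (Bag {#}) * (u a' * v b))"
    by (subst infsum_single_point[where a = a']) simp_all
  also have "\<dots> = u a' * (\<Sum>\<^sub>\<infinity>b. H b (Bag {#}) * v b)"
    by (simp only: infsum_cmult_ennreal[symmetric] mult.left_commute)
  finally show "(PRL \<odot> (u \<otimes>\<^sub>v v)) a' = (H \<odot> v) (Bag {#}) * u a'" unfolding H_weaken mult.commute[of "u a'"] .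
qed

lemma PRR_mapp: "PRR \<odot> (u \<otimes>\<^sub>v v) = (\<lambda>b. (H \<odot> u) (Bag {#}) * v b)"
proof
  fix b'
  have "(PRR \<odot> (u \<otimes>\<^sub>v v)) b' = (\<Sum>\<^sub>\<infinity>a. \<Sum>\<^sub>\<infinity>b. (if b = b' then H a (Bag {#}) else 0) * (u a * v b))"
    unfolding mapp_tensv by (simp add: PRR_def)
  also have "\<dots> = (\<Sum>\<^sub>\<infinity>a. H a (Bag {#}) * (u a * v b'))"
    by (intro infsum_cong, subst infsum_single_point[where a = b']) simp_all
  also have "\<dots> = (\<Sum>\<^sub>\<infinity>a. H a (Bag {#}) * u a) * v b'"
    by (simp only: infsum_multc_ennreal[symmetric] mult.assoc)
  finally show "(PRR \<odot> (u \<otimes>\<^sub>v v)) b' = (H \<odot> u) (Bag {#}) * v b'" by (simp only: H_weaken)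
qed

lemma EV_mapp: "EV \<odot> (w \<otimes>\<^sub>v v) = mat_of w \<odot> v"
proof
  fix b'
  have "(EV \<odot> (w \<otimes>\<^sub>v v)) b' = (\<Sum>\<^sub>\<infinity>d. \<Sum>\<^sub>\<infinity>a. (if d = Pair a b' then 1 else 0) * (w d * v a))"
    unfolding mapp_tensv by (simp add: EV_def)
  also have "\<dots> = (\<Sum>\<^sub>\<infinity>a. \<Sum>\<^sub>\<infinity>d. (if d = Pair a b' then 1 else 0) * (w d * v a))"
    by (rule infsum_swap_ennreal)
  also have "\<dots> = (\<Sum>\<^sub>\<infinity>a. w (Pair a b') * v a)"
  proof (rule infsum_cong)
    fix a
    show "(\<Sum>\<^sub>\<infinity>d. (if d = Pair a b' then 1 else 0) * (w d * v a)) = w (Pair a b') * v a"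
      by (subst infsum_single_point[where a = "Pair a b'"]) simp_all
  qed
  finally show "(EV \<odot> (w \<otimes>\<^sub>v v)) b' = (mat_of w \<odot> v) b'" by (simp add: mapp_def mat_of_def)
qed

lemma CASE_mapp:
  "CASE S T \<odot> (u \<otimes>\<^sub>v w) = (\<lambda>b. (S \<odot> (u \<otimes>\<^sub>v component Lft w)) b + (T \<odot> (u \<otimes>\<^sub>v component Rgt w)) b)"
proof
  fix b
  have "(\<Sum>\<^sub>\<infinity>d. CASE S T (Pair g d) b * (u g * w d)) =
      (\<Sum>\<^sub>\<infinity>a. S (Pair g a) b * (u g * w (In Lft a))) + (\<Sum>\<^sub>\<infinity>a. T (Pair g a) b * (u g * w (In Rgt a)))" for g
    by (subst infsum_In) (simp_all add: CASE_def copair_row_0)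
  then show "(CASE S T \<odot> (u \<otimes>\<^sub>v w)) b = (S \<odot> (u \<otimes>\<^sub>v component Lft w)) b + (T \<odot> (u \<otimes>\<^sub>v component Rgt w)) b"
    unfolding mapp_tensv by (simp add: infsum_add_ennreal component_def)
qed

lemma CUR_mapp:
  assumes "v \<in> vecs I"
  shows "mat_of (CUR I T \<odot> u) \<odot> v = T \<odot> (u \<otimes>\<^sub>v v)"
proof
  fix b
  have "mat_of (CUR I T \<odot> u) a b * v a = (\<Sum>\<^sub>\<infinity>g. T (Pair g a) b * (u g * v a))" for a
  proof (cases "a \<in> I")
    case True
    then show ?thesis
      by (simp only: mat_of_def mapp_def CUR_def pt.case if_True infsum_multc_ennreal[symmetric] mult.assoc)
  next
    case False
    then have "v a = 0" using assms unfolding vecs_def by blast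
    then show ?thesis by simp
  qed
  then have "(mat_of (CUR I T \<odot> u) \<odot> v) b = (\<Sum>\<^sub>\<infinity>a. \<Sum>\<^sub>\<infinity>g. T (Pair g a) b * (u g * v a))"
    by (simp add: mapp_def)
  also have "\<dots> = (\<Sum>\<^sub>\<infinity>g. \<Sum>\<^sub>\<infinity>a. T (Pair g a) b * (u g * v a))" by (rule infsum_swap_ennreal)
  finally show "(mat_of (CUR I T \<odot> u) \<odot> v) b = (T \<odot> (u \<otimes>\<^sub>v v)) b" unfolding mapp_tensv .
qed

text \<open>Every operation in \<open>fix_iter\<close> is monotone and the iteration starts at zero.
  This makes the supremum in \<open>uint\<close> commute with application to a vector.\<close>

lemma fix_iter_mono: "incseq (fix_iter m)"
proof (rule incseq_SucI)
  fix k show "fix_iter m k \<le> fix_iter m (Suc k)"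
  proof (induction k)
    case (Suc k)
    have "bangu (fix_iter m k) \<circ>\<^sub>m H \<le> bangu (fix_iter m (Suc k)) \<circ>\<^sub>m H"
    proof (rule le_funI)
      fix a
      show "(bangu (fix_iter m k) \<circ>\<^sub>m H) a \<le> (bangu (fix_iter m (Suc k)) \<circ>\<^sub>m H) a"
        unfolding mcomp_row by (rule mapp_mono[OF le_funD[OF bangu_mono[OF Suc]] order_refl])
    qed
    note B = this
    have T: "(IDU \<otimes>\<^sub>m (bangu (fix_iter m k) \<circ>\<^sub>m H)) c \<le> (IDU \<otimes>\<^sub>m (bangu (fix_iter m (Suc k)) \<circ>\<^sub>m H)) c" for c
    proof (cases "\<exists>a b. c = Pair a b")
      case True
      then obtain a b where "c = Pair a b" by blast
      then show ?thesis using tensv_mono[OF order_refl le_funD[OF B, of b], of "IDU a"] by simp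
    next
      case False
      then have "(S \<otimes>\<^sub>m T) c = (\<lambda>_. 0)" for S T by (intro tensm_row_0) blast
      then show ?thesis by simp
    qed
    have step: "(m \<circ>\<^sub>m (S \<circ>\<^sub>m CON)) a \<le> (m \<circ>\<^sub>m (T \<circ>\<^sub>m CON)) a" if ST: "\<And>c. S c \<le> T c" for S T :: mat and a
      unfolding mcomp_row by (rule mapp_mono[OF order_refl mapp_mono[OF ST order_refl]])
    show ?case
    proof (rule le_funI)
      fix a
      show "fix_iter m (Suc k) a \<le> fix_iter m (Suc (Suc k)) a"
        using step[of "IDU \<otimes>\<^sub>m (bangu (fix_iter m k) \<circ>\<^sub>m H)" "IDU \<otimes>\<^sub>m (bangu (fix_iter m (Suc k)) \<circ>\<^sub>m H)", OF T]
        unfolding fix_iter.simps(2) .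
    qed
  qed (simp add: le_fun_def)
qed

lemma fix_iter_cpt:
  assumes "cpt u"
  shows "fix_iter m k \<odot> u = ((\<lambda>w. m \<odot> (u \<otimes>\<^sub>v prom w)) ^^ k) (\<lambda>_. 0)"
proof (induction k)
  case (Suc k)
  have "fix_iter m (Suc k) \<odot> u = m \<odot> (u \<otimes>\<^sub>v prom (fix_iter m k \<odot> u))"
    using assms by (simp add: mapp_mcomp CON_cpt mapp_tensm cpt_def bangu_prom)
  then show ?case by (simp add: Suc)
qed simp

text \<open>The defining equations of the semantics. The point is coalgebraic because most clauses
  copy, promote or discard it.\<close>

lemma uint_cpt:
  assumes u: "cpt u"
  shows "uint Unit \<odot> u = unit_vec Star"
    and "uint (Stop M) \<odot> u = prom (uint M \<odot> u)"
    and "uint (Tup M N) \<odot> u = (uint M \<odot> u) \<otimes>\<^sub>v (uint N \<odot> u)"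
    and "uint (Inj i M) \<odot> u = InjU i \<odot> uint M \<odot> u"
    and "uint (App M N) \<odot> u = mat_of (uint M \<odot> u) \<odot> uint N \<odot> u"
    and "uint (Case M N\<^sub>l N\<^sub>r) \<odot> u = (\<lambda>b. (uint N\<^sub>l \<odot> (u \<otimes>\<^sub>v component Lft (uint M \<odot> u))) b +
        (uint N\<^sub>r \<odot> (u \<otimes>\<^sub>v component Rgt (uint M \<odot> u))) b)"
    and "uint (Prj Lft M) \<odot> u = PRL \<odot> uint M \<odot> u"
    and "uint (Prj Rgt M) \<odot> u = PRR \<odot> uint M \<odot> u"
    and "uint (Go M) \<odot> u = DER \<odot> uint M \<odot> u"
    and "uint (Fix \<sigma> M) \<odot> u = (SUP k. ((\<lambda>w. uint M \<odot> (u \<otimes>\<^sub>v prom w)) ^^ k) (\<lambda>_. 0))"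
    and "uint (Coin p) \<odot> u = (\<lambda>b. ennreal (of_rat p) * unit_vec (In Lft Star) b + ennreal (1 - of_rat p) * unit_vec (In Rgt Star) b)"
proof -
  show "uint (Stop M) \<odot> u = prom (uint M \<odot> u)"
    using u by (simp add: mapp_mcomp cpt_def bangu_prom)
  have "(\<lambda>b. SUP k. (fix_iter (uint M) k \<odot> u) b) = (SUP k. fix_iter (uint M) k \<odot> u)"
    by (rule ext) (rule SUP_apply[symmetric])
  then show "uint (Fix \<sigma> M) \<odot> u = (SUP k. ((\<lambda>w. uint M \<odot> (u \<otimes>\<^sub>v prom w)) ^^ k) (\<lambda>_. 0))"
    unfolding uint.simps mapp_SUP_left[OF fix_iter_mono] fix_iter_cpt[OF u] .
qed (simp_all add: mapp_mcomp WK_cpt[OF u] CON_cpt[OF u] mapp_tensm EV_mapp CASE_mapp, simp add: COIN_def)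

text \<open>Each discarded entry is coalgebraic and contributes the factor \<open>1\<close>.\<close>

lemma vproj_tens:
  assumes "n < length us" "\<forall>u\<in>set us. cpt u"
  shows "vproj n \<odot> tens us = us ! n"
  using assms
proof (induction us arbitrary: n)
  case (Cons u us)
  have t: "cpt (tens us)" if "\<forall>u\<in>set us. cpt u" for us
    using that by (induction us) (simp_all add: cpt_unit cpt_tensv)
  have "H \<odot> u = prom u" "H \<odot> tens us = prom (tens us)"
    using Cons.prems t[of us] by (simp_all add: cpt_def)
  then show ?case using Cons by (cases n) (simp_all add: mapp_mcomp PRR_mapp PRL_mapp)
qed simp

lemma vproj_env:
  assumes "wf_ctx \<Gamma>" "coalgebraic_env \<Gamma> us" "n < length \<Gamma>"
  shows "vproj n \<odot> tens us = us ! n"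
proof (rule vproj_tens)
  show "n < length us" using assms(2,3) unfolding coalgebraic_env_def by (simp add: list_all2_lengthD)
  show "\<forall>u\<in>set us. cpt u"
  proof
    fix u assume "u \<in> set us"
    then obtain i where i: "i < length us" "u = us ! i" by (metis in_set_conv_nth)
    then have "coalgebraic (psem (\<Gamma> ! i)) u" "i < length \<Gamma>"
      using assms(2) unfolding coalgebraic_env_def by (auto simp: list_all2_conv_all_nth)
    then show "cpt u" using coalgebraic_psem[of "\<Gamma> ! i"] assms(1) by (simp add: wf_ctx_def)
  qed
qed

section \<open>Structural matrices as morphisms\<close>

lemma H_weaken_le:
  assumes "is_pcs X" "mor X (bang X) H" "u \<in> pts X"
  shows "(H \<odot> u) (Bag {#}) \<le> 1"
proof -
  \<comment> \<open>Every promotion has the empty product \<open>1\<close> at the empty bag, so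
    reading this entry is a functional bounded by \<open>1\<close>.\<close>
  have "unit_vec (Bag {#}) \<in> pts (dual (bang X))"
    unfolding bang_gen pts_dual_gen[OF covered_bang[OF assms(1)]] orth_def
  proof (intro CollectI conjI ballI)
    show "unit_vec (Bag {#}) \<in> vecs (bweb (web X))" by (auto simp: vecs_def unit_vec_def)
    show "pairing v (unit_vec (Bag {#})) \<le> 1" if "v \<in> {prom u |u. u \<in> pts X}" for v
      using that by auto
  qed
  from dualD[OF this morD[OF assms(2,3)]] show ?thesis by simp
qed

lemma mor_PRL:
  assumes X: "is_pcs X" and Y: "is_pcs Y" and H: "mor Y (bang Y) H"
  shows "mor (tensor X Y) X PRL"
proof (rule mor_tensorI[OF X Y X])
  fix u v assume "u \<in> pts X" "v \<in> pts Y"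
  then show "PRL \<odot> (u \<otimes>\<^sub>v v) \<in> pts X"
    unfolding PRL_mapp by (intro pts_scale[OF X] H_weaken_le[OF Y H])
qed

lemma mor_PRR:
  assumes X: "is_pcs X" and Y: "is_pcs Y" and H: "mor X (bang X) H"
  shows "mor (tensor X Y) Y PRR"
proof (rule mor_tensorI[OF X Y Y])
  fix u v assume "u \<in> pts X" "v \<in> pts Y"
  then show "PRR \<odot> (u \<otimes>\<^sub>v v) \<in> pts Y"
    unfolding PRR_mapp by (intro pts_scale[OF Y] H_weaken_le[OF X H])
qed

lemma mor_CON:
  assumes X: "is_pcs X" and H: "mor X (bang X) H"
  shows "mor X (tensor X X) CON"
proof -
  have "mor (bang X) (tensor X X) DUP"
    by (rule mor_bangI[OF X is_pcs_tensor[OF X X]]) (simp add: DUP_prom tensv_pts X)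
  then show ?thesis unfolding CON_def by (rule mor_mcomp[OF H])
qed

lemma mor_WK:
  assumes X: "is_pcs X" and H: "mor X (bang X) H"
  shows "mor X one_pcs WK"
proof -
  have "mor (bang X) one_pcs EPS"
    by (rule mor_bangI[OF X is_pcs_one]) (simp add: EPS_mapp)
  then show ?thesis unfolding WK_def by (rule mor_mcomp[OF H])
qed

lemma mor_EV:
  assumes X: "is_pcs X" and Y: "is_pcs Y"
  shows "mor (tensor (lolli X Y) X) Y EV"
proof (rule mor_tensorI[OF is_pcs_lolli[OF X Y] X Y])
  fix w v assume w: "w \<in> pts (lolli X Y)" and v: "v \<in> pts X"
  have "mor X Y (mat_of w)" using w unfolding pts_lolli_iff[OF X Y] by (rule conjunct2)
  then show "EV \<odot> (w \<otimes>\<^sub>v v) \<in> pts Y" unfolding EV_mapp using v by (rule morD)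
qed

lemma mor_CUR:
  assumes G: "is_pcs G" and X: "is_pcs X" and Y: "is_pcs Y" and T: "mor (tensor G X) Y T"
  shows "mor G (lolli X Y) (CUR (web X) T)"
  unfolding mor_def
proof
  fix u assume u: "u \<in> pts G"
  show "CUR (web X) T \<odot> u \<in> pts (lolli X Y)"
    unfolding pts_lolli_iff[OF X Y]
  proof (intro conjI allI impI)
    show "mor X Y (mat_of (CUR (web X) T \<odot> u))"
      unfolding mor_def
    proof
      fix v assume v: "v \<in> pts X"
      show "mat_of (CUR (web X) T \<odot> u) \<odot> v \<in> pts Y"
        unfolding CUR_mapp[OF pts_vecs[OF X v]] by (rule morD[OF T tensv_pts[OF G X u v]])
    qed
    fix c assume c: "c \<notin> tweb (web X) (web Y)"
    have "CUR (web X) T g c * u g = 0" for g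
    proof (cases "g \<in> web G")
      case True
      show ?thesis
      proof (cases "\<exists>a b. c = Pair a b")
        case True
        then obtain a b where ab: "c = Pair a b" by blast
        show ?thesis
        proof (cases "a \<in> web X")
          case True
          then have "b \<notin> web Y" using c ab by simp
          then have "T (Pair g a) b = 0"
            using mor_support[OF is_pcs_tensor[OF G X] Y T, of "Pair g a" b] True \<open>g \<in> web G\<close> by simp
          then show ?thesis by (simp add: CUR_def ab)
        qed (simp add: CUR_def ab)
      next
        case False
        then have "CUR (web X) T g c = 0" by (cases c) (simp_all add: CUR_def)
        then show ?thesis by simp
      qed
    next
      case False
      then show ?thesis using pts_support[OF G u] by simp
    qed
    then show "(CUR (web X) T \<odot> u) c = 0" unfolding mapp_def by (simp only: infsum_0_simp)
  qed
qed

lemma mor_CASE: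
  assumes G: "is_pcs G" and X: "is_pcs X" and Y: "is_pcs Y" and Z: "is_pcs Z"
    and S: "mor (tensor G X) Z S" and T: "mor (tensor G Y) Z T"
  shows "mor (tensor G (oplus X Y)) Z (CASE S T)"
proof (rule mor_tensorI[OF G is_pcs_oplus[OF X Y] Z])
  fix u w assume u: "u \<in> pts G" and w: "w \<in> pts (oplus X Y)"
  obtain x y where xy: "x \<in> pts X" "y \<in> pts Y" "w = cotup x y" using pts_oplus[OF X Y w] by blast
  \<comment> \<open>With the context frozen at \<open>u\<close> the branches become morphisms out of
    the summands, and their copairing is the case distinction.\<close>
  let ?S = "\<lambda>a. S \<odot> (u \<otimes>\<^sub>v unit_vec a)" and ?T = "\<lambda>a. T \<odot> (u \<otimes>\<^sub>v unit_vec a)"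
  have "mor X Z ?S" "mor Y Z ?T"
    unfolding mor_def tensv_mat_right
    using morD[OF S tensv_pts[OF G X u]] morD[OF T tensv_pts[OF G Y u]] by blast+
  then have "copair ?S ?T \<odot> w \<in> pts Z" using morD[OF mor_copair[OF X Y Z] w] by blast
  moreover have "copair ?S ?T \<odot> w = CASE S T \<odot> (u \<otimes>\<^sub>v w)"
    by (simp add: xy(3) copair_cotup CASE_mapp tensv_mat_right)
  ultimately show "CASE S T \<odot> (u \<otimes>\<^sub>v w) \<in> pts Z" by simp
qed

lemma mor_COIN:
  assumes "0 \<le> p" "p \<le> 1"
  shows "mor one_pcs (oplus one_pcs one_pcs) (COIN p)"
proof (rule mor_oneI)
  note O = is_pcs_oplus[OF is_pcs_one is_pcs_one]
  show "is_pcs (oplus one_pcs one_pcs)" by (rule O)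
  have "unit_vec (In i Star) \<in> pts (oplus one_pcs one_pcs)" for i
    using morD[OF mor_InjU(1)[OF is_pcs_one is_pcs_one] unit_vec_one]
      morD[OF mor_InjU(2)[OF is_pcs_one is_pcs_one] unit_vec_one]
    by (cases i) (simp_all add: InjU_def)
  moreover have "ennreal (of_rat p) + ennreal (1 - of_rat p) \<le> 1"
    using assms by (simp add: ennreal_plus[symmetric] del: ennreal_plus)
  ultimately show "COIN p Star \<in> pts (oplus one_pcs one_pcs)"
    unfolding COIN_def by (intro pts_convex[OF O])
qed

section \<open>Closedness of the types in a derivation\<close>

lemma closed_lift:
  "ptclosed j \<phi> \<Longrightarrow> ptclosed (Suc j) (ptlift k \<phi>)" "gtclosed j \<sigma> \<Longrightarrow> gtclosed (Suc j) (gtlift k \<sigma>)"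
  by (induction \<phi> and \<sigma> arbitrary: j k and j k) simp_all

lemma closed_subst:
  "ptclosed (Suc j) \<phi> \<Longrightarrow> ptclosed j \<theta> \<Longrightarrow> k \<le> j \<Longrightarrow> ptclosed j (ptsubst \<phi> k \<theta>)"
  "gtclosed (Suc j) \<sigma> \<Longrightarrow> ptclosed j \<theta> \<Longrightarrow> k \<le> j \<Longrightarrow> gtclosed j (gtsubst \<sigma> k \<theta>)"
  by (induction \<phi> and \<sigma> arbitrary: j k \<theta> and j k \<theta>) (auto simp: closed_lift)

text \<open>The premise of the rule for \<open>Fold\<close> mentions only the unfolded type; this
  recovers the closedness of \<open>Mu \<psi>\<close> from it.\<close>

lemma closed_subst_rev:
  "ptclosed j (ptsubst \<phi> k \<theta>) \<Longrightarrow> k \<le> j \<Longrightarrow> ptclosed (Suc j) \<phi>"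
  "gtclosed j (gtsubst \<sigma> k \<theta>) \<Longrightarrow> k \<le> j \<Longrightarrow> gtclosed (Suc j) \<sigma>"
proof (induction \<phi> and \<sigma> arbitrary: j k \<theta> and j k \<theta>)
  case (TVar n)
  then show ?case by (auto split: if_splits)
next
  case (Mu \<phi>)
  then show ?case by (metis Suc_le_mono ptclosed.simps(6) ptsubst.simps(6))
qed auto

lemma typing_closed: "\<Gamma> \<turnstile> M \<Ztypecolon> \<sigma> \<Longrightarrow> wf_ctx \<Gamma> \<and> gtclosed 0 \<sigma>"
proof (induction rule: typing.induct)
  case (t_fold \<Gamma> M \<psi>)
  then show ?case using closed_subst_rev(1)[of 0 \<psi> 0 "Mu \<psi>"] by simp
next
  case (t_unfold \<Gamma> M \<psi>)
  then show ?case using closed_subst(1)[of 0 \<psi> "Mu \<psi>" 0] by simp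
next
  case (t_var \<Gamma> n)
  then show ?case by (simp add: wf_ctx_def)
qed simp_all

lemma mor_vproj:
  assumes "wf_ctx \<Gamma>" "n < length \<Gamma>"
  shows "mor (ctx_sem \<Gamma>) (fst (psem (\<Gamma> ! n))) (vproj n)"
  using assms
proof (induction \<Gamma> arbitrary: n)
  case (Cons \<phi> \<Gamma>)
  have c: "ptclosed 0 \<phi>" "wf_ctx \<Gamma>" using Cons.prems by simp_all
  note G = is_pcs_ctx[OF c(2)] and X = is_coalg_pcs[OF is_coalg_psem[OF c(1)]]
  show ?case
  proof (cases n)
    case 0
    then show ?thesis using mor_PRR[OF G X mor_H_ctx[OF c(2)]] by simp
  next
    case (Suc m)
    have "mor (ctx_sem \<Gamma>) (fst (psem (\<Gamma> ! m))) (vproj m)" using Cons Suc by simp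
    from mor_mcomp[OF mor_PRL[OF G X good_mor[OF is_coalg_psem[OF c(1)] good_psem[OF c(1)]]] this]
    show ?thesis using Suc by simp
  qed
qed simp

lemma mor_fix:
  assumes G: "is_pcs G" "mor G (bang G) H" and Z: "is_pcs Z" and m: "mor (tensor G (bang Z)) Z m"
  shows "mor G Z (fix_iter m k)" "mor G Z (\<lambda>a b. SUP k. fix_iter m k a b)"
proof -
  note B = is_pcs_bang[OF Z]
  show it: "mor G Z (fix_iter m k)" for k
  proof (induction k)
    case 0
    then show ?case using pts_zero[OF Z] by (simp add: mor_def)
  next
    case (Suc k)
    have "mor G (bang Z) (bangu (fix_iter m k) \<circ>\<^sub>m H)"
      by (rule mor_mcomp[OF G(2) mor_bangu[OF G(1) Z Suc]])
    from mor_mcomp[OF mor_mcomp[OF mor_CON[OF G] mor_tensm[OF G(1) G(1) G(1) B mor_IDU this]] m]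
    show ?case by simp
  qed
  show "mor G Z (\<lambda>a b. SUP k. fix_iter m k a b)"
    unfolding mor_def mapp_SUP_left[OF fix_iter_mono]
  proof
    fix u assume u: "u \<in> pts G"
    have "incseq (\<lambda>k. fix_iter m k \<odot> u)"
      using fix_iter_mono[of m] unfolding incseq_def
      by (intro allI impI mapp_mono order_refl) (simp add: le_funD)
    then show "(\<lambda>b. SUP k. (fix_iter m k \<odot> u) b) \<in> pts Z"
      by (rule pts_SUP[OF Z]) (rule morD[OF it u])
  qed
qed

text \<open>The same matrix \<open>uint M\<close> is a morphism for every typing of
  \<open>M\<close>; only the web to which it is restricted varies.\<close>

lemma typing_mor: "\<Gamma> \<turnstile> M \<Ztypecolon> \<sigma> \<Longrightarrow> mor (ctx_sem \<Gamma>) (gsem \<sigma>) (uint M)"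
proof (induction rule: typing.induct)
  case (t_var \<Gamma> n)
  then show ?case using mor_vproj by (simp add: gsem_simps)
next
  case (t_unit \<Gamma>)
  then show ?case using mor_WK[OF is_pcs_ctx mor_H_ctx] by (simp add: gsem_simps psem_simps one_coalg_eq)
next
  case (t_stop \<Gamma> M \<sigma>)
  note c = typing_closed[OF t_stop.hyps]
  note G = is_pcs_ctx[OF conjunct1[OF c]] and HG = mor_H_ctx[OF conjunct1[OF c]]
  show ?case
    using mor_mcomp[OF HG mor_bangu[OF G is_pcs_gsem[OF conjunct2[OF c]] t_stop.IH]]
    by (simp add: gsem_simps psem_simps)
next
  case (t_tup \<Gamma> M \<phi>\<^sub>l N \<phi>\<^sub>r)
  note c = typing_closed[OF t_tup.hyps(1)] and c' = typing_closed[OF t_tup.hyps(2)]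
  note G = is_pcs_ctx[OF conjunct1[OF c]] and HG = mor_H_ctx[OF conjunct1[OF c]]
  show ?case
    using mor_mcomp[OF mor_CON[OF G HG] mor_tensm[OF G G is_pcs_gsem[OF conjunct2[OF c]] is_pcs_gsem[OF conjunct2[OF c']] t_tup.IH]]
    by (simp add: gsem_simps psem_simps)
next
  case (t_inl \<Gamma> M \<phi>\<^sub>l \<phi>\<^sub>r)
  note c = typing_closed[OF t_inl.hyps(1)]
  show ?case
    using mor_mcomp[OF t_inl.IH] mor_InjU(1)[OF is_pcs_gsem[OF conjunct2[OF c]] is_pcs_gsem[of "Pos \<phi>\<^sub>r"]] t_inl.hyps
    by (simp add: gsem_simps psem_simps)
next
  case (t_inr \<Gamma> M \<phi>\<^sub>r \<phi>\<^sub>l)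
  note c = typing_closed[OF t_inr.hyps(1)]
  show ?case
    using mor_mcomp[OF t_inr.IH] mor_InjU(2)[OF is_pcs_gsem[of "Pos \<phi>\<^sub>l"] is_pcs_gsem[OF conjunct2[OF c]]] t_inr.hyps
    by (simp add: gsem_simps psem_simps)
next
  case (t_lam \<phi> \<Gamma> M \<sigma>)
  have c: "wf_ctx \<Gamma>" "ptclosed 0 \<phi>" "gtclosed 0 \<sigma>" using typing_closed[OF t_lam.hyps] by simp_all
  show ?case
    using mor_CUR[OF is_pcs_ctx[OF c(1)] is_coalg_pcs[OF is_coalg_psem[OF c(2)]] is_pcs_gsem[OF c(3)]] t_lam.IH
    by (simp add: gsem_simps)
next
  case (t_app \<Gamma> M \<phi> \<sigma> N)
  have c: "wf_ctx \<Gamma>" "ptclosed 0 \<phi>" "gtclosed 0 \<sigma>" using typing_closed[OF t_app.hyps(1)] by simp_all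
  note G = is_pcs_ctx[OF c(1)] and HG = mor_H_ctx[OF c(1)]
    and X = is_coalg_pcs[OF is_coalg_psem[OF c(2)]] and Y = is_pcs_gsem[OF c(3)]
  have M: "mor (ctx_sem \<Gamma>) (lolli (fst (psem \<phi>)) (gsem \<sigma>)) (uint M)"
    and N: "mor (ctx_sem \<Gamma>) (fst (psem \<phi>)) (uint N)" using t_app.IH by (simp_all add: gsem_simps)
  show ?case
    using mor_mcomp[OF mor_mcomp[OF mor_CON[OF G HG] mor_tensm[OF G G is_pcs_lolli[OF X Y] X M N]] mor_EV[OF X Y]]
    by simp
next
  case (t_case \<Gamma> M \<phi>\<^sub>l \<phi>\<^sub>r N\<^sub>l \<sigma> N\<^sub>r)
  have c: "wf_ctx \<Gamma>" "ptclosed 0 \<phi>\<^sub>l" "ptclosed 0 \<phi>\<^sub>r" "gtclosed 0 \<sigma>"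
    using typing_closed[OF t_case.hyps(1)] typing_closed[OF t_case.hyps(2)] by simp_all
  note G = is_pcs_ctx[OF c(1)] and HG = mor_H_ctx[OF c(1)]
    and X = is_coalg_pcs[OF is_coalg_psem[OF c(2)]] and Y = is_coalg_pcs[OF is_coalg_psem[OF c(3)]]
    and Z = is_pcs_gsem[OF c(4)]
  have M: "mor (ctx_sem \<Gamma>) (oplus (fst (psem \<phi>\<^sub>l)) (fst (psem \<phi>\<^sub>r))) (uint M)"
    using t_case.IH(1) by (simp add: gsem_simps psem_simps)
  have N: "mor (tensor (ctx_sem \<Gamma>) (fst (psem \<phi>\<^sub>l))) (gsem \<sigma>) (uint N\<^sub>l)"
    "mor (tensor (ctx_sem \<Gamma>) (fst (psem \<phi>\<^sub>r))) (gsem \<sigma>) (uint N\<^sub>r)" using t_case.IH(2,3) by simp_all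
  show ?case
    using mor_mcomp[OF mor_mcomp[OF mor_CON[OF G HG] mor_tensm[OF G G G is_pcs_oplus[OF X Y] mor_IDU M]]
        mor_CASE[OF G X Y Z N]] by simp
next
  case (t_prl \<Gamma> M \<phi>\<^sub>l \<phi>\<^sub>r)
  have c: "ptclosed 0 \<phi>\<^sub>l" "ptclosed 0 \<phi>\<^sub>r" using typing_closed[OF t_prl.hyps] by simp_all
  note X = is_coalg_psem[OF c(1)] and Y = is_coalg_psem[OF c(2)]
  have M: "mor (ctx_sem \<Gamma>) (tensor (fst (psem \<phi>\<^sub>l)) (fst (psem \<phi>\<^sub>r))) (uint M)"
    using t_prl.IH by (simp add: gsem_simps psem_simps)
  show ?case
    using mor_mcomp[OF M mor_PRL[OF is_coalg_pcs[OF X] is_coalg_pcs[OF Y] good_mor[OF Y good_psem[OF c(2)]]]]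
    by (simp add: gsem_simps)
next
  case (t_prr \<Gamma> M \<phi>\<^sub>l \<phi>\<^sub>r)
  have c: "ptclosed 0 \<phi>\<^sub>l" "ptclosed 0 \<phi>\<^sub>r" using typing_closed[OF t_prr.hyps] by simp_all
  note X = is_coalg_psem[OF c(1)] and Y = is_coalg_psem[OF c(2)]
  have M: "mor (ctx_sem \<Gamma>) (tensor (fst (psem \<phi>\<^sub>l)) (fst (psem \<phi>\<^sub>r))) (uint M)"
    using t_prr.IH by (simp add: gsem_simps psem_simps)
  show ?case
    using mor_mcomp[OF M mor_PRR[OF is_coalg_pcs[OF X] is_coalg_pcs[OF Y] good_mor[OF X good_psem[OF c(1)]]]]
    by (simp add: gsem_simps)
next
  case (t_go \<Gamma> M \<sigma>)
  have c: "gtclosed 0 \<sigma>" using typing_closed[OF t_go.hyps] by simp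
  have M: "mor (ctx_sem \<Gamma>) (bang (gsem \<sigma>)) (uint M)" using t_go.IH by (simp add: gsem_simps psem_simps)
  show ?case using mor_mcomp[OF M mor_DER[OF is_pcs_gsem[OF c]]] by simp
next
  case (t_fix \<sigma> \<Gamma> M)
  have c: "wf_ctx \<Gamma>" "gtclosed 0 \<sigma>" using typing_closed[OF t_fix.hyps] by simp_all
  have M: "mor (tensor (ctx_sem \<Gamma>) (bang (gsem \<sigma>))) (gsem \<sigma>) (uint M)"
    using t_fix.IH by (simp add: psem_simps)
  show ?case using mor_fix(2)[OF is_pcs_ctx[OF c(1)] mor_H_ctx[OF c(1)] is_pcs_gsem[OF c(2)] M] by simp
next
  case (t_fold \<Gamma> M \<psi>)
  have "ptclosed 0 (Mu \<psi>)" using typing_closed[OF typing.t_fold[OF t_fold.hyps]] by simp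
  then show ?case using t_fold.IH psem_unfold by (simp add: gsem_simps)
next
  case (t_unfold \<Gamma> M \<psi>)
  have "ptclosed 0 (Mu \<psi>)" using typing_closed[OF t_unfold.hyps] by simp
  then show ?case using t_unfold.IH psem_unfold by (simp add: gsem_simps)
next
  case (t_coin \<Gamma> p)
  show ?case
    using mor_mcomp[OF mor_WK[OF is_pcs_ctx[OF t_coin.hyps(1)] mor_H_ctx[OF t_coin.hyps(1)]] mor_COIN[OF t_coin.hyps(2,3)]]
    by (simp add: gsem_simps psem_simps one_coalg_eq)
qed


section \<open>Coherence of the semantics\<close>

abbreviation csem :: "ctx \<Rightarrow> tm \<Rightarrow> mat" where
  "csem \<Gamma> M \<equiv> rowr (web (ctx_sem \<Gamma>)) (uint M)"

lemma csem_app: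
  assumes "wf_ctx \<Gamma>" "coalgebraic_env \<Gamma> us"
  shows "csem \<Gamma> M \<odot> tens us = uint M \<odot> tens us"
  using tens_env[OF assms] by (intro rowr_mapp pts_vecs[OF is_pcs_ctx[OF assms(1)]]) blast

lemma uint_pts:
  assumes "\<Gamma> \<turnstile> M \<Ztypecolon> \<sigma>" "coalgebraic_env \<Gamma> us"
  shows "uint M \<odot> tens us \<in> pts (gsem \<sigma>)"
  using tens_env[of \<Gamma> us] typing_closed[OF assms(1)] assms(2) by (intro morD[OF typing_mor[OF assms(1)]]) blast

text \<open>A prescription on coalgebraic environments has at most one solution by separation, and
  the universal interpretation solves it. Rules of \<open>denotes\<close> stated through
  \<open>represents\<close> thereby have a definite result.\<close>

lemma represents_iff:
  assumes M: "\<Gamma> \<turnstile> M \<Ztypecolon> \<sigma>"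
    and f: "\<And>us. coalgebraic_env \<Gamma> us \<Longrightarrow> cpt (tens us) \<Longrightarrow> uint M \<odot> tens us = f us"
  shows "represents \<Gamma> \<sigma> f t \<longleftrightarrow> t = csem \<Gamma> M"
proof -
  have c: "wf_ctx \<Gamma>" "gtclosed 0 \<sigma>" using typing_closed[OF M] by blast+
  note G = is_pcs_ctx[OF c(1)] and Z = is_pcs_gsem[OF c(2)]
  have f': "uint M \<odot> tens us = f us" if "coalgebraic_env \<Gamma> us" for us
    using f[OF that] tens_env[OF c(1) that] by blast
  show ?thesis
  proof
    assume r: "represents \<Gamma> \<sigma> f t"
    then have t: "mor (ctx_sem \<Gamma>) (gsem \<sigma>) t" "\<And>a. a \<notin> web (ctx_sem \<Gamma>) \<Longrightarrow> t a = (\<lambda>_. 0)"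
      unfolding represents_def Pcoh_iff[OF G Z] by blast+
    have "rowr (web (ctx_sem \<Gamma>)) t = csem \<Gamma> M"
    proof (rule ctx_mor_eq[OF c(1) Z t(1) typing_mor[OF M]])
      fix us assume us: "coalgebraic_env \<Gamma> us"
      then have "t \<odot> tens us = f us" using r unfolding represents_def by blast
      then show "t \<odot> tens us = uint M \<odot> tens us" using f'[OF us] by simp
    qed
    then show "t = csem \<Gamma> M" using rowr_id[OF t(2)] by simp
  next
    assume t: "t = csem \<Gamma> M"
    show "represents \<Gamma> \<sigma> f t"
      unfolding represents_def t
      using rowr_Pcoh[OF G Z typing_mor[OF M]] csem_app[OF c(1)] f' by simp
  qed
qed

lemma restrm_mapp: "restrm i X \<odot> w = rst (web X) (component i w)"
proof
  fix b
  show "(restrm i X \<odot> w) b = rst (web X) (component i w) b"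
    unfolding mapp_def by (subst infsum_single_point[where a = "In i b"]) (auto simp: restrm_def rst_def component_def)
qed

lemma restrm_oplus:
  assumes "is_pcs X" "is_pcs Y" "w \<in> pts (oplus X Y)"
  shows "restrm Lft X \<odot> w = component Lft w" "restrm Rgt Y \<odot> w = component Rgt w"
proof -
  obtain u v where "u \<in> pts X" "v \<in> pts Y" "w = cotup u v" using pts_oplus[OF assms] by blast
  then show "restrm Lft X \<odot> w = component Lft w" "restrm Rgt Y \<odot> w = component Rgt w"
    by (simp_all add: restrm_mapp rst_vecs_id[OF pts_vecs[OF assms(1)]] rst_vecs_id[OF pts_vecs[OF assms(2)]])
qed

lemma prl_mapp:
  assumes C: "is_coalg C" and D: "is_coalg D" "good D" and w: "w \<in> pts (tensor (fst C) (fst D))"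
  shows "prl C D \<odot> w = PRL \<odot> w"
proof (rule mapp_eq_on)
  show "w \<in> vecs (tweb (web (fst C)) (web (fst D)))"
    using pts_vecs[OF is_pcs_tensor[OF is_coalg_pcs[OF C] is_coalg_pcs[OF D(1)]] w] by simp
  fix c assume "c \<in> tweb (web (fst C)) (web (fst D))"
  then obtain a b where c: "c = Pair a b" "a \<in> web (fst C)" "b \<in> web (fst D)" by (auto simp: tweb_def)
  show "prl C D c = PRL c"
    using good_row[OF D(2) c(3)] c(2) by (intro ext) (simp add: prl_def PRL_def c(1) case_prod_beta)
qed

lemma prr_mapp:
  assumes C: "is_coalg C" "good C" and D: "is_coalg D" and w: "w \<in> pts (tensor (fst C) (fst D))"
  shows "prr C D \<odot> w = PRR \<odot> w"
proof (rule mapp_eq_on)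
  show "w \<in> vecs (tweb (web (fst C)) (web (fst D)))"
    using pts_vecs[OF is_pcs_tensor[OF is_coalg_pcs[OF C(1)] is_coalg_pcs[OF D]] w] by simp
  fix c assume "c \<in> tweb (web (fst C)) (web (fst D))"
  then obtain a b where c: "c = Pair a b" "a \<in> web (fst C)" "b \<in> web (fst D)" by (auto simp: tweb_def)
  show "prr C D c = PRR c"
    using good_row[OF C(2) c(2)] c(3) by (intro ext) (simp add: prr_def PRR_def c(1) case_prod_beta)
qed

lemma rep_var:
  assumes "wf_ctx \<Gamma>" "n < length \<Gamma>"
  shows "represents \<Gamma> (Pos (\<Gamma> ! n)) (\<lambda>us. us ! n) t \<longleftrightarrow> t = csem \<Gamma> (Var n)"
  by (rule represents_iff[OF t_var[OF assms]]) (simp add: vproj_env[OF assms(1) _ assms(2)])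

lemma rep_unit:
  assumes "wf_ctx \<Gamma>"
  shows "represents \<Gamma> (Pos One) (\<lambda>us. unit_vec Star) t \<longleftrightarrow> t = csem \<Gamma> Unit"
  by (rule represents_iff[OF t_unit[OF assms]]) (rule uint_cpt(1))

lemma rep_stop:
  assumes M: "\<Gamma> \<turnstile> M \<Ztypecolon> \<sigma>"
  shows "represents \<Gamma> (Pos (Bang \<sigma>)) (\<lambda>us. prom (csem \<Gamma> M \<odot> tens us)) t \<longleftrightarrow> t = csem \<Gamma> (Stop M)"
  using csem_app[OF conjunct1[OF typing_closed[OF M]]]
  by (intro represents_iff[OF t_stop[OF M]]) (simp only: uint_cpt(2))

lemma rep_tup:
  assumes M: "\<Gamma> \<turnstile> M \<Ztypecolon> Pos \<phi>\<^sub>l" and N: "\<Gamma> \<turnstile> N \<Ztypecolon> Pos \<phi>\<^sub>r"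
  shows "represents \<Gamma> (Pos (Tensor \<phi>\<^sub>l \<phi>\<^sub>r)) (\<lambda>us. (csem \<Gamma> M \<odot> tens us) \<otimes>\<^sub>v (csem \<Gamma> N \<odot> tens us)) t
    \<longleftrightarrow> t = csem \<Gamma> (Tup M N)"
  using csem_app[OF conjunct1[OF typing_closed[OF M]]]
  by (intro represents_iff[OF t_tup[OF M N]]) (simp only: uint_cpt(3))

lemma injm_mapp: "is_pcs X \<Longrightarrow> w \<in> pts X \<Longrightarrow> injm i X \<odot> w = InjU i \<odot> w"
  unfolding injm_eq by (rule rowr_mapp[OF pts_vecs])

lemma rep_inl:
  assumes M: "\<Gamma> \<turnstile> M \<Ztypecolon> Pos \<phi>\<^sub>l" and c: "ptclosed 0 \<phi>\<^sub>r"
  shows "represents \<Gamma> (Pos (Plus \<phi>\<^sub>l \<phi>\<^sub>r)) (\<lambda>us. injm Lft (fst (psem \<phi>\<^sub>l)) \<odot> csem \<Gamma> M \<odot> tens us) t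
    \<longleftrightarrow> t = csem \<Gamma> (Inj Lft M)"
proof (rule represents_iff[OF t_inl[OF M c]])
  fix us assume us: "coalgebraic_env \<Gamma> us" and "cpt (tens us)"
  have "is_pcs (fst (psem \<phi>\<^sub>l))" using is_pcs_gsem typing_closed[OF M] by (simp add: gsem_simps[symmetric])
  then show "uint (Inj Lft M) \<odot> tens us = injm Lft (fst (psem \<phi>\<^sub>l)) \<odot> csem \<Gamma> M \<odot> tens us"
    using uint_pts[OF M us] csem_app[OF conjunct1[OF typing_closed[OF M]] us] uint_cpt(4)[OF \<open>cpt (tens us)\<close>]
    by (simp add: injm_mapp gsem_simps)
qed

lemma rep_inr:
  assumes M: "\<Gamma> \<turnstile> M \<Ztypecolon> Pos \<phi>\<^sub>r" and c: "ptclosed 0 \<phi>\<^sub>l"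
  shows "represents \<Gamma> (Pos (Plus \<phi>\<^sub>l \<phi>\<^sub>r)) (\<lambda>us. injm Rgt (fst (psem \<phi>\<^sub>r)) \<odot> csem \<Gamma> M \<odot> tens us) t
    \<longleftrightarrow> t = csem \<Gamma> (Inj Rgt M)"
proof (rule represents_iff[OF t_inr[OF M c]])
  fix us assume us: "coalgebraic_env \<Gamma> us" and "cpt (tens us)"
  have "is_pcs (fst (psem \<phi>\<^sub>r))" using is_pcs_gsem typing_closed[OF M] by (simp add: gsem_simps[symmetric])
  then show "uint (Inj Rgt M) \<odot> tens us = injm Rgt (fst (psem \<phi>\<^sub>r)) \<odot> csem \<Gamma> M \<odot> tens us"
    using uint_pts[OF M us] csem_app[OF conjunct1[OF typing_closed[OF M]] us] uint_cpt(4)[OF \<open>cpt (tens us)\<close>]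
    by (simp add: injm_mapp gsem_simps)
qed

lemma uint_lam:
  assumes M: "\<phi> # \<Gamma> \<turnstile> M \<Ztypecolon> \<sigma>" and v: "coalgebraic (psem \<phi>) v"
  shows "mat_of (uint (Lam \<phi> M) \<odot> u) \<odot> v = uint M \<odot> (u \<otimes>\<^sub>v v)"
proof -
  have c: "ptclosed 0 \<phi>" using typing_closed[OF M] by simp
  have "v \<in> vecs (web (fst (psem \<phi>)))"
    using v coalgebraic_psem[OF c] by (intro pts_vecs is_coalg_pcs is_coalg_psem c) blast
  then show ?thesis by (simp add: CUR_mapp)
qed

text \<open>The rule constrains the denotation only through application to coalgebraic arguments,
  hence the extra appeal to separation at the argument type.\<close>

lemma rep_lam:
  assumes M: "\<phi> # \<Gamma> \<turnstile> M \<Ztypecolon> \<sigma>"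
  shows "(t \<in> Pcoh (ctx_sem \<Gamma>) (gsem (Lolli \<phi> \<sigma>)) \<and> (\<forall>us v. coalgebraic_env \<Gamma> us \<and> coalgebraic (psem \<phi>) v \<longrightarrow>
        mat_of (t \<odot> tens us) \<odot> v = csem (\<phi> # \<Gamma>) M \<odot> (tens us \<otimes>\<^sub>v v))) \<longleftrightarrow> t = csem \<Gamma> (Lam \<phi> M)"
proof -
  have c': "wf_ctx (\<phi> # \<Gamma>)" and c: "wf_ctx \<Gamma>" "ptclosed 0 \<phi>" "gtclosed 0 \<sigma>" using typing_closed[OF M] by simp_all
  note L = t_lam[OF M]
  note G = is_pcs_ctx[OF c(1)] and X = is_coalg_pcs[OF is_coalg_psem[OF c(2)]] and Y = is_pcs_gsem[OF c(3)]
  have Z: "is_pcs (gsem (Lolli \<phi> \<sigma>))" by (rule is_pcs_gsem) (use c in simp)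
  have app: "csem (\<phi> # \<Gamma>) M \<odot> (tens us \<otimes>\<^sub>v v) = mat_of (uint (Lam \<phi> M) \<odot> tens us) \<odot> v"
    if "coalgebraic_env \<Gamma> us" "coalgebraic (psem \<phi>) v" for us v
    using csem_app[OF c', of "v # us" M] that uint_lam[OF M that(2)] by simp
  show ?thesis
  proof
    assume a: "t \<in> Pcoh (ctx_sem \<Gamma>) (gsem (Lolli \<phi> \<sigma>)) \<and> (\<forall>us v. coalgebraic_env \<Gamma> us \<and> coalgebraic (psem \<phi>) v \<longrightarrow>
        mat_of (t \<odot> tens us) \<odot> v = csem (\<phi> # \<Gamma>) M \<odot> (tens us \<otimes>\<^sub>v v))"
    then have t: "mor (ctx_sem \<Gamma>) (gsem (Lolli \<phi> \<sigma>)) t" "\<And>a. a \<notin> web (ctx_sem \<Gamma>) \<Longrightarrow> t a = (\<lambda>_. 0)"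
      unfolding Pcoh_iff[OF G Z] by blast+
    have "rowr (web (ctx_sem \<Gamma>)) t = csem \<Gamma> (Lam \<phi> M)"
    proof (rule ctx_mor_eq[OF c(1) Z t(1) typing_mor[OF L]])
      fix us assume us: "coalgebraic_env \<Gamma> us"
      have "tens us \<in> pts (ctx_sem \<Gamma>)" using tens_env[OF c(1) us] by blast
      then have w: "t \<odot> tens us \<in> pts (lolli (fst (psem \<phi>)) (gsem \<sigma>))"
        using morD[OF t(1)] by (simp add: gsem_simps)
      have w': "uint (Lam \<phi> M) \<odot> tens us \<in> pts (lolli (fst (psem \<phi>)) (gsem \<sigma>))"
        using uint_pts[OF L us] by (simp add: gsem_simps)
      show "t \<odot> tens us = uint (Lam \<phi> M) \<odot> tens us"
      proof (rule lolli_eqI[OF X Y good_sep[OF good_psem[OF c(2)]] w w'])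
        fix v assume "v \<in> {u \<in> pts (fst (psem \<phi>)). cpt u}"
        then have v: "coalgebraic (psem \<phi>) v" using coalgebraic_psem[OF c(2)] by blast
        then have "mat_of (t \<odot> tens us) \<odot> v = csem (\<phi> # \<Gamma>) M \<odot> (tens us \<otimes>\<^sub>v v)" using a us by blast
        then show "mat_of (t \<odot> tens us) \<odot> v = mat_of (uint (Lam \<phi> M) \<odot> tens us) \<odot> v" using app[OF us v] by simp
      qed
    qed
    then show "t = csem \<Gamma> (Lam \<phi> M)" using rowr_id[OF t(2)] by simp
  next
    assume t: "t = csem \<Gamma> (Lam \<phi> M)"
    show "t \<in> Pcoh (ctx_sem \<Gamma>) (gsem (Lolli \<phi> \<sigma>)) \<and> (\<forall>us v. coalgebraic_env \<Gamma> us \<and> coalgebraic (psem \<phi>) v \<longrightarrow>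
        mat_of (t \<odot> tens us) \<odot> v = csem (\<phi> # \<Gamma>) M \<odot> (tens us \<otimes>\<^sub>v v))"
      unfolding t
    proof (intro conjI allI impI)
      show "csem \<Gamma> (Lam \<phi> M) \<in> Pcoh (ctx_sem \<Gamma>) (gsem (Lolli \<phi> \<sigma>))" by (rule rowr_Pcoh[OF G Z typing_mor[OF L]])
      fix us v assume "coalgebraic_env \<Gamma> us \<and> coalgebraic (psem \<phi>) v"
      then have e: "coalgebraic_env \<Gamma> us" "coalgebraic (psem \<phi>) v" by blast+
      show "mat_of (csem \<Gamma> (Lam \<phi> M) \<odot> tens us) \<odot> v = csem (\<phi> # \<Gamma>) M \<odot> (tens us \<otimes>\<^sub>v v)"
        unfolding app[OF e] csem_app[OF c(1) e(1)] ..
    qed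
  qed
qed

lemma rep_app:
  assumes M: "\<Gamma> \<turnstile> M \<Ztypecolon> Lolli \<phi> \<sigma>" and N: "\<Gamma> \<turnstile> N \<Ztypecolon> Pos \<phi>"
  shows "represents \<Gamma> \<sigma> (\<lambda>us. mat_of (csem \<Gamma> M \<odot> tens us) \<odot> csem \<Gamma> N \<odot> tens us) t \<longleftrightarrow> t = csem \<Gamma> (App M N)"
  using csem_app[OF conjunct1[OF typing_closed[OF M]]]
  by (intro represents_iff[OF t_app[OF M N]]) (simp only: uint_cpt(5))

text \<open>The components passed to the branches are points of the summands, which is enough for
  the restricted matrices \<open>csem\<close> to agree with \<open>uint\<close> on them.\<close>

lemma rep_case:
  assumes M: "\<Gamma> \<turnstile> M \<Ztypecolon> Pos (Plus \<phi>\<^sub>l \<phi>\<^sub>r)" and N: "\<phi>\<^sub>l # \<Gamma> \<turnstile> N\<^sub>l \<Ztypecolon> \<sigma>" "\<phi>\<^sub>r # \<Gamma> \<turnstile> N\<^sub>r \<Ztypecolon> \<sigma>"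
  shows "represents \<Gamma> \<sigma> (\<lambda>us b.
        (csem (\<phi>\<^sub>l # \<Gamma>) N\<^sub>l \<odot> (tens us \<otimes>\<^sub>v (restrm Lft (fst (psem \<phi>\<^sub>l)) \<odot> csem \<Gamma> M \<odot> tens us))) b +
        (csem (\<phi>\<^sub>r # \<Gamma>) N\<^sub>r \<odot> (tens us \<otimes>\<^sub>v (restrm Rgt (fst (psem \<phi>\<^sub>r)) \<odot> csem \<Gamma> M \<odot> tens us))) b) t
    \<longleftrightarrow> t = csem \<Gamma> (Case M N\<^sub>l N\<^sub>r)"
proof (rule represents_iff[OF t_case[OF M N]])
  fix us assume us: "coalgebraic_env \<Gamma> us" and cp: "cpt (tens us)"
  have c: "wf_ctx \<Gamma>" "ptclosed 0 \<phi>\<^sub>l" "ptclosed 0 \<phi>\<^sub>r" using typing_closed[OF M] by simp_all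
  note X = is_coalg_pcs[OF is_coalg_psem[OF c(2)]] and Y = is_coalg_pcs[OF is_coalg_psem[OF c(3)]]
  note G = is_pcs_ctx[OF c(1)]
  let ?w = "uint M \<odot> tens us"
  have g: "tens us \<in> pts (ctx_sem \<Gamma>)" using tens_env[OF c(1) us] by blast
  have w: "?w \<in> pts (oplus (fst (psem \<phi>\<^sub>l)) (fst (psem \<phi>\<^sub>r)))"
    using uint_pts[OF M us] by (simp add: gsem_simps psem_simps)
  then have comp: "component Lft ?w \<in> pts (fst (psem \<phi>\<^sub>l))" "component Rgt ?w \<in> pts (fst (psem \<phi>\<^sub>r))"
    using pts_oplus[OF X Y w] by auto
  have "csem (\<phi>\<^sub>l # \<Gamma>) N\<^sub>l \<odot> (tens us \<otimes>\<^sub>v component Lft ?w) = uint N\<^sub>l \<odot> (tens us \<otimes>\<^sub>v component Lft ?w)"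
    using pts_vecs[OF is_pcs_tensor[OF G X] tensv_pts[OF G X g comp(1)]] by (simp add: rowr_mapp)
  moreover have "csem (\<phi>\<^sub>r # \<Gamma>) N\<^sub>r \<odot> (tens us \<otimes>\<^sub>v component Rgt ?w) = uint N\<^sub>r \<odot> (tens us \<otimes>\<^sub>v component Rgt ?w)"
    using pts_vecs[OF is_pcs_tensor[OF G Y] tensv_pts[OF G Y g comp(2)]] by (simp add: rowr_mapp)
  ultimately show "uint (Case M N\<^sub>l N\<^sub>r) \<odot> tens us = (\<lambda>b.
        (csem (\<phi>\<^sub>l # \<Gamma>) N\<^sub>l \<odot> (tens us \<otimes>\<^sub>v (restrm Lft (fst (psem \<phi>\<^sub>l)) \<odot> csem \<Gamma> M \<odot> tens us))) b +
        (csem (\<phi>\<^sub>r # \<Gamma>) N\<^sub>r \<odot> (tens us \<otimes>\<^sub>v (restrm Rgt (fst (psem \<phi>\<^sub>r)) \<odot> csem \<Gamma> M \<odot> tens us))) b)"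
    by (simp only: uint_cpt(6)[OF cp] csem_app[OF c(1) us] restrm_oplus[OF X Y w])
qed

lemma rep_prl:
  assumes M: "\<Gamma> \<turnstile> M \<Ztypecolon> Pos (Tensor \<phi>\<^sub>l \<phi>\<^sub>r)"
  shows "represents \<Gamma> (Pos \<phi>\<^sub>l) (\<lambda>us. prl (psem \<phi>\<^sub>l) (psem \<phi>\<^sub>r) \<odot> csem \<Gamma> M \<odot> tens us) t \<longleftrightarrow> t = csem \<Gamma> (Prj Lft M)"
proof (rule represents_iff[OF t_prl[OF M]])
  fix us assume us: "coalgebraic_env \<Gamma> us" and cp: "cpt (tens us)"
  have c: "wf_ctx \<Gamma>" "ptclosed 0 \<phi>\<^sub>l" "ptclosed 0 \<phi>\<^sub>r" using typing_closed[OF M] by simp_all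
  have w: "uint M \<odot> tens us \<in> pts (tensor (fst (psem \<phi>\<^sub>l)) (fst (psem \<phi>\<^sub>r)))"
    using uint_pts[OF M us] by (simp add: gsem_simps psem_simps)
  show "uint (Prj Lft M) \<odot> tens us = prl (psem \<phi>\<^sub>l) (psem \<phi>\<^sub>r) \<odot> csem \<Gamma> M \<odot> tens us"
    by (simp only: uint_cpt(7)[OF cp] csem_app[OF c(1) us]
        prl_mapp[OF is_coalg_psem[OF c(2)] is_coalg_psem[OF c(3)] good_psem[OF c(3)] w])
qed

lemma rep_prr:
  assumes M: "\<Gamma> \<turnstile> M \<Ztypecolon> Pos (Tensor \<phi>\<^sub>l \<phi>\<^sub>r)"
  shows "represents \<Gamma> (Pos \<phi>\<^sub>r) (\<lambda>us. prr (psem \<phi>\<^sub>l) (psem \<phi>\<^sub>r) \<odot> csem \<Gamma> M \<odot> tens us) t \<longleftrightarrow> t = csem \<Gamma> (Prj Rgt M)"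
proof (rule represents_iff[OF t_prr[OF M]])
  fix us assume us: "coalgebraic_env \<Gamma> us" and cp: "cpt (tens us)"
  have c: "wf_ctx \<Gamma>" "ptclosed 0 \<phi>\<^sub>l" "ptclosed 0 \<phi>\<^sub>r" using typing_closed[OF M] by simp_all
  have w: "uint M \<odot> tens us \<in> pts (tensor (fst (psem \<phi>\<^sub>l)) (fst (psem \<phi>\<^sub>r)))"
    using uint_pts[OF M us] by (simp add: gsem_simps psem_simps)
  show "uint (Prj Rgt M) \<odot> tens us = prr (psem \<phi>\<^sub>l) (psem \<phi>\<^sub>r) \<odot> csem \<Gamma> M \<odot> tens us"
    by (simp only: uint_cpt(8)[OF cp] csem_app[OF c(1) us]
        prr_mapp[OF is_coalg_psem[OF c(2)] good_psem[OF c(2)] is_coalg_psem[OF c(3)] w])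
qed

lemma rep_go:
  assumes M: "\<Gamma> \<turnstile> M \<Ztypecolon> Pos (Bang \<sigma>)"
  shows "represents \<Gamma> \<sigma> (\<lambda>us. der (gsem \<sigma>) \<odot> csem \<Gamma> M \<odot> tens us) t \<longleftrightarrow> t = csem \<Gamma> (Go M)"
proof (rule represents_iff[OF t_go[OF M]])
  fix us assume us: "coalgebraic_env \<Gamma> us" and cp: "cpt (tens us)"
  have c: "wf_ctx \<Gamma>" "gtclosed 0 \<sigma>" using typing_closed[OF M] by simp_all
  have "uint M \<odot> tens us \<in> pts (bang (gsem \<sigma>))" using uint_pts[OF M us] by (simp add: gsem_simps psem_simps)
  then have "uint M \<odot> tens us \<in> vecs (bweb (web (gsem \<sigma>)))"
    using pts_vecs[OF is_pcs_bang[OF is_pcs_gsem[OF c(2)]]] by fastforce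
  then show "uint (Go M) \<odot> tens us = der (gsem \<sigma>) \<odot> csem \<Gamma> M \<odot> tens us"
    by (simp only: uint_cpt(9)[OF cp] csem_app[OF c(1) us] der_eq rowr_mapp)
qed

text \<open>A promotion is always coalgebraic, whatever the point \<open>w\<close> may be; so the
  iterates stay inside the environments where the semantics is prescribed.\<close>

lemma fix_body:
  assumes M: "Bang \<sigma> # \<Gamma> \<turnstile> M \<Ztypecolon> \<sigma>" and us: "coalgebraic_env \<Gamma> us" and w: "w \<in> pts (gsem \<sigma>)"
  shows "coalgebraic_env (Bang \<sigma> # \<Gamma>) (prom w # us)" "uint M \<odot> (tens us \<otimes>\<^sub>v prom w) \<in> pts (gsem \<sigma>)"
proof -
  have c: "wf_ctx (Bang \<sigma> # \<Gamma>)" "gtclosed 0 \<sigma>" using typing_closed[OF M] by simp_all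
  have "coalgebraic (psem (Bang \<sigma>)) (prom w)"
    using coalgebraic_psem[of "Bang \<sigma>"] prom_pts[OF is_pcs_gsem[OF c(2)] w] cpt_prom c by (simp add: psem_simps)
  then show e: "coalgebraic_env (Bang \<sigma> # \<Gamma>) (prom w # us)" using us by simp
  show "uint M \<odot> (tens us \<otimes>\<^sub>v prom w) \<in> pts (gsem \<sigma>)" using uint_pts[OF M e] by simp
qed

lemma fix_iterates_pts:
  assumes M: "Bang \<sigma> # \<Gamma> \<turnstile> M \<Ztypecolon> \<sigma>" and us: "coalgebraic_env \<Gamma> us"
  shows "((\<lambda>w. uint M \<odot> (tens us \<otimes>\<^sub>v prom w)) ^^ k) (\<lambda>_. 0) \<in> pts (gsem \<sigma>)"
proof (induction k)
  case 0
  show ?case using pts_zero[OF is_pcs_gsem] typing_closed[OF M] by simp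
next
  case (Suc k)
  then show ?case using fix_body(2)[OF M us] by simp
qed

lemma funpow_cong_on:
  assumes "\<And>k. (f ^^ k) x \<in> A" "\<And>w. w \<in> A \<Longrightarrow> g w = f w"
  shows "(g ^^ k) x = (f ^^ k) x"
  using assms by (induction k) simp_all

lemma rep_fix:
  assumes M: "Bang \<sigma> # \<Gamma> \<turnstile> M \<Ztypecolon> \<sigma>"
  shows "represents \<Gamma> \<sigma> (\<lambda>us. SUP k. ((\<lambda>w. csem (Bang \<sigma> # \<Gamma>) M \<odot> (tens us \<otimes>\<^sub>v prom w)) ^^ k) (\<lambda>_. 0)) t
    \<longleftrightarrow> t = csem \<Gamma> (Fix \<sigma> M)"
proof (rule represents_iff[OF t_fix[OF M]])
  fix us assume us: "coalgebraic_env \<Gamma> us" and cp: "cpt (tens us)"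
  have c: "wf_ctx (Bang \<sigma> # \<Gamma>)" using typing_closed[OF M] by blast
  have "((\<lambda>w. csem (Bang \<sigma> # \<Gamma>) M \<odot> (tens us \<otimes>\<^sub>v prom w)) ^^ k) (\<lambda>_. 0) =
      ((\<lambda>w. uint M \<odot> (tens us \<otimes>\<^sub>v prom w)) ^^ k) (\<lambda>_. 0)" for k
  proof (rule funpow_cong_on[OF fix_iterates_pts[OF M us]])
    fix w assume "w \<in> pts (gsem \<sigma>)"
    from csem_app[OF c fix_body(1)[OF M us this]]
    show "csem (Bang \<sigma> # \<Gamma>) M \<odot> (tens us \<otimes>\<^sub>v prom w) = uint M \<odot> (tens us \<otimes>\<^sub>v prom w)" by simp
  qed
  then show "uint (Fix \<sigma> M) \<odot> tens us =
      (SUP k. ((\<lambda>w. csem (Bang \<sigma> # \<Gamma>) M \<odot> (tens us \<otimes>\<^sub>v prom w)) ^^ k) (\<lambda>_. 0))"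
    by (simp only: uint_cpt(10)[OF cp])
qed

lemma rep_coin:
  assumes "wf_ctx \<Gamma>" "0 \<le> p" "p \<le> 1"
  shows "represents \<Gamma> (Pos (Plus One One)) (\<lambda>us b.
        ennreal (of_rat p) * unit_vec (In Lft Star) b +
        ennreal (1 - of_rat p) * unit_vec (In Rgt Star) b) t \<longleftrightarrow> t = csem \<Gamma> (Coin p)"
  by (rule represents_iff[OF t_coin[OF assms]]) (rule uint_cpt(11))

text \<open>Coherence: the result depends on the term and the context alone, so all derivations
  agree.\<close>

lemma denotes_csem: "denotes \<Gamma> M \<sigma> t \<Longrightarrow> \<Gamma> \<turnstile> M \<Ztypecolon> \<sigma> \<and> t = csem \<Gamma> M"
proof (induction rule: denotes.induct)
  case (d_var \<Gamma> n t)
  then show ?case using rep_var[OF d_var(1,2)] t_var[OF d_var(1,2)] by blast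
next
  case (d_unit \<Gamma> t)
  then show ?case using rep_unit[OF d_unit(1)] t_unit[OF d_unit(1)] by blast
next
  case (d_stop \<Gamma> M \<sigma> m t)
  then have M: "\<Gamma> \<turnstile> M \<Ztypecolon> \<sigma>" and m: "m = csem \<Gamma> M" by blast+
  show ?case using d_stop.hyps(2) t_stop[OF M] unfolding m rep_stop[OF M] by blast
next
  case (d_tup \<Gamma> M \<phi>\<^sub>l m N \<phi>\<^sub>r n t)
  then have M: "\<Gamma> \<turnstile> M \<Ztypecolon> Pos \<phi>\<^sub>l" "\<Gamma> \<turnstile> N \<Ztypecolon> Pos \<phi>\<^sub>r" and m: "m = csem \<Gamma> M" "n = csem \<Gamma> N" by blast+
  show ?case using d_tup.hyps(3) t_tup[OF M] unfolding m rep_tup[OF M] by blast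
next
  case (d_inl \<Gamma> M \<phi>\<^sub>l m \<phi>\<^sub>r t)
  then have M: "\<Gamma> \<turnstile> M \<Ztypecolon> Pos \<phi>\<^sub>l" "ptclosed 0 \<phi>\<^sub>r" and m: "m = csem \<Gamma> M" by blast+
  show ?case using d_inl.hyps(3) t_inl[OF M] unfolding m rep_inl[OF M] by blast
next
  case (d_inr \<Gamma> M \<phi>\<^sub>r m \<phi>\<^sub>l t)
  then have M: "\<Gamma> \<turnstile> M \<Ztypecolon> Pos \<phi>\<^sub>r" "ptclosed 0 \<phi>\<^sub>l" and m: "m = csem \<Gamma> M" by blast+
  show ?case using d_inr.hyps(3) t_inr[OF M] unfolding m rep_inr[OF M] by blast
next
  case (d_lam \<phi> \<Gamma> M \<sigma> m t)
  then have M: "\<phi> # \<Gamma> \<turnstile> M \<Ztypecolon> \<sigma>" and m: "m = csem (\<phi> # \<Gamma>) M" by blast+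
  show ?case using d_lam.hyps(2,3) rep_lam[OF M, of t] t_lam[OF M] unfolding m by blast
next
  case (d_app \<Gamma> M \<phi> \<sigma> m N n t)
  then have M: "\<Gamma> \<turnstile> M \<Ztypecolon> Lolli \<phi> \<sigma>" "\<Gamma> \<turnstile> N \<Ztypecolon> Pos \<phi>" and m: "m = csem \<Gamma> M" "n = csem \<Gamma> N" by blast+
  show ?case using d_app.hyps(3) t_app[OF M] unfolding m rep_app[OF M] by blast
next
  case (d_case \<Gamma> M \<phi>\<^sub>l \<phi>\<^sub>r m N\<^sub>l \<sigma> n\<^sub>l N\<^sub>r n\<^sub>r t)
  then have M: "\<Gamma> \<turnstile> M \<Ztypecolon> Pos (Plus \<phi>\<^sub>l \<phi>\<^sub>r)" "\<phi>\<^sub>l # \<Gamma> \<turnstile> N\<^sub>l \<Ztypecolon> \<sigma>" "\<phi>\<^sub>r # \<Gamma> \<turnstile> N\<^sub>r \<Ztypecolon> \<sigma>"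
    and m: "m = csem \<Gamma> M" "n\<^sub>l = csem (\<phi>\<^sub>l # \<Gamma>) N\<^sub>l" "n\<^sub>r = csem (\<phi>\<^sub>r # \<Gamma>) N\<^sub>r" by blast+
  show ?case using d_case.hyps(4) t_case[OF M] unfolding m rep_case[OF M] by blast
next
  case (d_prl \<Gamma> M \<phi>\<^sub>l \<phi>\<^sub>r m t)
  then have M: "\<Gamma> \<turnstile> M \<Ztypecolon> Pos (Tensor \<phi>\<^sub>l \<phi>\<^sub>r)" and m: "m = csem \<Gamma> M" by blast+
  show ?case using d_prl.hyps(2) t_prl[OF M] unfolding m rep_prl[OF M] by blast
next
  case (d_prr \<Gamma> M \<phi>\<^sub>l \<phi>\<^sub>r m t)
  then have M: "\<Gamma> \<turnstile> M \<Ztypecolon> Pos (Tensor \<phi>\<^sub>l \<phi>\<^sub>r)" and m: "m = csem \<Gamma> M" by blast+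
  show ?case using d_prr.hyps(2) t_prr[OF M] unfolding m rep_prr[OF M] by blast
next
  case (d_go \<Gamma> M \<sigma> m t)
  then have M: "\<Gamma> \<turnstile> M \<Ztypecolon> Pos (Bang \<sigma>)" and m: "m = csem \<Gamma> M" by blast+
  show ?case using d_go.hyps(2) t_go[OF M] unfolding m rep_go[OF M] by blast
next
  case (d_fix \<sigma> \<Gamma> M m t)
  then have M: "Bang \<sigma> # \<Gamma> \<turnstile> M \<Ztypecolon> \<sigma>" and m: "m = csem (Bang \<sigma> # \<Gamma>) M" by blast+
  show ?case using d_fix.hyps(2) t_fix[OF M] unfolding m rep_fix[OF M] by blast
next
  case (d_fold \<Gamma> M \<psi> t)
  then show ?case using t_fold[of \<Gamma> M \<psi>] by simp
next
  case (d_unfold \<Gamma> M \<psi> t)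
  then show ?case using t_unfold[of \<Gamma> M \<psi>] by simp
next
  case (d_coin \<Gamma> p t)
  then show ?case using rep_coin[OF d_coin(1-3)] t_coin[OF d_coin(1-3)] by blast
qed

lemma typing_denotes: "\<Gamma> \<turnstile> M \<Ztypecolon> \<sigma> \<Longrightarrow> denotes \<Gamma> M \<sigma> (csem \<Gamma> M)"
proof (induction rule: typing.induct)
  case (t_var \<Gamma> n)
  then show ?case using d_var[OF t_var] rep_var[OF t_var] by blast
next
  case (t_unit \<Gamma>)
  then show ?case using d_unit[OF t_unit] rep_unit[OF t_unit] by blast
next
  case (t_stop \<Gamma> M \<sigma>)
  show ?case using d_stop[OF t_stop.IH] rep_stop[OF t_stop.hyps] by blast
next
  case (t_tup \<Gamma> M \<phi>\<^sub>l N \<phi>\<^sub>r)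
  show ?case using d_tup[OF t_tup.IH] rep_tup[OF t_tup.hyps] by blast
next
  case (t_inl \<Gamma> M \<phi>\<^sub>l \<phi>\<^sub>r)
  show ?case using d_inl[OF t_inl.IH t_inl.hyps(2)] rep_inl[OF t_inl.hyps] by blast
next
  case (t_inr \<Gamma> M \<phi>\<^sub>r \<phi>\<^sub>l)
  show ?case using d_inr[OF t_inr.IH t_inr.hyps(2)] rep_inr[OF t_inr.hyps] by blast
next
  case (t_lam \<phi> \<Gamma> M \<sigma>)
  show ?case using d_lam[OF t_lam.IH] rep_lam[OF t_lam.hyps, of "csem \<Gamma> (Lam \<phi> M)"] by blast
next
  case (t_app \<Gamma> M \<phi> \<sigma> N)
  show ?case using d_app[OF t_app.IH] rep_app[OF t_app.hyps] by blast
next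
  case (t_case \<Gamma> M \<phi>\<^sub>l \<phi>\<^sub>r N\<^sub>l \<sigma> N\<^sub>r)
  show ?case using d_case[OF t_case.IH] rep_case[OF t_case.hyps] by blast
next
  case (t_prl \<Gamma> M \<phi>\<^sub>l \<phi>\<^sub>r)
  show ?case using d_prl[OF t_prl.IH] rep_prl[OF t_prl.hyps] by blast
next
  case (t_prr \<Gamma> M \<phi>\<^sub>l \<phi>\<^sub>r)
  show ?case using d_prr[OF t_prr.IH] rep_prr[OF t_prr.hyps] by blast
next
  case (t_go \<Gamma> M \<sigma>)
  show ?case using d_go[OF t_go.IH] rep_go[OF t_go.hyps] by blast
next
  case (t_fix \<sigma> \<Gamma> M)
  show ?case using d_fix[OF t_fix.IH] rep_fix[OF t_fix.hyps] by blast
next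
  case (t_fold \<Gamma> M \<psi>)
  show ?case using d_fold[OF t_fold.IH] by simp
next
  case (t_unfold \<Gamma> M \<psi>)
  show ?case using d_unfold[OF t_unfold.IH] by simp
next
  case (t_coin \<Gamma> p)
  show ?case using d_coin[OF t_coin] rep_coin[OF t_coin] by blast
qed

lemma sem_eq: "\<Gamma> \<turnstile> M \<Ztypecolon> \<sigma> \<Longrightarrow> sem \<Gamma> M \<sigma> = csem \<Gamma> M"
  unfolding sem_def using typing_denotes denotes_csem by (intro the_equality) blast+

section \<open>Substitution\<close>

lemma coalgebraic_env_append:
  "coalgebraic_env \<Delta> us \<Longrightarrow> coalgebraic_env \<Gamma> us' \<Longrightarrow> coalgebraic_env (\<Delta> @ \<Gamma>) (us @ us')"
  unfolding coalgebraic_env_def by (rule list_all2_appendI)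

lemma coalgebraic_env_length: "coalgebraic_env \<Gamma> us \<Longrightarrow> length us = length \<Gamma>"
  unfolding coalgebraic_env_def by (simp add: list_all2_lengthD)

lemma env_cpt: "\<Gamma> \<turnstile> M \<Ztypecolon> \<sigma> \<Longrightarrow> coalgebraic_env \<Gamma> us \<Longrightarrow> cpt (tens us)"
  using tens_env typing_closed by blast

text \<open>The branches of a \<open>Case\<close> are applied to components that need not be coalgebraic.\<close>

lemma eq_on_pts:
  assumes G: "is_pcs G" and G': "is_pcs G'" and C: "is_coalg C" "good C" and Z: "is_pcs Z"
    and S: "mor (tensor G (fst C)) Z S" and T: "mor (tensor G' (fst C)) Z T" and g: "g \<in> pts G" and g': "g' \<in> pts G'"
    and eq: "\<And>v. coalgebraic C v \<Longrightarrow> S \<odot> (g \<otimes>\<^sub>v v) = T \<odot> (g' \<otimes>\<^sub>v v)" and v: "v \<in> pts (fst C)"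
  shows "S \<odot> (g \<otimes>\<^sub>v v) = T \<odot> (g' \<otimes>\<^sub>v v)"
proof -
  note X = is_coalg_pcs[OF C(1)]
  \<comment> \<open>With the contexts frozen both sides are linear in the last argument, so
    agreement on coalgebraic points extends to all points of \<open>C\<close>.\<close>
  let ?S = "\<lambda>a. S \<odot> (g \<otimes>\<^sub>v unit_vec a)" and ?T = "\<lambda>a. T \<odot> (g' \<otimes>\<^sub>v unit_vec a)"
  have "mor (fst C) Z ?S" "mor (fst C) Z ?T"
    unfolding mor_def tensv_mat_right
    using morD[OF S tensv_pts[OF G X g]] morD[OF T tensv_pts[OF G' X g']] by blast+
  then have "?S a = ?T a" if "a \<in> web (fst C)" for a
  proof (rule sep_mor_eq[OF X Z good_sep[OF C(2)] _ _ _ that])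
    fix u assume "u \<in> {u \<in> pts (fst C). cpt u}"
    then have "coalgebraic C u" using coalgebraic_iff[OF C] by blast
    then show "?S \<odot> u = ?T \<odot> u" unfolding tensv_mat_right by (rule eq)
  qed
  then have "?S \<odot> v = ?T \<odot> v" by (rule mapp_eq_on[OF pts_vecs[OF X v]])
  then show ?thesis unfolding tensv_mat_right .
qed

text \<open>Two contexts are allowed, because weakening and substitution compare a term in one
  context with its image in another. The same holds for the congruences of branches,
  \<open>Case\<close> and \<open>Fix\<close>.\<close>

lemma lam_cong:
  assumes M: "\<phi> # \<Gamma> \<turnstile> M \<Ztypecolon> \<sigma>" and M': "\<phi> # \<Gamma>' \<turnstile> M' \<Ztypecolon> \<sigma>"
    and us: "coalgebraic_env \<Gamma> us" and us': "coalgebraic_env \<Gamma>' us'"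
    and eq: "\<And>v. coalgebraic (psem \<phi>) v \<Longrightarrow> uint M \<odot> tens (v # us) = uint M' \<odot> tens (v # us')"
  shows "uint (Lam \<phi> M) \<odot> tens us = uint (Lam \<phi> M') \<odot> tens us'"
proof -
  have c: "ptclosed 0 \<phi>" "gtclosed 0 \<sigma>" using typing_closed[OF M] by simp_all
  have w: "uint (Lam \<phi> M) \<odot> tens us \<in> pts (lolli (fst (psem \<phi>)) (gsem \<sigma>))"
    "uint (Lam \<phi> M') \<odot> tens us' \<in> pts (lolli (fst (psem \<phi>)) (gsem \<sigma>))"
    using uint_pts[OF t_lam[OF M] us] uint_pts[OF t_lam[OF M'] us'] by (simp_all add: gsem_simps)
  show ?thesis
  proof (rule lolli_eqI[OF is_coalg_pcs[OF is_coalg_psem[OF c(1)]] is_pcs_gsem[OF c(2)] good_sep[OF good_psem[OF c(1)]] w])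
    fix v assume "v \<in> {u \<in> pts (fst (psem \<phi>)). cpt u}"
    then have v: "coalgebraic (psem \<phi>) v" using coalgebraic_psem[OF c(1)] by blast
    show "mat_of (uint (Lam \<phi> M) \<odot> tens us) \<odot> v = mat_of (uint (Lam \<phi> M') \<odot> tens us') \<odot> v"
      using eq[OF v] unfolding uint_lam[OF M v] uint_lam[OF M' v] tens.simps .
  qed
qed

lemma branch_cong:
  assumes N: "\<phi> # \<Gamma> \<turnstile> N \<Ztypecolon> \<sigma>" and N': "\<phi> # \<Gamma>' \<turnstile> N' \<Ztypecolon> \<sigma>"
    and us: "coalgebraic_env \<Gamma> us" and us': "coalgebraic_env \<Gamma>' us'"
    and eq: "\<And>v. coalgebraic (psem \<phi>) v \<Longrightarrow> uint N \<odot> tens (v # us) = uint N' \<odot> tens (v # us')"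
    and v: "v \<in> pts (fst (psem \<phi>))"
  shows "uint N \<odot> (tens us \<otimes>\<^sub>v v) = uint N' \<odot> (tens us' \<otimes>\<^sub>v v)"
proof -
  have c: "ptclosed 0 \<phi>" "wf_ctx \<Gamma>" "wf_ctx \<Gamma>'" "gtclosed 0 \<sigma>" using typing_closed[OF N] typing_closed[OF N'] by simp_all
  show ?thesis
  proof (rule eq_on_pts[OF is_pcs_ctx[OF c(2)] is_pcs_ctx[OF c(3)] is_coalg_psem[OF c(1)] good_psem[OF c(1)] is_pcs_gsem[OF c(4)] _ _ _ _ _ v])
    show "mor (tensor (ctx_sem \<Gamma>) (fst (psem \<phi>))) (gsem \<sigma>) (uint N)"
      "mor (tensor (ctx_sem \<Gamma>') (fst (psem \<phi>))) (gsem \<sigma>) (uint N')"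
      using typing_mor[OF N] typing_mor[OF N'] by simp_all
    show "tens us \<in> pts (ctx_sem \<Gamma>)" "tens us' \<in> pts (ctx_sem \<Gamma>')"
      using tens_env[OF c(2) us] tens_env[OF c(3) us'] by blast+
    show "uint N \<odot> (tens us \<otimes>\<^sub>v v) = uint N' \<odot> (tens us' \<otimes>\<^sub>v v)" if "coalgebraic (psem \<phi>) v" for v
      using eq[OF that] by simp
  qed
qed

lemma case_cong:
  assumes M: "\<Gamma> \<turnstile> M \<Ztypecolon> Pos (Plus \<phi>\<^sub>l \<phi>\<^sub>r)" and M': "\<Gamma>' \<turnstile> M' \<Ztypecolon> Pos (Plus \<phi>\<^sub>l \<phi>\<^sub>r)"
    and L: "\<phi>\<^sub>l # \<Gamma> \<turnstile> N\<^sub>l \<Ztypecolon> \<sigma>" "\<phi>\<^sub>l # \<Gamma>' \<turnstile> N\<^sub>l' \<Ztypecolon> \<sigma>" and R: "\<phi>\<^sub>r # \<Gamma> \<turnstile> N\<^sub>r \<Ztypecolon> \<sigma>" "\<phi>\<^sub>r # \<Gamma>' \<turnstile> N\<^sub>r' \<Ztypecolon> \<sigma>"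
    and us: "coalgebraic_env \<Gamma> us" and us': "coalgebraic_env \<Gamma>' us'"
    and eq: "uint M \<odot> tens us = uint M' \<odot> tens us'"
    and eql: "\<And>v. coalgebraic (psem \<phi>\<^sub>l) v \<Longrightarrow> uint N\<^sub>l \<odot> tens (v # us) = uint N\<^sub>l' \<odot> tens (v # us')"
    and eqr: "\<And>v. coalgebraic (psem \<phi>\<^sub>r) v \<Longrightarrow> uint N\<^sub>r \<odot> tens (v # us) = uint N\<^sub>r' \<odot> tens (v # us')"
  shows "uint (Case M N\<^sub>l N\<^sub>r) \<odot> tens us = uint (Case M' N\<^sub>l' N\<^sub>r') \<odot> tens us'"
proof -
  have c: "ptclosed 0 \<phi>\<^sub>l" "ptclosed 0 \<phi>\<^sub>r" using typing_closed[OF M] by simp_all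
  let ?w = "uint M' \<odot> tens us'"
  have w: "?w \<in> pts (oplus (fst (psem \<phi>\<^sub>l)) (fst (psem \<phi>\<^sub>r)))"
    using uint_pts[OF M' us'] by (simp add: gsem_simps psem_simps)
  have comp: "component Lft ?w \<in> pts (fst (psem \<phi>\<^sub>l))" "component Rgt ?w \<in> pts (fst (psem \<phi>\<^sub>r))"
    using pts_oplus[OF is_coalg_pcs[OF is_coalg_psem[OF c(1)]] is_coalg_pcs[OF is_coalg_psem[OF c(2)]] w] by auto
  have l: "uint N\<^sub>l \<odot> (tens us \<otimes>\<^sub>v component Lft ?w) = uint N\<^sub>l' \<odot> (tens us' \<otimes>\<^sub>v component Lft ?w)"
    by (rule branch_cong[OF L us us' _ comp(1)]) (rule eql)
  have r: "uint N\<^sub>r \<odot> (tens us \<otimes>\<^sub>v component Rgt ?w) = uint N\<^sub>r' \<odot> (tens us' \<otimes>\<^sub>v component Rgt ?w)"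
    by (rule branch_cong[OF R us us' _ comp(2)]) (rule eqr)
  show ?thesis
    unfolding uint_cpt(6)[OF env_cpt[OF M us]] uint_cpt(6)[OF env_cpt[OF M' us']] eq l r ..
qed

lemma fix_cong:
  assumes M: "Bang \<sigma> # \<Gamma> \<turnstile> M \<Ztypecolon> \<sigma>" and M': "Bang \<sigma> # \<Gamma>' \<turnstile> M' \<Ztypecolon> \<sigma>"
    and us: "coalgebraic_env \<Gamma> us" and us': "coalgebraic_env \<Gamma>' us'"
    and eq: "\<And>v. coalgebraic (psem (Bang \<sigma>)) v \<Longrightarrow> uint M \<odot> tens (v # us) = uint M' \<odot> tens (v # us')"
  shows "uint (Fix \<sigma> M) \<odot> tens us = uint (Fix \<sigma> M') \<odot> tens us'"
proof -
  have "((\<lambda>w. uint M \<odot> (tens us \<otimes>\<^sub>v prom w)) ^^ k) (\<lambda>_. 0) = ((\<lambda>w. uint M' \<odot> (tens us' \<otimes>\<^sub>v prom w)) ^^ k) (\<lambda>_. 0)" for k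
  proof (rule funpow_cong_on[OF fix_iterates_pts[OF M' us']])
    fix w assume "w \<in> pts (gsem \<sigma>)"
    from fix_body(1)[OF M us this] have "coalgebraic (psem (Bang \<sigma>)) (prom w)" by simp
    from eq[OF this] show "uint M \<odot> (tens us \<otimes>\<^sub>v prom w) = uint M' \<odot> (tens us' \<otimes>\<^sub>v prom w)" by simp
  qed
  then show ?thesis
    by (simp only: uint_cpt(10)[OF env_cpt[OF t_fix[OF M] us]] uint_cpt(10)[OF env_cpt[OF t_fix[OF M'] us']])
qed

lemma uint_congs:
  assumes c: "cpt u" "cpt u'" and M: "uint M \<odot> u = uint M' \<odot> u'"
  shows "uint (Stop M) \<odot> u = uint (Stop M') \<odot> u'"
    and "uint (Inj i M) \<odot> u = uint (Inj i M') \<odot> u'"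
    and "uint (Prj i M) \<odot> u = uint (Prj i M') \<odot> u'"
    and "uint (Go M) \<odot> u = uint (Go M') \<odot> u'"
    and "uint N \<odot> u = uint N' \<odot> u' \<Longrightarrow> uint (Tup M N) \<odot> u = uint (Tup M' N') \<odot> u'"
    and "uint N \<odot> u = uint N' \<odot> u' \<Longrightarrow> uint (App M N) \<odot> u = uint (App M' N') \<odot> u'"
proof -
  show "uint (Prj i M) \<odot> u = uint (Prj i M') \<odot> u'"
    by (cases i) (simp_all only: uint_cpt(7,8)[OF c(1)] uint_cpt(7,8)[OF c(2)] M)
qed (simp_all only: uint_cpt(2-5,9)[OF c(1)] uint_cpt(2-5,9)[OF c(2)] M)

section \<open>Weakening\<close>

definition lift_sound :: "ctx \<Rightarrow> pty \<Rightarrow> ctx \<Rightarrow> tm \<Rightarrow> gty \<Rightarrow> bool" where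
  "lift_sound \<Delta> \<phi> \<Gamma> M \<sigma> \<longleftrightarrow> \<Delta> @ \<phi> # \<Gamma> \<turnstile> lift (length \<Delta>) M \<Ztypecolon> \<sigma> \<and>
     (\<forall>us v us'. coalgebraic_env \<Delta> us \<longrightarrow> coalgebraic (psem \<phi>) v \<longrightarrow> coalgebraic_env \<Gamma> us' \<longrightarrow>
        uint (lift (length \<Delta>) M) \<odot> tens (us @ v # us') = uint M \<odot> tens (us @ us'))"

lemma lift_soundI:
  assumes M: "\<Delta> @ \<Gamma> \<turnstile> M \<Ztypecolon> \<sigma>" and \<phi>: "ptclosed 0 \<phi>" and "\<Delta> @ \<phi> # \<Gamma> \<turnstile> lift (length \<Delta>) M \<Ztypecolon> \<sigma>"
    and "\<And>us v us'. coalgebraic_env \<Delta> us \<Longrightarrow> coalgebraic (psem \<phi>) v \<Longrightarrow> coalgebraic_env \<Gamma> us' \<Longrightarrow>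
        coalgebraic_env (\<Delta> @ \<Gamma>) (us @ us') \<Longrightarrow> coalgebraic_env (\<Delta> @ \<phi> # \<Gamma>) (us @ v # us') \<Longrightarrow>
        cpt (tens (us @ us')) \<Longrightarrow> cpt (tens (us @ v # us')) \<Longrightarrow>
        uint (lift (length \<Delta>) M) \<odot> tens (us @ v # us') = uint M \<odot> tens (us @ us')"
  shows "lift_sound \<Delta> \<phi> \<Gamma> M \<sigma>"
  unfolding lift_sound_def
proof (intro conjI allI impI)
  fix us v us' assume e: "coalgebraic_env \<Delta> us" "coalgebraic (psem \<phi>) v" "coalgebraic_env \<Gamma> us'"
  have e1: "coalgebraic_env (\<Delta> @ \<Gamma>) (us @ us')" by (rule coalgebraic_env_append[OF e(1,3)])
  have e2: "coalgebraic_env (\<Delta> @ \<phi> # \<Gamma>) (us @ v # us')" using e by (intro coalgebraic_env_append) simp_all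
  show "uint (lift (length \<Delta>) M) \<odot> tens (us @ v # us') = uint M \<odot> tens (us @ us')"
    by (rule assms(4)[OF e e1 e2 env_cpt[OF M e1] env_cpt[OF assms(3) e2]])
qed (rule assms(3))

lemma lift_soundD:
  assumes "lift_sound \<Delta> \<phi> \<Gamma> M \<sigma>"
  shows "\<Delta> @ \<phi> # \<Gamma> \<turnstile> lift (length \<Delta>) M \<Ztypecolon> \<sigma>"
    and "coalgebraic_env \<Delta> us \<Longrightarrow> coalgebraic (psem \<phi>) v \<Longrightarrow> coalgebraic_env \<Gamma> us' \<Longrightarrow>
        uint (lift (length \<Delta>) M) \<odot> tens (us @ v # us') = uint M \<odot> tens (us @ us')"
  using assms unfolding lift_sound_def by blast+

lemma lift_soundD_Cons:
  assumes "lift_sound (\<psi> # \<Delta>) \<phi> \<Gamma> M \<sigma>"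
  shows "\<psi> # \<Delta> @ \<phi> # \<Gamma> \<turnstile> lift (Suc (length \<Delta>)) M \<Ztypecolon> \<sigma>"
    and "coalgebraic (psem \<psi>) w \<Longrightarrow> coalgebraic_env \<Delta> us \<Longrightarrow> coalgebraic (psem \<phi>) v \<Longrightarrow> coalgebraic_env \<Gamma> us' \<Longrightarrow>
        uint (lift (Suc (length \<Delta>)) M) \<odot> tens (w # us @ v # us') = uint M \<odot> tens (w # us @ us')"
  using lift_soundD(1)[OF assms] lift_soundD(2)[OF assms, of "w # us" v us'] by simp_all

text \<open>The variable is inserted below the prefix \<open>\<Delta>\<close>, which grows when the
  induction passes a binder. Typing and meaning are treated together since the congruences for
  binders require both terms to be typed.\<close>

lemma lift_sem:
  assumes "\<Gamma>' \<turnstile> M \<Ztypecolon> \<sigma>" "\<Gamma>' = \<Delta> @ \<Gamma>" and \<phi>: "ptclosed 0 \<phi>"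
  shows "lift_sound \<Delta> \<phi> \<Gamma> M \<sigma>"
  using assms(1,2)
proof (induction arbitrary: \<Delta> rule: typing.induct)
  case (t_var \<Gamma>' n)
  have wf: "wf_ctx (\<Delta> @ \<phi> # \<Gamma>)" using t_var \<phi> by (auto simp: wf_ctx_def)
  \<comment> \<open>Indices at or beyond the insertion point are shifted by one, and so are the
    entries of the environment.\<close>
  let ?n = "if n < length \<Delta> then n else Suc n"
  have n: "?n < length (\<Delta> @ \<phi> # \<Gamma>)" "(\<Delta> @ \<phi> # \<Gamma>) ! ?n = \<Gamma>' ! n"
    using t_var by (auto simp: nth_append Suc_diff_le)
  show ?case
  proof (rule lift_soundI[OF _ \<phi>])
    show "\<Delta> @ \<Gamma> \<turnstile> Var n \<Ztypecolon> Pos (\<Gamma>' ! n)" using typing.t_var[OF t_var.hyps] t_var.prems by simp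
    show "\<Delta> @ \<phi> # \<Gamma> \<turnstile> lift (length \<Delta>) (Var n) \<Ztypecolon> Pos (\<Gamma>' ! n)"
      using typing.t_var[OF wf n(1)] n(2) by simp
    fix us v us' assume e: "coalgebraic_env \<Delta> us" "coalgebraic_env (\<Delta> @ \<Gamma>) (us @ us')"
      "coalgebraic_env (\<Delta> @ \<phi> # \<Gamma>) (us @ v # us')"
    have "uint (lift (length \<Delta>) (Var n)) \<odot> tens (us @ v # us') = (us @ v # us') ! ?n"
      using vproj_env[OF wf e(3) n(1)] by simp
    also have "\<dots> = (us @ us') ! n"
      using coalgebraic_env_length[OF e(1)] by (auto simp: nth_append Suc_diff_le)
    also have "\<dots> = uint (Var n) \<odot> tens (us @ us')"
      using vproj_env[OF _ e(2), of n] t_var by simp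
    finally show "uint (lift (length \<Delta>) (Var n)) \<odot> tens (us @ v # us') = uint (Var n) \<odot> tens (us @ us')" .
  qed
next
  case (t_unit \<Gamma>')
  then have "wf_ctx (\<Delta> @ \<Gamma>)" "wf_ctx (\<Delta> @ \<phi> # \<Gamma>)" using \<phi> by (auto simp: wf_ctx_def)
  then show ?case
    by (intro lift_soundI[OF typing.t_unit \<phi>]) (simp_all only: lift.simps typing.t_unit uint_cpt(1))
next
  case (t_stop \<Gamma>' M \<sigma>)
  note IH = lift_soundD[OF t_stop.IH[OF t_stop.prems]]
  show ?case
  proof (rule lift_soundI[OF _ \<phi>])
    show "\<Delta> @ \<Gamma> \<turnstile> Stop M \<Ztypecolon> Pos (Bang \<sigma>)" using typing.t_stop[OF t_stop.hyps] t_stop.prems by simp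
    show "\<Delta> @ \<phi> # \<Gamma> \<turnstile> lift (length \<Delta>) (Stop M) \<Ztypecolon> Pos (Bang \<sigma>)" using typing.t_stop[OF IH(1)] by simp
  qed (use IH(2) in \<open>simp only: lift.simps, intro uint_congs\<close>)
next
  case (t_tup \<Gamma>' M \<phi>\<^sub>l N \<phi>\<^sub>r)
  note IH = lift_soundD[OF t_tup.IH(1)[OF t_tup.prems]] lift_soundD[OF t_tup.IH(2)[OF t_tup.prems]]
  show ?case
  proof (rule lift_soundI[OF _ \<phi>])
    show "\<Delta> @ \<Gamma> \<turnstile> Tup M N \<Ztypecolon> Pos (Tensor \<phi>\<^sub>l \<phi>\<^sub>r)" using typing.t_tup[OF t_tup.hyps] t_tup.prems by simp
    show "\<Delta> @ \<phi> # \<Gamma> \<turnstile> lift (length \<Delta>) (Tup M N) \<Ztypecolon> Pos (Tensor \<phi>\<^sub>l \<phi>\<^sub>r)" using typing.t_tup[OF IH(1,3)] by simp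
  qed (use IH(2,4) in \<open>simp only: lift.simps, intro uint_congs\<close>)
next
  case (t_inl \<Gamma>' M \<phi>\<^sub>l \<phi>\<^sub>r)
  note IH = lift_soundD[OF t_inl.IH[OF t_inl.prems]]
  show ?case
  proof (rule lift_soundI[OF _ \<phi>])
    show "\<Delta> @ \<Gamma> \<turnstile> Inj Lft M \<Ztypecolon> Pos (Plus \<phi>\<^sub>l \<phi>\<^sub>r)" using typing.t_inl[OF t_inl.hyps] t_inl.prems by simp
    show "\<Delta> @ \<phi> # \<Gamma> \<turnstile> lift (length \<Delta>) (Inj Lft M) \<Ztypecolon> Pos (Plus \<phi>\<^sub>l \<phi>\<^sub>r)" using typing.t_inl[OF IH(1) t_inl.hyps(2)] by simp
  qed (use IH(2) in \<open>simp only: lift.simps, intro uint_congs\<close>)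
next
  case (t_inr \<Gamma>' M \<phi>\<^sub>r \<phi>\<^sub>l)
  note IH = lift_soundD[OF t_inr.IH[OF t_inr.prems]]
  show ?case
  proof (rule lift_soundI[OF _ \<phi>])
    show "\<Delta> @ \<Gamma> \<turnstile> Inj Rgt M \<Ztypecolon> Pos (Plus \<phi>\<^sub>l \<phi>\<^sub>r)" using typing.t_inr[OF t_inr.hyps] t_inr.prems by simp
    show "\<Delta> @ \<phi> # \<Gamma> \<turnstile> lift (length \<Delta>) (Inj Rgt M) \<Ztypecolon> Pos (Plus \<phi>\<^sub>l \<phi>\<^sub>r)" using typing.t_inr[OF IH(1) t_inr.hyps(2)] by simp
  qed (use IH(2) in \<open>simp only: lift.simps, intro uint_congs\<close>)
next
  case (t_lam \<psi> \<Gamma>' M \<sigma>)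
  note IH = lift_soundD_Cons[OF t_lam.IH[of "\<psi> # \<Delta>", unfolded t_lam.prems append_Cons, OF refl]]
  have M: "\<psi> # \<Delta> @ \<Gamma> \<turnstile> M \<Ztypecolon> \<sigma>" using t_lam.hyps t_lam.prems by simp
  show ?case
  proof (rule lift_soundI[OF typing.t_lam[OF M] \<phi>])
    show "\<Delta> @ \<phi> # \<Gamma> \<turnstile> lift (length \<Delta>) (Lam \<psi> M) \<Ztypecolon> Lolli \<psi> \<sigma>" using typing.t_lam[OF IH(1)] by simp
  qed (simp only: lift.simps, rule lam_cong[OF IH(1) M _ _ IH(2)])
next
  case (t_app \<Gamma>' M \<psi> \<sigma> N)
  note IH = lift_soundD[OF t_app.IH(1)[OF t_app.prems]] lift_soundD[OF t_app.IH(2)[OF t_app.prems]]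
  show ?case
  proof (rule lift_soundI[OF _ \<phi>])
    show "\<Delta> @ \<Gamma> \<turnstile> App M N \<Ztypecolon> \<sigma>" using typing.t_app[OF t_app.hyps] t_app.prems by simp
    show "\<Delta> @ \<phi> # \<Gamma> \<turnstile> lift (length \<Delta>) (App M N) \<Ztypecolon> \<sigma>" using typing.t_app[OF IH(1,3)] by simp
  qed (use IH(2,4) in \<open>simp only: lift.simps, intro uint_congs\<close>)
next
  case (t_case \<Gamma>' M \<phi>\<^sub>l \<phi>\<^sub>r N\<^sub>l \<sigma> N\<^sub>r)
  note IH = lift_soundD[OF t_case.IH(1)[OF t_case.prems]]
  note L = lift_soundD_Cons[OF t_case.IH(2)[of "\<phi>\<^sub>l # \<Delta>", unfolded t_case.prems append_Cons, OF refl]]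
  note R = lift_soundD_Cons[OF t_case.IH(3)[of "\<phi>\<^sub>r # \<Delta>", unfolded t_case.prems append_Cons, OF refl]]
  have M: "\<Delta> @ \<Gamma> \<turnstile> M \<Ztypecolon> Pos (Plus \<phi>\<^sub>l \<phi>\<^sub>r)" "\<phi>\<^sub>l # \<Delta> @ \<Gamma> \<turnstile> N\<^sub>l \<Ztypecolon> \<sigma>" "\<phi>\<^sub>r # \<Delta> @ \<Gamma> \<turnstile> N\<^sub>r \<Ztypecolon> \<sigma>"
    using t_case.hyps t_case.prems by simp_all
  show ?case
  proof (rule lift_soundI[OF typing.t_case[OF M] \<phi>])
    show "\<Delta> @ \<phi> # \<Gamma> \<turnstile> lift (length \<Delta>) (Case M N\<^sub>l N\<^sub>r) \<Ztypecolon> \<sigma>" using typing.t_case[OF IH(1) L(1) R(1)] by simp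
  qed (simp only: lift.simps, rule case_cong[OF IH(1) M(1) L(1) M(2) R(1) M(3) _ _ IH(2) L(2) R(2)])
next
  case (t_prl \<Gamma>' M \<phi>\<^sub>l \<phi>\<^sub>r)
  note IH = lift_soundD[OF t_prl.IH[OF t_prl.prems]]
  show ?case
  proof (rule lift_soundI[OF _ \<phi>])
    show "\<Delta> @ \<Gamma> \<turnstile> Prj Lft M \<Ztypecolon> Pos \<phi>\<^sub>l" using typing.t_prl[OF t_prl.hyps] t_prl.prems by simp
    show "\<Delta> @ \<phi> # \<Gamma> \<turnstile> lift (length \<Delta>) (Prj Lft M) \<Ztypecolon> Pos \<phi>\<^sub>l" using typing.t_prl[OF IH(1)] by simp
  qed (use IH(2) in \<open>simp only: lift.simps, intro uint_congs\<close>)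
next
  case (t_prr \<Gamma>' M \<phi>\<^sub>l \<phi>\<^sub>r)
  note IH = lift_soundD[OF t_prr.IH[OF t_prr.prems]]
  show ?case
  proof (rule lift_soundI[OF _ \<phi>])
    show "\<Delta> @ \<Gamma> \<turnstile> Prj Rgt M \<Ztypecolon> Pos \<phi>\<^sub>r" using typing.t_prr[OF t_prr.hyps] t_prr.prems by simp
    show "\<Delta> @ \<phi> # \<Gamma> \<turnstile> lift (length \<Delta>) (Prj Rgt M) \<Ztypecolon> Pos \<phi>\<^sub>r" using typing.t_prr[OF IH(1)] by simp
  qed (use IH(2) in \<open>simp only: lift.simps, intro uint_congs\<close>)
next
  case (t_go \<Gamma>' M \<sigma>)
  note IH = lift_soundD[OF t_go.IH[OF t_go.prems]]
  show ?case
  proof (rule lift_soundI[OF _ \<phi>])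
    show "\<Delta> @ \<Gamma> \<turnstile> Go M \<Ztypecolon> \<sigma>" using typing.t_go[OF t_go.hyps] t_go.prems by simp
    show "\<Delta> @ \<phi> # \<Gamma> \<turnstile> lift (length \<Delta>) (Go M) \<Ztypecolon> \<sigma>" using typing.t_go[OF IH(1)] by simp
  qed (use IH(2) in \<open>simp only: lift.simps, intro uint_congs\<close>)
next
  case (t_fix \<sigma> \<Gamma>' M)
  note IH = lift_soundD_Cons[OF t_fix.IH[of "Bang \<sigma> # \<Delta>", unfolded t_fix.prems append_Cons, OF refl]]
  have M: "Bang \<sigma> # \<Delta> @ \<Gamma> \<turnstile> M \<Ztypecolon> \<sigma>" using t_fix.hyps t_fix.prems by simp
  show ?case
  proof (rule lift_soundI[OF typing.t_fix[OF M] \<phi>])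
    show "\<Delta> @ \<phi> # \<Gamma> \<turnstile> lift (length \<Delta>) (Fix \<sigma> M) \<Ztypecolon> \<sigma>" using typing.t_fix[OF IH(1)] by simp
  qed (simp only: lift.simps, rule fix_cong[OF IH(1) M _ _ IH(2)])
next
  case (t_fold \<Gamma>' M \<psi>)
  note IH = lift_soundD[OF t_fold.IH[OF t_fold.prems]]
  show ?case unfolding lift_sound_def using typing.t_fold[OF IH(1)] IH(2) by simp
next
  case (t_unfold \<Gamma>' M \<psi>)
  note IH = lift_soundD[OF t_unfold.IH[OF t_unfold.prems]]
  show ?case unfolding lift_sound_def using typing.t_unfold[OF IH(1)] IH(2) by simp
next
  case (t_coin \<Gamma>' p)
  then have "wf_ctx (\<Delta> @ \<Gamma>)" "wf_ctx (\<Delta> @ \<phi> # \<Gamma>)" using \<phi> by (auto simp: wf_ctx_def)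
  then show ?case using t_coin.hyps(2,3)
    by (intro lift_soundI[OF typing.t_coin \<phi>]) (simp_all only: lift.simps typing.t_coin uint_cpt(11))
qed

section \<open>Values denote coalgebraic points\<close>

inductive_cases typing_VarE: "\<Gamma> \<turnstile> Var n \<Ztypecolon> \<sigma>"
inductive_cases typing_StopE: "\<Gamma> \<turnstile> Stop M \<Ztypecolon> \<sigma>"
inductive_cases typing_TupE: "\<Gamma> \<turnstile> Tup M N \<Ztypecolon> \<sigma>"
inductive_cases typing_InjE: "\<Gamma> \<turnstile> Inj i M \<Ztypecolon> \<sigma>"
inductive_cases typing_LamE: "\<Gamma> \<turnstile> Lam \<phi> M \<Ztypecolon> \<sigma>"
inductive_cases typing_AppE: "\<Gamma> \<turnstile> App M N \<Ztypecolon> \<sigma>"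
inductive_cases typing_CaseE: "\<Gamma> \<turnstile> Case M N N' \<Ztypecolon> \<sigma>"
inductive_cases typing_PrjE: "\<Gamma> \<turnstile> Prj i M \<Ztypecolon> \<sigma>"
inductive_cases typing_GoE: "\<Gamma> \<turnstile> Go M \<Ztypecolon> \<sigma>"
inductive_cases typing_FixE: "\<Gamma> \<turnstile> Fix \<tau> M \<Ztypecolon> \<sigma>"
inductive_cases typing_FoldE: "\<Gamma> \<turnstile> Fold M \<Ztypecolon> \<sigma>"
inductive_cases typing_UnfoldE: "\<Gamma> \<turnstile> Unfold M \<Ztypecolon> \<sigma>"
inductive_cases typing_CoinE: "\<Gamma> \<turnstile> Coin p \<Ztypecolon> \<sigma>"

lemma env_nth_cpt: "wf_ctx \<Gamma> \<Longrightarrow> coalgebraic_env \<Gamma> us \<Longrightarrow> n < length \<Gamma> \<Longrightarrow> cpt (us ! n)"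
proof -
  assume w: "wf_ctx \<Gamma>" and e: "coalgebraic_env \<Gamma> us" and n: "n < length \<Gamma>"
  have "coalgebraic (psem (\<Gamma> ! n)) (us ! n)" using e n unfolding coalgebraic_env_def by (rule list_all2_nthD)
  moreover have "ptclosed 0 (\<Gamma> ! n)" using w n by (simp add: wf_ctx_def)
  ultimately show ?thesis using coalgebraic_psem by blast
qed

text \<open>Variables and the unit stand for coalgebraic points, promotions are coalgebraic, and
  coalgebraic points are closed under pairing and injection. Abstractions are not values, so no
  function space arises here.\<close>

lemma value_cpt:
  assumes "is_val V" "\<Gamma> \<turnstile> V \<Ztypecolon> \<sigma>" and us: "coalgebraic_env \<Gamma> us"
  shows "cpt (uint V \<odot> tens us)"
  using assms(1,2)
proof (induction arbitrary: \<sigma> rule: is_val.induct)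
  case (1 n)
  have "wf_ctx \<Gamma>" "n < length \<Gamma>" using 1 by (auto elim: typing_VarE)
  then show ?case using env_nth_cpt[OF _ us] vproj_env[OF _ us] by simp
next
  case 2
  show ?case using cpt_unit uint_cpt(1)[OF env_cpt[OF 2 us]] by simp
next
  case (3 M)
  show ?case unfolding uint_cpt(2)[OF env_cpt[OF 3 us]] by (rule cpt_prom)
next
  case (4 V W)
  from 4(5) obtain \<phi> \<psi> where t: "\<Gamma> \<turnstile> V \<Ztypecolon> Pos \<phi>" "\<Gamma> \<turnstile> W \<Ztypecolon> Pos \<psi>" by (auto elim: typing_TupE)
  show ?case unfolding uint_cpt(3)[OF env_cpt[OF 4(5) us]] by (rule cpt_tensv[OF 4(3)[OF t(1)] 4(4)[OF t(2)]])
next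
  case (5 V i)
  from 5(3) obtain \<phi> where t: "\<Gamma> \<turnstile> V \<Ztypecolon> Pos \<phi>" by (auto elim: typing_InjE)
  show ?case unfolding uint_cpt(4)[OF env_cpt[OF 5(3) us]] by (rule cpt_Inj[OF 5(2)[OF t]])
next
  case (6 V)
  from 6(3) obtain \<phi> where t: "\<Gamma> \<turnstile> V \<Ztypecolon> Pos \<phi>" by (auto elim: typing_FoldE)
  show ?case using 6(2)[OF t] by simp
qed

lemma value_coalgebraic:
  assumes "is_val V" "\<Gamma> \<turnstile> V \<Ztypecolon> Pos \<phi>" "coalgebraic_env \<Gamma> us"
  shows "coalgebraic (psem \<phi>) (uint V \<odot> tens us)"
  using value_cpt[OF assms] uint_pts[OF assms(2,3)] coalgebraic_psem[of \<phi>] typing_closed[OF assms(2)]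
  by (simp add: gsem_simps)

lemma is_val_lift: "is_val V \<Longrightarrow> is_val (lift k V)"
  by (induction rule: is_val.induct) (simp_all add: is_val.intros)

section \<open>Substitution of values\<close>

definition subst_sound :: "ctx \<Rightarrow> pty \<Rightarrow> ctx \<Rightarrow> tm \<Rightarrow> tm \<Rightarrow> gty \<Rightarrow> bool" where
  "subst_sound \<Delta> \<phi> \<Gamma> V M \<sigma> \<longleftrightarrow> \<Delta> @ \<Gamma> \<turnstile> subst M (length \<Delta>) V \<Ztypecolon> \<sigma> \<and>
     (\<forall>us us'. coalgebraic_env \<Delta> us \<longrightarrow> coalgebraic_env \<Gamma> us' \<longrightarrow>
        uint (subst M (length \<Delta>) V) \<odot> tens (us @ us') = uint M \<odot> tens (us @ (uint V \<odot> tens (us @ us')) # us'))"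

lemma subst_soundI:
  assumes M: "\<Delta> @ \<phi> # \<Gamma> \<turnstile> M \<Ztypecolon> \<sigma>" and V: "\<Delta> @ \<Gamma> \<turnstile> V \<Ztypecolon> Pos \<phi>" "is_val V"
    and "\<Delta> @ \<Gamma> \<turnstile> subst M (length \<Delta>) V \<Ztypecolon> \<sigma>"
    and "\<And>us us' v. coalgebraic_env \<Delta> us \<Longrightarrow> coalgebraic_env \<Gamma> us' \<Longrightarrow> v = uint V \<odot> tens (us @ us') \<Longrightarrow>
        coalgebraic_env (\<Delta> @ \<Gamma>) (us @ us') \<Longrightarrow> coalgebraic_env (\<Delta> @ \<phi> # \<Gamma>) (us @ v # us') \<Longrightarrow>
        cpt (tens (us @ us')) \<Longrightarrow> cpt (tens (us @ v # us')) \<Longrightarrow>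
        uint (subst M (length \<Delta>) V) \<odot> tens (us @ us') = uint M \<odot> tens (us @ v # us')"
  shows "subst_sound \<Delta> \<phi> \<Gamma> V M \<sigma>"
  unfolding subst_sound_def
proof (intro conjI allI impI)
  fix us us' assume e: "coalgebraic_env \<Delta> us" "coalgebraic_env \<Gamma> us'"
  let ?v = "uint V \<odot> tens (us @ us')"
  have e1: "coalgebraic_env (\<Delta> @ \<Gamma>) (us @ us')" by (rule coalgebraic_env_append[OF e])
  have e2: "coalgebraic_env (\<Delta> @ \<phi> # \<Gamma>) (us @ ?v # us')"
    using e value_coalgebraic[OF V(2,1) e1] by (intro coalgebraic_env_append) simp_all
  show "uint (subst M (length \<Delta>) V) \<odot> tens (us @ us') = uint M \<odot> tens (us @ ?v # us')"
    by (rule assms(5)[OF e refl e1 e2 env_cpt[OF assms(4) e1] env_cpt[OF M e2]])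
qed (rule assms(4))

lemma subst_soundD:
  assumes "subst_sound \<Delta> \<phi> \<Gamma> V M \<sigma>"
  shows "\<Delta> @ \<Gamma> \<turnstile> subst M (length \<Delta>) V \<Ztypecolon> \<sigma>"
    and "coalgebraic_env \<Delta> us \<Longrightarrow> coalgebraic_env \<Gamma> us' \<Longrightarrow> v = uint V \<odot> tens (us @ us') \<Longrightarrow>
        uint (subst M (length \<Delta>) V) \<odot> tens (us @ us') = uint M \<odot> tens (us @ v # us')"
  using assms unfolding subst_sound_def by blast+

text \<open>Below a binder the substituted value is lifted, and by \<open>lift_sem\<close> its
  denotation ignores the new entry \<open>w\<close>.\<close>

lemma subst_soundD_Cons:
  assumes S: "subst_sound (\<psi> # \<Delta>) \<phi> \<Gamma> (lift 0 V) M \<sigma>" and V: "\<Delta> @ \<Gamma> \<turnstile> V \<Ztypecolon> Pos \<phi>" and \<psi>: "ptclosed 0 \<psi>"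
  shows "\<psi> # \<Delta> @ \<Gamma> \<turnstile> subst M (Suc (length \<Delta>)) (lift 0 V) \<Ztypecolon> \<sigma>"
    and "coalgebraic (psem \<psi>) w \<Longrightarrow> coalgebraic_env \<Delta> us \<Longrightarrow> coalgebraic_env \<Gamma> us' \<Longrightarrow> v = uint V \<odot> tens (us @ us') \<Longrightarrow>
        uint (subst M (Suc (length \<Delta>)) (lift 0 V)) \<odot> tens (w # us @ us') = uint M \<odot> tens (w # us @ v # us')"
proof -
  show "\<psi> # \<Delta> @ \<Gamma> \<turnstile> subst M (Suc (length \<Delta>)) (lift 0 V) \<Ztypecolon> \<sigma>" using subst_soundD(1)[OF S] by simp
  assume w: "coalgebraic (psem \<psi>) w" and e: "coalgebraic_env \<Delta> us" "coalgebraic_env \<Gamma> us'" and v: "v = uint V \<odot> tens (us @ us')"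
  have "lift_sound [] \<psi> (\<Delta> @ \<Gamma>) V (Pos \<phi>)" by (rule lift_sem[OF V _ \<psi>]) simp
  from lift_soundD(2)[OF this, of "[]" w "us @ us'"]
  have "v = uint (lift 0 V) \<odot> tens ((w # us) @ us')"
    using w coalgebraic_env_append[OF e] v by simp
  from subst_soundD(2)[OF S _ e(2) this]
  show "uint (subst M (Suc (length \<Delta>)) (lift 0 V)) \<odot> tens (w # us @ us') = uint M \<odot> tens (w # us @ v # us')"
    using w e(1) by simp
qed

lemma lift_value:
  assumes V: "\<Delta> @ \<Gamma> \<turnstile> V \<Ztypecolon> Pos \<phi>" "is_val V" and \<psi>: "ptclosed 0 \<psi>"
  shows "(\<psi> # \<Delta>) @ \<Gamma> \<turnstile> lift 0 V \<Ztypecolon> Pos \<phi>" "is_val (lift 0 V)"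
proof -
  have "lift_sound [] \<psi> (\<Delta> @ \<Gamma>) V (Pos \<phi>)" by (rule lift_sem[OF V(1) _ \<psi>]) simp
  then show "(\<psi> # \<Delta>) @ \<Gamma> \<turnstile> lift 0 V \<Ztypecolon> Pos \<phi>" using lift_soundD(1) by fastforce
qed (rule is_val_lift[OF V(2)])

text \<open>Substituting \<open>V\<close> amounts to inserting its denotation into the environment.
  The extended environment is again coalgebraic because \<open>V\<close> is a value, so the
  equations for coalgebraic environments apply to both sides.\<close>

lemma subst_sem:
  assumes "\<Gamma>' \<turnstile> M \<Ztypecolon> \<sigma>" "\<Gamma>' = \<Delta> @ \<phi> # \<Gamma>" "\<Delta> @ \<Gamma> \<turnstile> V \<Ztypecolon> Pos \<phi>" "is_val V"
  shows "subst_sound \<Delta> \<phi> \<Gamma> V M \<sigma>"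
  using assms
proof (induction arbitrary: \<Delta> V rule: typing.induct)
  case (t_var \<Gamma>' n)
  note V = t_var.prems(2,3)
  have wf: "wf_ctx (\<Delta> @ \<Gamma>)" using typing_closed[OF V(1)] by blast
  have M: "\<Delta> @ \<phi> # \<Gamma> \<turnstile> Var n \<Ztypecolon> Pos (\<Gamma>' ! n)" using typing.t_var[OF t_var.hyps] t_var.prems by simp
  show ?case
  proof (rule subst_soundI[OF M V])
    have "\<Delta> @ \<Gamma> \<turnstile> Var n \<Ztypecolon> Pos (\<Gamma>' ! n)" if "n < length \<Delta>"
      using typing.t_var[OF wf, of n] that t_var.prems(1) by (simp add: nth_append)
    moreover have "\<Delta> @ \<Gamma> \<turnstile> Var (n - 1) \<Ztypecolon> Pos (\<Gamma>' ! n)" if "\<not> n < length \<Delta>" "n \<noteq> length \<Delta>"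
    proof -
      have "n - 1 < length (\<Delta> @ \<Gamma>)" using that t_var by auto
      moreover have "(\<Delta> @ \<Gamma>) ! (n - 1) = \<Gamma>' ! n"
        using that t_var.prems(1) by (auto simp: nth_append nth_Cons' Suc_diff_Suc)
      ultimately show ?thesis using typing.t_var[OF wf, of "n - 1"] by simp
    qed
    moreover have "\<Delta> @ \<Gamma> \<turnstile> V \<Ztypecolon> Pos (\<Gamma>' ! n)" if "n = length \<Delta>"
      using V(1) that t_var.prems(1) by (simp add: nth_append)
    ultimately show "\<Delta> @ \<Gamma> \<turnstile> subst (Var n) (length \<Delta>) V \<Ztypecolon> Pos (\<Gamma>' ! n)" by simp
    fix us us' v assume e: "coalgebraic_env \<Delta> us" "v = uint V \<odot> tens (us @ us')"
      "coalgebraic_env (\<Delta> @ \<Gamma>) (us @ us')" "coalgebraic_env (\<Delta> @ \<phi> # \<Gamma>) (us @ v # us')"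
    have len: "length us = length \<Delta>" by (rule coalgebraic_env_length[OF e(1)])
    have r: "uint (Var n) \<odot> tens (us @ v # us') = (us @ v # us') ! n"
      using vproj_env[OF _ e(4), of n] t_var by simp
    \<comment> \<open>A variable of the prefix, the substituted variable itself, or a variable of
      \<open>\<Gamma>\<close>, whose index drops by one.\<close>
    consider "n < length \<Delta>" | "n = length \<Delta>" | "n > length \<Delta>" by linarith
    then show "uint (subst (Var n) (length \<Delta>) V) \<odot> tens (us @ us') = uint (Var n) \<odot> tens (us @ v # us')"
    proof cases
      case 1
      then show ?thesis unfolding r using vproj_env[OF wf e(3), of n] by (simp add: nth_append len)
    next
      case 2
      then show ?thesis unfolding r using e(2) by (simp add: nth_append len)
    next
      case 3
      then have "n - 1 < length (\<Delta> @ \<Gamma>)" using t_var by auto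
      then have "vproj (n - 1) \<odot> tens (us @ us') = (us @ us') ! (n - 1)" by (rule vproj_env[OF wf e(3)])
      also have "\<dots> = (us @ v # us') ! n" using 3 len by (auto simp: nth_append nth_Cons' Suc_diff_Suc)
      finally show ?thesis unfolding r using 3 by simp
    qed
  qed
next
  case (t_unit \<Gamma>')
  have "wf_ctx (\<Delta> @ \<Gamma>)" "wf_ctx (\<Delta> @ \<phi> # \<Gamma>)" using t_unit typing_closed by blast+
  then show ?case
    by (intro subst_soundI[OF typing.t_unit t_unit.prems(2,3)]) (simp_all only: subst.simps typing.t_unit uint_cpt(1))
next
  case (t_coin \<Gamma>' p)
  have "wf_ctx (\<Delta> @ \<Gamma>)" "wf_ctx (\<Delta> @ \<phi> # \<Gamma>)" using t_coin typing_closed by blast+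
  then show ?case using t_coin.hyps(2,3)
    by (intro subst_soundI[OF typing.t_coin t_coin.prems(2,3)]) (simp_all only: subst.simps typing.t_coin uint_cpt(11))
next
  case (t_stop \<Gamma>' M \<sigma>)
  note IH = subst_soundD[OF t_stop.IH[OF t_stop.prems]]
  have M: "\<Delta> @ \<phi> # \<Gamma> \<turnstile> Stop M \<Ztypecolon> Pos (Bang \<sigma>)" using typing.t_stop[OF t_stop.hyps] t_stop.prems(1) by simp
  show ?case
  proof (rule subst_soundI[OF M t_stop.prems(2,3)])
    show "\<Delta> @ \<Gamma> \<turnstile> subst (Stop M) (length \<Delta>) V \<Ztypecolon> Pos (Bang \<sigma>)" using typing.t_stop[OF IH(1)] by simp
  qed (use IH(2) in \<open>simp only: subst.simps, intro uint_congs\<close>)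
next
  case (t_inl \<Gamma>' M \<phi>\<^sub>l \<phi>\<^sub>r)
  note IH = subst_soundD[OF t_inl.IH[OF t_inl.prems]]
  have M: "\<Delta> @ \<phi> # \<Gamma> \<turnstile> Inj Lft M \<Ztypecolon> Pos (Plus \<phi>\<^sub>l \<phi>\<^sub>r)" using typing.t_inl[OF t_inl.hyps] t_inl.prems(1) by simp
  show ?case
  proof (rule subst_soundI[OF M t_inl.prems(2,3)])
    show "\<Delta> @ \<Gamma> \<turnstile> subst (Inj Lft M) (length \<Delta>) V \<Ztypecolon> Pos (Plus \<phi>\<^sub>l \<phi>\<^sub>r)" using typing.t_inl[OF IH(1) t_inl.hyps(2)] by simp
  qed (use IH(2) in \<open>simp only: subst.simps, intro uint_congs\<close>)
next
  case (t_inr \<Gamma>' M \<phi>\<^sub>r \<phi>\<^sub>l)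
  note IH = subst_soundD[OF t_inr.IH[OF t_inr.prems]]
  have M: "\<Delta> @ \<phi> # \<Gamma> \<turnstile> Inj Rgt M \<Ztypecolon> Pos (Plus \<phi>\<^sub>l \<phi>\<^sub>r)" using typing.t_inr[OF t_inr.hyps] t_inr.prems(1) by simp
  show ?case
  proof (rule subst_soundI[OF M t_inr.prems(2,3)])
    show "\<Delta> @ \<Gamma> \<turnstile> subst (Inj Rgt M) (length \<Delta>) V \<Ztypecolon> Pos (Plus \<phi>\<^sub>l \<phi>\<^sub>r)" using typing.t_inr[OF IH(1) t_inr.hyps(2)] by simp
  qed (use IH(2) in \<open>simp only: subst.simps, intro uint_congs\<close>)
next
  case (t_prl \<Gamma>' M \<phi>\<^sub>l \<phi>\<^sub>r)
  note IH = subst_soundD[OF t_prl.IH[OF t_prl.prems]]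
  have M: "\<Delta> @ \<phi> # \<Gamma> \<turnstile> Prj Lft M \<Ztypecolon> Pos \<phi>\<^sub>l" using typing.t_prl[OF t_prl.hyps] t_prl.prems(1) by simp
  show ?case
  proof (rule subst_soundI[OF M t_prl.prems(2,3)])
    show "\<Delta> @ \<Gamma> \<turnstile> subst (Prj Lft M) (length \<Delta>) V \<Ztypecolon> Pos \<phi>\<^sub>l" using typing.t_prl[OF IH(1)] by simp
  qed (use IH(2) in \<open>simp only: subst.simps, intro uint_congs\<close>)
next
  case (t_prr \<Gamma>' M \<phi>\<^sub>l \<phi>\<^sub>r)
  note IH = subst_soundD[OF t_prr.IH[OF t_prr.prems]]
  have M: "\<Delta> @ \<phi> # \<Gamma> \<turnstile> Prj Rgt M \<Ztypecolon> Pos \<phi>\<^sub>r" using typing.t_prr[OF t_prr.hyps] t_prr.prems(1) by simp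
  show ?case
  proof (rule subst_soundI[OF M t_prr.prems(2,3)])
    show "\<Delta> @ \<Gamma> \<turnstile> subst (Prj Rgt M) (length \<Delta>) V \<Ztypecolon> Pos \<phi>\<^sub>r" using typing.t_prr[OF IH(1)] by simp
  qed (use IH(2) in \<open>simp only: subst.simps, intro uint_congs\<close>)
next
  case (t_go \<Gamma>' M \<sigma>)
  note IH = subst_soundD[OF t_go.IH[OF t_go.prems]]
  have M: "\<Delta> @ \<phi> # \<Gamma> \<turnstile> Go M \<Ztypecolon> \<sigma>" using typing.t_go[OF t_go.hyps] t_go.prems(1) by simp
  show ?case
  proof (rule subst_soundI[OF M t_go.prems(2,3)])
    show "\<Delta> @ \<Gamma> \<turnstile> subst (Go M) (length \<Delta>) V \<Ztypecolon> \<sigma>" using typing.t_go[OF IH(1)] by simp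
  qed (use IH(2) in \<open>simp only: subst.simps, intro uint_congs\<close>)
next
  case (t_tup \<Gamma>' M \<phi>\<^sub>l N \<phi>\<^sub>r)
  note IH = subst_soundD[OF t_tup.IH(1)[OF t_tup.prems]] subst_soundD[OF t_tup.IH(2)[OF t_tup.prems]]
  have M: "\<Delta> @ \<phi> # \<Gamma> \<turnstile> Tup M N \<Ztypecolon> Pos (Tensor \<phi>\<^sub>l \<phi>\<^sub>r)" using typing.t_tup[OF t_tup.hyps] t_tup.prems(1) by simp
  show ?case
  proof (rule subst_soundI[OF M t_tup.prems(2,3)])
    show "\<Delta> @ \<Gamma> \<turnstile> subst (Tup M N) (length \<Delta>) V \<Ztypecolon> Pos (Tensor \<phi>\<^sub>l \<phi>\<^sub>r)" using typing.t_tup[OF IH(1,3)] by simp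
  qed (use IH(2,4) in \<open>simp only: subst.simps, intro uint_congs\<close>)
next
  case (t_app \<Gamma>' M \<psi> \<sigma> N)
  note IH = subst_soundD[OF t_app.IH(1)[OF t_app.prems]] subst_soundD[OF t_app.IH(2)[OF t_app.prems]]
  have M: "\<Delta> @ \<phi> # \<Gamma> \<turnstile> App M N \<Ztypecolon> \<sigma>" using typing.t_app[OF t_app.hyps] t_app.prems(1) by simp
  show ?case
  proof (rule subst_soundI[OF M t_app.prems(2,3)])
    show "\<Delta> @ \<Gamma> \<turnstile> subst (App M N) (length \<Delta>) V \<Ztypecolon> \<sigma>" using typing.t_app[OF IH(1,3)] by simp
  qed (use IH(2,4) in \<open>simp only: subst.simps, intro uint_congs\<close>)
next
  case (t_fold \<Gamma>' M \<psi>)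
  note IH = subst_soundD[OF t_fold.IH[OF t_fold.prems]]
  show ?case unfolding subst_sound_def using typing.t_fold[OF IH(1)] IH(2) by simp
next
  case (t_unfold \<Gamma>' M \<psi>)
  note IH = subst_soundD[OF t_unfold.IH[OF t_unfold.prems]]
  show ?case unfolding subst_sound_def using typing.t_unfold[OF IH(1)] IH(2) by simp
next
  case (t_lam \<psi> \<Gamma>' M \<sigma>)
  have M: "\<psi> # \<Delta> @ \<phi> # \<Gamma> \<turnstile> M \<Ztypecolon> \<sigma>" using t_lam.hyps t_lam.prems(1) by simp
  have c: "ptclosed 0 (\<psi>)" using typing_closed[OF M] by simp
  have "subst_sound (\<psi> # \<Delta>) \<phi> \<Gamma> (lift 0 V) M \<sigma>"
    by (rule t_lam.IH[OF _ lift_value[OF t_lam.prems(2,3) c]]) (simp add: t_lam.prems(1))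
  note IH = subst_soundD_Cons[OF this t_lam.prems(2) c]
  show ?case
  proof (rule subst_soundI[OF typing.t_lam[OF M] t_lam.prems(2,3)])
    show "\<Delta> @ \<Gamma> \<turnstile> subst (Lam \<psi> M) (length \<Delta>) V \<Ztypecolon> Lolli \<psi> \<sigma>" using typing.t_lam[OF IH(1)] by simp
    fix us us' v assume e: "coalgebraic_env \<Delta> us" "coalgebraic_env \<Gamma> us'" "v = uint V \<odot> tens (us @ us')"
      "coalgebraic_env (\<Delta> @ \<Gamma>) (us @ us')" "coalgebraic_env (\<Delta> @ \<phi> # \<Gamma>) (us @ v # us')"
    show "uint (subst (Lam \<psi> M) (length \<Delta>) V) \<odot> tens (us @ us') = uint (Lam \<psi> M) \<odot> tens (us @ v # us')"
      unfolding subst.simps by (rule lam_cong[OF IH(1) M e(4,5)]) (rule IH(2)[OF _ e(1-3)])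
  qed
next
  case (t_fix \<sigma> \<Gamma>' M)
  have M: "Bang \<sigma> # \<Delta> @ \<phi> # \<Gamma> \<turnstile> M \<Ztypecolon> \<sigma>" using t_fix.hyps t_fix.prems(1) by simp
  have c: "ptclosed 0 (Bang \<sigma>)" using typing_closed[OF M] by simp
  have "subst_sound (Bang \<sigma> # \<Delta>) \<phi> \<Gamma> (lift 0 V) M \<sigma>"
    by (rule t_fix.IH[OF _ lift_value[OF t_fix.prems(2,3) c]]) (simp add: t_fix.prems(1))
  note IH = subst_soundD_Cons[OF this t_fix.prems(2) c]
  show ?case
  proof (rule subst_soundI[OF typing.t_fix[OF M] t_fix.prems(2,3)])
    show "\<Delta> @ \<Gamma> \<turnstile> subst (Fix \<sigma> M) (length \<Delta>) V \<Ztypecolon> \<sigma>" using typing.t_fix[OF IH(1)] by simp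
    fix us us' v assume e: "coalgebraic_env \<Delta> us" "coalgebraic_env \<Gamma> us'" "v = uint V \<odot> tens (us @ us')"
      "coalgebraic_env (\<Delta> @ \<Gamma>) (us @ us')" "coalgebraic_env (\<Delta> @ \<phi> # \<Gamma>) (us @ v # us')"
    show "uint (subst (Fix \<sigma> M) (length \<Delta>) V) \<odot> tens (us @ us') = uint (Fix \<sigma> M) \<odot> tens (us @ v # us')"
      unfolding subst.simps by (rule fix_cong[OF IH(1) M e(4,5)]) (rule IH(2)[OF _ e(1-3)])
  qed
next
  case (t_case \<Gamma>' M \<phi>\<^sub>l \<phi>\<^sub>r N\<^sub>l \<sigma> N\<^sub>r)
  have M: "\<Delta> @ \<phi> # \<Gamma> \<turnstile> M \<Ztypecolon> Pos (Plus \<phi>\<^sub>l \<phi>\<^sub>r)" "\<phi>\<^sub>l # \<Delta> @ \<phi> # \<Gamma> \<turnstile> N\<^sub>l \<Ztypecolon> \<sigma>" "\<phi>\<^sub>r # \<Delta> @ \<phi> # \<Gamma> \<turnstile> N\<^sub>r \<Ztypecolon> \<sigma>"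
    using t_case.hyps t_case.prems(1) by simp_all
  have c: "ptclosed 0 \<phi>\<^sub>l" "ptclosed 0 \<phi>\<^sub>r" using typing_closed[OF M(1)] by simp_all
  note IH = subst_soundD[OF t_case.IH(1)[OF t_case.prems]]
  have "subst_sound (\<phi>\<^sub>l # \<Delta>) \<phi> \<Gamma> (lift 0 V) N\<^sub>l \<sigma>"
    by (rule t_case.IH(2)[OF _ lift_value[OF t_case.prems(2,3) c(1)]]) (simp add: t_case.prems(1))
  note L = subst_soundD_Cons[OF this t_case.prems(2) c(1)]
  have "subst_sound (\<phi>\<^sub>r # \<Delta>) \<phi> \<Gamma> (lift 0 V) N\<^sub>r \<sigma>"
    by (rule t_case.IH(3)[OF _ lift_value[OF t_case.prems(2,3) c(2)]]) (simp add: t_case.prems(1))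
  note R = subst_soundD_Cons[OF this t_case.prems(2) c(2)]
  show ?case
  proof (rule subst_soundI[OF typing.t_case[OF M] t_case.prems(2,3)])
    show "\<Delta> @ \<Gamma> \<turnstile> subst (Case M N\<^sub>l N\<^sub>r) (length \<Delta>) V \<Ztypecolon> \<sigma>" using typing.t_case[OF IH(1) L(1) R(1)] by simp
    fix us us' v assume e: "coalgebraic_env \<Delta> us" "coalgebraic_env \<Gamma> us'" "v = uint V \<odot> tens (us @ us')"
      "coalgebraic_env (\<Delta> @ \<Gamma>) (us @ us')" "coalgebraic_env (\<Delta> @ \<phi> # \<Gamma>) (us @ v # us')"
    show "uint (subst (Case M N\<^sub>l N\<^sub>r) (length \<Delta>) V) \<odot> tens (us @ us') = uint (Case M N\<^sub>l N\<^sub>r) \<odot> tens (us @ v # us')"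
      unfolding subst.simps
    proof (rule case_cong[OF IH(1) M(1) L(1) M(2) R(1) M(3) e(4,5) IH(2)[OF e(1-3)]])
    qed (rule L(2)[OF _ e(1-3)] R(2)[OF _ e(1-3)], assumption)+
  qed
qed

lemma subst_0:
  assumes "\<phi> # \<Gamma> \<turnstile> M \<Ztypecolon> \<sigma>" "\<Gamma> \<turnstile> V \<Ztypecolon> Pos \<phi>" "is_val V"
  shows "\<Gamma> \<turnstile> subst M 0 V \<Ztypecolon> \<sigma>"
    and "coalgebraic_env \<Gamma> us \<Longrightarrow> uint (subst M 0 V) \<odot> tens us = uint M \<odot> (tens us \<otimes>\<^sub>v (uint V \<odot> tens us))"
proof -
  have s: "subst_sound [] \<phi> \<Gamma> V M \<sigma>" by (rule subst_sem[OF assms(1)]) (use assms in simp_all)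
  show "\<Gamma> \<turnstile> subst M 0 V \<Ztypecolon> \<sigma>" using subst_soundD(1)[OF s] by simp
  show "uint (subst M 0 V) \<odot> tens us = uint M \<odot> (tens us \<otimes>\<^sub>v (uint V \<odot> tens us))" if "coalgebraic_env \<Gamma> us"
    using subst_soundD(2)[OF s, of "[]" us] that by simp
qed

section \<open>Reduction\<close>

inductive_cases red_VarE: "red (Var n) p N"
inductive_cases red_UnitE: "red Unit p N"
inductive_cases red_StopE: "red (Stop M) p N"
inductive_cases red_TupE: "red (Tup M M') p N"
inductive_cases red_InjE: "red (Inj i M) p N"
inductive_cases red_LamE: "red (Lam \<phi> M) p N"
inductive_cases red_AppE: "red (App M M') p N"
inductive_cases red_CaseE: "red (Case M L R) p N"
inductive_cases red_PrjE: "red (Prj i M) p N"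
inductive_cases red_GoE: "red (Go M) p N"
inductive_cases red_FixE: "red (Fix \<sigma> M) p N"
inductive_cases red_FoldE: "red (Fold M) p N"
inductive_cases red_UnfoldE: "red (Unfold M) p N"
inductive_cases red_CoinE: "red (Coin q) p N"

inductive_cases weak_VarE: "Var n \<leadsto> N"
inductive_cases weak_UnitE: "Unit \<leadsto> N"
inductive_cases weak_StopE: "Stop M \<leadsto> N"
inductive_cases weak_TupE: "Tup M M' \<leadsto> N"
inductive_cases weak_InjE: "Inj i M \<leadsto> N"
inductive_cases weak_LamE: "Lam \<phi> M \<leadsto> N"
inductive_cases weak_AppE: "App M M' \<leadsto> N"
inductive_cases weak_CaseE: "Case M L R \<leadsto> N"
inductive_cases weak_PrjE: "Prj i M \<leadsto> N"
inductive_cases weak_GoE: "Go M \<leadsto> N"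
inductive_cases weak_FixE: "Fix \<sigma> M \<leadsto> N"
inductive_cases weak_FoldE: "Fold M \<leadsto> N"
inductive_cases weak_UnfoldE: "Unfold M \<leadsto> N"
inductive_cases weak_CoinE: "Coin q \<leadsto> N"

lemma value_no_red:
  assumes "is_val V"
  shows "\<not> red V p N"
  using assms
proof (induction arbitrary: p N rule: is_val.induct)
  case (1 n)
  show ?case by (blast elim: red_VarE weak_VarE)
next
  case 2
  show ?case by (blast elim: red_UnitE weak_UnitE)
next
  case (3 M)
  show ?case by (blast elim: red_StopE weak_StopE)
next
  case (4 V W)
  then show ?case by (blast elim: red_TupE weak_TupE)
next
  case (5 V i)
  then show ?case by (blast elim: red_InjE weak_InjE)
next
  case (6 V)
  then show ?case by (blast elim: red_FoldE weak_FoldE)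
qed

lemma Lam_no_red: "\<not> red (Lam \<phi> M) p N"
  by (blast elim: red_LamE weak_LamE)

lemma red_not_value: "red M p N \<Longrightarrow> \<not> is_val M"
  using value_no_red by blast

lemma is_val_Tup: "is_val (Tup V W) \<longleftrightarrow> is_val V \<and> is_val W"
  by (auto elim: is_val.cases intro: is_val.intros)

lemma is_val_Inj: "is_val (Inj i V) \<longleftrightarrow> is_val V"
  by (auto elim: is_val.cases intro: is_val.intros)

lemma is_val_Fold: "is_val (Fold V) \<longleftrightarrow> is_val V"
  by (auto elim: is_val.cases intro: is_val.intros)

text \<open>A term that reduces is neither a value nor an abstraction. Hence it cannot complete a
  redex with the surrounding frame, and the value restrictions on frames exclude a competing
  reduction in the neighbouring subterm.\<close>

lemma red_frames:
  assumes "red M p0 N0"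
  shows "red (Go M) q L \<longleftrightarrow> (\<exists>M'. red M q M' \<and> L = Go M')"
    and "is_val V \<Longrightarrow> red (App M V) q L \<longleftrightarrow> (\<exists>M'. red M q M' \<and> L = App M' V)"
    and "red (App N M) q L \<longleftrightarrow> (\<exists>M'. red M q M' \<and> L = App N M')"
    and "red (Prj i M) q L \<longleftrightarrow> (\<exists>M'. red M q M' \<and> L = Prj i M')"
    and "red (Tup M N) q L \<longleftrightarrow> (\<exists>M'. red M q M' \<and> L = Tup M' N)"
    and "is_val V \<Longrightarrow> red (Tup V M) q L \<longleftrightarrow> (\<exists>M'. red M q M' \<and> L = Tup V M')"
    and "red (Inj i M) q L \<longleftrightarrow> (\<exists>M'. red M q M' \<and> L = Inj i M')"
    and "red (Case M N\<^sub>l N\<^sub>r) q L \<longleftrightarrow> (\<exists>M'. red M q M' \<and> L = Case M' N\<^sub>l N\<^sub>r)"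
    and "red (Fold M) q L \<longleftrightarrow> (\<exists>M'. red M q M' \<and> L = Fold M')"
    and "red (Unfold M) q L \<longleftrightarrow> (\<exists>M'. red M q M' \<and> L = Unfold M')"
proof -
  have nv: "\<not> is_val M" by (rule red_not_value[OF assms])
  have nl: "M \<noteq> Lam \<phi> K" for \<phi> K using assms Lam_no_red by blast
  have ns: "M \<noteq> Stop K" for K using nv is_val.intros(3) by blast
  show "red (Go M) q L \<longleftrightarrow> (\<exists>M'. red M q M' \<and> L = Go M')"
    using ns by (auto elim!: red_GoE weak_GoE intro: red.intros)
  show "red (App M V) q L \<longleftrightarrow> (\<exists>M'. red M q M' \<and> L = App M' V)" if "is_val V"
    using nl that value_no_red[OF that] by (auto elim!: red_AppE weak_AppE intro: red.intros)
  show "red (App N M) q L \<longleftrightarrow> (\<exists>M'. red M q M' \<and> L = App N M')"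
    using nv by (auto elim!: red_AppE weak_AppE intro: red.intros)
  show "red (Prj i M) q L \<longleftrightarrow> (\<exists>M'. red M q M' \<and> L = Prj i M')"
    using nv by (auto simp: is_val_Tup elim!: red_PrjE weak_PrjE intro: red.intros)
  show "red (Tup M N) q L \<longleftrightarrow> (\<exists>M'. red M q M' \<and> L = Tup M' N)"
    using nv by (auto elim!: red_TupE weak_TupE intro: red.intros)
  show "red (Tup V M) q L \<longleftrightarrow> (\<exists>M'. red M q M' \<and> L = Tup V M')" if "is_val V"
    using that value_no_red[OF that] by (auto elim!: red_TupE weak_TupE intro: red.intros)
  show "red (Inj i M) q L \<longleftrightarrow> (\<exists>M'. red M q M' \<and> L = Inj i M')"
    by (auto elim!: red_InjE weak_InjE intro: red.intros)
  show "red (Case M N\<^sub>l N\<^sub>r) q L \<longleftrightarrow> (\<exists>M'. red M q M' \<and> L = Case M' N\<^sub>l N\<^sub>r)"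
    using nv by (auto simp: is_val_Inj elim!: red_CaseE weak_CaseE intro: red.intros)
  show "red (Fold M) q L \<longleftrightarrow> (\<exists>M'. red M q M' \<and> L = Fold M')"
    by (auto elim!: red_FoldE weak_FoldE intro: red.intros)
  show "red (Unfold M) q L \<longleftrightarrow> (\<exists>M'. red M q M' \<and> L = Unfold M')"
    using nv by (auto simp: is_val_Fold elim!: red_UnfoldE weak_UnfoldE intro: red.intros)
qed

text \<open>Every subterm of a redex at which a frame could reduce is a value or an abstraction, so
  only the redex itself can be contracted.\<close>

lemma weak_red_deterministic:
  assumes "M \<leadsto> N"
  shows "red M q L \<longleftrightarrow> q = 1 \<and> L = N"
  using assms
proof cases
  case 1
  then show ?thesis using value_no_red[OF is_val.intros(3)]
    by (auto elim!: red_GoE weak_GoE intro: red.intros weak_red.intros)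
next
  case (2 V \<phi> K)
  then show ?thesis using value_no_red[OF 2(3)] Lam_no_red
    by (auto elim!: red_AppE weak_AppE intro: red.intros weak_red.intros)
next
  case (3 W)
  have "\<not> red (Tup N W) p K" for p K using 3 by (intro value_no_red) (simp add: is_val_Tup)
  then show ?thesis using 3
    by (auto elim!: red_PrjE weak_PrjE intro: red.intros weak_red.intros)
next
  case (4 V)
  have "\<not> red (Tup V N) p K" for p K using 4 by (intro value_no_red) (simp add: is_val_Tup)
  then show ?thesis using 4
    by (auto elim!: red_PrjE weak_PrjE intro: red.intros weak_red.intros)
next
  case (5 \<sigma> K)
  then show ?thesis by (auto elim!: red_FixE weak_FixE intro: red.intros weak_red.intros)
next
  case (6 V K K')
  have "\<not> red (Inj Lft V) p J" for p J using 6 by (intro value_no_red) (simp add: is_val_Inj)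
  then show ?thesis using 6
    by (auto elim!: red_CaseE weak_CaseE intro: red.intros weak_red.intros)
next
  case (7 V K K')
  have "\<not> red (Inj Rgt V) p J" for p J using 7 by (intro value_no_red) (simp add: is_val_Inj)
  then show ?thesis using 7
    by (auto elim!: red_CaseE weak_CaseE intro: red.intros weak_red.intros)
next
  case 8
  have "\<not> red (Fold N) p J" for p J using 8 by (intro value_no_red) (simp add: is_val_Fold)
  then show ?thesis using 8
    by (auto elim!: red_UnfoldE weak_UnfoldE intro: red.intros weak_red.intros)
qed

lemma weak_red_sound:
  assumes "M \<leadsto> N" and M: "\<Gamma> \<turnstile> M \<Ztypecolon> \<sigma>"
  shows "\<Gamma> \<turnstile> N \<Ztypecolon> \<sigma> \<and> (\<forall>us. coalgebraic_env \<Gamma> us \<longrightarrow> uint M \<odot> tens us = uint N \<odot> tens us)"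
  using assms(1)
proof cases
  case 1
  then have "\<Gamma> \<turnstile> N \<Ztypecolon> \<sigma>" using M by (auto elim!: typing_GoE typing_StopE)
  moreover have "uint M \<odot> tens us = uint N \<odot> tens us" if "coalgebraic_env \<Gamma> us" for us
    using env_cpt[OF M that] by (simp only: 1 uint_cpt(9) uint_cpt(2) DER_prom)
  ultimately show ?thesis by blast
next
  case (2 V \<phi> K)
  from M 2(1) have "\<exists>\<psi>. \<Gamma> \<turnstile> Lam \<phi> K \<Ztypecolon> Lolli \<psi> \<sigma> \<and> \<Gamma> \<turnstile> V \<Ztypecolon> Pos \<psi>" by (auto elim: typing_AppE)
  then have K: "\<phi> # \<Gamma> \<turnstile> K \<Ztypecolon> \<sigma>" and V: "\<Gamma> \<turnstile> V \<Ztypecolon> Pos \<phi>" by (auto elim!: typing_LamE)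
  have "uint M \<odot> tens us = uint N \<odot> tens us" if us: "coalgebraic_env \<Gamma> us" for us
  proof -
    have "uint M \<odot> tens us = mat_of (uint (Lam \<phi> K) \<odot> tens us) \<odot> uint V \<odot> tens us"
      unfolding 2(1) by (rule uint_cpt(5)[OF env_cpt[OF M us]])
    also have "\<dots> = uint K \<odot> (tens us \<otimes>\<^sub>v (uint V \<odot> tens us))"
      by (rule uint_lam[OF K value_coalgebraic[OF 2(3) V us]])
    finally show ?thesis using subst_0(2)[OF K V 2(3) us] 2(2) by simp
  qed
  then show ?thesis using subst_0(1)[OF K V 2(3)] 2(2) by blast
next
  case (3 W)
  from M 3(1) obtain \<phi> \<psi> where s: "\<sigma> = Pos \<phi>" and t: "\<Gamma> \<turnstile> Tup N W \<Ztypecolon> Pos (Tensor \<phi> \<psi>)"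
    by (auto elim!: typing_PrjE)
  then have N: "\<Gamma> \<turnstile> N \<Ztypecolon> Pos \<phi>" and W: "\<Gamma> \<turnstile> W \<Ztypecolon> Pos \<psi>" by (auto elim!: typing_TupE)
  have "uint M \<odot> tens us = uint N \<odot> tens us" if us: "coalgebraic_env \<Gamma> us" for us
  proof -
    \<comment> \<open>The discarded component is coalgebraic, so weakening it gives exactly
      \<open>1\<close>.\<close>
    have "H \<odot> uint W \<odot> tens us = prom (uint W \<odot> tens us)" using value_cpt[OF 3(3) W us] by (simp add: cpt_def)
    then show ?thesis
      unfolding 3(1) uint_cpt(7)[OF env_cpt[OF M us]] uint_cpt(3)[OF env_cpt[OF M us]] PRL_mapp by simp
  qed
  then show ?thesis using N s by blast
next
  case (4 V)
  from M 4(1) obtain \<phi> \<psi> where s: "\<sigma> = Pos \<psi>" and t: "\<Gamma> \<turnstile> Tup V N \<Ztypecolon> Pos (Tensor \<phi> \<psi>)"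
    by (auto elim!: typing_PrjE)
  then have N: "\<Gamma> \<turnstile> N \<Ztypecolon> Pos \<psi>" and V: "\<Gamma> \<turnstile> V \<Ztypecolon> Pos \<phi>" by (auto elim!: typing_TupE)
  have "uint M \<odot> tens us = uint N \<odot> tens us" if us: "coalgebraic_env \<Gamma> us" for us
  proof -
    have "H \<odot> uint V \<odot> tens us = prom (uint V \<odot> tens us)" using value_cpt[OF 4(2) V us] by (simp add: cpt_def)
    then show ?thesis
      unfolding 4(1) uint_cpt(8)[OF env_cpt[OF M us]] uint_cpt(3)[OF env_cpt[OF M us]] PRR_mapp by simp
  qed
  then show ?thesis using N s by blast
next
  case (5 \<tau> K)
  have s: "\<tau> = \<sigma>" and K: "Bang \<sigma> # \<Gamma> \<turnstile> K \<Ztypecolon> \<sigma>" using M 5(1) by (auto elim!: typing_FixE)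
  note V = t_stop[OF M]
  have N: "N = subst K 0 (Stop M)" using 5 s by simp
  have "uint M \<odot> tens us = uint N \<odot> tens us" if us: "coalgebraic_env \<Gamma> us" for us
  proof -
    \<comment> \<open>One unfolding applies \<open>?f\<close> once more. Since \<open>?f\<close> is
      continuous, this shifts the increasing sequence of iterates by one and leaves its supremum
      unchanged.\<close>
    let ?f = "\<lambda>w. uint K \<odot> (tens us \<otimes>\<^sub>v prom w)"
    let ?w = "\<lambda>k. (?f ^^ k) (\<lambda>_. 0)"
    note cp = env_cpt[OF M us]
    have inc: "incseq ?w"
    proof (rule incseq_SucI)
      fix k show "?w k \<le> ?w (Suc k)"
      proof (induction k)
        case (Suc k)
        then have "?f (?w k) \<le> ?f (?w (Suc k))"
          by (intro mapp_mono[OF order_refl] tensv_mono[OF order_refl] prom_mono)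
        then show ?case by simp
      qed (simp add: le_fun_def)
    qed
    have M_eq: "uint M \<odot> tens us = (\<lambda>b. SUP k. ?w k b)"
      unfolding 5(1) uint_cpt(10)[OF cp] by (rule ext) (rule SUP_apply)
    have "uint N \<odot> tens us = ?f (uint M \<odot> tens us)"
      unfolding N subst_0(2)[OF K V is_val.intros(3) us] uint_cpt(2)[OF cp] ..
    also have "\<dots> = (\<lambda>b. SUP k. ?f (?w k) b)"
    proof -
      have inc2: "incseq (\<lambda>k. tens us \<otimes>\<^sub>v prom (?w k))"
        using inc unfolding incseq_def by (blast intro: tensv_mono prom_mono)
      show ?thesis
        unfolding M_eq prom_SUP[OF inc] tensv_SUP_right mapp_SUP_right[OF inc2] ..
    qed
    also have "\<dots> = (\<lambda>b. SUP k. ?w (Suc k) b)" by simp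
    also have "\<dots> = (\<lambda>b. SUP k. ?w k b)"
    proof
      fix b
      show "(SUP k. ?w (Suc k) b) = (SUP k. ?w k b)"
      proof (rule antisym)
        show "(SUP k. ?w (Suc k) b) \<le> (SUP k. ?w k b)"
          by (rule SUP_least) (rule SUP_upper, rule UNIV_I)
        have "?w k b \<le> (SUP k. ?w (Suc k) b)" for k
        proof (rule order_trans)
          show "?w k b \<le> ?w (Suc k) b" using incseq_SucD[OF inc, of k] by (rule le_funD)
          show "?w (Suc k) b \<le> (SUP k. ?w (Suc k) b)" by (rule SUP_upper) (rule UNIV_I)
        qed
        then show "(SUP k. ?w k b) \<le> (SUP k. ?w (Suc k) b)" by (rule SUP_least)
      qed
    qed
    finally show ?thesis using M_eq by simp
  qed
  then show ?thesis using subst_0(1)[OF K V is_val.intros(3)] N by blast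
next
  case (6 V K K')
  from M 6(1) obtain \<phi> \<psi> where t: "\<Gamma> \<turnstile> Inj Lft V \<Ztypecolon> Pos (Plus \<phi> \<psi>)" and K: "\<phi> # \<Gamma> \<turnstile> K \<Ztypecolon> \<sigma>"
    by (auto elim!: typing_CaseE)
  then have V: "\<Gamma> \<turnstile> V \<Ztypecolon> Pos \<phi>" by (auto elim!: typing_InjE)
  have "uint M \<odot> tens us = uint N \<odot> tens us" if us: "coalgebraic_env \<Gamma> us" for us
    unfolding 6(2) subst_0(2)[OF K V 6(3) us] 6(1) uint_cpt(6)[OF env_cpt[OF M us]] uint_cpt(4)[OF env_cpt[OF M us]]
      InjU_mapp component_cotup by simp
  then show ?thesis using subst_0(1)[OF K V 6(3)] 6(2) by blast
next
  case (7 V K' K)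
  from M 7(1) obtain \<phi> \<psi> where t: "\<Gamma> \<turnstile> Inj Rgt V \<Ztypecolon> Pos (Plus \<psi> \<phi>)" and K: "\<phi> # \<Gamma> \<turnstile> K \<Ztypecolon> \<sigma>"
    by (auto elim!: typing_CaseE)
  then have V: "\<Gamma> \<turnstile> V \<Ztypecolon> Pos \<phi>" by (auto elim!: typing_InjE)
  have "uint M \<odot> tens us = uint N \<odot> tens us" if us: "coalgebraic_env \<Gamma> us" for us
    unfolding 7(2) subst_0(2)[OF K V 7(3) us] 7(1) uint_cpt(6)[OF env_cpt[OF M us]] uint_cpt(4)[OF env_cpt[OF M us]]
      InjU_mapp component_cotup by simp
  then show ?thesis using subst_0(1)[OF K V 7(3)] 7(2) by blast
next
  case 8
  then have "\<Gamma> \<turnstile> N \<Ztypecolon> \<sigma>" using M by (auto elim!: typing_UnfoldE typing_FoldE)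
  then show ?thesis using 8 by simp
qed

section \<open>Convex combinations and evaluation contexts\<close>

definition mix :: "real \<Rightarrow> vec \<Rightarrow> vec \<Rightarrow> vec" where
  "mix r u v = (\<lambda>b. ennreal r * u b + ennreal (1 - r) * v b)"

text \<open>Records the complete list of reducts, since \<open>Red\<close> is defined by a unique
  weight. Distinctness of the two reducts matters: if they coincided, both \<open>r\<close> and
  \<open>1 - r\<close> would be weights of the same term.\<close>

definition red_sound :: "ctx \<Rightarrow> gty \<Rightarrow> tm \<Rightarrow> bool" where
  "red_sound \<Gamma> \<sigma> M \<longleftrightarrow>
     (\<exists>N. (\<forall>q L. red M q L \<longleftrightarrow> q = 1 \<and> L = N) \<and> \<Gamma> \<turnstile> N \<Ztypecolon> \<sigma> \<and>
        (\<forall>us. coalgebraic_env \<Gamma> us \<longrightarrow> uint M \<odot> tens us = uint N \<odot> tens us)) \<or>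
     (\<exists>r N\<^sub>l N\<^sub>r. 0 \<le> r \<and> r \<le> 1 \<and> N\<^sub>l \<noteq> N\<^sub>r \<and>
        (\<forall>q L. red M q L \<longleftrightarrow> q = r \<and> L = N\<^sub>l \<or> q = 1 - r \<and> L = N\<^sub>r) \<and> \<Gamma> \<turnstile> N\<^sub>l \<Ztypecolon> \<sigma> \<and> \<Gamma> \<turnstile> N\<^sub>r \<Ztypecolon> \<sigma> \<and>
        (\<forall>us. coalgebraic_env \<Gamma> us \<longrightarrow> uint M \<odot> tens us = mix r (uint N\<^sub>l \<odot> tens us) (uint N\<^sub>r \<odot> tens us)))"

text \<open>An evaluation context acts on denotations through a map \<open>F\<close> that preserves
  convex combinations. Injectivity of \<open>K\<close> keeps the two reducts distinct.\<close>

lemma red_sound_frame: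
  assumes M: "red_sound \<Gamma> \<tau> M"
    and red: "\<And>q L. red (K M) q L \<longleftrightarrow> (\<exists>M'. red M q M' \<and> L = K M')"
    and inj: "\<And>M M'. K M = K M' \<Longrightarrow> M = M'"
    and ty: "\<And>M'. \<Gamma> \<turnstile> M' \<Ztypecolon> \<tau> \<Longrightarrow> \<Gamma> \<turnstile> K M' \<Ztypecolon> \<sigma>"
    and F: "\<And>us M'. coalgebraic_env \<Gamma> us \<Longrightarrow> uint (K M') \<odot> tens us = F us (uint M' \<odot> tens us)"
    and lin: "\<And>us r u v. F us (mix r u v) = mix r (F us u) (F us v)"
  shows "red_sound \<Gamma> \<sigma> (K M)"
  using M unfolding red_sound_def
proof (rule disj_forward)
  assume "\<exists>N. (\<forall>q L. red M q L \<longleftrightarrow> q = 1 \<and> L = N) \<and> \<Gamma> \<turnstile> N \<Ztypecolon> \<tau> \<and>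
        (\<forall>us. coalgebraic_env \<Gamma> us \<longrightarrow> uint M \<odot> tens us = uint N \<odot> tens us)"
  then obtain N where r: "\<And>q L. red M q L \<longleftrightarrow> q = 1 \<and> L = N" and t: "\<Gamma> \<turnstile> N \<Ztypecolon> \<tau>"
    and e: "\<And>us. coalgebraic_env \<Gamma> us \<Longrightarrow> uint M \<odot> tens us = uint N \<odot> tens us" by blast
  have "red (K M) q L \<longleftrightarrow> q = 1 \<and> L = K N" for q L unfolding red r by blast
  moreover have "uint (K M) \<odot> tens us = uint (K N) \<odot> tens us" if "coalgebraic_env \<Gamma> us" for us
    unfolding F[OF that] e[OF that] ..
  ultimately show "\<exists>N. (\<forall>q L. red (K M) q L \<longleftrightarrow> q = 1 \<and> L = N) \<and> \<Gamma> \<turnstile> N \<Ztypecolon> \<sigma> \<and>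
        (\<forall>us. coalgebraic_env \<Gamma> us \<longrightarrow> uint (K M) \<odot> tens us = uint N \<odot> tens us)"
    using ty[OF t] by blast
next
  assume "\<exists>r N\<^sub>l N\<^sub>r. 0 \<le> r \<and> r \<le> 1 \<and> N\<^sub>l \<noteq> N\<^sub>r \<and>
        (\<forall>q L. red M q L \<longleftrightarrow> q = r \<and> L = N\<^sub>l \<or> q = 1 - r \<and> L = N\<^sub>r) \<and> \<Gamma> \<turnstile> N\<^sub>l \<Ztypecolon> \<tau> \<and> \<Gamma> \<turnstile> N\<^sub>r \<Ztypecolon> \<tau> \<and>
        (\<forall>us. coalgebraic_env \<Gamma> us \<longrightarrow> uint M \<odot> tens us = mix r (uint N\<^sub>l \<odot> tens us) (uint N\<^sub>r \<odot> tens us))"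
  then obtain r N\<^sub>l N\<^sub>r where 01: "0 \<le> r" "r \<le> 1" and ne: "N\<^sub>l \<noteq> N\<^sub>r"
    and r: "\<And>q L. red M q L \<longleftrightarrow> q = r \<and> L = N\<^sub>l \<or> q = 1 - r \<and> L = N\<^sub>r"
    and t: "\<Gamma> \<turnstile> N\<^sub>l \<Ztypecolon> \<tau>" "\<Gamma> \<turnstile> N\<^sub>r \<Ztypecolon> \<tau>"
    and e: "\<And>us. coalgebraic_env \<Gamma> us \<Longrightarrow> uint M \<odot> tens us = mix r (uint N\<^sub>l \<odot> tens us) (uint N\<^sub>r \<odot> tens us)" by blast
  have "red (K M) q L \<longleftrightarrow> q = r \<and> L = K N\<^sub>l \<or> q = 1 - r \<and> L = K N\<^sub>r" for q L unfolding red r by blast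
  moreover have "K N\<^sub>l \<noteq> K N\<^sub>r" using inj ne by blast
  moreover have "uint (K M) \<odot> tens us = mix r (uint (K N\<^sub>l) \<odot> tens us) (uint (K N\<^sub>r) \<odot> tens us)"
    if "coalgebraic_env \<Gamma> us" for us
    unfolding F[OF that] e[OF that] lin ..
  ultimately show "\<exists>r N\<^sub>l N\<^sub>r. 0 \<le> r \<and> r \<le> 1 \<and> N\<^sub>l \<noteq> N\<^sub>r \<and>
        (\<forall>q L. red (K M) q L \<longleftrightarrow> q = r \<and> L = N\<^sub>l \<or> q = 1 - r \<and> L = N\<^sub>r) \<and> \<Gamma> \<turnstile> N\<^sub>l \<Ztypecolon> \<sigma> \<and> \<Gamma> \<turnstile> N\<^sub>r \<Ztypecolon> \<sigma> \<and>
        (\<forall>us. coalgebraic_env \<Gamma> us \<longrightarrow> uint (K M) \<odot> tens us = mix r (uint N\<^sub>l \<odot> tens us) (uint N\<^sub>r \<odot> tens us))"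
    using 01 ty[OF t(1)] ty[OF t(2)] by (intro exI[of _ r] exI[of _ "K N\<^sub>l"] exI[of _ "K N\<^sub>r"]) blast
qed

lemma mapp_mix: "T \<odot> mix r u v = mix r (T \<odot> u) (T \<odot> v)"
  by (simp add: mix_def mapp_add mapp_cmult)

lemma mat_of_mix: "mat_of (mix r u v) \<odot> w = mix r (mat_of u \<odot> w) (mat_of v \<odot> w)"
proof -
  have "mat_of (mix r u v) = (\<lambda>a b. ennreal r * mat_of u a b + ennreal (1 - r) * mat_of v a b)"
    by (simp add: mat_of_def mix_def)
  then show ?thesis
    using mat_add_mapp[of "\<lambda>a b. ennreal r * mat_of u a b" "\<lambda>a b. ennreal (1 - r) * mat_of v a b" w]
    by (simp add: mat_cmult_mapp) (simp add: mix_def)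
qed

lemma tensv_mix: "mix r u v \<otimes>\<^sub>v w = mix r (u \<otimes>\<^sub>v w) (v \<otimes>\<^sub>v w)" "w \<otimes>\<^sub>v mix r u v = mix r (w \<otimes>\<^sub>v u) (w \<otimes>\<^sub>v v)"
proof -
  show "mix r u v \<otimes>\<^sub>v w = mix r (u \<otimes>\<^sub>v w) (v \<otimes>\<^sub>v w)"
  proof
    fix c show "(mix r u v \<otimes>\<^sub>v w) c = mix r (u \<otimes>\<^sub>v w) (v \<otimes>\<^sub>v w) c"
      by (cases c) (simp_all add: mix_def tensv_def distrib_right mult.assoc)
  qed
  show "w \<otimes>\<^sub>v mix r u v = mix r (w \<otimes>\<^sub>v u) (w \<otimes>\<^sub>v v)"
  proof
    fix c show "(w \<otimes>\<^sub>v mix r u v) c = mix r (w \<otimes>\<^sub>v u) (w \<otimes>\<^sub>v v) c"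
      by (cases c) (simp_all add: mix_def tensv_def distrib_left mult.left_commute)
  qed
qed

lemma component_mix: "component i (mix r u v) = mix r (component i u) (component i v)"
  by (simp add: component_def mix_def)

lemma mix_add: "(\<lambda>b. mix r u v b + mix r u' v' b) = mix r (\<lambda>b. u b + u' b) (\<lambda>b. v b + v' b)"
  by (rule ext) (simp add: mix_def distrib_left add_ac)

lemma coin_sound:
  assumes "\<Gamma> \<turnstile> Coin p \<Ztypecolon> \<sigma>"
  shows "red_sound \<Gamma> \<sigma> (Coin p)"
proof -
  have w: "wf_ctx \<Gamma>" and p: "0 \<le> p" "p \<le> 1" and s: "\<sigma> = Pos (Plus One One)"
    using assms by (auto elim: typing_CoinE)
  have "red (Coin p) q L \<longleftrightarrow> q = of_rat p \<and> L = Inj Lft Unit \<or> q = 1 - of_rat p \<and> L = Inj Rgt Unit" for q L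
    by (auto elim!: red_CoinE weak_CoinE intro: red.intros)
  moreover have "\<Gamma> \<turnstile> Inj Lft Unit \<Ztypecolon> \<sigma>" "\<Gamma> \<turnstile> Inj Rgt Unit \<Ztypecolon> \<sigma>"
    unfolding s by (simp_all add: t_inl t_inr t_unit w)
  moreover have "uint (Coin p) \<odot> tens us = mix (of_rat p) (uint (Inj Lft Unit) \<odot> tens us) (uint (Inj Rgt Unit) \<odot> tens us)"
    if "coalgebraic_env \<Gamma> us" for us
    unfolding uint_cpt(11)[OF env_cpt[OF assms that]] uint_cpt(4)[OF env_cpt[OF assms that]]
      uint_cpt(1)[OF env_cpt[OF assms that]] mapp_unit_vec InjU_def mix_def ..
  ultimately show ?thesis
    unfolding red_sound_def using p
    by (intro disjI2 exI[of _ "of_rat p"] exI[of _ "Inj Lft Unit"] exI[of _ "Inj Rgt Unit"]) simp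
qed

lemma red_is_sound:
  assumes "red M p N" "\<Gamma> \<turnstile> M \<Ztypecolon> \<sigma>"
  shows "red_sound \<Gamma> \<sigma> M"
  using assms
proof (induction arbitrary: \<sigma> rule: red.induct)
  case (1 M M')
  show ?case
    unfolding red_sound_def
    using weak_red_deterministic[OF 1(1)] weak_red_sound[OF 1] by blast
next
  case (2 p)
  show ?case by (rule coin_sound[OF 2])
next
  case (3 p)
  show ?case by (rule coin_sound[OF 3])
next
  case (4 M p M')
  from 4(3) have t: "\<Gamma> \<turnstile> M \<Ztypecolon> Pos (Bang \<sigma>)" by (auto elim: typing_GoE)
  show ?case
  proof (rule red_sound_frame[where K = Go and F = "\<lambda>_ w. DER \<odot> w", OF 4(2)[OF t] red_frames(1)[OF 4(1)]])
  qed ((erule t_go) | (rule uint_cpt(9)[OF env_cpt[OF 4(3)]], assumption) | (simp only: mapp_mix) | simp)+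
next
  case (5 M p M' V)
  from 5(4) obtain \<phi> where t: "\<Gamma> \<turnstile> M \<Ztypecolon> Lolli \<phi> \<sigma>" and V: "\<Gamma> \<turnstile> V \<Ztypecolon> Pos \<phi>" by (auto elim: typing_AppE)
  show ?case
  proof (rule red_sound_frame[where K = "\<lambda>M. App M V" and F = "\<lambda>us w. mat_of w \<odot> uint V \<odot> tens us",
          OF 5(3)[OF t] red_frames(2)[OF 5(1,2)]])
  qed ((erule t_app[OF _ V]) | (rule uint_cpt(5)[OF env_cpt[OF 5(4)]], assumption) | (simp only: mat_of_mix) | simp)+
next
  case (6 M p M' N)
  from 6(3) obtain \<phi> where N: "\<Gamma> \<turnstile> N \<Ztypecolon> Lolli \<phi> \<sigma>" and t: "\<Gamma> \<turnstile> M \<Ztypecolon> Pos \<phi>" by (auto elim: typing_AppE)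
  show ?case
  proof (rule red_sound_frame[where K = "\<lambda>M. App N M" and F = "\<lambda>us w. mat_of (uint N \<odot> tens us) \<odot> w",
          OF 6(2)[OF t] red_frames(3)[OF 6(1)]])
  qed ((erule t_app[OF N]) | (rule uint_cpt(5)[OF env_cpt[OF 6(3)]], assumption) | (simp only: mapp_mix) | simp)+
next
  case (7 M p M' i)
  show ?case
  proof (cases i)
    case Lft
    from 7(3) Lft obtain \<phi> \<psi> where s: "\<sigma> = Pos \<phi>" and t: "\<Gamma> \<turnstile> M \<Ztypecolon> Pos (Tensor \<phi> \<psi>)" by (auto elim: typing_PrjE)
    show ?thesis
      unfolding Lft s
    proof (rule red_sound_frame[where K = "Prj Lft" and F = "\<lambda>us w. PRL \<odot> w", OF 7(2)[OF t] red_frames(4)[OF 7(1)]])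
    qed ((erule t_prl[of _ _ _ \<psi>]) | (rule uint_cpt(7)[OF env_cpt[OF 7(3)]], assumption) | (simp only: mapp_mix) | simp)+
  next
    case Rgt
    from 7(3) Rgt obtain \<phi> \<psi> where s: "\<sigma> = Pos \<psi>" and t: "\<Gamma> \<turnstile> M \<Ztypecolon> Pos (Tensor \<phi> \<psi>)" by (auto elim: typing_PrjE)
    show ?thesis
      unfolding Rgt s
    proof (rule red_sound_frame[where K = "Prj Rgt" and F = "\<lambda>us w. PRR \<odot> w", OF 7(2)[OF t] red_frames(4)[OF 7(1)]])
    qed ((erule t_prr[of _ _ \<phi>]) | (rule uint_cpt(8)[OF env_cpt[OF 7(3)]], assumption) | (simp only: mapp_mix) | simp)+
  qed
next
  case (8 M p M' N)
  from 8(3) obtain \<phi> \<psi> where s: "\<sigma> = Pos (Tensor \<phi> \<psi>)" and t: "\<Gamma> \<turnstile> M \<Ztypecolon> Pos \<phi>" and N: "\<Gamma> \<turnstile> N \<Ztypecolon> Pos \<psi>"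
    by (auto elim: typing_TupE)
  show ?case
    unfolding s
  proof (rule red_sound_frame[where K = "\<lambda>M. Tup M N" and F = "\<lambda>us w. w \<otimes>\<^sub>v (uint N \<odot> tens us)",
          OF 8(2)[OF t] red_frames(5)[OF 8(1)]])
  qed ((erule t_tup[OF _ N]) | (rule uint_cpt(3)[OF env_cpt[OF 8(3)]], assumption) | (simp only: tensv_mix) | simp)+
next
  case (9 M p M' V)
  from 9(4) obtain \<phi> \<psi> where s: "\<sigma> = Pos (Tensor \<phi> \<psi>)" and V: "\<Gamma> \<turnstile> V \<Ztypecolon> Pos \<phi>" and t: "\<Gamma> \<turnstile> M \<Ztypecolon> Pos \<psi>"
    by (auto elim: typing_TupE)
  show ?case
    unfolding s
  proof (rule red_sound_frame[where K = "\<lambda>M. Tup V M" and F = "\<lambda>us w. (uint V \<odot> tens us) \<otimes>\<^sub>v w",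
          OF 9(3)[OF t] red_frames(6)[OF 9(1,2)]])
  qed ((erule t_tup[OF V]) | (rule uint_cpt(3)[OF env_cpt[OF 9(4)]], assumption) | (simp only: tensv_mix) | simp)+
next
  case (10 M p M' i)
  \<comment> \<open>The term does not record the type of the other summand. It is kept fixed by
    remembering that every term of type \<open>Pos \<phi>\<close> may be injected at
    \<sigma>.\<close>
  have "\<exists>\<phi>. \<Gamma> \<turnstile> M \<Ztypecolon> Pos \<phi> \<and> (\<forall>M'. \<Gamma> \<turnstile> M' \<Ztypecolon> Pos \<phi> \<longrightarrow> \<Gamma> \<turnstile> Inj i M' \<Ztypecolon> \<sigma>)"
    using 10(3) by (rule typing_InjE) (use t_inl t_inr in blast)+
  then obtain \<phi> where t: "\<Gamma> \<turnstile> M \<Ztypecolon> Pos \<phi>" and ty: "\<And>M'. \<Gamma> \<turnstile> M' \<Ztypecolon> Pos \<phi> \<Longrightarrow> \<Gamma> \<turnstile> Inj i M' \<Ztypecolon> \<sigma>" by blast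
  show ?case
  proof (rule red_sound_frame[where K = "Inj i" and F = "\<lambda>us w. InjU i \<odot> w", OF 10(2)[OF t] red_frames(7)[OF 10(1)]])
  qed ((erule ty) | (rule uint_cpt(4)[OF env_cpt[OF 10(3)]], assumption) | (simp only: mapp_mix) | simp)+
next
  case (11 M p M' N\<^sub>l N\<^sub>r)
  from 11(3) obtain \<phi> \<psi> where t: "\<Gamma> \<turnstile> M \<Ztypecolon> Pos (Plus \<phi> \<psi>)" and N: "\<phi> # \<Gamma> \<turnstile> N\<^sub>l \<Ztypecolon> \<sigma>" "\<psi> # \<Gamma> \<turnstile> N\<^sub>r \<Ztypecolon> \<sigma>"
    by (auto elim: typing_CaseE)
  show ?case
  proof (rule red_sound_frame[where K = "\<lambda>M. Case M N\<^sub>l N\<^sub>r" and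
          F = "\<lambda>us w b. (uint N\<^sub>l \<odot> (tens us \<otimes>\<^sub>v component Lft w)) b + (uint N\<^sub>r \<odot> (tens us \<otimes>\<^sub>v component Rgt w)) b",
          OF 11(2)[OF t] red_frames(8)[OF 11(1)]])
  qed ((erule t_case[OF _ N]) | (rule uint_cpt(6)[OF env_cpt[OF 11(3)]], assumption) | (simp only: component_mix tensv_mix mapp_mix mix_add) | simp)+
next
  case (12 M p M')
  from 12(3) obtain \<psi> where s: "\<sigma> = Pos (Mu \<psi>)" and t: "\<Gamma> \<turnstile> M \<Ztypecolon> Pos (ptsubst \<psi> 0 (Mu \<psi>))" by (auto elim: typing_FoldE)
  show ?case
    unfolding s
    by (rule red_sound_frame[where K = Fold and F = "\<lambda>us w. w", OF 12(2)[OF t] red_frames(9)[OF 12(1)]])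
      (simp_all add: t_fold)
next
  case (13 M p M')
  from 13(3) obtain \<psi> where s: "\<sigma> = Pos (ptsubst \<psi> 0 (Mu \<psi>))" and t: "\<Gamma> \<turnstile> M \<Ztypecolon> Pos (Mu \<psi>)" by (auto elim: typing_UnfoldE)
  show ?case
    unfolding s
    by (rule red_sound_frame[where K = Unfold and F = "\<lambda>us w. w", OF 13(2)[OF t] red_frames(10)[OF 13(1)]])
      (simp_all add: t_unfold)
qed

theorem theorem3p18:
  fixes \<Gamma> :: ctx and M :: tm and \<sigma> :: gty
  assumes "\<Gamma> \<turnstile> M \<Ztypecolon> \<sigma>"
  shows "sem \<Gamma> M \<sigma> =
    (\<lambda>a b. \<Sum>\<^sub>\<infinity>M'\<in>{M'. \<Gamma> \<turnstile> M' \<Ztypecolon> \<sigma>}. ennreal (Red M M') * sem \<Gamma> M' \<sigma> a b)"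
proof -
  have c: "wf_ctx \<Gamma>" "gtclosed 0 \<sigma>" using typing_closed[OF assms] by blast+
  note G = is_pcs_ctx[OF c(1)] and Z = is_pcs_gsem[OF c(2)]
  \<comment> \<open>\<open>Red M\<close> will be concentrated on a finite set of well-typed terms,
    to which the infinite sum collapses.\<close>
  have sum: "(\<Sum>\<^sub>\<infinity>M'\<in>{M'. \<Gamma> \<turnstile> M' \<Ztypecolon> \<sigma>}. ennreal (Red M M') * sem \<Gamma> M' \<sigma> a b) =
      (\<Sum>M'\<in>F. ennreal (Red M M') * csem \<Gamma> M' a b)"
    if F: "finite F" "\<And>M'. M' \<in> F \<Longrightarrow> \<Gamma> \<turnstile> M' \<Ztypecolon> \<sigma>" "\<And>M'. M' \<notin> F \<Longrightarrow> Red M M' = 0" for F a b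
  proof -
    have "(\<Sum>\<^sub>\<infinity>M'\<in>{M'. \<Gamma> \<turnstile> M' \<Ztypecolon> \<sigma>}. ennreal (Red M M') * sem \<Gamma> M' \<sigma> a b) =
        infsum (\<lambda>M'. ennreal (Red M M') * csem \<Gamma> M' a b) F"
    proof (rule infsum_cong_neutral)
      fix M' assume "M' \<in> {M'. \<Gamma> \<turnstile> M' \<Ztypecolon> \<sigma>} - F"
      then show "ennreal (Red M M') * sem \<Gamma> M' \<sigma> a b = 0" using F(3) by simp
    next
      fix M' assume "M' \<in> {M'. \<Gamma> \<turnstile> M' \<Ztypecolon> \<sigma>} \<inter> F"
      then show "ennreal (Red M M') * sem \<Gamma> M' \<sigma> a b = ennreal (Red M M') * csem \<Gamma> M' a b" using sem_eq by simp
    qed (use F(2) in blast)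
    then show ?thesis using F(1) by simp
  qed
  show ?thesis
  proof (cases "weak_normal M")
    case True
    then have R: "Red M M' = (if M' = M then 1 else 0)" for M' by (auto simp: Red_def weak_normal_def)
    have "(\<Sum>\<^sub>\<infinity>M'\<in>{M'. \<Gamma> \<turnstile> M' \<Ztypecolon> \<sigma>}. ennreal (Red M M') * sem \<Gamma> M' \<sigma> a b) = csem \<Gamma> M a b" for a b
      by (subst sum[of "{M}"]) (use assms in \<open>simp_all add: R\<close>)
    then show ?thesis by (simp add: sem_eq[OF assms])
  next
    case False
    then obtain p N where "red M p N" by (auto simp: weak_normal_def)
    from red_is_sound[OF this assms] show ?thesis
      unfolding red_sound_def
    proof (elim disjE exE conjE)
      fix N assume r: "\<forall>q L. red M q L \<longleftrightarrow> q = 1 \<and> L = N" and N: "\<Gamma> \<turnstile> N \<Ztypecolon> \<sigma>"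
        and e: "\<forall>us. coalgebraic_env \<Gamma> us \<longrightarrow> uint M \<odot> tens us = uint N \<odot> tens us"
      have R: "Red M M' = (if M' = N then 1 else 0)" for M' using r False by (simp add: Red_def)
      have "csem \<Gamma> M = csem \<Gamma> N"
        by (rule ctx_mor_eq[OF c(1) Z typing_mor[OF assms] typing_mor[OF N]]) (use e in blast)
      moreover have "(\<Sum>\<^sub>\<infinity>M'\<in>{M'. \<Gamma> \<turnstile> M' \<Ztypecolon> \<sigma>}. ennreal (Red M M') * sem \<Gamma> M' \<sigma> a b) = csem \<Gamma> N a b" for a b
        by (subst sum[of "{N}"]) (use N in \<open>simp_all add: R\<close>)
      ultimately show ?thesis by (simp add: sem_eq[OF assms])
    next
      fix r N\<^sub>l N\<^sub>r assume 01: "0 \<le> r" "r \<le> 1" and ne: "N\<^sub>l \<noteq> N\<^sub>r"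
        and r: "\<forall>q L. red M q L \<longleftrightarrow> q = r \<and> L = N\<^sub>l \<or> q = 1 - r \<and> L = N\<^sub>r"
        and t: "\<Gamma> \<turnstile> N\<^sub>l \<Ztypecolon> \<sigma>" "\<Gamma> \<turnstile> N\<^sub>r \<Ztypecolon> \<sigma>"
        and e: "\<forall>us. coalgebraic_env \<Gamma> us \<longrightarrow> uint M \<odot> tens us = mix r (uint N\<^sub>l \<odot> tens us) (uint N\<^sub>r \<odot> tens us)"
      have R: "Red M N\<^sub>l = r" "Red M N\<^sub>r = 1 - r" "\<And>M'. M' \<notin> {N\<^sub>l, N\<^sub>r} \<Longrightarrow> Red M M' = 0"
        using r ne False by (auto simp: Red_def)
      \<comment> \<open>The convex combination is itself a morphism because the points of the target
        are convex; separation then turns agreement on coalgebraic environments into equality of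
        matrices.\<close>
      let ?T = "\<lambda>a. mix r (uint N\<^sub>l a) (uint N\<^sub>r a)"
      have T: "?T \<odot> u = mix r (uint N\<^sub>l \<odot> u) (uint N\<^sub>r \<odot> u)" for u
        unfolding mix_def mat_add_mapp mat_cmult_mapp ..
      have le: "ennreal r + ennreal (1 - r) \<le> 1"
        using 01 by (simp add: ennreal_plus[symmetric] del: ennreal_plus)
      have "mor (ctx_sem \<Gamma>) (gsem \<sigma>) ?T"
        unfolding mor_def T
      proof
        fix u assume u: "u \<in> pts (ctx_sem \<Gamma>)"
        show "mix r (uint N\<^sub>l \<odot> u) (uint N\<^sub>r \<odot> u) \<in> pts (gsem \<sigma>)"
          unfolding mix_def
          by (rule pts_convex[OF Z morD[OF typing_mor[OF t(1)] u] morD[OF typing_mor[OF t(2)] u] le])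
      qed
      then have "csem \<Gamma> M = rowr (web (ctx_sem \<Gamma>)) ?T"
        by (rule ctx_mor_eq[OF c(1) Z typing_mor[OF assms]]) (use e in \<open>simp add: T\<close>)
      then have "csem \<Gamma> M a b = ennreal r * csem \<Gamma> N\<^sub>l a b + ennreal (1 - r) * csem \<Gamma> N\<^sub>r a b" for a b
        by (simp add: rowr_def mix_def)
      moreover have "(\<Sum>\<^sub>\<infinity>M'\<in>{M'. \<Gamma> \<turnstile> M' \<Ztypecolon> \<sigma>}. ennreal (Red M M') * sem \<Gamma> M' \<sigma> a b) =
          ennreal r * csem \<Gamma> N\<^sub>l a b + ennreal (1 - r) * csem \<Gamma> N\<^sub>r a b" for a b
        by (subst sum[of "{N\<^sub>l, N\<^sub>r}"]) (use t ne R in auto)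
      ultimately show ?thesis unfolding sem_eq[OF assms] by presburger
    qed
  qed
qed

end
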